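(* Let $\Omega\subset\mathbb{R}^n$ be a bounded $C^2$ domain, $p\in(1,\infty)$, and let $g\in W^{1,p}(\Omega)\cap C^{0,\beta}(\overline\Omega)$ for some $\beta\in(0,1)$. Let $v\in g+W^{1,p}_0(\Omega)$ be the unique minimizer of $$w\mapsto\frac1p\int_\Omega|\nabla w|^p\,dx\qquad\text{over } w\in g+W^{1,p}_0(\Omega).$$ Then $v\in C^{0,\beta}(\overline\Omega)$, and for some constant $\tilde C$, depending on $n,p,\Omega$ (and on the fixed exponent $\beta$), it holds that $$\|v\|_{C^{0,\beta}(\overline\Omega)}\le\tilde C\,\|g\|_{C^{0,\beta}(\overline\Omega)}.$$
   Context: $\|w\|_{C^{0,\beta}(\overline\Omega)}=\max_{\overline\Omega}|w|+\sup_{x\ne y}\frac{|w(x)-w(y)|}{|x-y|^\beta}$. As usual, $v\in C^{0,\beta}(\overline\Omega)$ means that $v$ has a representative in this space. *)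

theory Defs
  imports "HOL-Analysis.Analysis"
begin

definition partial_deriv :: "'a::euclidean_space \<Rightarrow> ('a \<Rightarrow> real) \<Rightarrow> 'a \<Rightarrow> real" where
  "partial_deriv b f x = frechet_derivative f (at x) b"

fun Ck :: "nat \<Rightarrow> ('a::euclidean_space \<Rightarrow> real) \<Rightarrow> bool" where
  "Ck 0 f \<longleftrightarrow> continuous_on UNIV f"
| "Ck (Suc k) f \<longleftrightarrow> (\<forall>x. f differentiable (at x)) \<and> (\<forall>b\<in>Basis. Ck k (partial_deriv b f))"

text \<open>Near each boundary point, the set is the part of a ball above a \<open>C\<^sup>2\<close> graph in some
  unit direction \<open>e\<close>. The height function is evaluated only on the hyperplane orthogonal to
  \<open>e\<close>; since a \<open>C\<^sup>2\<close> function on that hyperplane extends constantly along \<open>e\<close>, taking it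
  on the whole space is no restriction. In dimension one the graph is a point.\<close>

definition C2_boundary :: "'a::euclidean_space set \<Rightarrow> bool" where
  "C2_boundary \<Omega> \<longleftrightarrow>
     (\<forall>x0\<in>frontier \<Omega>. \<exists>r>0. \<exists>e \<gamma>. norm e = 1 \<and> Ck 2 \<gamma> \<and>
        \<Omega> \<inter> ball x0 r = {x \<in> ball x0 r. x \<bullet> e > \<gamma> (x - (x \<bullet> e) *\<^sub>R e)})"

definition bounded_C2_domain :: "'a::euclidean_space set \<Rightarrow> bool" where
  "bounded_C2_domain \<Omega> \<longleftrightarrow>
     open \<Omega> \<and> connected \<Omega> \<and> \<Omega> \<noteq> {} \<and> bounded \<Omega> \<and> C2_boundary \<Omega>"

definition test_function :: "'a::euclidean_space set \<Rightarrow> ('a \<Rightarrow> real) \<Rightarrow> bool" where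
  "test_function \<Omega> \<phi> \<longleftrightarrow> (\<forall>k. Ck k \<phi>) \<and>
     compact (closure {x. \<phi> x \<noteq> 0}) \<and> closure {x. \<phi> x \<noteq> 0} \<subseteq> \<Omega>"

text \<open>Elements of Lebesgue and Sobolev spaces are represented by functions on the whole space,
  whose values outside the open set \<open>\<Omega>\<close> are irrelevant and which are not identified when they
  agree almost everywhere on \<open>\<Omega>\<close>.\<close>

definition Lp_space ::
    "'a::euclidean_space set \<Rightarrow> real \<Rightarrow> ('a \<Rightarrow> 'b::euclidean_space) set" where
  "Lp_space \<Omega> p = {f. f \<in> borel_measurable (lebesgue_on \<Omega>) \<and>
     integrable (lebesgue_on \<Omega>) (\<lambda>x. norm (f x) powr p)}"

definition locally_integrable ::
    "'a::euclidean_space set \<Rightarrow> ('a \<Rightarrow> 'b::euclidean_space) \<Rightarrow> bool" where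
  "locally_integrable \<Omega> f \<longleftrightarrow>
     (\<forall>K. compact K \<and> K \<subseteq> \<Omega> \<longrightarrow> integrable (lebesgue_on K) f)"

definition is_weak_gradient ::
    "'a::euclidean_space set \<Rightarrow> ('a \<Rightarrow> real) \<Rightarrow> ('a \<Rightarrow> 'a) \<Rightarrow> bool" where
  "is_weak_gradient \<Omega> u G \<longleftrightarrow> locally_integrable \<Omega> u \<and> locally_integrable \<Omega> G \<and>
     (\<forall>\<phi>. test_function \<Omega> \<phi> \<longrightarrow> (\<forall>b\<in>Basis.
        (\<integral>x. u x * partial_deriv b \<phi> x \<partial>(lebesgue_on \<Omega>)) =
        - (\<integral>x. (G x \<bullet> b) * \<phi> x \<partial>(lebesgue_on \<Omega>))))"

text \<open>Weak gradients are unique up to null sets, and \<open>weak_gradient\<close> is used below only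
  under integrals, so the choice made here does not matter.\<close>

definition weak_gradient ::
    "'a::euclidean_space set \<Rightarrow> ('a \<Rightarrow> real) \<Rightarrow> 'a \<Rightarrow> 'a" where
  "weak_gradient \<Omega> u = (SOME G. is_weak_gradient \<Omega> u G)"

definition W1p :: "'a::euclidean_space set \<Rightarrow> real \<Rightarrow> ('a \<Rightarrow> real) set" where
  "W1p \<Omega> p = {u. u \<in> Lp_space \<Omega> p \<and> (\<exists>G. is_weak_gradient \<Omega> u G \<and> G \<in> Lp_space \<Omega> p)}"

definition W1p_norm :: "'a::euclidean_space set \<Rightarrow> real \<Rightarrow> ('a \<Rightarrow> real) \<Rightarrow> real" where
  "W1p_norm \<Omega> p u =
     ((\<integral>x. \<bar>u x\<bar> powr p \<partial>(lebesgue_on \<Omega>)) +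
      (\<integral>x. norm (weak_gradient \<Omega> u x) powr p \<partial>(lebesgue_on \<Omega>))) powr (1 / p)"

definition W1p_0 :: "'a::euclidean_space set \<Rightarrow> real \<Rightarrow> ('a \<Rightarrow> real) set" where
  "W1p_0 \<Omega> p = {u \<in> W1p \<Omega> p. \<exists>\<phi>. (\<forall>k. test_function \<Omega> (\<phi> k)) \<and>
     (\<lambda>k::nat. W1p_norm \<Omega> p (\<lambda>x. u x - \<phi> k x)) \<longlonglongrightarrow> 0}"

definition dirichlet_class ::
    "'a::euclidean_space set \<Rightarrow> real \<Rightarrow> ('a \<Rightarrow> real) \<Rightarrow> ('a \<Rightarrow> real) set" where
  "dirichlet_class \<Omega> p g = {w. (\<lambda>x. w x - g x) \<in> W1p_0 \<Omega> p}"

definition p_energy :: "'a::euclidean_space set \<Rightarrow> real \<Rightarrow> ('a \<Rightarrow> real) \<Rightarrow> real" where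
  "p_energy \<Omega> p w = 1 / p * (\<integral>x. norm (weak_gradient \<Omega> w x) powr p \<partial>(lebesgue_on \<Omega>))"

definition holder_space :: "'a::euclidean_space set \<Rightarrow> real \<Rightarrow> ('a \<Rightarrow> real) set" where
  "holder_space K \<beta> = {h. \<exists>M. \<forall>x\<in>K. \<forall>y\<in>K. \<bar>h x - h y\<bar> \<le> M * norm (x - y) powr \<beta>}"

text \<open>Only meaningful for \<open>h \<in> holder_space K \<beta>\<close> with \<open>K\<close> compact and containing at least
  two points; both suprema are then finite and the first one is attained.\<close>

definition holder_norm :: "'a::euclidean_space set \<Rightarrow> real \<Rightarrow> ('a \<Rightarrow> real) \<Rightarrow> real" where
  "holder_norm K \<beta> h = (SUP x\<in>K. \<bar>h x\<bar>) +
     (SUP (x, y)\<in>{(x, y). x \<in> K \<and> y \<in> K \<and> x \<noteq> y}. \<bar>h x - h y\<bar> / norm (x - y) powr \<beta>)"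

definition is_holder_rep ::
    "'a::euclidean_space set \<Rightarrow> real \<Rightarrow> ('a \<Rightarrow> real) \<Rightarrow> ('a \<Rightarrow> real) \<Rightarrow> bool" where
  "is_holder_rep \<Omega> \<beta> u h \<longleftrightarrow>
     h \<in> holder_space (closure \<Omega>) \<beta> \<and> (AE x in lebesgue_on \<Omega>. u x = h x)"

definition holder_class :: "'a::euclidean_space set \<Rightarrow> real \<Rightarrow> ('a \<Rightarrow> real) set" where
  "holder_class \<Omega> \<beta> = {u. \<exists>h. is_holder_rep \<Omega> \<beta> u h}"

text \<open>For \<open>\<Omega>\<close> open, two Hoelder representatives agree on the closure of \<open>\<Omega>\<close>, so the norm
  does not depend on the one chosen.\<close>

definition holder_class_norm :: "'a::euclidean_space set \<Rightarrow> real \<Rightarrow> ('a \<Rightarrow> real) \<Rightarrow> real" where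
  "holder_class_norm \<Omega> \<beta> u = holder_norm (closure \<Omega>) \<beta> (SOME h. is_holder_rep \<Omega> \<beta> u h)"

end

theory Submission
  imports Defs
begin

text \<open>
  At a boundary point \<open>z\<close> the domain lies outside balls of every small radius \<open>t\<close> touching at
  \<open>z\<close>; each carries a barrier \<open>b\<^sub>t\<close> that is bounded, of order one at distance \<open>t\<close> from \<open>z\<close>, and
  has slope of order \<open>1 / t\<close>. Because \<open>\<beta> < 1\<close>, the sum of \<open>t\<^sup>\<beta> b\<^sub>t\<close> over dyadic radii between
  \<open>\<bar>x - z\<bar>\<close> and a fixed scale dominates \<open>\<bar>\<cdot> - z\<bar>\<^sup>\<beta>\<close> up to a small constant, and its value at
  \<open>x\<close> is at most a multiple of \<open>\<bar>x - z\<bar>\<^sup>\<beta>\<close>. For steep radial profiles such sums are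
  supersolutions of the \<open>p\<close>-Laplace equation, so comparison gives
  \<open>\<bar>v x - g z\<bar> \<le> C M \<bar>x - z\<bar>\<^sup>\<beta>\<close>, where \<open>M\<close> exceeds the Hoelder norm of \<open>g\<close>.

  Near the boundary of \<open>\<Omega> \<inter> (\<Omega> - h)\<close> this bounds \<open>v (x + h) - v x\<close> by \<open>3 C M \<bar>h\<bar>\<^sup>\<beta>\<close>. Both
  \<open>v\<close> and its translate are minimizers, so the bound propagates to the whole intersection; no
  interior regularity theory is needed, and the exponent \<open>\<beta>\<close> is kept.

  Comparison uses only minimality and the strict convexity of \<open>\<bar>\<cdot>\<bar>\<^sup>p\<close>, tested with \<open>eta u\<close>, a
  continuously differentiable substitute for the positive part of \<open>u\<close>.
\<close>

section \<open>Functions of class \<open>C\<^sup>k\<close>\<close>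

text \<open>One exterior ball is not enough: seen from \<open>z\<close> in a tangential direction,
  the barrier of a ball of fixed radius may be as small as |x - z|^2, far below |x - z|^\<beta>. A
  ball of radius comparable to |x - z| has a barrier of order one there, whence the superposition of
  scales. For p \<noteq> 2 superposition is the obstacle, since a sum of supersolutions need not be
  one. However, the operator applied to a sum splits into second-order terms frozen at the common
  gradient D, so it is enough that every single profile has the right sign for every direction of D.
  A power |x - y|^(-s) has this property as soon as s is large in terms of n and p. The splitting
  requires D \<noteq> 0 up to the boundary, and infinitely many centres would accumulate at
  \<open>z\<close>; therefore the sums are finite, at the price of an error that is removed by
  choosing the number of scales separately at each point. All comparisons hold only almost
  everywhere. Uncountable families are handled through a dense countable set and continuity
  (boundary points) or through Fubini's theorem (translations).\<close>

lemma partial_deriv_eqI: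
  "(f has_derivative f') (at x) \<Longrightarrow> partial_deriv b f x = f' b"
  using frechet_derivative_at[of f f' x] by (simp add: partial_deriv_def)

lemma Ck_Suc_imp_Ck: "Ck (Suc k) f \<Longrightarrow> Ck k f"
proof (induction k arbitrary: f)
  case 0
  then show ?case
    by (auto intro!: differentiable_imp_continuous_on simp: differentiable_on_def)
next
  case (Suc k)
  then show ?case by auto
qed

lemma Ck_const: "Ck k (\<lambda>x::'a::euclidean_space. c)"
proof (induction k arbitrary: c)
  case (Suc k)
  have "partial_deriv b (\<lambda>x::'a. c) = (\<lambda>x. 0)" for b
    by (rule ext, rule partial_deriv_eqI) simp
  then show ?case using Suc by auto
qed simp

lemma Ck_add: "Ck k f \<Longrightarrow> Ck k g \<Longrightarrow> Ck k (\<lambda>x. f x + g x)"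
proof (induction k arbitrary: f g)
  case (Suc k)
  have "partial_deriv b (\<lambda>x. f x + g x) = (\<lambda>x. partial_deriv b f x + partial_deriv b g x)" for b
  proof
    fix x
    have "((\<lambda>x. f x + g x) has_derivative
        (\<lambda>h. frechet_derivative f (at x) h + frechet_derivative g (at x) h)) (at x)"
      using Suc.prems by (intro has_derivative_add) (auto simp: frechet_derivative_works)
    then show "partial_deriv b (\<lambda>x. f x + g x) x = partial_deriv b f x + partial_deriv b g x"
      by (subst partial_deriv_eqI) (auto simp: partial_deriv_def)
  qed
  then show ?case using Suc by auto
qed (auto intro: continuous_intros)

lemma partial_deriv_mult:
  assumes "f differentiable (at x)" "g differentiable (at x)"
  shows "partial_deriv b (\<lambda>x. f x * g x) x = f x * partial_deriv b g x + partial_deriv b f x * g x"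
proof -
  have "((\<lambda>x. f x * g x) has_derivative
      (\<lambda>h. f x * frechet_derivative g (at x) h + frechet_derivative f (at x) h * g x)) (at x)"
    using assms by (intro has_derivative_mult) (auto simp: frechet_derivative_works)
  then show ?thesis
    by (subst partial_deriv_eqI) (auto simp: partial_deriv_def)
qed

lemma Ck_mult: "Ck k f \<Longrightarrow> Ck k g \<Longrightarrow> Ck k (\<lambda>x. f x * g x)"
proof (induction k arbitrary: f g)
  case (Suc k)
  have eq: "partial_deriv b (\<lambda>x. f x * g x) =
      (\<lambda>x. f x * partial_deriv b g x + partial_deriv b f x * g x)" for b
    using Suc.prems by (intro ext partial_deriv_mult) auto
  have "Ck k f" "Ck k g" using Suc.prems Ck_Suc_imp_Ck by blast+
  then have "Ck k (partial_deriv b (\<lambda>x. f x * g x))" if "b \<in> Basis" for b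
    unfolding eq using Suc that by (intro Ck_add) auto
  moreover have "(\<lambda>x. f x * g x) differentiable (at x)" for x
    using Suc.prems by (intro differentiable_mult) auto
  ultimately show ?case by auto
qed (auto intro: continuous_intros)

lemma Ck_inner: "Ck k (\<lambda>x::'a::euclidean_space. x \<bullet> c)"
proof (cases k)
  case (Suc j)
  have der: "((\<lambda>x. x \<bullet> c) has_derivative (\<lambda>h. h \<bullet> c)) (at x)" for x :: 'a
    by (auto intro!: derivative_eq_intros)
  have "partial_deriv b (\<lambda>x. x \<bullet> c) = (\<lambda>x. b \<bullet> c)" for b
    by (rule ext, rule partial_deriv_eqI[OF der])
  then show ?thesis using der Suc Ck_const by (auto simp: differentiable_def)
qed (auto intro: continuous_intros)

lemma partial_deriv_affine:
  assumes "f differentiable (at (a + s *\<^sub>R x))"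
  shows "partial_deriv b (\<lambda>x. f (a + s *\<^sub>R x)) x = s * partial_deriv b f (a + s *\<^sub>R x)"
proof -
  have "(f has_derivative frechet_derivative f (at (a + s *\<^sub>R x))) (at (a + s *\<^sub>R x))"
    using assms frechet_derivative_works by auto
  then have der: "((\<lambda>x. f (a + s *\<^sub>R x)) has_derivative
      (\<lambda>h. frechet_derivative f (at (a + s *\<^sub>R x)) (s *\<^sub>R h))) (at x)"
    by (rule has_derivative_compose[rotated]) (auto intro!: derivative_eq_intros)
  have "linear (frechet_derivative f (at (a + s *\<^sub>R x)))"
    using assms linear_frechet_derivative by auto
  then show ?thesis
    unfolding partial_deriv_eqI[OF der] by (simp add: linear_cmul partial_deriv_def)
qed

lemma Ck_affine: "Ck k f \<Longrightarrow> Ck k (\<lambda>x. f (a + s *\<^sub>R x))"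
proof (induction k arbitrary: f)
  case 0
  have "continuous_on UNIV (\<lambda>x. a + s *\<^sub>R x)" by (intro continuous_intros)
  with 0 show ?case by (auto intro: continuous_on_compose2)
next
  case (Suc k)
  have "partial_deriv b (\<lambda>x. f (a + s *\<^sub>R x)) = (\<lambda>x. s * partial_deriv b f (a + s *\<^sub>R x))" for b
    using Suc.prems by (intro ext partial_deriv_affine) simp
  moreover have "(\<lambda>x. f (a + s *\<^sub>R x)) differentiable (at x)" for x
    using Suc.prems differentiable_compose[of f "\<lambda>x. a + s *\<^sub>R x" x UNIV] by (simp add:
        differentiable_add)
  ultimately show ?case using Suc by (auto intro!: Ck_mult Ck_const)
qed

lemma Ck_sum:
  assumes "\<And>i. i \<in> I \<Longrightarrow> Ck k (f i)"
  shows "Ck k (\<lambda>x. \<Sum>i\<in>I. f i x)"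
  using assms
  by (induction I rule: infinite_finite_induct) (auto intro: Ck_add Ck_const)

text \<open>Differentiating \<open>F j (q x)\<close> produces only \<open>F (Suc j)\<close> next to
  derivatives of \<open>q\<close>, so a sequence of successive derivatives is closed under the
  operation and the induction on \<open>k\<close> runs over all \<open>j\<close> at once.\<close>

lemma Ck_compose:
  fixes F :: "nat \<Rightarrow> real \<Rightarrow> real" and q :: "'a::euclidean_space \<Rightarrow> real"
  assumes F: "\<And>j t. (F j has_real_derivative F (Suc j) t) (at t)"
    and q: "\<And>k. Ck k q"
  shows "Ck k (\<lambda>x. F j (q x))"
proof (induction k arbitrary: j)
  case 0
  have "continuous_on UNIV (F j)"
    using F by (meson DERIV_isCont continuous_at_imp_continuous_on)
  moreover have "continuous_on UNIV q" using q[of 0] by simp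
  ultimately show ?case by (auto intro: continuous_on_compose2)
next
  case (Suc k)
  have der: "((\<lambda>x. F j (q x)) has_derivative
      (\<lambda>h. F (Suc j) (q x) * frechet_derivative q (at x) h)) (at x)" for x
  proof -
    have "(q has_derivative frechet_derivative q (at x)) (at x)"
      using q[of "Suc 0"] frechet_derivative_works by auto
    then show ?thesis
      using has_derivative_compose F unfolding has_field_derivative_def by blast
  qed
  have "partial_deriv b (\<lambda>x. F j (q x)) = (\<lambda>x. F (Suc j) (q x) * partial_deriv b q x)" for b
    by (rule ext, subst partial_deriv_eqI[OF der]) (simp add: partial_deriv_def)
  moreover have "(\<lambda>x. F j (q x)) differentiable (at x)" for x
    using der differentiable_def by blast
  moreover have "Ck k (partial_deriv b q)" if "b \<in> Basis" for b
    using q[of "Suc k"] that by auto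
  ultimately show ?case using Suc by (auto intro!: Ck_mult)
qed

text \<open>A family closed under differentiation: the derivative of P(1/t) exp(-1/t) has the
  polynomial X^2 (P - P'). The case \<open>P = 1\<close> is the classical smooth function that is
  flat at the origin, and the polynomial parameter supplies the sequence asked for by
  \<open>Ck_compose\<close>.\<close>

definition flat_exp :: "real poly \<Rightarrow> real \<Rightarrow> real" where
  "flat_exp P t = (if t > 0 then poly P (1 / t) * exp (- (1 / t)) else 0)"

lemma poly_exp_tendsto_0: "((\<lambda>y. poly P y * exp (- y)) \<longlongrightarrow> (0::real)) at_top"
proof -
  have "((\<lambda>y. \<Sum>i\<le>degree P. coeff P i * (y ^ i / exp y)) \<longlongrightarrow> (\<Sum>i\<le>degree P. coeff P i * 0)) at_top"
    by (intro tendsto_intros tendsto_power_div_exp_0)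
  then show ?thesis
    by (simp add: poly_altdef sum_distrib_right exp_minus divide_inverse mult.assoc)
qed

lemma flat_exp_deriv:
  "(flat_exp P has_real_derivative flat_exp (pCons 0 (pCons 0 (P - pderiv P))) t) (at t)"
proof (cases "t = 0")
  case False
  then consider "t > 0" | "t < 0" by linarith
  then show ?thesis
  proof cases
    case 1
    have "((\<lambda>t. poly P (1 / t) * exp (- (1 / t))) has_real_derivative
        flat_exp (pCons 0 (pCons 0 (P - pderiv P))) t) (at t)"
    proof -
      have 2: "((\<lambda>t. 1 / t) has_real_derivative - (1 / t\<^sup>2)) (at t)"
        using 1 by (auto intro!: derivative_eq_intros simp: power2_eq_square divide_inverse)
      have 3: "((\<lambda>t. poly P (1 / t)) has_real_derivative poly (pderiv P) (1 / t) * - (1 / t\<^sup>2)) (at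
          t)"
        by (rule DERIV_chain2[OF poly_DERIV 2])
      have 4: "((\<lambda>t. exp (- (1 / t))) has_real_derivative exp (- (1 / t)) * (1 / t\<^sup>2)) (at t)"
        using DERIV_chain2[OF DERIV_exp DERIV_minus[OF 2]] by simp
      show ?thesis
      proof (rule DERIV_cong[OF DERIV_mult[OF 3 4]])
        have i: "1 / t\<^sup>2 = (1 / t) * (1 / t)" by (simp add: power2_eq_square)
        have "flat_exp (pCons 0 (pCons 0 (P - pderiv P))) t =
            1 / t * (1 / t * (poly P (1 / t) - poly (pderiv P) (1 / t))) * exp (- (1 / t))"
          using 1 by (simp add: flat_exp_def)
        then show "poly (pderiv P) (1 / t) * - (1 / t\<^sup>2) * exp (- (1 / t)) +
            exp (- (1 / t)) * (1 / t\<^sup>2) * poly P (1 / t) =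
            flat_exp (pCons 0 (pCons 0 (P - pderiv P))) t"
          unfolding i by algebra
      qed
    qed
    moreover have ev: "eventually (\<lambda>s. flat_exp P s = poly P (1 / s) * exp (- (1 / s))) (nhds t)"
      using eventually_nhds_in_open[of "{0<..}" t] 1
      by (auto elim!: eventually_mono simp: flat_exp_def)
    ultimately show ?thesis
      by (simp add: DERIV_cong_ev[OF refl ev refl])
  next
    case 2
    have "eventually (\<lambda>s. flat_exp P s = 0) (nhds t)"
      using eventually_nhds_in_open[of "{..<0}" t] 2
      by (auto elim!: eventually_mono simp: flat_exp_def)
    moreover have "((\<lambda>s. 0) has_real_derivative 0) (at t)" by simp
    ultimately show ?thesis
      using DERIV_cong_ev[of t t "flat_exp P" "\<lambda>s. 0" _ 0] 2 by (simp add: flat_exp_def)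
  qed
next
  case True
  \<comment> \<open>At the origin the right difference quotient is again a polynomial in 1/h times
    exp(-1/h), with \<open>P\<close> multiplied by the variable; in terms of 1/h this is a
    polynomial against a decaying exponential at infinity.\<close>
  have "((\<lambda>h. flat_exp P h / h) \<longlongrightarrow> 0) (at_right 0)"
  proof -
    have "((\<lambda>h. poly (pCons 0 P) (inverse h) * exp (- inverse h)) \<longlongrightarrow> 0) (at_right (0::real))"
      using filterlim_compose[OF poly_exp_tendsto_0 filterlim_inverse_at_top_right] .
    moreover have "eventually (\<lambda>h. poly (pCons 0 P) (inverse h) * exp (- inverse h)
        = flat_exp P h / h) (at_right (0::real))"
      using eventually_at_right_less[of 0]
      by eventually_elim (auto simp: flat_exp_def field_simps)
    ultimately show ?thesis by (rule Lim_transform_eventually)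
  qed
  moreover have "((\<lambda>h. flat_exp P h / h) \<longlongrightarrow> 0) (at_left 0)"
  proof -
    have "eventually (\<lambda>h. 0 = flat_exp P h / h) (at_left (0::real))"
      by (auto simp: flat_exp_def eventually_at_filter)
    then show ?thesis using tendsto_const Lim_transform_eventually by fast
  qed
  ultimately have "((\<lambda>h. flat_exp P h / h) \<longlongrightarrow> 0) (at 0)"
    by (simp add: filterlim_at_split)
  then show ?thesis
    using True by (simp add: DERIV_def flat_exp_def)
qed

lemma Ck_flat_exp:
  assumes "\<And>k. Ck k q"
  shows "Ck k (\<lambda>x. flat_exp P (q x))"
proof -
  define F where "F = (\<lambda>j. flat_exp (((\<lambda>P. pCons 0 (pCons 0 (P - pderiv P))) ^^ j) P))"
  have "(F j has_real_derivative F (Suc j) t) (at t)" for j t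
    unfolding F_def funpow.simps comp_def by (rule flat_exp_deriv)
  from Ck_compose[where F = F and q = q and j = 0, OF this assms] show ?thesis
    by (simp add: F_def)
qed

section \<open>Gradients and a second-order Taylor estimate\<close>

lemma has_derivative_grad:
  assumes "f differentiable (at x)"
  shows "(f has_derivative (\<lambda>h. \<Sum>b\<in>Basis. (h \<bullet> b) * partial_deriv b f x)) (at x)"
proof -
  have lin: "linear (frechet_derivative f (at x))"
    using assms linear_frechet_derivative by blast
  have "frechet_derivative f (at x) h = (\<Sum>b\<in>Basis. (h \<bullet> b) * partial_deriv b f x)" for h
  proof -
    have "frechet_derivative f (at x) h = frechet_derivative f (at x) (\<Sum>b\<in>Basis. (h \<bullet> b) *\<^sub>R b)"
      by (simp add: euclidean_representation)
    also have "\<dots> = (\<Sum>b\<in>Basis. (h \<bullet> b) * partial_deriv b f x)"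
      by (simp add: linear_sum[OF lin] linear_cmul[OF lin] partial_deriv_def)
    finally show ?thesis .
  qed
  then have "frechet_derivative f (at x) = (\<lambda>h. \<Sum>b\<in>Basis. (h \<bullet> b) * partial_deriv b f x)" ..
  then show ?thesis
    using assms unfolding frechet_derivative_works by simp
qed

definition grad :: "('a::euclidean_space \<Rightarrow> real) \<Rightarrow> 'a \<Rightarrow> 'a" where
  "grad f x = (\<Sum>b\<in>Basis. partial_deriv b f x *\<^sub>R b)"

lemma grad_inner: "grad f x \<bullet> h = (\<Sum>b\<in>Basis. (h \<bullet> b) * partial_deriv b f x)"
  unfolding grad_def inner_sum_left by (intro sum.cong) (simp_all add: inner_commute[of h])

lemma grad_inner_Basis: "b \<in> Basis \<Longrightarrow> grad f x \<bullet> b = partial_deriv b f x"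
  by (simp add: grad_def)

lemma has_derivative_grad_inner:
  assumes "f differentiable (at x)"
  shows "(f has_derivative (\<lambda>h. grad f x \<bullet> h)) (at x)"
  using has_derivative_grad[OF assms] unfolding grad_inner .

lemma grad_unique:
  assumes "(f has_derivative (\<lambda>h. G \<bullet> h)) (at x)"
  shows "grad f x = G"
proof (rule euclidean_eqI)
  fix b :: 'a assume "b \<in> Basis"
  then show "grad f x \<bullet> b = G \<bullet> b"
    by (simp add: grad_inner_Basis partial_deriv_eqI[OF assms])
qed

text \<open>The mean value inequality, applied twice: to each first partial derivative, and to
  \<open>f\<close> minus its linear part at \<open>z\<close>. Each application costs a factor DIM
  from summing over the basis.\<close>

lemma taylor_bound:
  fixes f :: "'a::euclidean_space \<Rightarrow> real"
  assumes f: "Ck 2 f" and S: "convex S"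
    and B: "\<And>x b c. x \<in> S \<Longrightarrow> b \<in> Basis \<Longrightarrow> c \<in> Basis \<Longrightarrow> \<bar>partial_deriv c (partial_deriv b f) x\<bar> \<le> B"
    and xz: "x \<in> S" "z \<in> S" and B0: "B \<ge> 0"
  shows "\<bar>f x - f z - grad f z \<bullet> (x - z)\<bar> \<le> (real DIM('a))\<^sup>2 * B * (norm (x - z))\<^sup>2"
proof -
  define n where "n = real DIM('a)"
  have n0: "n \<ge> 0" by (simp add: n_def)
  have d: "f differentiable (at x)" "b \<in> Basis \<Longrightarrow> partial_deriv b f differentiable (at x)" for x b
    using f by (auto simp: numeral_2_eq_2)
  have lip: "\<bar>partial_deriv b f y - partial_deriv b f z\<bar> \<le> n * B * norm (y - z)"
    if "y \<in> S" and b: "b \<in> Basis" for y b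
  proof -
    have "norm (partial_deriv b f y - partial_deriv b f z) \<le> n * B * norm (y - z)"
    proof (rule differentiable_bound[OF S])
      fix x assume "x \<in> S"
      show "(partial_deriv b f has_derivative
          (\<lambda>h. \<Sum>c\<in>Basis. (h \<bullet> c) * partial_deriv c (partial_deriv b f) x)) (at x within S)"
        using has_derivative_grad[OF d(2)[OF b]] has_derivative_at_withinI by blast
      show "onorm (\<lambda>h. \<Sum>c\<in>Basis. (h \<bullet> c) * partial_deriv c (partial_deriv b f) x) \<le> n * B"
      proof (rule onorm_le)
        fix h :: 'a
        have "norm (\<Sum>c\<in>Basis. (h \<bullet> c) * partial_deriv c (partial_deriv b f) x)
            \<le> (\<Sum>c\<in>(Basis::'a set). norm h * B)"
          using B[OF \<open>x \<in> S\<close> b] 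
          by (intro sum_norm_le) (auto simp: abs_mult intro!: mult_mono Basis_le_norm)
        then show "norm (\<Sum>c\<in>Basis. (h \<bullet> c) * partial_deriv c (partial_deriv b f) x) \<le> n * B * norm
            h"
          by (simp add: n_def mult_ac)
      qed
    qed (use that xz in auto)
    then show ?thesis by simp
  qed
  \<comment> \<open>Points of the segment are at most |x - z| away from \<open>z\<close>, which may
    fail on the rest of \<open>S\<close>; on \<open>T\<close> the Lipschitz bound for the partial
    derivatives thus becomes a constant.\<close>
  define T where "T = closed_segment z x"
  have T: "T \<subseteq> S" unfolding T_def using S xz by (simp add: closed_segment_subset)
  have "norm ((f x - grad f z \<bullet> x) - (f z - grad f z \<bullet> z)) \<le> (n * (n * B * norm (x - z))) * norm (x
      - z)"
  proof (rule differentiable_bound[of T])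
    show "convex T" by (simp add: T_def)
    fix y assume y: "y \<in> T"
    show "((\<lambda>x. f x - grad f z \<bullet> x) has_derivative (\<lambda>h. grad f y \<bullet> h - grad f z \<bullet> h)) (at y within
        T)"
      by (intro has_derivative_diff has_derivative_at_withinI[OF has_derivative_grad_inner[OF d(1)]]
          derivative_eq_intros) auto
    show "onorm (\<lambda>h. grad f y \<bullet> h - grad f z \<bullet> h) \<le> n * (n * B * norm (x - z))"
    proof (rule onorm_le)
      fix h :: 'a
      have yz: "norm (y - z) \<le> norm (x - z)"
        using y unfolding T_def by (metis dist_norm dist_in_closed_segment norm_minus_commute)
      have "grad f y \<bullet> h - grad f z \<bullet> h = (\<Sum>b\<in>Basis. (partial_deriv b f y - partial_deriv b f z) *
          (h \<bullet> b))"
        by (simp add: grad_inner left_diff_distrib sum_subtractf mult.commute[of "h \<bullet> _"])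
      also have "norm \<dots> \<le> (\<Sum>b\<in>(Basis::'a set). (n * B * norm (x - z)) * norm h)"
      proof (rule sum_norm_le)
        fix b :: 'a assume b: "b \<in> Basis"
        have "\<bar>partial_deriv b f y - partial_deriv b f z\<bar> \<le> n * B * norm (y - z)"
          using lip y T b by auto
        also have "\<dots> \<le> n * B * norm (x - z)" using yz n0 B0 by (intro mult_left_mono) auto
        finally show "norm ((partial_deriv b f y - partial_deriv b f z) * (h \<bullet> b)) \<le> n * B * norm (x
            - z) * norm h"
          using b n0 B0 unfolding real_norm_def abs_mult by (intro mult_mono) (auto simp:
              Basis_le_norm)
      qed
      finally show "norm (grad f y \<bullet> h - grad f z \<bullet> h) \<le> n * (n * B * norm (x - z)) * norm h"
        by (simp add: n_def mult_ac)
    qed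
  qed (auto simp: T_def)
  then show ?thesis
    by (simp add: n_def inner_diff_right power2_eq_square algebra_simps)
qed

section \<open>Test functions and integration by parts\<close>

text \<open>Translations and point reflections are the only changes of variables in the development;
  both have Jacobian one.\<close>

lemma lebesgue_distr_affine:
  assumes "s = 1 \<or> s = -1"
  shows "(\<lambda>x::'a::euclidean_space. a + s *\<^sub>R x) \<in> lebesgue \<rightarrow>\<^sub>M lebesgue"
    and "distr lebesgue lebesgue (\<lambda>x::'a. a + s *\<^sub>R x) = lebesgue"
proof -
  have T: "(\<lambda>x::'a. a + (\<Sum>j\<in>Basis. (s * (x \<bullet> j)) *\<^sub>R j)) = (\<lambda>x. a + s *\<^sub>R x)"
    by (simp flip: scaleR_scaleR scaleR_sum_right add: euclidean_representation)
  have p: "(\<Prod>j\<in>(Basis::'a set). \<bar>s\<bar>) = 1" using assms by auto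
  show "(\<lambda>x::'a. a + s *\<^sub>R x) \<in> lebesgue \<rightarrow>\<^sub>M lebesgue"
    using lebesgue_affine_measurable[where c="\<lambda>_. s" and t=a] assms T by auto
  show "distr lebesgue lebesgue (\<lambda>x::'a. a + s *\<^sub>R x) = lebesgue"
    using lebesgue_affine_euclidean[where c="\<lambda>_. s" and t=a] assms T p
    by (auto simp: density_1)
qed

lemma lebesgue_affine_integral:
  fixes f :: "'a::euclidean_space \<Rightarrow> 'b::euclidean_space"
  assumes s: "s = 1 \<or> s = -1" and f: "f \<in> borel_measurable lebesgue"
  shows "(\<lambda>x. f (a + s *\<^sub>R x)) \<in> borel_measurable lebesgue"
    and "(\<integral>x. f (a + s *\<^sub>R x) \<partial>lebesgue) = (\<integral>x. f x \<partial>lebesgue)"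
    and "integrable lebesgue (\<lambda>x. f (a + s *\<^sub>R x)) \<longleftrightarrow> integrable lebesgue f"
proof -
  note d = lebesgue_distr_affine[OF s, of a]
  show "(\<lambda>x. f (a + s *\<^sub>R x)) \<in> borel_measurable lebesgue"
    using measurable_compose[OF d(1) f] .
  show "(\<integral>x. f (a + s *\<^sub>R x) \<partial>lebesgue) = (\<integral>x. f x \<partial>lebesgue)"
    using integral_distr[OF d(1), of f] f d(2) by simp
  show "integrable lebesgue (\<lambda>x. f (a + s *\<^sub>R x)) \<longleftrightarrow> integrable lebesgue f"
    using integrable_distr_eq[OF d(1), of f] f d(2) by simp
qed

lemma AE_lebesgue_affine:
  assumes s: "s = 1 \<or> s = -1" and P: "AE x in lebesgue. P x"
  shows "AE x::'a::euclidean_space in lebesgue. P (a + s *\<^sub>R x)"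
proof -
  note d = lebesgue_distr_affine[OF s, of a]
  obtain N where N: "{x \<in> space lebesgue. \<not> P x} \<subseteq> N" "emeasure lebesgue N = 0" "N \<in> sets lebesgue"
    using P by (rule AE_E)
  have "AE x in lebesgue. x \<notin> N" using N by (intro AE_not_in) auto
  then have "AE x in distr lebesgue lebesgue (\<lambda>x::'a. a + s *\<^sub>R x). x \<notin> N" unfolding d(2) .
  then have "AE x in lebesgue. a + s *\<^sub>R x \<notin> N"
    by (subst (asm) AE_distr_iff[OF d(1)]) (use N in \<open>simp_all add: Compl_in_sets_lebesgue flip:
        Compl_eq\<close>)
  then show ?thesis using N by (auto elim!: eventually_mono)
qed

section \<open>Calculus of test functions\<close>

lemma Ck_mono: "Ck k f \<Longrightarrow> j \<le> k \<Longrightarrow> Ck j f"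
  by (induction k) (auto simp: le_Suc_eq dest: Ck_Suc_imp_Ck simp del: Ck.simps)

lemma Ck_continuous: "Ck k f \<Longrightarrow> continuous_on S f"
  using Ck_mono[of k f 0] continuous_on_subset by auto

lemma test_function_smooth: "test_function \<Omega> \<phi> \<Longrightarrow> Ck k \<phi>"
  by (simp add: test_function_def)

lemma test_function_continuous: "test_function \<Omega> \<phi> \<Longrightarrow> continuous_on S \<phi>"
  using Ck_continuous test_function_smooth by blast

lemma test_function_differentiable: "test_function \<Omega> \<phi> \<Longrightarrow> \<phi> differentiable (at x)"
  using test_function_smooth[of \<Omega> \<phi> "Suc 0"] by simp

lemma test_function_eq_0: "test_function \<Omega> \<phi> \<Longrightarrow> x \<notin> closure {x. \<phi> x \<noteq> 0} \<Longrightarrow> \<phi> x = 0"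
  using closure_subset[of "{x. \<phi> x \<noteq> 0}"] by auto

lemma test_function_eq_0': "test_function \<Omega> \<phi> \<Longrightarrow> x \<notin> \<Omega> \<Longrightarrow> \<phi> x = 0"
  using test_function_eq_0[of \<Omega> \<phi> x] by (auto simp: test_function_def)

lemma test_function_mono: "test_function \<Omega> \<phi> \<Longrightarrow> \<Omega> \<subseteq> \<Omega>' \<Longrightarrow> test_function \<Omega>' \<phi>"
  by (auto simp: test_function_def)

lemma test_functionI:
  assumes "\<And>k. Ck k \<phi>" "compact K" "K \<subseteq> \<Omega>" "\<And>x. x \<notin> K \<Longrightarrow> \<phi> x = 0"
  shows "test_function \<Omega> \<phi>"
proof -
  have "closure {x. \<phi> x \<noteq> 0} \<subseteq> K"
    using assms by (intro closure_minimal) (auto simp: compact_imp_closed)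
  moreover have "compact (closure {x. \<phi> x \<noteq> 0})"
    using compact_Int_closed[OF assms(2) closed_closure, of "{x. \<phi> x \<noteq> 0}"] calculation
    by (simp add: inf_absorb2)
  ultimately show ?thesis using assms by (auto simp: test_function_def)
qed

lemma test_function_add:
  assumes "test_function \<Omega> \<phi>" "test_function \<Omega> \<psi>"
  shows "test_function \<Omega> (\<lambda>x. \<phi> x + \<psi> x)"
proof (rule test_functionI[of _ "closure {x. \<phi> x \<noteq> 0} \<union> closure {x. \<psi> x \<noteq> 0}"])
  show "Ck k (\<lambda>x. \<phi> x + \<psi> x)" for k
    by (intro Ck_add test_function_smooth[OF assms(1)] test_function_smooth[OF assms(2)])
  show "compact (closure {x. \<phi> x \<noteq> 0} \<union> closure {x. \<psi> x \<noteq> 0})"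
    "closure {x. \<phi> x \<noteq> 0} \<union> closure {x. \<psi> x \<noteq> 0} \<subseteq> \<Omega>"
    using assms unfolding test_function_def by blast+
  fix x assume "x \<notin> closure {x. \<phi> x \<noteq> 0} \<union> closure {x. \<psi> x \<noteq> 0}"
  then show "\<phi> x + \<psi> x = 0"
    using test_function_eq_0[OF assms(1), of x] test_function_eq_0[OF assms(2), of x] by simp
qed

lemma test_function_mult:
  assumes "test_function \<Omega> \<phi>" "\<And>k. Ck k \<zeta>"
  shows "test_function \<Omega> (\<lambda>x. \<zeta> x * \<phi> x)"
proof (rule test_functionI[of _ "closure {x. \<phi> x \<noteq> 0}"])
  show "Ck k (\<lambda>x. \<zeta> x * \<phi> x)" for k
    by (intro Ck_mult assms(2) test_function_smooth[OF assms(1)])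
  show "compact (closure {x. \<phi> x \<noteq> 0})" "closure {x. \<phi> x \<noteq> 0} \<subseteq> \<Omega>"
    using assms unfolding test_function_def by blast+
  show "\<zeta> x * \<phi> x = 0" if "x \<notin> closure {x. \<phi> x \<noteq> 0}" for x
    using test_function_eq_0[OF assms(1) that] by simp
qed

lemma test_function_scale:
  "test_function \<Omega> \<phi> \<Longrightarrow> test_function \<Omega> (\<lambda>x. c * \<phi> x)"
  by (rule test_function_mult) (auto intro: Ck_const)

lemma partial_deriv_eq_0:
  assumes "x \<notin> closure {x. f x \<noteq> 0}"
  shows "partial_deriv b f x = 0"
proof -
  have "(f has_derivative (\<lambda>h. 0)) (at x)"
  proof (rule has_derivative_transform_within_open[of "\<lambda>x. 0" "\<lambda>h. 0"])
    show "((\<lambda>x. 0) has_derivative (\<lambda>h. 0)) (at x)" by simp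
    show "open (- closure {x. f x \<noteq> 0})" "x \<in> - closure {x. f x \<noteq> 0}" using assms by auto
    show "0 = f y" if "y \<in> - closure {x. f x \<noteq> 0}" for y
      using that closure_subset[of "{x. f x \<noteq> 0}"] by auto
  qed
  then show ?thesis using partial_deriv_eqI by metis
qed

lemma grad_eq_0: "x \<notin> closure {x. f x \<noteq> 0} \<Longrightarrow> grad f x = 0"
  by (simp add: grad_def partial_deriv_eq_0)

lemma test_function_partial_deriv:
  assumes "test_function \<Omega> \<phi>" "b \<in> Basis"
  shows "test_function \<Omega> (partial_deriv b \<phi>)"
proof (rule test_functionI[of _ "closure {x. \<phi> x \<noteq> 0}"])
  show "Ck k (partial_deriv b \<phi>)" for k
    using test_function_smooth[OF assms(1), of "Suc k"] assms(2) by auto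
  show "compact (closure {x. \<phi> x \<noteq> 0})" "closure {x. \<phi> x \<noteq> 0} \<subseteq> \<Omega>"
    using assms unfolding test_function_def by blast+
qed (rule partial_deriv_eq_0)

lemma test_function_affine:
  assumes \<phi>: "test_function \<Omega> \<phi>" and s: "s = 1 \<or> s = -1"
  shows "test_function ((\<lambda>x. s *\<^sub>R (x - a)) ` \<Omega>) (\<lambda>x. \<phi> (a + s *\<^sub>R x))"
proof (rule test_functionI[of _ "(\<lambda>x. s *\<^sub>R (x - a)) ` closure {x. \<phi> x \<noteq> 0}"])
  show "Ck k (\<lambda>x. \<phi> (a + s *\<^sub>R x))" for k
    using Ck_affine test_function_smooth[OF \<phi>] by blast
  show "compact ((\<lambda>x. s *\<^sub>R (x - a)) ` closure {x. \<phi> x \<noteq> 0})"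
    using \<phi> by (intro compact_continuous_image continuous_intros) (auto simp: test_function_def)
  show "(\<lambda>x. s *\<^sub>R (x - a)) ` closure {x. \<phi> x \<noteq> 0} \<subseteq> (\<lambda>x. s *\<^sub>R (x - a)) ` \<Omega>"
    using \<phi> by (auto simp: test_function_def)
  fix x assume x: "x \<notin> (\<lambda>x. s *\<^sub>R (x - a)) ` closure {x. \<phi> x \<noteq> 0}"
  have "x = s *\<^sub>R ((a + s *\<^sub>R x) - a)" using s by auto
  then have "a + s *\<^sub>R x \<notin> closure {x. \<phi> x \<noteq> 0}" using x by blast
  then show "\<phi> (a + s *\<^sub>R x) = 0" using test_function_eq_0[OF \<phi>] by blast
qed

lemma test_function_bounded:
  assumes "test_function \<Omega> \<phi>"
  obtains B where "B > 0" "\<And>x. \<bar>\<phi> x\<bar> \<le> B"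
proof -
  have "compact (\<phi> ` closure {x. \<phi> x \<noteq> 0})"
    using assms test_function_continuous by (intro compact_continuous_image) (auto simp:
        test_function_def)
  then obtain B where B: "\<forall>y\<in>\<phi> ` closure {x. \<phi> x \<noteq> 0}. norm y \<le> B" and B0: "B > 0"
    by (metis bounded_pos compact_imp_bounded)
  have "\<bar>\<phi> x\<bar> \<le> B" for x
    using B B0 test_function_eq_0[OF assms, of x] by (cases "x \<in> closure {x. \<phi> x \<noteq> 0}") auto
  then show ?thesis using that B0 by blast
qed

section \<open>Integrability of continuous functions and integration by parts\<close>

lemma continuous_integrable_on_compact:
  fixes f :: "'a::euclidean_space \<Rightarrow> 'b::euclidean_space"
  assumes "continuous_on K f" "compact K"
  shows "integrable (lebesgue_on K) f"
proof -
  have "integrable lborel (\<lambda>x. indicator K x *\<^sub>R f x)"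
    using assms by (rule borel_integrable_compact[rotated])
  then have "integrable lebesgue (\<lambda>x. indicator K x *\<^sub>R f x)"
    using integrable_completion borel_measurable_integrable by blast
  moreover have "K \<in> sets lebesgue" using lmeasurable_compact[OF assms(2)] by (rule fmeasurableD)
  ultimately show ?thesis by (simp add: integrable_restrict_space)
qed

lemma continuous_compact_support_integrable:
  fixes f :: "'a::euclidean_space \<Rightarrow> 'b::euclidean_space"
  assumes "continuous_on UNIV f" "compact K" "\<And>x. x \<notin> K \<Longrightarrow> f x = 0"
  shows "integrable lebesgue f"
proof -
  have "integrable (lebesgue_on K) f"
    using assms by (intro continuous_integrable_on_compact) (auto intro: continuous_on_subset)
  then have "integrable lebesgue (\<lambda>x. indicator K x *\<^sub>R f x)"
    using compact_imp_closed[OF assms(2)] by (subst (asm) integrable_restrict_space) auto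
  moreover have "(\<lambda>x. indicator K x *\<^sub>R f x) = f" using assms(3) by (auto simp: indicator_def)
  ultimately show ?thesis by simp
qed

lemma test_function_integrable:
  assumes "test_function \<Omega> \<phi>" shows "integrable lebesgue \<phi>"
proof (rule continuous_compact_support_integrable[of _ "closure {x. \<phi> x \<noteq> 0}"])
  show "compact (closure {x. \<phi> x \<noteq> 0})" using assms by (simp add: test_function_def)
qed (fact test_function_continuous[OF assms], fact test_function_eq_0[OF assms])

lemma continuous_borel_measurable_lebesgue:
  fixes f :: "'a::euclidean_space \<Rightarrow> 'b::euclidean_space"
  shows "continuous_on UNIV f \<Longrightarrow> f \<in> borel_measurable lebesgue"
  using borel_measurable_continuous_onI measurable_completion by (metis measurable_lborel2)

lemma test_function_borel_measurable: "test_function \<Omega> \<phi> \<Longrightarrow> \<phi> \<in> borel_measurable lebesgue"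
  using test_function_integrable by blast

text \<open>Translation invariance of the measure makes every difference quotient of
  \<open>f\<close> in direction \<open>b\<close> integrate to zero; dominated convergence carries
  this over to the derivative.\<close>

lemma integral_directional_derivative_eq_0:
  fixes f f' :: "'a::euclidean_space \<Rightarrow> real"
  assumes K: "compact K" and f0: "\<And>x. x \<notin> K \<Longrightarrow> f x = 0" and f'0: "\<And>x. x \<notin> K \<Longrightarrow> f' x = 0"
    and der: "\<And>x. ((\<lambda>t. f (x + t *\<^sub>R b)) has_real_derivative f' x) (at 0)"
    and cf: "continuous_on UNIV f" and cf': "continuous_on UNIV f'" and b: "norm b = 1"
  shows "(\<integral>x. f' x \<partial>lebesgue) = 0"
proof -
  obtain R where R: "\<forall>x\<in>K. norm x \<le> R" using K compact_imp_bounded bounded_iff by metis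
  obtain B where B: "\<forall>y\<in>f' ` K. norm y \<le> B" and B0: "B > 0"
    using K cf' by (metis bounded_pos compact_imp_bounded compact_continuous_image
        continuous_on_subset subset_UNIV)
  have B': "\<bar>f' x\<bar> \<le> B" for x using B B0 f'0[of x] by (cases "x \<in> K") auto
  have der': "((\<lambda>t. f (x + t *\<^sub>R b)) has_real_derivative f' (x + s *\<^sub>R b)) (at s)" for x s
  proof -
    have "((\<lambda>t. f (x + s *\<^sub>R b + t *\<^sub>R b)) has_real_derivative f' (x + s *\<^sub>R b)) (at (s - s))"
      using der[of "x + s *\<^sub>R b"] by simp
    then have "((\<lambda>t. f (x + s *\<^sub>R b + (t - s) *\<^sub>R b)) has_real_derivative f' (x + s *\<^sub>R b) * 1) (at
        s)"
      by (rule DERIV_chain2[where g = "\<lambda>t. t - s"]) (auto intro!: derivative_eq_intros)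
    then show ?thesis by (simp add: algebra_simps)
  qed
  define t where "t = (\<lambda>n. 1 / real (Suc n))"
  have t0: "t n > 0" "t n \<le> 1" for n by (auto simp: t_def)
  define g where "g = (\<lambda>n x. (f (x + t n *\<^sub>R b) - f x) / t n)"
  have tlim: "t \<longlonglongrightarrow> 0" unfolding t_def using LIMSEQ_inverse_real_of_nat by (simp add:
      inverse_eq_divide)
  have int_f: "integrable lebesgue f" by (rule continuous_compact_support_integrable[OF cf K f0])
  have meas_f: "f \<in> borel_measurable lebesgue" using int_f by blast
  have shift: "integrable lebesgue (\<lambda>x. f (x + t n *\<^sub>R b))"
    "(\<integral>x. f (x + t n *\<^sub>R b) \<partial>lebesgue) = (\<integral>x. f x \<partial>lebesgue)" for n
    using lebesgue_affine_integral[of 1 f "t n *\<^sub>R b"] meas_f int_f by (auto simp: add.commute)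
  have int0: "(\<integral>x. g n x \<partial>lebesgue) = 0" for n
    unfolding g_def using shift int_f by simp
  have "(\<lambda>n. \<integral>x. g n x \<partial>lebesgue) \<longlonglongrightarrow> (\<integral>x. f' x \<partial>lebesgue)"
  proof (rule integral_dominated_convergence[where w = "\<lambda>x. indicator (cball 0 (R + 1)) x * B"])
    show "f' \<in> borel_measurable lebesgue" by (rule continuous_borel_measurable_lebesgue[OF cf'])
    show "g n \<in> borel_measurable lebesgue" for n
      unfolding g_def using shift(1)[of n] int_f by (intro borel_measurable_divide
          borel_measurable_diff) auto
    show "integrable lebesgue (\<lambda>x. indicator (cball 0 (R + 1)) x * B)"
      by (intro integrable_mult_left integrable_real_indicator)
         (use emeasure_lborel_cball_finite[of 0 "R + 1"] in auto)
    show "AE x in lebesgue. (\<lambda>n. g n x) \<longlonglongrightarrow> f' x"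
    proof (rule AE_I2)
      fix x
      have "(\<lambda>h. (f (x + h *\<^sub>R b) - f x) / h) \<midarrow>0\<rightarrow> f' x"
        using der[of x] by (simp add: DERIV_def)
      moreover have "filterlim t (at 0) sequentially"
        using tlim t0(1) by (intro filterlim_atI) (auto simp: less_le)
      ultimately show "(\<lambda>n. g n x) \<longlonglongrightarrow> f' x"
        unfolding g_def by (rule filterlim_compose)
    qed
    \<comment> \<open>Inside the ball the mean value theorem gives the bound \<open>B\<close>.
      Outside it \<open>x\<close> and the shifted point both miss \<open>K\<close>, since the step
      \<open>t n\<close> is at most one; hence the radius \<open>R + 1\<close>.\<close>
    show "AE x in lebesgue. norm (g n x) \<le> indicator (cball 0 (R + 1)) x * B" for n
    proof (rule AE_I2)
      fix x
      show "norm (g n x) \<le> indicator (cball 0 (R + 1)) x * B"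
      proof (cases "x \<in> cball 0 (R + 1)")
        case True
        obtain z where z: "f (x + t n *\<^sub>R b) - f (x + 0 *\<^sub>R b) = (t n - 0) * f' (x + z *\<^sub>R b)"
          using MVT2[OF t0(1)[of n], of "\<lambda>t. f (x + t *\<^sub>R b)" "\<lambda>t. f' (x + t *\<^sub>R b)"] der' by blast
        have "g n x = f' (x + z *\<^sub>R b)" using z t0[of n] by (simp add: g_def field_simps)
        then show ?thesis using True B' by simp
      next
        case False
        then have x: "norm x > R + 1" by simp
        have "norm x \<le> norm (x + t n *\<^sub>R b) + norm (t n *\<^sub>R b)"
          using norm_triangle_ineq4[of "x + t n *\<^sub>R b" "t n *\<^sub>R b"] by simp
        then have "norm (x + t n *\<^sub>R b) > R" using x b t0[of n] by simp
        then have "x + t n *\<^sub>R b \<notin> K" "x \<notin> K" using R x by (auto simp: not_le[symmetric])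
        then show ?thesis using False by (simp add: g_def f0)
      qed
    qed
  qed
  then show ?thesis using int0 LIMSEQ_unique by (simp add: LIMSEQ_const_iff)
qed

text \<open>The factor \<open>w\<close> may blow up at the boundary of \<open>\<Omega>\<close>. The
  set \<open>\<Omega>\<close> and the complement of the support of \<open>\<phi>\<close> are two
  open sets covering the space, and the product is continuous on each of them.\<close>

lemma continuous_on_test_extension:
  fixes w :: "'a::euclidean_space \<Rightarrow> real"
  assumes "open \<Omega>" "continuous_on \<Omega> w" "test_function \<Omega> \<phi>"
  shows "continuous_on UNIV (\<lambda>x. indicator \<Omega> x * (w x * \<phi> x))"
proof -
  define S where "S = - closure {x. \<phi> x \<noteq> 0}"
  have U: "UNIV = \<Omega> \<union> S" using assms(3) by (auto simp: S_def test_function_def)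
  have S: "\<phi> x = 0" if "x \<in> S" for x using that test_function_eq_0[OF assms(3), of x] by (simp add:
      S_def)
  show ?thesis unfolding U
  proof (rule continuous_on_open_Un)
    have "continuous_on \<Omega> (\<lambda>x. w x * \<phi> x)"
      by (intro continuous_on_mult assms(2) test_function_continuous[OF assms(3)])
    then show "continuous_on \<Omega> (\<lambda>x. indicator \<Omega> x * (w x * \<phi> x))"
      by (rule continuous_on_eq) simp
    have "continuous_on S (\<lambda>x. 0::real)" by simp
    then show "continuous_on S (\<lambda>x. indicator \<Omega> x * (w x * \<phi> x))"
      by (rule continuous_on_eq) (simp add: S)
  qed (use assms in \<open>auto simp: S_def\<close>)
qed

lemma integral_lebesgue_on:
  fixes f :: "'a::euclidean_space \<Rightarrow> real"
  assumes "\<Omega> \<in> sets lebesgue"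
  shows "(\<integral>x. f x \<partial>(lebesgue_on \<Omega>)) = (\<integral>x. indicator \<Omega> x * f x \<partial>lebesgue)"
    "integrable (lebesgue_on \<Omega>) f \<longleftrightarrow> integrable lebesgue (\<lambda>x. indicator \<Omega> x * f x)"
  using integral_restrict_space[of \<Omega> lebesgue f] integrable_restrict_space[of \<Omega> lebesgue f] assms by
      auto

text \<open>The product of \<open>u\<close> with a test function, extended by zero, is
  differentiable on the whole space. Its directional derivative is the sum of the two integrands in
  question and has integral zero.\<close>

lemma is_weak_gradient_C1:
  fixes u :: "'a::euclidean_space \<Rightarrow> real"
  assumes \<Omega>: "open \<Omega>" and der: "\<And>x. x \<in> \<Omega> \<Longrightarrow> (u has_derivative (\<lambda>h. U x \<bullet> h)) (at x)"
    and cU: "continuous_on \<Omega> U"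
  shows "is_weak_gradient \<Omega> u U"
  unfolding is_weak_gradient_def
proof (intro conjI allI impI ballI)
  have cu: "continuous_on \<Omega> u"
    using der by (meson \<Omega> has_derivative_continuous continuous_at_imp_continuous_on)
  have sets: "\<Omega> \<in> sets lebesgue" using \<Omega> by auto
  show "locally_integrable \<Omega> u" "locally_integrable \<Omega> U"
    unfolding locally_integrable_def using cu cU
    by (meson continuous_integrable_on_compact continuous_on_subset)+
  fix \<phi> and b :: 'a assume \<phi>: "test_function \<Omega> \<phi>" and b: "b \<in> Basis"
  define K where "K = closure {x. \<phi> x \<noteq> 0}"
  have K: "compact K" "K \<subseteq> \<Omega>" using \<phi> by (auto simp: K_def test_function_def)
  have \<phi>': "test_function \<Omega> (partial_deriv b \<phi>)" by (rule test_function_partial_deriv[OF \<phi> b])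
  have cUb: "continuous_on \<Omega> (\<lambda>x. U x \<bullet> b)" using cU by (intro continuous_intros)
  define f where "f = (\<lambda>x. indicator \<Omega> x * (u x * \<phi> x))"
  define f1 where "f1 = (\<lambda>x. indicator \<Omega> x * (u x * partial_deriv b \<phi> x))"
  define f2 where "f2 = (\<lambda>x. indicator \<Omega> x * ((U x \<bullet> b) * \<phi> x))"
  have out: "\<phi> x = 0" "partial_deriv b \<phi> x = 0" if "x \<notin> K" for x
    using that partial_deriv_eq_0[of x \<phi> b] test_function_eq_0[OF \<phi>, of x] by (simp_all add: K_def)
  have c: "continuous_on UNIV f" "continuous_on UNIV f1" "continuous_on UNIV f2"
    unfolding f_def f1_def f2_def using \<Omega> cu cUb \<phi> \<phi>' by (auto intro: continuous_on_test_extension)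
  have i: "integrable lebesgue f1" "integrable lebesgue f2"
    by (intro continuous_compact_support_integrable[OF _ K(1)] c; simp add: f1_def f2_def out)+
  have "(\<integral>x. f1 x + f2 x \<partial>lebesgue) = 0"
  proof (rule integral_directional_derivative_eq_0[OF K(1), of f])
    show "norm b = 1" using b by simp
    fix x
    show "x \<notin> K \<Longrightarrow> f x = 0" "x \<notin> K \<Longrightarrow> f1 x + f2 x = 0"
      using out by (auto simp: f_def f1_def f2_def)
    have "\<exists>L. (f has_derivative L) (at x) \<and> L b = f1 x + f2 x"
    proof (cases "x \<in> \<Omega>")
      case True
      have "((\<lambda>x. u x * \<phi> x) has_derivative (\<lambda>h. u x * (grad \<phi> x \<bullet> h) + (U x \<bullet> h) * \<phi> x)) (at x)"
        by (intro has_derivative_mult der True has_derivative_grad_inner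
            test_function_differentiable[OF \<phi>])
      then have "(f has_derivative (\<lambda>h. u x * (grad \<phi> x \<bullet> h) + (U x \<bullet> h) * \<phi> x)) (at x)"
        by (rule has_derivative_transform_within_open[OF _ \<Omega> True]) (auto simp: f_def)
      moreover have "u x * (grad \<phi> x \<bullet> b) + (U x \<bullet> b) * \<phi> x = f1 x + f2 x"
        using True b by (simp add: f1_def f2_def grad_inner_Basis)
      ultimately show ?thesis by blast
    next
      case False
      then have xK: "x \<in> - K" using K by auto
      have "(f has_derivative (\<lambda>h. 0)) (at x)"
        by (rule has_derivative_transform_within_open[of "\<lambda>x. 0" _ _ _ "- K"])
          (use xK K out in \<open>auto simp: f_def compact_imp_closed\<close>)
      moreover have "0 = f1 x + f2 x" using False by (simp add: f1_def f2_def)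
      ultimately show ?thesis by blast
    qed
    then obtain L where L: "(f has_derivative L) (at x)" "L b = f1 x + f2 x" by blast
    have "((\<lambda>t. x + t *\<^sub>R b) has_derivative (\<lambda>t. t *\<^sub>R b)) (at 0)"
      by (auto intro!: derivative_eq_intros)
    then have "((\<lambda>t. f (x + t *\<^sub>R b)) has_derivative (\<lambda>t. L (t *\<^sub>R b))) (at 0)"
      by (rule has_derivative_compose) (use L in simp)
    moreover have "(\<lambda>t. L (t *\<^sub>R b)) = (*) (f1 x + f2 x)"
      using linear_cmul[OF has_derivative_linear[OF L(1)]] L(2) by (auto simp: mult.commute)
    ultimately show "((\<lambda>t. f (x + t *\<^sub>R b)) has_real_derivative f1 x + f2 x) (at 0)"
      unfolding has_field_derivative_def by simp
    show "continuous_on UNIV f" "continuous_on UNIV (\<lambda>x. f1 x + f2 x)"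
      using c by (auto intro: continuous_intros)
  qed
  then have "(\<integral>x. f1 x \<partial>lebesgue) = - (\<integral>x. f2 x \<partial>lebesgue)" using i by simp
  then show "(\<integral>x. u x * partial_deriv b \<phi> x \<partial>(lebesgue_on \<Omega>)) =
        - (\<integral>x. (U x \<bullet> b) * \<phi> x \<partial>(lebesgue_on \<Omega>))"
    unfolding integral_lebesgue_on[OF sets] f1_def f2_def .
qed

section \<open>A smooth kernel of unit mass\<close>

definition mollifier :: "real \<Rightarrow> 'a::euclidean_space \<Rightarrow> real" where
  "mollifier \<epsilon> x = flat_exp 1 (\<epsilon>\<^sup>2 - x \<bullet> x) / (\<integral>x. flat_exp 1 (\<epsilon>\<^sup>2 - (x::'a) \<bullet> x) \<partial>lebesgue)"

lemma Ck_inner_self: "Ck k (\<lambda>x::'a::euclidean_space. x \<bullet> x)"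
proof -
  have "(\<lambda>x::'a. x \<bullet> x) = (\<lambda>x. \<Sum>b\<in>Basis. (x \<bullet> b) * (x \<bullet> b))"
    by (intro ext) (rule euclidean_inner)
  then show ?thesis by (simp add: Ck_sum Ck_mult Ck_inner)
qed

lemma mollifier:
  assumes \<epsilon>: "\<epsilon> > 0"
  shows test_function_mollifier: "cball 0 \<epsilon> \<subseteq> \<Omega> \<Longrightarrow> test_function \<Omega> (mollifier \<epsilon> ::
      'a::euclidean_space \<Rightarrow> real)"
    and mollifier_nonneg: "mollifier \<epsilon> x \<ge> 0"
    and mollifier_eq_0: "norm (x::'a) \<ge> \<epsilon> \<Longrightarrow> mollifier \<epsilon> x = 0"
    and integrable_mollifier: "integrable lebesgue (mollifier \<epsilon> :: 'a \<Rightarrow> real)"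
    and integral_mollifier: "(\<integral>x. mollifier \<epsilon> (x::'a) \<partial>lebesgue) = 1"
    and "Ck k (mollifier \<epsilon> :: 'a \<Rightarrow> real)"
proof -
  define f where "f = (\<lambda>x::'a. flat_exp 1 (\<epsilon>\<^sup>2 - x \<bullet> x))"
  have Ckf: "Ck k f" for k
    unfolding f_def
  proof (rule Ck_flat_exp)
    fix k
    have "(\<lambda>x::'a. \<epsilon>\<^sup>2 - x \<bullet> x) = (\<lambda>x. \<epsilon>\<^sup>2 + (-1) * (x \<bullet> x))" by auto
    then show "Ck k (\<lambda>x::'a. \<epsilon>\<^sup>2 - x \<bullet> x)"
      using Ck_add[OF Ck_const[of k "\<epsilon>\<^sup>2"] Ck_mult[OF Ck_const[of k "-1"] Ck_inner_self]] by simp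
  qed
  have f0: "f x \<ge> 0" for x by (auto simp: f_def flat_exp_def)
  have fz: "f x = 0" if "norm x \<ge> \<epsilon>" for x
    using power_mono[OF that, of 2] \<epsilon> by (simp add: f_def flat_exp_def dot_square_norm not_less)
  have fp: "f x > 0" if "norm x < \<epsilon>" for x
    using that power_strict_mono[of "norm x" \<epsilon> 2] by (simp add: f_def flat_exp_def dot_square_norm)
  have int: "integrable lebesgue f"
    by (rule continuous_compact_support_integrable[of _ "cball 0 \<epsilon>"]) (auto intro: Ck_continuous[OF
        Ckf] fz)
  define Z where "Z = (\<integral>x. f x \<partial>lebesgue)"
  \<comment> \<open>The normalisation divides by \<open>Z\<close>. Were it zero, the nonnegative
    bump would vanish almost everywhere, although it is positive on an open ball.\<close>
  have "Z \<noteq> 0"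
  proof
    assume "Z = 0"
    then have "AE x in lebesgue. f x = 0"
      unfolding Z_def using integral_nonneg_eq_0_iff_AE[OF int] f0 by auto
    then have "AE x in lebesgue. x \<notin> ball (0::'a) \<epsilon>"
      by eventually_elim (use fp in force)
    then have "ball (0::'a) \<epsilon> \<in> null_sets lebesgue" by (subst (asm) AE_iff_null_sets[symmetric])
        auto
    then have "negligible (ball (0::'a) \<epsilon>)" by (simp add: negligible_iff_null_sets)
    then show False using open_not_negligible[of "ball (0::'a) \<epsilon>"] \<epsilon> by auto
  qed
  moreover have "Z \<ge> 0" unfolding Z_def using f0 by simp
  ultimately have Z: "Z > 0" by simp
  have m: "mollifier \<epsilon> = (\<lambda>x. (1 / Z) * f x)" by (auto simp: mollifier_def f_def Z_def)
  show Ckm: "Ck k (mollifier \<epsilon> :: 'a \<Rightarrow> real)" for k unfolding m by (intro Ck_mult Ck_const Ckf)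
  show "mollifier \<epsilon> x \<ge> 0" for x :: 'a using Z f0 by (simp add: m)
  show z: "norm x \<ge> \<epsilon> \<Longrightarrow> mollifier \<epsilon> x = 0" for x :: 'a by (simp add: m fz)
  show "integrable lebesgue (mollifier \<epsilon> :: 'a \<Rightarrow> real)" using int by (simp add: m)
  show "(\<integral>x. mollifier \<epsilon> (x::'a) \<partial>lebesgue) = 1" using Z by (simp add: m Z_def)
  show "cball 0 \<epsilon> \<subseteq> \<Omega> \<Longrightarrow> test_function \<Omega> (mollifier \<epsilon> :: 'a \<Rightarrow> real)"
    using Ckm by (rule test_functionI[of _ "cball 0 \<epsilon>"]) (auto intro: z)
qed

section \<open>Inequalities for powers and translations in \<open>L\<^sup>p\<close>\<close>

lemma powr_add_le:
  fixes a b p :: real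
  assumes "a \<ge> 0" "b \<ge> 0" "p \<ge> 0"
  shows "(a + b) powr p \<le> 2 powr p * (a powr p + b powr p)"
proof -
  have "(a + b) powr p \<le> (2 * max a b) powr p"
    using assms by (intro powr_mono2) auto
  also have "\<dots> = 2 powr p * max a b powr p" using assms by (simp add: powr_mult)
  also have "\<dots> \<le> 2 powr p * (a powr p + b powr p)"
    by (intro mult_left_mono) (auto simp: max_def)
  finally show ?thesis .
qed

lemma norm_add_powr_le:
  assumes "p \<ge> 0"
  shows "norm (a + b) powr p \<le> 2 powr p * (norm a powr p + norm b powr p)"
  using powr_mono2[OF assms norm_ge_zero norm_triangle_ineq[of a b]]
    powr_add_le[OF norm_ge_zero[of a] norm_ge_zero[of b] assms] by linarith

text \<open>Young's inequality with weights 1/p and 1 - 1/p, applied to s^p and t^p, is this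
  inequality rearranged. It is used for positive arguments, so a vanishing one is treated
  separately.\<close>

lemma powr_tangent:
  fixes s t p :: real
  assumes "s \<ge> 0" "t \<ge> 0" "p \<ge> 1"
  shows "t powr p + p * t powr (p - 1) * (s - t) \<le> s powr p"
proof (cases "s = 0 \<or> t = 0")
  case False
  then have st: "s > 0" "t > 0" using assms by auto
  have "(s powr p) powr (1 / p) * (t powr p) powr (1 - 1 / p) \<le> (1 / p) * s powr p + (1 - 1 / p) * t
      powr p"
    using assms st by (intro Youngs_inequality_0) auto
  moreover have "(s powr p) powr (1 / p) * (t powr p) powr (1 - 1 / p) = s * t powr (p - 1)"
    using assms st by (simp add: powr_powr right_diff_distrib)
  ultimately have "p * (s * t powr (p - 1)) \<le> p * ((1 / p) * s powr p + (1 - 1 / p) * t powr p)"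
    using assms by (intro mult_left_mono) auto
  also have "\<dots> = s powr p + (p - 1) * t powr p" using assms by (simp add: field_simps)
  finally have 1: "p * (s * t powr (p - 1)) \<le> s powr p + (p - 1) * t powr p" .
  have "t powr p = t * t powr (p - 1)" using st by (simp add: powr_mult_base)
  with 1 show ?thesis by (simp add: algebra_simps)
next
  case True
  have "t * t powr (p - 1) = t powr p" using assms by (simp add: powr_mult_base)
  then have "t powr p + p * t powr (p - 1) * (0 - t) = (1 - p) * t powr p"
    by (simp add: algebra_simps)
  also have "\<dots> \<le> 0" using assms by (simp add: mult_nonpos_nonneg)
  finally show ?thesis using True by auto
qed

lemma powr_tangent_strict:
  fixes s t p :: real
  assumes "s \<ge> 0" "t > 0" "p > 1" "s \<noteq> t"
  shows "t powr p + p * t powr (p - 1) * (s - t) < s powr p"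
proof (cases "s = 0")
  case True
  have "t * t powr (p - 1) = t powr p" using assms by (simp add: powr_mult_base)
  then have "t powr p + p * t powr (p - 1) * (0 - t) = (1 - p) * t powr p"
    by (simp add: algebra_simps)
  also have "\<dots> < 0" using assms by (simp add: mult_neg_pos)
  finally show ?thesis using True by auto
next
  case False
  then have s: "s > 0" using assms by simp
  have der: "((\<lambda>x. x powr p) has_real_derivative p * x powr (p - 1)) (at x)" if "x > 0" for x ::
      real
    using that by (auto intro!: derivative_eq_intros simp: powr_diff)
  show ?thesis
  proof (cases "s < t")
    case True
    obtain z where z: "s < z" "z < t" "t powr p - s powr p = (t - s) * (p * z powr (p - 1))"
      using MVT2[OF True, of "\<lambda>x. x powr p" "\<lambda>x. p * x powr (p - 1)"] der s by auto
    have "z powr (p - 1) < t powr (p - 1)" using z s assms by (intro powr_less_mono2) auto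
    then have "(t - s) * (p * z powr (p - 1)) < (t - s) * (p * t powr (p - 1))"
      using True assms by (intro mult_strict_left_mono) auto
    with z(3) show ?thesis by (simp add: algebra_simps)
  next
    case False
    then have "t < s" using assms by simp
    then obtain z where z: "t < z" "z < s" "s powr p - t powr p = (s - t) * (p * z powr (p - 1))"
      using MVT2[of t s "\<lambda>x. x powr p" "\<lambda>x. p * x powr (p - 1)"] der assms by auto
    have "t powr (p - 1) < z powr (p - 1)" using z s assms by (intro powr_less_mono2) auto
    then have "(s - t) * (p * t powr (p - 1)) < (s - t) * (p * z powr (p - 1))"
      using \<open>t < s\<close> assms by (intro mult_strict_left_mono) auto
    with z(3) show ?thesis by (simp add: algebra_simps)
  qed
qed

text \<open>The vector field |a|^(p-2) a, for p > 1 the gradient of |a|^p / p. Evaluated at the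
  gradient of a function it is the flux whose divergence is the p-Laplace operator.\<close>

definition pflux :: "real \<Rightarrow> 'a::real_inner \<Rightarrow> 'a" where
  "pflux p a = norm a powr (p - 2) *\<^sub>R a"

lemma pflux_inner_self: "pflux p a \<bullet> a = norm a powr p"
proof (cases "a = 0")
  case False
  then have "norm a powr (p - 2) * (norm a)\<^sup>2 = norm a powr p"
    using powr_add[of "norm a" "p - 2" 2] by simp
  then show ?thesis by (simp add: pflux_def dot_square_norm)
qed (simp add: pflux_def)

lemma norm_pflux: "norm (pflux p a) = norm a powr (p - 1)"
proof (cases "a = 0")
  case False
  then have "norm a powr (p - 2) * norm a = norm a powr (p - 1)"
    using powr_add[of "norm a" "p - 2" 1] by simp
  then show ?thesis by (simp add: pflux_def)
qed (simp add: pflux_def)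

text \<open>Cauchy-Schwarz reduces the vector inequality to the scalar tangent inequality between
  the norms of \<open>a\<close> and \<open>b\<close>.\<close>

lemma norm_powr_tangent:
  fixes a b :: "'a::real_inner"
  assumes "p \<ge> 1"
  shows "norm a powr p + p * (pflux p a \<bullet> (b - a)) \<le> norm b powr p"
proof -
  have "pflux p a \<bullet> b \<le> norm a powr (p - 1) * norm b"
    using norm_cauchy_schwarz[of "pflux p a" b] by (simp add: norm_pflux)
  moreover have "norm a powr p = norm a powr (p - 1) * norm a"
    by (simp add: powr_mult_base mult.commute)
  ultimately have "pflux p a \<bullet> (b - a) \<le> norm a powr (p - 1) * (norm b - norm a)"
    by (simp add: inner_diff_right pflux_inner_self right_diff_distrib)
  then have "p * (pflux p a \<bullet> (b - a)) \<le> p * (norm a powr (p - 1) * (norm b - norm a))"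
    using assms by (intro mult_left_mono) auto
  with powr_tangent[of "norm b" "norm a" p] assms show ?thesis
    unfolding mult.assoc by (smt (verit) norm_ge_zero)
qed

text \<open>Strictness has two sources. If the norms differ, it comes from the scalar inequality; if
  they agree and \<open>a \<noteq> b\<close>, Cauchy-Schwarz is strict, as expanding |b - a|^2
  shows. At \<open>a = 0\<close> the flux vanishes and |b| > 0 remains.\<close>

lemma norm_powr_tangent_strict:
  fixes a b :: "'a::real_inner"
  assumes p: "p > 1" and ab: "a \<noteq> b"
  shows "norm a powr p + p * (pflux p a \<bullet> (b - a)) < norm b powr p"
proof (cases "a = 0")
  case True
  then show ?thesis using assms by (simp add: pflux_def)
next
  case False
  have eq: "norm a powr p = norm a powr (p - 1) * norm a"
    by (simp add: powr_mult_base mult.commute)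
  have le: "pflux p a \<bullet> b \<le> norm a powr (p - 1) * norm b"
    using norm_cauchy_schwarz[of "pflux p a" b] by (simp add: norm_pflux)
  show ?thesis
  proof (cases "norm b = norm a")
    case False
    have "pflux p a \<bullet> (b - a) \<le> norm a powr (p - 1) * (norm b - norm a)"
      using le eq by (simp add: inner_diff_right pflux_inner_self right_diff_distrib)
    then have "p * (pflux p a \<bullet> (b - a)) \<le> p * (norm a powr (p - 1) * (norm b - norm a))"
      using p by (intro mult_left_mono) auto
    moreover have "norm a powr p + p * (norm a powr (p - 1) * (norm b - norm a)) < norm b powr p"
      using powr_tangent_strict[of "norm b" "norm a" p] p False \<open>a \<noteq> 0\<close> by (simp add: mult.assoc)
    ultimately show ?thesis by linarith
  next
    case True
    have "0 < (norm (b - a))\<^sup>2" using ab by simp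
    also have "\<dots> = 2 * (norm a)\<^sup>2 - 2 * (a \<bullet> b)"
      using True by (simp add: power2_norm_eq_inner inner_diff inner_commute norm_eq)
    finally have "a \<bullet> b < a \<bullet> a" by (simp add: power2_norm_eq_inner)
    then have "pflux p a \<bullet> (b - a) < 0"
      using \<open>a \<noteq> 0\<close> by (simp add: pflux_def inner_diff_right mult_pos_neg)
    then show ?thesis using True p by (simp add: mult_pos_neg)
  qed
qed

text \<open>The weighted sum of the two tangent inequalities at the intermediate point: the linear
  terms cancel. The strict version arises in the same way from the strict tangent
  inequality.\<close>

lemma norm_powr_convex:
  fixes a b :: "'a::real_inner"
  assumes p: "p \<ge> 1" and t: "0 \<le> t" "t \<le> 1"
  shows "norm (a + t *\<^sub>R (b - a)) powr p \<le> (1 - t) * norm a powr p + t * norm b powr p"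
proof -
  define c where "c = a + t *\<^sub>R (b - a)"
  have "(1 - t) * (norm c powr p + p * (pflux p c \<bullet> (a - c))) + t * (norm c powr p + p * (pflux p c
      \<bullet> (b - c)))
      \<le> (1 - t) * norm a powr p + t * norm b powr p"
    using t by (intro add_mono mult_left_mono norm_powr_tangent p) auto
  also have "(1 - t) * (norm c powr p + p * (pflux p c \<bullet> (a - c))) + t * (norm c powr p + p * (pflux
      p c \<bullet> (b - c)))
      = norm c powr p + p * (pflux p c \<bullet> ((1 - t) *\<^sub>R (a - c) + t *\<^sub>R (b - c)))"
    by (simp add: inner_add_right algebra_simps)
  also have "(1 - t) *\<^sub>R (a - c) + t *\<^sub>R (b - c) = 0" by (simp add: c_def algebra_simps)
  finally show ?thesis by (simp add: c_def)
qed

lemma norm_powr_strict_convex: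
  fixes a b :: "'a::real_inner"
  assumes p: "p > 1" and t: "0 < t" "t < 1" and ab: "a \<noteq> b"
  shows "norm (a + t *\<^sub>R (b - a)) powr p < (1 - t) * norm a powr p + t * norm b powr p"
proof -
  define c where "c = a + t *\<^sub>R (b - a)"
  have "a - c = t *\<^sub>R (a - b)" "b - c = (1 - t) *\<^sub>R (b - a)" by (simp_all add: c_def algebra_simps)
  then have ne: "c \<noteq> a" "c \<noteq> b" using t ab by auto
  have "(1 - t) * (norm c powr p + p * (pflux p c \<bullet> (a - c))) + t * (norm c powr p + p * (pflux p c
      \<bullet> (b - c)))
      < (1 - t) * norm a powr p + t * norm b powr p"
    using t by (intro add_strict_mono mult_strict_left_mono norm_powr_tangent_strict p ne) auto
  also have "(1 - t) * (norm c powr p + p * (pflux p c \<bullet> (a - c))) + t * (norm c powr p + p * (pflux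
      p c \<bullet> (b - c)))
      = norm c powr p + p * (pflux p c \<bullet> ((1 - t) *\<^sub>R (a - c) + t *\<^sub>R (b - c)))"
    by (simp add: inner_add_right algebra_simps)
  also have "(1 - t) *\<^sub>R (a - c) + t *\<^sub>R (b - c) = 0" by (simp add: c_def algebra_simps)
  finally show ?thesis by (simp add: c_def)
qed

text \<open>The tangent inequality at the mean value \<open>a\<close> is integrated against the
  weight \<open>w\<close>; its linear term has integral zero. The right-hand side is an extended
  nonnegative integral, so without integrability it is infinite and the bound is trivial.\<close>

lemma jensen_powr:
  fixes f w :: "'a \<Rightarrow> real"
  assumes p: "p \<ge> 1" and w: "integrable M w" "(\<integral>y. w y \<partial>M) = 1" and w0: "\<And>y. w y \<ge> 0"
    and wf: "integrable M (\<lambda>y. w y * f y)" and f: "f \<in> borel_measurable M"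
  shows "ennreal (\<bar>\<integral>y. w y * f y \<partial>M\<bar> powr p) \<le> (\<integral>\<^sup>+y. ennreal (w y * \<bar>f y\<bar> powr p) \<partial>M)"
proof (cases "integrable M (\<lambda>y. w y * \<bar>f y\<bar> powr p)")
  case True
  define a where "a = (\<integral>y. w y * f y \<partial>M)"
  have "(\<integral>y. w y * \<bar>a\<bar> powr p + p * pflux p a * (w y * f y - w y * a) \<partial>M) \<le> (\<integral>y. w y * \<bar>f y\<bar> powr p
      \<partial>M)"
  proof (rule integral_mono[OF _ True])
    show "integrable M (\<lambda>y. w y * \<bar>a\<bar> powr p + p * pflux p a * (w y * f y - w y * a))"
      using w wf by (intro Bochner_Integration.integrable_add integrable_mult_left
          integrable_mult_right
          Bochner_Integration.integrable_diff) auto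
    fix y
    have "w y * (\<bar>a\<bar> powr p + p * (pflux p a * (f y - a))) \<le> w y * \<bar>f y\<bar> powr p"
      using norm_powr_tangent[OF p, of a "f y"] w0[of y] by (intro mult_left_mono) (auto simp:
          mult.commute)
    then show "w y * \<bar>a\<bar> powr p + p * pflux p a * (w y * f y - w y * a) \<le> w y * \<bar>f y\<bar> powr p"
      by (simp add: algebra_simps)
  qed
  also have "(\<integral>y. w y * \<bar>a\<bar> powr p + p * pflux p a * (w y * f y - w y * a) \<partial>M) = \<bar>a\<bar> powr p"
    using w wf by (simp add: a_def)
  finally show ?thesis
    using True w0 by (subst nn_integral_eq_integral) (auto simp: a_def)
next
  case False
  have "(\<integral>\<^sup>+y. ennreal (w y * \<bar>f y\<bar> powr p) \<partial>M) = \<infinity>"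
  proof (rule ccontr)
    assume "(\<integral>\<^sup>+y. ennreal (w y * \<bar>f y\<bar> powr p) \<partial>M) \<noteq> \<infinity>"
    then have "integrable M (\<lambda>y. w y * \<bar>f y\<bar> powr p)"
      using w(1) f w0 by (intro integrableI_nonneg) (auto simp: less_top)
    with False show False by simp
  qed
  then show ?thesis by simp
qed

lemma Lp_dominated_convergence:
  fixes g :: "nat \<Rightarrow> 'a \<Rightarrow> 'b::euclidean_space"
  assumes p: "p > 0" and g: "\<And>k. g k \<in> borel_measurable M"
    and w: "integrable M w" and bound: "\<And>k. AE x in M. norm (g k x) powr p \<le> w x"
    and lim: "AE x in M. (\<lambda>k. g k x) \<longlonglongrightarrow> 0"
  shows "(\<lambda>k. \<integral>\<^sup>+x. ennreal (norm (g k x) powr p) \<partial>M) \<longlonglongrightarrow> 0"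
proof -
  have "(\<lambda>k. (\<integral>\<^sup>+x. ennreal (norm (0 - norm (g k x) powr p)) \<partial>M)) \<longlonglongrightarrow> 0"
  proof (rule nn_integral_dominated_convergence_norm[where w = "\<lambda>x. \<bar>w x\<bar>"])
    show "AE x in M. norm (norm (g k x) powr p) \<le> \<bar>w x\<bar>" for k
      using bound[of k] by eventually_elim auto
    show "(\<integral>\<^sup>+ x. ennreal \<bar>w x\<bar> \<partial>M) < \<infinity>"
      using w by (simp add: integrable_iff_bounded)
    show "AE x in M. (\<lambda>k. norm (g k x) powr p) \<longlonglongrightarrow> 0"
      using lim
    proof eventually_elim
      case (elim x)
      then show ?case using p by (intro tendsto_zero_powrI[where b=p]) (auto simp:
          tendsto_norm_zero_iff)
    qed
  qed (use g w in auto)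
  then show ?thesis by simp
qed

lemma lebesgue_affine_nn_integral:
  fixes f :: "'a::euclidean_space \<Rightarrow> ennreal"
  assumes s: "s = 1 \<or> s = -1" and f: "f \<in> borel_measurable lebesgue"
  shows "(\<integral>\<^sup>+x. f (a + s *\<^sub>R x) \<partial>lebesgue) = (\<integral>\<^sup>+x. f x \<partial>lebesgue)"
  using nn_integral_distr[OF lebesgue_distr_affine(1)[OF s, of a], of f] f
      lebesgue_distr_affine(2)[OF s, of a]
  by simp

text \<open>The property holds for continuous functions of bounded support and survives
  approximation in the p-th mean. It is transferred twice: to functions with bounded values and
  bounded support, and from these to \<open>u\<close>.\<close>

lemma Lp_translation_continuous:
  fixes u :: "'a::euclidean_space \<Rightarrow> real"
  assumes p: "p \<ge> 1" and u: "u \<in> borel_measurable lebesgue" "integrable lebesgue (\<lambda>x. \<bar>u x\<bar> powr p)"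
    and \<delta>: "\<delta> > (0::real)"
  shows "\<exists>\<eta>>0. \<forall>y. norm y \<le> \<eta> \<longrightarrow> (\<integral>\<^sup>+x. ennreal (\<bar>u (x - y) - u x\<bar> powr p) \<partial>lebesgue) \<le> ennreal \<delta>"
    (is "?P u \<delta>")
proof -
  \<comment> \<open>For shifts of length at most one the difference lives on the ball of radius
    \<open>R + 1\<close>, and both arguments stay in the ball of radius \<open>R + 2\<close>, on
    which \<open>f\<close> is uniformly continuous.\<close>
  have cont: "?P f \<delta>" if f: "continuous_on UNIV f" and z: "\<And>x. norm x > R \<Longrightarrow> f x = 0"
    and \<delta>: "\<delta> > (0::real)" for f :: "'a \<Rightarrow> real" and R \<delta>
  proof -
    define V where "V = measure lebesgue (cball (0::'a) (R + 1))"
    define e where "e = (\<delta> / (V + 1)) powr (1 / p)"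
    have V: "V \<ge> 0" by (simp add: V_def)
    have e: "e > 0" "e powr p = \<delta> / (V + 1)" using \<delta> V p by (simp_all add: e_def powr_powr)
    have "uniformly_continuous_on (cball 0 (R + 2)) f"
      using f by (intro compact_uniformly_continuous) (auto intro: continuous_on_subset)
    then obtain d where d: "d > 0" "\<And>x y. x \<in> cball 0 (R + 2) \<Longrightarrow> y \<in> cball 0 (R + 2) \<Longrightarrow> dist y x < d \<Longrightarrow>
        dist (f y) (f x) < e"
      using e(1) unfolding uniformly_continuous_on_def by metis
    have "(\<integral>\<^sup>+x. ennreal (\<bar>f (x - y) - f x\<bar> powr p) \<partial>lebesgue) \<le> ennreal \<delta>" if y: "norm y \<le> min 1 (d
        / 2)" for y
    proof -
      have "\<bar>f (x - y) - f x\<bar> powr p \<le> (\<delta> / (V + 1)) * indicator (cball 0 (R + 1)) x" for x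
      proof (cases "x \<in> cball 0 (R + 1)")
        case True
        have "norm (x - y) \<le> norm x + norm y" by (rule norm_triangle_ineq4)
        then have "dist (f (x - y)) (f x) < e"
          using True y d(1) by (intro d(2)) (auto simp: dist_norm norm_minus_commute[of y x])
        then have "\<bar>f (x - y) - f x\<bar> powr p \<le> e powr p"
          using p by (intro powr_mono2) (auto simp: dist_norm)
        then show ?thesis using True e by simp
      next
        case False
        have "norm x \<le> norm (x - y) + norm y" using norm_triangle_ineq[of "x - y" y] by simp
        then show ?thesis using False y z[of x] z[of "x - y"] by simp
      qed
      note le = this
      have "(\<integral>\<^sup>+x. ennreal (\<bar>f (x - y) - f x\<bar> powr p) \<partial>lebesgue)
          \<le> (\<integral>\<^sup>+x. ennreal (\<delta> / (V + 1)) * indicator (cball (0::'a) (R + 1)) x \<partial>lebesgue)"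
      proof (intro nn_integral_mono)
        fix x :: 'a
        show "ennreal (\<bar>f (x - y) - f x\<bar> powr p) \<le> ennreal (\<delta> / (V + 1)) * indicator (cball 0 (R +
            1)) x"
          using ennreal_leI[OF le[of x]] by (cases "x \<in> cball 0 (R + 1)") auto
      qed
      also have "\<dots> = ennreal (\<delta> / (V + 1)) * emeasure lebesgue (cball (0::'a) (R + 1))"
        by (simp add: nn_integral_cmult_indicator)
      also have "\<dots> = ennreal (\<delta> / (V + 1)) * ennreal V"
        using emeasure_lborel_cball_finite[of "0::'a" "R + 1"]
        by (simp add: V_def emeasure_eq_ennreal_measure)
      also have "\<dots> = ennreal (\<delta> / (V + 1) * V)"
        using V \<delta> by (intro ennreal_mult[symmetric]) auto
      also have "\<dots> \<le> ennreal \<delta>" using V \<delta> by (intro ennreal_leI) (auto simp: field_simps)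
      finally show ?thesis .
    qed
    then show ?thesis using d(1) by (intro exI[of _ "min 1 (d / 2)"]) auto
  qed
  \<comment> \<open>Three differences, of which the outer two have the same integral by translation
    invariance. The factor 8 is a generous bound for a sum of three terms by their maximum, and 3
    counts the terms.\<close>
  have approx: "?P u \<delta>" if f: "f \<in> borel_measurable lebesgue" "u \<in> borel_measurable lebesgue"
    and Pf: "\<And>\<delta>. \<delta> > 0 \<Longrightarrow> ?P f \<delta>"

    and \<delta>: "\<delta> > 0" and le: "(\<integral>\<^sup>+x. ennreal (\<bar>u x - f x\<bar> powr p) \<partial>lebesgue) \<le> ennreal (\<delta> / (8 powr p
        * 3))"
    for u f :: "'a \<Rightarrow> real" and \<delta> :: real
  proof -
    define e where "e = \<delta> / (8 powr p * 3)"
    have e: "e > 0" using \<delta> by (simp add: e_def)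
    obtain \<eta> where \<eta>: "\<eta> > 0" "\<And>y. norm y \<le> \<eta> \<Longrightarrow> (\<integral>\<^sup>+x. ennreal (\<bar>f (x - y) - f x\<bar> powr p) \<partial>lebesgue)
        \<le> ennreal e"
      using Pf[OF e] by blast
    have "(\<integral>\<^sup>+x. ennreal (\<bar>u (x - y) - u x\<bar> powr p) \<partial>lebesgue) \<le> ennreal \<delta>" if y: "norm y \<le> \<eta>" for y
    proof -
      have m: "(\<lambda>x. u (x - y)) \<in> borel_measurable lebesgue" "(\<lambda>x. f (x - y)) \<in> borel_measurable
          lebesgue"
        using lebesgue_affine_integral(1)[of 1 u "- y"] lebesgue_affine_integral(1)[of 1 f "- y"] f
            by auto
      have 1: "\<bar>u (x - y) - u x\<bar> powr p \<le> 8 powr p * (\<bar>u (x - y) - f (x - y)\<bar> powr p + \<bar>f (x - y) -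
          f x\<bar> powr p + \<bar>u x - f x\<bar> powr p)" for x
      proof -
        define a b c where "a = \<bar>u (x - y) - f (x - y)\<bar>" "b = \<bar>f (x - y) - f x\<bar>" "c = \<bar>u x - f x\<bar>"
        have "\<bar>u (x - y) - u x\<bar> powr p \<le> (8 * max a (max b c)) powr p"
        proof (intro powr_mono2)
          have "\<bar>u (x - y) - u x\<bar> \<le> a + b + c" by (simp add: a_b_c_def)
          moreover have "a \<le> max a (max b c)" "b \<le> max a (max b c)" "c \<le> max a (max b c)" "a \<ge> 0"
            by (auto simp: a_b_c_def)
          ultimately show "\<bar>u (x - y) - u x\<bar> \<le> 8 * max a (max b c)" by linarith
        qed (use p in auto)
        also have "\<dots> = 8 powr p * max a (max b c) powr p"
          by (subst powr_mult) (auto simp: a_b_c_def)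
        also have "\<dots> \<le> 8 powr p * (a powr p + b powr p + c powr p)"
          by (intro mult_left_mono) (auto simp: max_def)
        finally show ?thesis by (simp add: a_b_c_def)
      qed
      have "(\<integral>\<^sup>+x. ennreal (\<bar>u (x - y) - u x\<bar> powr p) \<partial>lebesgue)
        \<le> (\<integral>\<^sup>+x. ennreal (8 powr p) * (ennreal (\<bar>u (x - y) - f (x - y)\<bar> powr p) + ennreal (\<bar>f (x -
            y) - f x\<bar> powr p) + ennreal (\<bar>u x - f x\<bar> powr p)) \<partial>lebesgue)"
        using 1 by (intro nn_integral_mono) (simp flip: ennreal_plus ennreal_mult)
      also have "\<dots> = ennreal (8 powr p) * ((\<integral>\<^sup>+x. ennreal (\<bar>u (x - y) - f (x - y)\<bar> powr p)
          \<partial>lebesgue)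
          + (\<integral>\<^sup>+x. ennreal (\<bar>f (x - y) - f x\<bar> powr p) \<partial>lebesgue) + (\<integral>\<^sup>+x. ennreal (\<bar>u x - f x\<bar> powr
              p) \<partial>lebesgue))"
        using m f by (simp add: nn_integral_cmult nn_integral_add)
      also have "(\<integral>\<^sup>+x. ennreal (\<bar>u (x - y) - f (x - y)\<bar> powr p) \<partial>lebesgue) = (\<integral>\<^sup>+x. ennreal (\<bar>u x -
          f x\<bar> powr p) \<partial>lebesgue)"
        using lebesgue_affine_nn_integral[of 1 "\<lambda>x. ennreal (\<bar>u x - f x\<bar> powr p)" "- y"] f by simp
      also have "ennreal (8 powr p) * ((\<integral>\<^sup>+x. ennreal (\<bar>u x - f x\<bar> powr p) \<partial>lebesgue)
          + (\<integral>\<^sup>+x. ennreal (\<bar>f (x - y) - f x\<bar> powr p) \<partial>lebesgue) + (\<integral>\<^sup>+x. ennreal (\<bar>u x - f x\<bar> powr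
              p) \<partial>lebesgue))
          \<le> ennreal (8 powr p) * (ennreal e + ennreal e + ennreal e)"
        using le \<eta>(2)[OF y] by (intro mult_left_mono add_mono) (auto simp: e_def)
      also have "ennreal e + ennreal e + ennreal e = ennreal (e + e + e)"
        using e by (metis ennreal_plus add_nonneg_nonneg less_imp_le)
      also have "ennreal (8 powr p) * \<dots> = ennreal (8 powr p * (e + e + e))"
        using e by (intro ennreal_mult[symmetric]) auto
      also have "8 powr p * (e + e + e) = \<delta>" by (simp add: e_def)
      finally show ?thesis .
    qed
    then show ?thesis using \<eta>(1) by blast
  qed
  have Lp_small: "\<exists>k. (\<integral>\<^sup>+x. ennreal (\<bar>g k x\<bar> powr p) \<partial>lebesgue) \<le> ennreal e"
    if "(\<lambda>k. \<integral>\<^sup>+x. ennreal (norm (g k x) powr p) \<partial>lebesgue) \<longlonglongrightarrow> 0" "e > 0"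
    for g :: "nat \<Rightarrow> 'a \<Rightarrow> real" and e
  proof -
    have "\<forall>\<^sub>F k in sequentially. (\<integral>\<^sup>+x. ennreal (norm (g k x) powr p) \<partial>lebesgue) < ennreal e"
      using order_tendstoD(2)[OF that(1)] that(2) by simp
    then obtain k where "(\<integral>\<^sup>+x. ennreal (norm (g k x) powr p) \<partial>lebesgue) < ennreal e"
      using eventually_happens'[OF sequentially_bot] by blast
    then show ?thesis by (auto intro: less_imp_le)
  qed
  define cut where "cut = (\<lambda>m x::'a. max 0 (min 1 (real m + 1 - norm x)))"
  define clamp where "clamp = (\<lambda>m t::real. max (- real m) (min (real m) t))"
  have cut: "0 \<le> cut m x" "cut m x \<le> 1" "norm x > real m + 1 \<Longrightarrow> cut m x = 0" "continuous_on UNIV (cut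
      m)" for m x
    unfolding cut_def by (auto intro!: continuous_intros)
  have cut_meas: "cut m \<in> borel_measurable lebesgue" for m
    by (rule continuous_borel_measurable_lebesgue[OF cut(4)])
  have clamp: "\<bar>clamp m t\<bar> \<le> real m" "\<bar>clamp m t\<bar> \<le> \<bar>t\<bar>" "continuous_on UNIV (clamp m)" for m t
    unfolding clamp_def by (auto intro!: continuous_intros)
  have clamp_meas: "(\<lambda>x. clamp m (f x)) \<in> borel_measurable lebesgue" if "f \<in> borel_measurable
      lebesgue" for m and f :: "'a \<Rightarrow> real"
    using that unfolding clamp_def by measurable
  have P_clamp: "?P (\<lambda>x. cut m x * clamp m (u x)) \<delta>" if \<delta>: "\<delta> > 0" for m \<delta>
  proof -
    \<comment> \<open>Lebesgue measurability in the form of almost everywhere approximation by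
      continuous functions \<open>g n\<close>; after clamping the values and cutting off in space,
      the convergence is dominated by a constant on a ball.\<close>
    have "u measurable_on UNIV" using u(1) by (simp add: lebesgue_measurable_imp_measurable_on)
    then obtain N g where N: "negligible N" and g: "\<And>n. continuous_on UNIV (g n)"
      "\<And>x. x \<notin> N \<Longrightarrow> (\<lambda>n. g n x) \<longlonglongrightarrow> u x"
      unfolding measurable_on_def by auto
    have AEN: "AE x in lebesgue. x \<notin> N"
      using N by (simp add: AE_not_in negligible_iff_null_sets)
    have gm: "g n \<in> borel_measurable lebesgue" for n
      by (rule continuous_borel_measurable_lebesgue[OF g(1)])
    have "(\<lambda>n. \<integral>\<^sup>+x. ennreal (norm (cut m x * clamp m (u x) - cut m x * clamp m (g n x)) powr p)
        \<partial>lebesgue) \<longlonglongrightarrow> 0"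
    proof (rule Lp_dominated_convergence[where w="\<lambda>x. indicator (cball 0 (real m + 1)) x * (2 * real
        m) powr p"])
      show "integrable lebesgue (\<lambda>x::'a. indicator (cball 0 (real m + 1)) x * (2 * real m) powr p)"
        by (intro integrable_mult_left integrable_real_indicator)
         (use emeasure_lborel_cball_finite[of "0::'a" "real m + 1"] in auto)
      show "AE x in lebesgue. norm (cut m x * clamp m (u x) - cut m x * clamp m (g n x)) powr p
          \<le> indicator (cball 0 (real m + 1)) x * (2 * real m) powr p" for n
      proof (rule AE_I2)
        fix x
        show "norm (cut m x * clamp m (u x) - cut m x * clamp m (g n x)) powr p
          \<le> indicator (cball 0 (real m + 1)) x * (2 * real m) powr p"
        proof (cases "norm x > real m + 1")
          case False
          have "\<bar>cut m x\<bar> * \<bar>clamp m (u x) - clamp m (g n x)\<bar> \<le> 1 * (2 * real m)"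
            using cut(1,2)[of m x] clamp(1)[of m "u x"] clamp(1)[of m "g n x"]
            by (intro mult_mono) auto
          then have "norm (cut m x * clamp m (u x) - cut m x * clamp m (g n x)) \<le> 2 * real m"
            by (simp add: abs_mult flip: right_diff_distrib)
          then show ?thesis using False p by (auto intro!: powr_mono2)
        qed (simp add: cut(3))
      qed
      show "AE x in lebesgue. (\<lambda>n. cut m x * clamp m (u x) - cut m x * clamp m (g n x)) \<longlonglongrightarrow> 0"
        using AEN
      proof eventually_elim
        case (elim x)
        have "(\<lambda>n. clamp m (g n x)) \<longlonglongrightarrow> clamp m (u x)"
          using continuous_on_tendsto_compose[OF clamp(3) g(2)[OF elim]] by simp
        then have "(\<lambda>n. cut m x * clamp m (u x) - cut m x * clamp m (g n x)) \<longlonglongrightarrow> cut m x * clamp m (u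
            x) - cut m x * clamp m (u x)"
          by (intro tendsto_intros)
        then show ?case by simp
      qed
    qed (use p u(1) gm cut_meas clamp_meas in auto)
    from Lp_small[OF this, of "\<delta> / (8 powr p * 3)"] obtain n where n:
      "(\<integral>\<^sup>+x. ennreal (\<bar>cut m x * clamp m (u x) - cut m x * clamp m (g n x)\<bar> powr p) \<partial>lebesgue) \<le>
          ennreal (\<delta> / (8 powr p * 3))"
      using \<delta> by auto
    show ?thesis
    proof (rule approx[OF _ _ _ \<delta> n])
      fix \<delta> :: real assume "\<delta> > 0"
      then show "?P (\<lambda>x. cut m x * clamp m (g n x)) \<delta>"
        by (intro cont[of _ "real m + 1"])
          (auto simp: cut intro!: continuous_intros cut(4) continuous_on_compose2[OF clamp(3) g(1)])
    qed (use u(1) gm cut_meas clamp_meas in auto)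
  qed
  have "(\<lambda>m. \<integral>\<^sup>+x. ennreal (norm (u x - cut m x * clamp m (u x)) powr p) \<partial>lebesgue) \<longlonglongrightarrow> 0"
  proof (rule Lp_dominated_convergence[where w="\<lambda>x. 2 powr p * \<bar>u x\<bar> powr p"])
    show "AE x in lebesgue. norm (u x - cut m x * clamp m (u x)) powr p \<le> 2 powr p * \<bar>u x\<bar> powr p"
        for m
    proof (rule AE_I2)
      fix x
      have "\<bar>cut m x\<bar> * \<bar>clamp m (u x)\<bar> \<le> 1 * \<bar>u x\<bar>"
        using cut(1,2)[of m x] clamp(2)[of m "u x"] by (intro mult_mono) auto
      then have "norm (u x - cut m x * clamp m (u x)) \<le> 2 * \<bar>u x\<bar>"
        using abs_triangle_ineq4[of "u x" "cut m x * clamp m (u x)"] by (simp add: abs_mult)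
      then have "norm (u x - cut m x * clamp m (u x)) powr p \<le> (2 * \<bar>u x\<bar>) powr p"
        using p by (intro powr_mono2) auto
      then show "norm (u x - cut m x * clamp m (u x)) powr p \<le> 2 powr p * \<bar>u x\<bar> powr p"
        by (simp add: powr_mult)
    qed
    show "AE x in lebesgue. (\<lambda>m. u x - cut m x * clamp m (u x)) \<longlonglongrightarrow> 0"
    proof (rule AE_I2)
      fix x
      obtain m0 :: nat where m0: "real m0 \<ge> max (norm x) \<bar>u x\<bar>" using real_arch_simple by blast
      have "u x - cut m x * clamp m (u x) = 0" if "m \<ge> m0" for m
      proof -
        have m: "real m \<ge> norm x" "real m \<ge> \<bar>u x\<bar>" using m0 that by linarith+
        then have "cut m x = 1" "clamp m (u x) = u x" by (auto simp: cut_def clamp_def)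
        then show ?thesis by simp
      qed
      then have "\<forall>\<^sub>F m in sequentially. u x - cut m x * clamp m (u x) = 0"
        using eventually_sequentially by blast
      then show "(\<lambda>m. u x - cut m x * clamp m (u x)) \<longlonglongrightarrow> 0" by (rule tendsto_eventually)
    qed
  qed (use p u cut_meas clamp_meas in auto)
  from Lp_small[OF this, of "\<delta> / (8 powr p * 3)"] obtain m where m:
    "(\<integral>\<^sup>+x. ennreal (\<bar>u x - cut m x * clamp m (u x)\<bar> powr p) \<partial>lebesgue) \<le> ennreal (\<delta> / (8 powr p *
        3))"
    using \<delta> by auto
  show ?thesis
    by (rule approx[OF _ _ P_clamp \<delta> m]) (use u(1) cut_meas clamp_meas in auto)
qed

section \<open>Mollification\<close>

definition conv :: "('a::euclidean_space \<Rightarrow> real) \<Rightarrow> ('a \<Rightarrow> real) \<Rightarrow> 'a \<Rightarrow> real" where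
  "conv u \<rho> x = (\<integral>y. u y * \<rho> (x - y) \<partial>lebesgue)"

lemma test_function_reflect:
  assumes "test_function UNIV \<rho>"
  shows "test_function UNIV (\<lambda>y. \<rho> (x - y))"
  using test_function_mono[OF test_function_affine[OF assms, of "-1" x]] by simp

lemma integrable_mult_bounded:
  fixes u \<phi> :: "'a \<Rightarrow> real"
  assumes "integrable M u" "\<phi> \<in> borel_measurable M" "\<And>x. \<bar>\<phi> x\<bar> \<le> B"
  shows "integrable M (\<lambda>x. u x * \<phi> x)"
proof (rule Bochner_Integration.integrable_bound[where f="\<lambda>x. B * u x"])
  show "AE x in M. norm (u x * \<phi> x) \<le> norm (B * u x)"
  proof (rule AE_I2)
    fix x
    have "\<bar>u x\<bar> * \<bar>\<phi> x\<bar> \<le> \<bar>u x\<bar> * B" using assms(3) by (intro mult_left_mono) auto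
    also have "\<dots> \<le> \<bar>u x\<bar> * \<bar>B\<bar>" by (intro mult_left_mono) auto
    finally show "norm (u x * \<phi> x) \<le> norm (B * u x)" by (simp add: abs_mult mult.commute)
  qed
qed (use assms in auto)

lemma integrable_mult_test_function:
  fixes u :: "'a::euclidean_space \<Rightarrow> real"
  assumes "integrable lebesgue u" "test_function \<Omega> \<phi>"
  shows "integrable lebesgue (\<lambda>x. u x * \<phi> x)"
proof -
  obtain B where "\<And>x. \<bar>\<phi> x\<bar> \<le> B" using test_function_bounded[OF assms(2)] by metis
  then show ?thesis
    using integrable_mult_bounded[OF assms(1) test_function_borel_measurable[OF assms(2)]] by blast
qed

lemma conv_integrable:
  assumes "integrable lebesgue u" "test_function UNIV \<rho>"
  shows "integrable lebesgue (\<lambda>y. u y * \<rho> (x - y))"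
  by (rule integrable_mult_test_function[OF assms(1) test_function_reflect[OF assms(2)]])

text \<open>Remainders of this kind arise twice: for integrals against a smooth kernel, and for
  \<open>eta\<close> at the origin.\<close>

lemma has_derivative_quadratic:
  fixes f :: "'a::euclidean_space \<Rightarrow> real"
  assumes "bounded_linear L" and bound: "\<And>h. \<bar>f (x + h) - f x - L h\<bar> \<le> C * (norm h)\<^sup>2"
  shows "(f has_derivative L) (at x)"
  unfolding has_derivative_iff_norm
proof (intro conjI assms)
  have "((\<lambda>y. C * norm (y - x)) \<longlongrightarrow> C * norm (x - x)) (at x)"
    by (intro tendsto_intros)
  then have lim: "((\<lambda>y. C * norm (y - x)) \<longlongrightarrow> 0) (at x)" by simp
  show "((\<lambda>y. norm (f y - f x - L (y - x)) / norm (y - x)) \<longlongrightarrow> 0) (at x)"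
  proof (rule tendsto_sandwich[OF _ _ tendsto_const lim])
    show "\<forall>\<^sub>F y in at x. 0 \<le> norm (f y - f x - L (y - x)) / norm (y - x)" by simp
    show "\<forall>\<^sub>F y in at x. norm (f y - f x - L (y - x)) / norm (y - x) \<le> C * norm (y - x)"
      unfolding eventually_at_filter
    proof (rule always_eventually, intro allI impI)
      fix y assume "y \<noteq> x"
      then show "norm (f y - f x - L (y - x)) / norm (y - x) \<le> C * norm (y - x)"
        using bound[of "y - x"] by (simp add: divide_le_eq power2_eq_square mult.assoc)
    qed
  qed
qed

text \<open>Second derivatives of a test function are bounded, so the Taylor remainder of the kernel
  is quadratic in \<open>h\<close> uniformly in the base point, and it stays quadratic after
  integration against \<open>u\<close>.\<close>

lemma conv_has_derivative:
  fixes u :: "'a::euclidean_space \<Rightarrow> real"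
  assumes u: "integrable lebesgue u" and \<rho>: "test_function UNIV \<rho>"
  shows "(conv u \<rho> has_derivative (\<lambda>h. \<Sum>b\<in>Basis. (h \<bullet> b) * conv u (partial_deriv b \<rho>) x)) (at x)"
proof -
  \<comment> \<open>Bounds for the individual second derivatives are selected by choice, so that
    their sum \<open>B\<close> bounds all of them simultaneously.\<close>
  define BB where "BB = (\<lambda>b c. SOME B. B > 0 \<and> (\<forall>x. \<bar>partial_deriv c (partial_deriv b \<rho>) x\<bar> \<le> B))"
  define B where "B = (\<Sum>b\<in>Basis. \<Sum>c\<in>Basis. BB b c)"
  have BB: "BB b c > 0" "\<bar>partial_deriv c (partial_deriv b \<rho>) x\<bar> \<le> BB b c" if "b \<in> Basis" "c \<in>
      Basis" for b c x
  proof -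
    have "test_function UNIV (partial_deriv c (partial_deriv b \<rho>))"
      using that by (intro test_function_partial_deriv \<rho>)
    then have "\<exists>B. B > 0 \<and> (\<forall>x. \<bar>partial_deriv c (partial_deriv b \<rho>) x\<bar> \<le> B)"
      using test_function_bounded by metis
    from someI_ex[OF this] show "BB b c > 0" "\<bar>partial_deriv c (partial_deriv b \<rho>) x\<bar> \<le> BB b c"
      unfolding BB_def by auto
  qed
  have BBle: "BB b c \<le> B" if "b \<in> Basis" "c \<in> Basis" for b c
  proof -
    have "BB b c \<le> (\<Sum>c\<in>Basis. BB b c)"
      using that BB by (intro member_le_sum) (auto intro: less_imp_le)
    also have "\<dots> \<le> B" unfolding B_def
      using that BB by (intro member_le_sum sum_nonneg) (auto intro: less_imp_le)
    finally show ?thesis .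
  qed
  have B0: "B \<ge> 0" unfolding B_def using BB by (intro sum_nonneg) (auto intro: less_imp_le)
  define n where "n = (real DIM('a))\<^sup>2 * B"
  have taylor: "\<bar>\<rho> (x + h) - \<rho> x - grad \<rho> x \<bullet> h\<bar> \<le> n * (norm h)\<^sup>2" for x h
  proof -
    have "\<bar>\<rho> (x + h) - \<rho> x - grad \<rho> x \<bullet> ((x + h) - x)\<bar> \<le> n * (norm ((x + h) - x))\<^sup>2"
      unfolding n_def
    proof (rule taylor_bound[of _ UNIV])
      show "Ck 2 \<rho>" by (rule test_function_smooth[OF \<rho>])
      show "\<bar>partial_deriv c (partial_deriv b \<rho>) x\<bar> \<le> B" if "b \<in> Basis" "c \<in> Basis" for x b c
        using BB(2)[OF that, of x] BBle[OF that] by linarith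
    qed (use B0 in auto)
    then show ?thesis by simp
  qed
  have int: "integrable lebesgue (\<lambda>y. u y * \<rho> (x - y))"
    "b \<in> Basis \<Longrightarrow> integrable lebesgue (\<lambda>y. u y * partial_deriv b \<rho> (x - y))" for x b
    using conv_integrable[OF u] \<rho> test_function_partial_deriv by blast+
  show ?thesis
  proof (rule has_derivative_quadratic[where C = "n * (\<integral>y. \<bar>u y\<bar> \<partial>lebesgue)"])
    show "bounded_linear (\<lambda>h. \<Sum>b\<in>Basis. (h \<bullet> b) * conv u (partial_deriv b \<rho>) x)"
      by (intro bounded_linear_sum bounded_linear_mult_const bounded_linear_inner_left)
    fix h
    have grad: "u y * (grad \<rho> (x - y) \<bullet> h) = (\<Sum>b\<in>Basis. (h \<bullet> b) * (u y * partial_deriv b \<rho> (x -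
        y)))" for y
      by (simp add: grad_inner sum_distrib_left mult_ac)
    have intg: "integrable lebesgue (\<lambda>y. u y * (grad \<rho> (x - y) \<bullet> h))"
      unfolding grad by (intro Bochner_Integration.integrable_sum integrable_mult_right int)
    have "(\<Sum>b\<in>Basis. (h \<bullet> b) * conv u (partial_deriv b \<rho>) x) = (\<integral>y. u y * (grad \<rho> (x - y) \<bullet> h)
        \<partial>lebesgue)"
      unfolding grad conv_def by (subst Bochner_Integration.integral_sum) (auto intro!: int)
    then have "conv u \<rho> (x + h) - conv u \<rho> x - (\<Sum>b\<in>Basis. (h \<bullet> b) * conv u (partial_deriv b \<rho>) x)
        = (\<integral>y. u y * \<rho> (x + h - y) - u y * \<rho> (x - y) - u y * (grad \<rho> (x - y) \<bullet> h) \<partial>lebesgue)"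
      using int intg by (simp add: conv_def)
    also have "\<bar>\<dots>\<bar> \<le> (\<integral>y. n * (norm h)\<^sup>2 * \<bar>u y\<bar> \<partial>lebesgue)"
    proof (rule integral_abs_bound_integral)
      show "integrable lebesgue (\<lambda>y. u y * \<rho> (x + h - y) - u y * \<rho> (x - y) - u y * (grad \<rho> (x - y) \<bullet>
          h))"
        by (intro Bochner_Integration.integrable_diff int intg)
      show "integrable lebesgue (\<lambda>y. n * (norm h)\<^sup>2 * \<bar>u y\<bar>)"
        by (intro integrable_mult_right integrable_abs u)
      fix y
      have "x + h - y = (x - y) + h" by simp
      then have "u y * \<rho> (x + h - y) - u y * \<rho> (x - y) - u y * (grad \<rho> (x - y) \<bullet> h)
          = u y * (\<rho> ((x - y) + h) - \<rho> (x - y) - grad \<rho> (x - y) \<bullet> h)"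
        by (simp add: algebra_simps)
      also have "\<bar>\<dots>\<bar> \<le> \<bar>u y\<bar> * (n * (norm h)\<^sup>2)"
        unfolding abs_mult by (intro mult_left_mono taylor) auto
      finally show "\<bar>u y * \<rho> (x + h - y) - u y * \<rho> (x - y) - u y * (grad \<rho> (x - y) \<bullet> h)\<bar> \<le> n * (norm
          h)\<^sup>2 * \<bar>u y\<bar>"
        by (simp add: mult_ac)
    qed
    finally show "\<bar>conv u \<rho> (x + h) - conv u \<rho> x - (\<Sum>b\<in>Basis. (h \<bullet> b) * conv u (partial_deriv b \<rho>)
        x)\<bar>
        \<le> n * (\<integral>y. \<bar>u y\<bar> \<partial>lebesgue) * (norm h)\<^sup>2"
      by (simp add: mult_ac)
  qed
qed

lemma partial_deriv_conv:
  assumes "integrable lebesgue u" "test_function UNIV \<rho>" "b \<in> Basis"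
  shows "partial_deriv b (conv u \<rho>) = conv u (partial_deriv b \<rho>)"
proof
  fix x
  show "partial_deriv b (conv u \<rho>) x = conv u (partial_deriv b \<rho>) x"
    using assms(3) by (subst partial_deriv_eqI[OF conv_has_derivative[OF assms(1,2)]])
      (simp add: inner_Basis if_distrib[of "\<lambda>x. x * _"] cong: if_cong)
qed

lemma Ck_conv:
  assumes u: "integrable lebesgue u" and \<rho>: "test_function UNIV \<rho>"
  shows "Ck k (conv u \<rho>)"
  using \<rho>
proof (induction k arbitrary: \<rho>)
  case 0
  have "continuous (at x) (conv u \<rho>)" for x
    using conv_has_derivative[OF u 0] has_derivative_continuous by blast
  then show ?case by (simp add: continuous_at_imp_continuous_on)
next
  case (Suc k)
  have "Ck k (partial_deriv b (conv u \<rho>))" if "b \<in> Basis" for b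
    unfolding partial_deriv_conv[OF u Suc.prems that]
    using Suc.IH test_function_partial_deriv[OF Suc.prems that] .
  moreover have "conv u \<rho> differentiable (at x)" for x
    using conv_has_derivative[OF u Suc.prems] differentiable_def by blast
  ultimately show ?case by simp
qed

lemma conv_eq_0:
  fixes u :: "'a::euclidean_space \<Rightarrow> real"
  assumes "AE y in lebesgue. y \<notin> K \<longrightarrow> u y = 0" "\<And>y. y \<in> K \<Longrightarrow> \<rho> (x - y) = 0"
  shows "conv u \<rho> x = 0"
proof -
  have "AE y in lebesgue. u y * \<rho> (x - y) = 0"
    using assms(1) by eventually_elim (use assms(2) in auto)
  then show ?thesis unfolding conv_def by (rule integral_eq_zero_AE)
qed

lemma test_function_conv:
  fixes u :: "'a::euclidean_space \<Rightarrow> real"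
  assumes u: "integrable lebesgue u" and K: "compact K" "AE y in lebesgue. y \<notin> K \<longrightarrow> u y = 0"
    and \<epsilon>: "\<epsilon> > 0" and sub: "\<And>x y. y \<in> K \<Longrightarrow> norm (x - y) \<le> \<epsilon> \<Longrightarrow> x \<in> \<Omega>"
  shows "test_function \<Omega> (conv u (mollifier \<epsilon>))"
proof (rule test_functionI)
  have \<rho>: "test_function UNIV (mollifier \<epsilon> :: 'a \<Rightarrow> real)"
    by (rule test_function_mollifier[OF \<epsilon>]) simp
  show "Ck k (conv u (mollifier \<epsilon>))" for k by (rule Ck_conv[OF u \<rho>])
  show "compact {x + y | x y. x \<in> K \<and> y \<in> cball 0 \<epsilon>}"
    using K(1) by (intro compact_sums) auto
  show "{x + y | x y. x \<in> K \<and> y \<in> cball 0 \<epsilon>} \<subseteq> \<Omega>" using sub by force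
  fix x assume x: "x \<notin> {x + y | x y. x \<in> K \<and> y \<in> cball 0 \<epsilon>}"
  show "conv u (mollifier \<epsilon>) x = 0"
  proof (rule conv_eq_0[OF K(2)])
    fix y assume y: "y \<in> K"
    have "\<not> norm (x - y) \<le> \<epsilon>"
    proof
      assume "norm (x - y) \<le> \<epsilon>"
      then have "x = y + (x - y) \<and> y \<in> K \<and> x - y \<in> cball 0 \<epsilon>" using y by simp
      with x show False by blast
    qed
    then show "mollifier \<epsilon> (x - y) = 0" by (intro mollifier_eq_0[OF \<epsilon>]) simp
  qed
qed

text \<open>Jensen's inequality for the probability density \<open>mollifier \<epsilon>\<close>
  bounds the error at \<open>x\<close> by an average of p-th powers of translation differences;
  after exchanging the integrals, this is an average of quantities at most \<open>\<delta>\<close>.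
  Shifts longer than \<open>\<epsilon>\<close> do not count, because the kernel vanishes
  there.\<close>

lemma conv_mollifier_Lp_bound:
  fixes u :: "'a::euclidean_space \<Rightarrow> real"
  assumes p: "p \<ge> 1" and u: "integrable lebesgue u" and \<epsilon>: "\<epsilon> > 0"
    and \<delta>: "\<And>y. norm y \<le> \<epsilon> \<Longrightarrow> (\<integral>\<^sup>+x. ennreal (\<bar>u (x - y) - u x\<bar> powr p) \<partial>lebesgue) \<le> \<delta>"
  shows "(\<integral>\<^sup>+x. ennreal (\<bar>conv u (mollifier \<epsilon>) x - u x\<bar> powr p) \<partial>lebesgue) \<le> \<delta>"
proof -
  define \<rho> where "\<rho> = (mollifier \<epsilon> :: 'a \<Rightarrow> real)"
  have \<rho>: "test_function UNIV \<rho>" unfolding \<rho>_def by (rule test_function_mollifier[OF \<epsilon>]) simp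
  have \<rho>0: "\<rho> y \<ge> 0" for y unfolding \<rho>_def by (rule mollifier_nonneg[OF \<epsilon>])
  have \<rho>1: "integrable lebesgue \<rho>" "(\<integral>y. \<rho> y \<partial>lebesgue) = 1"
    unfolding \<rho>_def using integrable_mollifier[OF \<epsilon>] integral_mollifier[OF \<epsilon>] by auto
  \<comment> \<open>Exchanging the integrals requires joint measurability in \<open>x\<close> and
    \<open>y\<close>, which a Borel representative provides.\<close>
  obtain u' where u'[measurable]: "u' \<in> borel_measurable borel" and eq: "AE x in lborel. u x = u' x"
    using completion_ex_borel_measurable_real[OF borel_measurable_integrable[OF u]] by auto
  have [measurable]: "\<rho> \<in> borel_measurable borel"
    using test_function_continuous[OF \<rho>] by (intro borel_measurable_continuous_onI) auto
  have eql: "AE x in lebesgue. u x = u' x" using eq by (rule AE_completion)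
  have u'l: "u' \<in> borel_measurable lebesgue" using u' by (intro measurable_completion) simp
  have intu': "integrable lebesgue u'" using u eql u'l by (subst integrable_cong_AE[where g=u]) auto
  have shift: "AE x in lebesgue. u (x - y) = u' (x - y)" for y
    using AE_lebesgue_affine[OF _ eql, of 1 "- y"] by simp
  have conv: "conv u \<rho> x = conv u' \<rho> x" for x
    unfolding conv_def
  proof (rule integral_cong_AE)
    show "AE y in lebesgue. u y * \<rho> (x - y) = u' y * \<rho> (x - y)" using eql by eventually_elim simp
  qed (use conv_integrable[OF u \<rho>] conv_integrable[OF intu' \<rho>] in auto)
  have jensen: "ennreal (\<bar>conv u' \<rho> x - u' x\<bar> powr p) \<le> (\<integral>\<^sup>+y. ennreal (\<rho> y * \<bar>u' (x - y) - u' x\<bar>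
      powr p) \<partial>lebesgue)" for x
  proof -
    have m: "(\<lambda>y. u' y * \<rho> (x - y)) \<in> borel_measurable lebesgue"
      using conv_integrable[OF intu' \<rho>] by blast
    have i: "integrable lebesgue (\<lambda>y. \<rho> y * u' (x - y))"
      using lebesgue_affine_integral(3)[OF _ m, of "-1" x] conv_integrable[OF intu' \<rho>, of x] by
          (simp add: mult.commute)
    have "conv u' \<rho> x = (\<integral>y. \<rho> y * u' (x - y) \<partial>lebesgue)"
      using lebesgue_affine_integral(2)[OF _ m, of "-1" x] by (simp add: conv_def mult.commute)
    then have "conv u' \<rho> x - u' x = (\<integral>y. \<rho> y * (u' (x - y) - u' x) \<partial>lebesgue)"
      using i \<rho>1 by (simp add: right_diff_distrib)
    moreover have "integrable lebesgue (\<lambda>y. \<rho> y * (u' (x - y) - u' x))"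
      using i \<rho>1 by (simp add: right_diff_distrib)
    moreover have "(\<lambda>y. u' (x - y) - u' x) \<in> borel_measurable lebesgue"
      by (intro measurable_completion) simp
    ultimately show ?thesis
      using jensen_powr[OF p \<rho>1 \<rho>0, of "\<lambda>y. u' (x - y) - u' x"] by simp
  qed
  have "(\<integral>\<^sup>+x. ennreal (\<bar>conv u \<rho> x - u x\<bar> powr p) \<partial>lebesgue)
      = (\<integral>\<^sup>+x. ennreal (\<bar>conv u' \<rho> x - u' x\<bar> powr p) \<partial>lebesgue)"
    using eql by (intro nn_integral_cong_AE) (auto simp: conv)
  also have "\<dots> \<le> (\<integral>\<^sup>+x. (\<integral>\<^sup>+y. ennreal (\<rho> y * \<bar>u' (x - y) - u' x\<bar> powr p) \<partial>lebesgue) \<partial>lebesgue)"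
    by (intro nn_integral_mono jensen)
  also have "\<dots> = (\<integral>\<^sup>+x. (\<integral>\<^sup>+y. ennreal (\<rho> y * \<bar>u' (x - y) - u' x\<bar> powr p) \<partial>lborel) \<partial>lborel)"
    by (simp add: nn_integral_completion)
  also have "\<dots> = (\<integral>\<^sup>+y. (\<integral>\<^sup>+x. ennreal (\<rho> y * \<bar>u' (x - y) - u' x\<bar> powr p) \<partial>lborel) \<partial>lborel)"
    by (rule lborel_pair.Fubini'[symmetric]) measurable
  also have "\<dots> \<le> (\<integral>\<^sup>+y. ennreal (\<rho> y) * \<delta> \<partial>lborel)"
  proof (rule nn_integral_mono)
    fix y :: 'a
    have "(\<integral>\<^sup>+x. ennreal (\<rho> y * \<bar>u' (x - y) - u' x\<bar> powr p) \<partial>lborel)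
        = ennreal (\<rho> y) * (\<integral>\<^sup>+x. ennreal (\<bar>u' (x - y) - u' x\<bar> powr p) \<partial>lborel)"
      using \<rho>0 by (simp add: ennreal_mult nn_integral_cmult)
    also have "(\<integral>\<^sup>+x. ennreal (\<bar>u' (x - y) - u' x\<bar> powr p) \<partial>lborel) = (\<integral>\<^sup>+x. ennreal (\<bar>u (x - y) - u
        x\<bar> powr p) \<partial>lebesgue)"
      using shift[of y] eql by (subst nn_integral_completion[symmetric], intro nn_integral_cong_AE)
          auto
    also have "ennreal (\<rho> y) * \<dots> \<le> ennreal (\<rho> y) * \<delta>"
    proof (cases "norm y \<le> \<epsilon>")
      case True
      then show ?thesis by (intro mult_left_mono \<delta>) auto
    next
      case False
      then have "\<rho> y = 0" unfolding \<rho>_def by (intro mollifier_eq_0 \<epsilon>) auto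
      then show ?thesis by simp
    qed
    finally show "(\<integral>\<^sup>+x. ennreal (\<rho> y * \<bar>u' (x - y) - u' x\<bar> powr p) \<partial>lborel) \<le> ennreal (\<rho> y) * \<delta>" .
  qed
  also have "\<dots> = (\<integral>\<^sup>+y. ennreal (\<rho> y) \<partial>lborel) * \<delta>" by (intro nn_integral_multc) simp
  also have "(\<integral>\<^sup>+y. ennreal (\<rho> y) \<partial>lborel) = (\<integral>\<^sup>+y. ennreal (\<rho> y) \<partial>lebesgue)" by (simp add:
      nn_integral_completion)
  also have "\<dots> = 1" using \<rho>1 \<rho>0 by (subst nn_integral_eq_integral) auto
  finally show ?thesis by (simp add: \<rho>_def)
qed

lemma conv_mollifier_Lp_tendsto:
  fixes u :: "'a::euclidean_space \<Rightarrow> real"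
  assumes p: "p \<ge> 1" and u: "integrable lebesgue u" "integrable lebesgue (\<lambda>x. \<bar>u x\<bar> powr p)"
    and \<epsilon>: "\<epsilon> \<longlonglongrightarrow> 0" "\<And>k. \<epsilon> k > (0::real)"
  shows "(\<lambda>k. \<integral>\<^sup>+x. ennreal (\<bar>conv u (mollifier (\<epsilon> k)) x - u x\<bar> powr p) \<partial>lebesgue) \<longlonglongrightarrow> 0"
proof (rule order_tendstoI)
  fix a :: ennreal assume "a > 0"
  then obtain c where c: "0 < c" "c < a" using dense by blast
  then have "c < \<infinity>" using less_le_trans top_greatest by (metis infinity_ennreal_def)
  then obtain \<delta> where "c = ennreal \<delta>" "\<delta> \<ge> 0" by (cases c) auto
  with c have \<delta>: "\<delta> > 0" "ennreal \<delta> < a" by auto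
  obtain \<eta> where \<eta>: "\<eta> > 0" "\<And>y. norm y \<le> \<eta> \<Longrightarrow> (\<integral>\<^sup>+x. ennreal (\<bar>u (x - y) - u x\<bar> powr p) \<partial>lebesgue) \<le>
      ennreal \<delta>"
    using Lp_translation_continuous[OF p _ u(2) \<delta>(1)] u(1) by blast
  have "\<forall>\<^sub>F k in sequentially. \<epsilon> k < \<eta>" using order_tendstoD(2)[OF \<epsilon>(1) \<eta>(1)] .
  then show "\<forall>\<^sub>F k in sequentially. (\<integral>\<^sup>+x. ennreal (\<bar>conv u (mollifier (\<epsilon> k)) x - u x\<bar> powr p)
      \<partial>lebesgue) < a"
  proof eventually_elim
    case (elim k)
    have "(\<integral>\<^sup>+x. ennreal (\<bar>conv u (mollifier (\<epsilon> k)) x - u x\<bar> powr p) \<partial>lebesgue) \<le> ennreal \<delta>"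
      by (rule conv_mollifier_Lp_bound[OF p u(1) \<epsilon>(2)]) (use elim \<eta> in auto)
    then show ?case using \<delta>(2) by simp
  qed
qed simp

lemma compact_neighbourhood_subset_open:
  fixes K :: "'a::euclidean_space set"
  assumes "compact K" "open \<Omega>" "K \<subseteq> \<Omega>"
  obtains d where "d > 0" "\<And>x y. y \<in> K \<Longrightarrow> norm (x - y) \<le> d \<Longrightarrow> x \<in> \<Omega>"
proof -
  obtain e where e: "e > 0" "{x. infdist x K \<le> e} \<subseteq> \<Omega> \<or> K = {}"
  proof (cases "K = {}")
    case False
    from compact_in_open_separated[OF False assms] obtain e where "e > 0" "{x. infdist x K \<le> e} \<subseteq> \<Omega>"
        by blast
    then show ?thesis using that by blast
  qed (use that[of 1] in auto)
  show thesis
  proof (rule that[OF e(1)])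
    fix x y assume y: "y \<in> K" "norm (x - y) \<le> e"
    then have "infdist x K \<le> e" using infdist_le[OF y(1), of x] by (simp add: dist_norm)
    then show "x \<in> \<Omega>" using e y by auto
  qed
qed

text \<open>The indicator of the 2e-neighbourhood of \<open>K\<close> is mollified at radius
  \<open>e\<close>. On the e-neighbourhood the kernel sees only the value one; the support stays in
  the 3e-neighbourhood, which is inside \<open>\<Omega>\<close> because \<open>d\<close> is
  \<open>4 * e\<close>.\<close>

lemma test_function_cutoff:
  fixes K :: "'a::euclidean_space set"
  assumes K: "compact K" and \<Omega>: "open \<Omega>" "K \<subseteq> \<Omega>"
  obtains \<zeta> V where "test_function \<Omega> \<zeta>" "open V" "K \<subseteq> V" "\<And>x. x \<in> V \<Longrightarrow> \<zeta> x = 1"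
proof -
  obtain d where d: "d > 0" "\<And>x y. y \<in> K \<Longrightarrow> norm (x - y) \<le> d \<Longrightarrow> x \<in> \<Omega>"
    using compact_neighbourhood_subset_open[OF assms] by blast
  define e where "e = d / 4"
  have e: "e > 0" using d by (simp add: e_def)
  define L where "L = {x + y | x y. x \<in> K \<and> y \<in> cball 0 (2 * e)}"
  have L: "compact L" unfolding L_def using K by (intro compact_sums) auto
  then have L': "L \<in> sets lebesgue" "emeasure lebesgue L < \<infinity>"
    using lmeasurable_compact[OF L] by (auto simp: fmeasurable_def)
  have intL: "integrable lebesgue (indicator L :: 'a \<Rightarrow> real)"
    using L' by (intro integrable_real_indicator) auto
  have "test_function \<Omega> (conv (indicator L) (mollifier e))"
  proof (rule test_function_conv[OF intL L _ e])
    fix x y assume y: "y \<in> L" "norm (x - y) \<le> e"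
    then obtain a b where ab: "y = a + b" "a \<in> K" "norm b \<le> 2 * e" by (auto simp: L_def)
    have "norm (x - a) \<le> norm (x - y) + norm (y - a)" using norm_triangle_ineq[of "x - y" "y - a"]
        by simp
    also have "\<dots> \<le> d" using y ab e by (simp add: e_def)
    finally show "x \<in> \<Omega>" using d ab by blast
  qed auto
  moreover have "open (\<Union>x\<in>K. ball x e)" "K \<subseteq> (\<Union>x\<in>K. ball x e)" using e by auto
  moreover have "conv (indicator L) (mollifier e) x = 1" if x: "x \<in> (\<Union>x\<in>K. ball x e)" for x
  proof -
    obtain a where a: "a \<in> K" "norm (x - a) < e" using x by (auto simp: dist_norm
        norm_minus_commute)
    have "indicator L y * mollifier e (x - y) = mollifier e (x - y)" for y
    proof (cases "norm (x - y) < e")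
      case True
      have "norm (y - a) \<le> norm (y - x) + norm (x - a)" using norm_triangle_ineq[of "y - x" "x - a"]
          by simp
      also have "\<dots> \<le> 2 * e" using True a by (simp add: norm_minus_commute)
      finally have "y - a \<in> cball 0 (2 * e)" by simp
      moreover have "y = a + (y - a)" by simp
      ultimately have "y \<in> L" unfolding L_def using a(1) by blast
      then show ?thesis by simp
    next
      case False
      then have "mollifier e (x - y) = 0" by (intro mollifier_eq_0 e) auto
      then show ?thesis by simp
    qed
    then have "conv (indicator L) (mollifier e) x = (\<integral>y. mollifier e (x - y) \<partial>lebesgue)"
      unfolding conv_def by (intro Bochner_Integration.integral_cong refl)
    also have "\<dots> = (\<integral>y. mollifier e (y::'a) \<partial>lebesgue)"
      using lebesgue_affine_integral(2)[of "-1" "mollifier e :: 'a \<Rightarrow> real" x]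
          integrable_mollifier[OF e] by auto
    finally show ?thesis using integral_mollifier[OF e] by simp
  qed
  ultimately show thesis using that by blast
qed

section \<open>Convergence in \<open>L\<^sup>p\<close> and weak gradients\<close>

text \<open>The p-th power of the norm, as an extended number. It makes sense for every function, so
  comparison and convergence to zero can be stated independently of integrability.\<close>

definition Lp_mod :: "'a measure \<Rightarrow> real \<Rightarrow> ('a \<Rightarrow> 'b::real_normed_vector) \<Rightarrow> ennreal" where
  "Lp_mod M p f = (\<integral>\<^sup>+x. ennreal (norm (f x) powr p) \<partial>M)"

lemma Lp_mod_mono_AE:
  assumes "p \<ge> 0" "c \<ge> 0" "g \<in> borel_measurable M" "AE x in M. norm (f x) \<le> c * norm (g x)"
  shows "Lp_mod M p f \<le> ennreal (c powr p) * Lp_mod M p g"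
proof -
  have "Lp_mod M p f \<le> (\<integral>\<^sup>+x. ennreal (c powr p) * ennreal (norm (g x) powr p) \<partial>M)"
    unfolding Lp_mod_def
  proof (rule nn_integral_mono_AE, use assms(4) in eventually_elim)
    case (elim x)
    then have "norm (f x) powr p \<le> (c * norm (g x)) powr p"
      using assms by (intro powr_mono2) auto
    also have "\<dots> = c powr p * norm (g x) powr p" using assms by (simp add: powr_mult)
    finally show ?case by (simp add: ennreal_leI flip: ennreal_mult)
  qed
  also have "\<dots> = ennreal (c powr p) * Lp_mod M p g"
    unfolding Lp_mod_def using assms by (intro nn_integral_cmult) measurable
  finally show ?thesis .
qed

lemma Lp_mod_cong_AE:
  "AE x in M. norm (f x) = norm (g x) \<Longrightarrow> Lp_mod M p f = Lp_mod M p g"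
  unfolding Lp_mod_def by (rule nn_integral_cong_AE) (auto elim: eventually_mono)

lemma Lp_mod_minus: "Lp_mod M p (\<lambda>x. - f x) = Lp_mod M p f"
  by (simp add: Lp_mod_def)

lemma Lp_mod_minus_commute: "Lp_mod M p (\<lambda>x. f x - g x) = Lp_mod M p (\<lambda>x. g x - f x)"
  by (simp add: Lp_mod_def norm_minus_commute)

lemma Lp_mod_add_le:
  fixes f g :: "'a \<Rightarrow> 'b::euclidean_space"
  assumes "p \<ge> 0" "f \<in> borel_measurable M" "g \<in> borel_measurable M"
  shows "Lp_mod M p (\<lambda>x. f x + g x) \<le> ennreal (2 powr p) * (Lp_mod M p f + Lp_mod M p g)"
proof -
  have "Lp_mod M p (\<lambda>x. f x + g x) \<le> (\<integral>\<^sup>+x. ennreal (2 powr p) * (ennreal (norm (f x) powr p) +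
      ennreal (norm (g x) powr p)) \<partial>M)"
    unfolding Lp_mod_def
    by (intro nn_integral_mono)
      (use norm_add_powr_le[OF assms(1)] in \<open>simp flip: ennreal_plus ennreal_mult\<close>)
  also have "\<dots> = ennreal (2 powr p) * (Lp_mod M p f + Lp_mod M p g)"
    unfolding Lp_mod_def using assms by (simp add: nn_integral_cmult nn_integral_add)
  finally show ?thesis .
qed

lemma tendsto_cmult_0_ennreal:
  fixes f :: "nat \<Rightarrow> ennreal"
  assumes "f \<longlonglongrightarrow> 0"
  shows "(\<lambda>k. ennreal c * f k) \<longlonglongrightarrow> 0"
  using ennreal_tendsto_cmult[OF _ assms, of "ennreal c"] by simp

lemma Lp_mod_add_tendsto:
  fixes f g :: "nat \<Rightarrow> 'a \<Rightarrow> 'b::euclidean_space"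
  assumes p: "p \<ge> 0" and meas: "\<And>k. f k \<in> borel_measurable M" "\<And>k. g k \<in> borel_measurable M"
    and lim: "(\<lambda>k. Lp_mod M p (f k)) \<longlonglongrightarrow> 0" "(\<lambda>k. Lp_mod M p (g k)) \<longlonglongrightarrow> 0"
  shows "(\<lambda>k. Lp_mod M p (\<lambda>x. f k x + g k x)) \<longlonglongrightarrow> 0"
proof (rule tendsto_sandwich[OF _ _ tendsto_const])
  have "(\<lambda>k. Lp_mod M p (f k) + Lp_mod M p (g k)) \<longlonglongrightarrow> 0 + 0" by (intro tendsto_add lim)
  then show "(\<lambda>k. ennreal (2 powr p) * (Lp_mod M p (f k) + Lp_mod M p (g k))) \<longlonglongrightarrow> 0"
    by (intro tendsto_cmult_0_ennreal) simp
  show "\<forall>\<^sub>F k in sequentially. Lp_mod M p (\<lambda>x. f k x + g k x) \<le> ennreal (2 powr p) * (Lp_mod M p (f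
      k) + Lp_mod M p (g k))"
    by (intro always_eventually allI Lp_mod_add_le p meas)
qed simp

lemma Lp_mod_dominated_tendsto:
  assumes p: "p \<ge> 0" "c \<ge> 0" and meas: "\<And>k. g k \<in> borel_measurable M"
    and le: "\<And>k. AE x in M. norm (f k x) \<le> c * norm (g k x)"
    and lim: "(\<lambda>k. Lp_mod M p (g k)) \<longlonglongrightarrow> 0"
  shows "(\<lambda>k. Lp_mod M p (f k)) \<longlonglongrightarrow> 0"
proof (rule tendsto_sandwich[OF _ _ tendsto_const])
  show "(\<lambda>k. ennreal (c powr p) * Lp_mod M p (g k)) \<longlonglongrightarrow> 0"
    by (intro tendsto_cmult_0_ennreal lim)
  show "\<forall>\<^sub>F k in sequentially. Lp_mod M p (f k) \<le> ennreal (c powr p) * Lp_mod M p (g k)"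
    by (intro always_eventually allI Lp_mod_mono_AE p meas le)
qed simp

definition Lp :: "'a measure \<Rightarrow> real \<Rightarrow> ('a \<Rightarrow> 'b::euclidean_space) \<Rightarrow> bool" where
  "Lp M p f \<longleftrightarrow> f \<in> borel_measurable M \<and> integrable M (\<lambda>x. norm (f x) powr p)"

lemma Lp_space_iff: "f \<in> Lp_space \<Omega> p \<longleftrightarrow> Lp (lebesgue_on \<Omega>) p f"
  by (simp add: Lp_space_def Lp_def)

lemma Lp_measurable: "Lp M p f \<Longrightarrow> f \<in> borel_measurable M"
  by (simp add: Lp_def)

lemma Lp_iff_Lp_mod:
  "Lp M p f \<longleftrightarrow> f \<in> borel_measurable M \<and> Lp_mod M p f < \<infinity>"
proof -
  have "f \<in> borel_measurable M \<Longrightarrow> (\<lambda>x. norm (f x) powr p) \<in> borel_measurable M" by measurable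
  then show ?thesis unfolding Lp_def Lp_mod_def integrable_iff_bounded by auto
qed

lemma Lp_mod_eq_integral: "Lp M p f \<Longrightarrow> Lp_mod M p f = ennreal (\<integral>x. norm (f x) powr p \<partial>M)"
  unfolding Lp_def Lp_mod_def by (subst nn_integral_eq_integral) auto

lemma Lp_add:
  assumes "p \<ge> 0" "Lp M p f" "Lp M p g"
  shows "Lp M p (\<lambda>x. f x + g x)"
proof -
  have "ennreal (2 powr p) * (Lp_mod M p f + Lp_mod M p g) < \<infinity>"
    using assms by (simp add: Lp_iff_Lp_mod ennreal_mult_less_top)
  then show ?thesis
    using assms Lp_mod_add_le[OF assms(1), of f M g]
    by (auto simp: Lp_iff_Lp_mod intro: order.strict_trans1)
qed

lemma Lp_bounded:
  fixes f :: "'a \<Rightarrow> 'b::euclidean_space" and g :: "'a \<Rightarrow> 'c::euclidean_space"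
  assumes "p \<ge> 0" "Lp M p g" "f \<in> borel_measurable M" "c \<ge> 0" "AE x in M. norm (f x) \<le> c * norm (g
      x)"
  shows "Lp M p f"
proof -
  have "ennreal (c powr p) * Lp_mod M p g < \<infinity>"
    using assms by (simp add: Lp_iff_Lp_mod ennreal_mult_less_top)
  then show ?thesis
    using Lp_mod_mono_AE[OF assms(1,4) _ assms(5)] assms
    by (auto simp: Lp_iff_Lp_mod intro: order.strict_trans1)
qed

lemma Lp_uminus: "Lp M p f \<Longrightarrow> Lp M p (\<lambda>x. - f x)"
  by (auto simp: Lp_def)

lemma Lp_diff:
  assumes "p \<ge> 0" "Lp M p f" "Lp M p g"
  shows "Lp M p (\<lambda>x. f x - g x)"
  using Lp_add[OF assms(1,2) Lp_uminus[OF assms(3)]] by simp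

lemma Lp_const: "finite_measure M \<Longrightarrow> Lp M p (\<lambda>x. c)"
  unfolding Lp_def using finite_measure.integrable_const by auto

lemma Lp_bounded_fun:
  assumes "finite_measure M" "p \<ge> 0" "f \<in> borel_measurable M" "AE x in M. norm (f x) \<le> c"
  shows "Lp M p f"
proof -
  have "AE x in M. norm (f x) \<le> max c 0 * norm (1::real)" using assms(4) by eventually_elim auto
  then show ?thesis
    by (rule Lp_bounded[OF assms(2) Lp_const[OF assms(1), of p "1::real"] assms(3), rotated]) simp
qed

lemma Lp_integrable:
  assumes "finite_measure M" "p \<ge> 1" "Lp M p f"
  shows "integrable M f"
proof (rule Bochner_Integration.integrable_bound)
  show "integrable M (\<lambda>x. 1 + norm (f x) powr p)"
    using assms finite_measure.integrable_const[OF assms(1)] by (intro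
        Bochner_Integration.integrable_add) (auto simp: Lp_def)
  show "AE x in M. norm (f x) \<le> norm (1 + norm (f x) powr p)"
  proof (rule AE_I2)
    fix x
    show "norm (f x) \<le> norm (1 + norm (f x) powr p)"
    proof (cases "norm (f x) \<le> 1")
      case True
      then show ?thesis using powr_ge_zero[of "norm (f x)" p] unfolding real_norm_def by linarith
    next
      case False
      then have "norm (f x) powr 1 \<le> norm (f x) powr p" using assms by (intro powr_mono) auto
      then show ?thesis using False by auto
    qed
  qed
qed (use assms in \<open>simp add: Lp_def\<close>)

text \<open>For every d > 0 one has |f| \<le> d + d^(1-p) |f|^p, since |f|^(1-p) \<le> d^(1-p)
  wherever |f| > d. The first term costs d times the total mass, and the second tends to
  zero.\<close>

lemma Lp_mod_imp_L1_tendsto: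
  fixes f :: "nat \<Rightarrow> 'a \<Rightarrow> 'b::euclidean_space"
  assumes M: "finite_measure M" and p: "p \<ge> 1" and meas: "\<And>k. f k \<in> borel_measurable M"
    and lim: "(\<lambda>k. Lp_mod M p (f k)) \<longlonglongrightarrow> 0"
  shows "(\<lambda>k. \<integral>\<^sup>+x. ennreal (norm (f k x)) \<partial>M) \<longlonglongrightarrow> 0"
proof (rule order_tendstoI)
  interpret finite_measure M by (rule M)
  fix a :: ennreal assume "a > 0"
  then obtain c where c: "0 < c" "c < a" using dense by blast
  then have "c < \<infinity>" using less_le_trans top_greatest by (metis infinity_ennreal_def)
  then obtain e where "c = ennreal e" "e \<ge> 0" by (cases c) auto
  with c have e: "e > 0" "ennreal e < a" by auto
  define V where "V = measure M (space M)"
  have V: "V \<ge> 0" "emeasure M (space M) = ennreal V" by (auto simp: V_def emeasure_eq_measure)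
  \<comment> \<open>The constant term uses at most half of \<open>e\<close>; the threshold e / (4
    d^(1-p)) imposed below leaves a quarter for the other term.\<close>
  define d where "d = e / (2 * (V + 1))"
  have d: "d > 0" "d * V \<le> e / 2" using e V by (auto simp: d_def field_simps)
  have pos: "d powr (1 - p) > 0" using d by simp
  have "\<forall>\<^sub>F k in sequentially. Lp_mod M p (f k) < ennreal (e / (4 * d powr (1 - p)))"
    using order_tendstoD(2)[OF lim] e d by simp
  then show "\<forall>\<^sub>F k in sequentially. (\<integral>\<^sup>+x. ennreal (norm (f k x)) \<partial>M) < a"
  proof eventually_elim
    case (elim k)
    have pt: "norm (f k x) \<le> d + d powr (1 - p) * norm (f k x) powr p" for x
    proof (cases "norm (f k x) \<le> d")
      case True
      then show ?thesis using d by (simp add: add_increasing2)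
    next
      case False
      then have n: "norm (f k x) > d" "norm (f k x) > 0" using d by linarith+
      have "norm (f k x) = norm (f k x) powr (1 - p) * norm (f k x) powr p"
        using n by (simp flip: powr_add)
      also have "\<dots> \<le> d powr (1 - p) * norm (f k x) powr p"
        using n d p by (intro mult_right_mono powr_mono2') auto
      finally show ?thesis using d by simp
    qed
    have "(\<integral>\<^sup>+x. ennreal (norm (f k x)) \<partial>M) \<le> (\<integral>\<^sup>+x. ennreal d + ennreal (d powr (1 - p)) * ennreal
        (norm (f k x) powr p) \<partial>M)"
      using d by (intro nn_integral_mono) (simp add: ennreal_leI pt flip: ennreal_plus ennreal_mult)
    also have "\<dots> = ennreal d * ennreal V + ennreal (d powr (1 - p)) * Lp_mod M p (f k)"
      unfolding Lp_mod_def using meas by (simp add: nn_integral_add nn_integral_cmult V)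
    also have "\<dots> \<le> ennreal (d * V) + ennreal (d powr (1 - p)) * ennreal (e / (4 * d powr (1 - p)))"
      using elim d V by (intro add_mono mult_left_mono) (auto simp: ennreal_mult)
    also have "\<dots> = ennreal (d * V + d powr (1 - p) * (e / (4 * d powr (1 - p))))"
    proof -
      have nn: "0 \<le> d * V" "0 \<le> d powr (1 - p)" "0 \<le> e / (4 * d powr (1 - p))"
        using d(1) V(1) e(1) by auto
      show ?thesis
        by (simp only: ennreal_plus[OF nn(1) mult_nonneg_nonneg[OF nn(2,3)]] ennreal_mult[OF
            nn(2,3)])
    qed
    also have "d * V + d powr (1 - p) * (e / (4 * d powr (1 - p))) \<le> e"
      using d e pos by (simp add: field_simps)
    finally show ?case using e(2) by (auto intro: order.strict_trans1 ennreal_leI)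
  qed
qed simp

text \<open>On a finite measure space convergence in the p-th mean implies convergence in the first
  mean, which a bounded factor \<open>h\<close> preserves.\<close>

lemma Lp_mod_tendsto_integral:
  fixes f :: "nat \<Rightarrow> 'a \<Rightarrow> 'b::euclidean_space"
  assumes M: "finite_measure M" and p: "p \<ge> 1" and f: "\<And>k. Lp M p (f k)" "Lp M p g"
    and lim: "(\<lambda>k. Lp_mod M p (\<lambda>x. f k x - g x)) \<longlonglongrightarrow> 0"
    and h: "h \<in> borel_measurable M" "\<And>x. x \<in> space M \<Longrightarrow> norm (h x) \<le> B"
  shows "(\<lambda>k. \<integral>x. f k x \<bullet> h x \<partial>M) \<longlonglongrightarrow> (\<integral>x. g x \<bullet> h x \<partial>M)"
    and "integrable M (\<lambda>x. g x \<bullet> h x)"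
proof -
  define C where "C = max B 0"
  have hC: "norm (h x) \<le> C" if "x \<in> space M" for x using h(2)[OF that] by (simp add: C_def)
  have C: "C \<ge> 0" by (simp add: C_def)
  have int: "integrable M (\<lambda>x. u x \<bullet> h x)" if u: "Lp M p u" for u
  proof (rule Bochner_Integration.integrable_bound)
    show "integrable M (\<lambda>x. C * norm (u x))"
      using Lp_integrable[OF M p u] by auto
    show "AE x in M. norm (u x \<bullet> h x) \<le> norm (C * norm (u x))"
    proof (rule AE_I2)
      fix x assume x: "x \<in> space M"
      have "\<bar>u x \<bullet> h x\<bar> \<le> norm (u x) * norm (h x)" by (rule Cauchy_Schwarz_ineq2)
      also have "\<dots> \<le> norm (u x) * C" by (intro mult_left_mono hC x) auto
      finally show "norm (u x \<bullet> h x) \<le> norm (C * norm (u x))" using C by (simp add: mult.commute)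
    qed
    show "(\<lambda>x. u x \<bullet> h x) \<in> borel_measurable M" using u h(1) by (auto simp: Lp_def)
  qed
  show "integrable M (\<lambda>x. g x \<bullet> h x)" by (rule int[OF f(2)])
  have p0: "p \<ge> 0" using p by simp
  have meas: "(\<lambda>x. f k x - g x) \<in> borel_measurable M" for k
    using Lp_measurable[OF f(1)] Lp_measurable[OF f(2)] by (rule borel_measurable_diff)
  have L1: "(\<lambda>k. \<integral>\<^sup>+x. ennreal (norm (f k x - g x)) \<partial>M) \<longlonglongrightarrow> 0"
    by (rule Lp_mod_imp_L1_tendsto[OF M p meas lim])
  show "(\<lambda>k. \<integral>x. f k x \<bullet> h x \<partial>M) \<longlonglongrightarrow> (\<integral>x. g x \<bullet> h x \<partial>M)"
  proof (rule tendsto_L1_int[OF int[OF f(1)] int[OF f(2)]])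
    show "(\<lambda>k. \<integral>\<^sup>+x. ennreal (norm (f k x \<bullet> h x - g x \<bullet> h x)) \<partial>M) \<longlonglongrightarrow> 0"
    proof (rule tendsto_sandwich[OF _ _ tendsto_const])
      show "(\<lambda>k. ennreal C * (\<integral>\<^sup>+x. ennreal (norm (f k x - g x)) \<partial>M)) \<longlonglongrightarrow> 0"
        by (rule tendsto_cmult_0_ennreal[OF L1])
      show "\<forall>\<^sub>F k in sequentially. (\<integral>\<^sup>+x. ennreal (norm (f k x \<bullet> h x - g x \<bullet> h x)) \<partial>M)
          \<le> ennreal C * (\<integral>\<^sup>+x. ennreal (norm (f k x - g x)) \<partial>M)"
      proof (intro always_eventually allI)
        fix k
        have "(\<integral>\<^sup>+x. ennreal (norm (f k x \<bullet> h x - g x \<bullet> h x)) \<partial>M) \<le> (\<integral>\<^sup>+x. ennreal C * ennreal (norm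
            (f k x - g x)) \<partial>M)"
        proof (rule nn_integral_mono)
          fix x assume x: "x \<in> space M"
          have "\<bar>(f k x - g x) \<bullet> h x\<bar> \<le> norm (f k x - g x) * norm (h x)" by (rule
              Cauchy_Schwarz_ineq2)
          also have "\<dots> \<le> norm (f k x - g x) * C" by (intro mult_left_mono hC x) auto
          finally show "ennreal (norm (f k x \<bullet> h x - g x \<bullet> h x)) \<le> ennreal C * ennreal (norm (f k x
              - g x))"
            using C by (simp add: inner_diff_left mult.commute ennreal_leI flip: ennreal_mult)
        qed
        also have "\<dots> = ennreal C * (\<integral>\<^sup>+x. ennreal (norm (f k x - g x)) \<partial>M)"
          using meas[of k] by (intro nn_integral_cmult) simp
        finally show "(\<integral>\<^sup>+x. ennreal (norm (f k x \<bullet> h x - g x \<bullet> h x)) \<partial>M)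
          \<le> ennreal C * (\<integral>\<^sup>+x. ennreal (norm (f k x - g x)) \<partial>M)" .
      qed
    qed simp
  qed
qed

lemma Lp_mod_AE_subseq:
  fixes f :: "nat \<Rightarrow> 'a \<Rightarrow> 'b::euclidean_space"
  assumes p: "p > 0" and f: "\<And>k. Lp M p (f k)" and lim: "(\<lambda>k. Lp_mod M p (f k)) \<longlonglongrightarrow> 0"
  shows "\<exists>r::nat \<Rightarrow> nat. strict_mono r \<and> (AE x in M. (\<lambda>k. f (r k) x) \<longlonglongrightarrow> 0)"
proof -
  have "(\<lambda>k. ennreal (\<integral>x. norm (f k x) powr p \<partial>M)) \<longlonglongrightarrow> ennreal 0"
    using lim Lp_mod_eq_integral[OF f] by simp
  then have "(\<lambda>k. (\<integral>x. norm (norm (f k x) powr p) \<partial>M)) \<longlonglongrightarrow> 0"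
    by (subst (asm) tendsto_ennreal_iff) auto
  from tendsto_L1_AE_subseq[OF _ this] obtain r :: "nat \<Rightarrow> nat" where r: "strict_mono r"
    and ae: "AE x in M. (\<lambda>k. norm (f (r k) x) powr p) \<longlonglongrightarrow> 0"
    using f by (auto simp: Lp_def)
  have "AE x in M. (\<lambda>k. f (r k) x) \<longlonglongrightarrow> 0"
    using ae
  proof eventually_elim
    case (elim x)
    have "(\<lambda>k. (norm (f (r k) x) powr p) powr (1 / p)) \<longlonglongrightarrow> 0"
      by (rule tendsto_zero_powrI[OF elim tendsto_const]) (use p in auto)
    then show ?case using p by (simp add: powr_powr tendsto_norm_zero_iff)
  qed
  with r show ?thesis by blast
qed

section \<open>Local integrability and weak gradients\<close>

lemma finite_measure_lebesgue_on:
  assumes "bounded \<Omega>" "\<Omega> \<in> sets lebesgue"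
  shows "finite_measure (lebesgue_on \<Omega>)"
proof (rule finite_measureI)
  have "emeasure lebesgue \<Omega> < \<infinity>"
    using bounded_set_imp_lmeasurable[OF assms] unfolding fmeasurable_def by blast
  then show "emeasure (lebesgue_on \<Omega>) (space (lebesgue_on \<Omega>)) \<noteq> \<infinity>"
    using assms by (simp add: emeasure_restrict_space space_restrict_space)
qed

lemma integrable_lebesgue_on_subset:
  fixes f :: "'a::euclidean_space \<Rightarrow> 'b::euclidean_space"
  assumes "integrable (lebesgue_on A) f" "A \<in> sets lebesgue" "B \<in> sets lebesgue" "B \<subseteq> A"
  shows "integrable (lebesgue_on B) f"
proof -
  have "integrable lebesgue (\<lambda>x. indicator A x *\<^sub>R f x)"
    using assms by (simp add: integrable_restrict_space)
  then have "integrable lebesgue (\<lambda>x. indicator B x *\<^sub>R (indicator A x *\<^sub>R f x))"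
    by (rule integrable_mult_indicator[OF assms(3)])
  moreover have "(\<lambda>x. indicator B x *\<^sub>R (indicator A x *\<^sub>R f x)) = (\<lambda>x. indicator B x *\<^sub>R f x)"
    using assms(4) by (intro ext) (auto simp: indicator_def)
  ultimately show ?thesis using assms by (simp add: integrable_restrict_space)
qed

lemma integrable_imp_locally_integrable:
  assumes "integrable (lebesgue_on \<Omega>) f" "\<Omega> \<in> sets lebesgue"
  shows "locally_integrable \<Omega> f"
  unfolding locally_integrable_def
  using integrable_lebesgue_on_subset[OF assms] lmeasurable_compact fmeasurableD by blast

text \<open>The field selected by \<open>weak_gradient\<close> is known a priori only to be locally
  integrable; a countable exhaustion of \<open>\<Omega>\<close> by compact sets makes it measurable
  on all of \<open>\<Omega>\<close>.\<close>

lemma locally_integrable_measurable: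
  fixes f :: "'a::euclidean_space \<Rightarrow> 'b::euclidean_space"
  assumes "open \<Omega>" "locally_integrable \<Omega> f"
  shows "f \<in> borel_measurable (lebesgue_on \<Omega>)"
proof -
  obtain C where C: "\<And>n::nat. compact (C n)" "\<And>n. C n \<subseteq> \<Omega>" "(\<Union>n. C n) = \<Omega>"
    using open_Union_compact_subsets[OF assms(1)] by (metis)
  have Cl: "C n \<in> sets lebesgue" for n using lmeasurable_compact[OF C(1)] by (rule fmeasurableD)
  show ?thesis
  proof (rule measurable_piecewise_restrict[of "range C"])
    fix A assume "A \<in> range C"
    then obtain n where n: "A = C n" by auto
    show "A \<inter> space (lebesgue_on \<Omega>) \<in> sets (lebesgue_on \<Omega>)"
      using Cl[of n] C(2)[of n] assms(1) by (auto simp: n sets_restrict_space space_restrict_space)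
    have "restrict_space (lebesgue_on \<Omega>) A = lebesgue_on A"
      using C(2)[of n] assms(1) Cl[of n] by (simp add: restrict_restrict_space n Int_absorb1
          Int_absorb2)
    moreover have "integrable (lebesgue_on A) f"
      using assms(2) C(1)[of n] C(2)[of n] n by (auto simp: locally_integrable_def)
    ultimately show "f \<in> borel_measurable (restrict_space (lebesgue_on \<Omega>) A)"
      by (metis borel_measurable_integrable)
  qed (use C in auto)
qed

lemma integral_lebesgue_on_subset:
  fixes f :: "'a::euclidean_space \<Rightarrow> real"
  assumes "\<Omega> \<in> sets lebesgue" "\<Omega>' \<in> sets lebesgue" "\<Omega>' \<subseteq> \<Omega>" "\<And>x. x \<in> \<Omega> \<Longrightarrow> x \<notin> \<Omega>' \<Longrightarrow> f x = 0"
  shows "(\<integral>x. f x \<partial>(lebesgue_on \<Omega>')) = (\<integral>x. f x \<partial>(lebesgue_on \<Omega>))"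
  unfolding integral_lebesgue_on[OF assms(1)] integral_lebesgue_on[OF assms(2)]
  by (rule Bochner_Integration.integral_cong) (use assms(3,4) in \<open>auto simp: indicator_def\<close>)

lemma AE_lebesgue_on_iff:
  "\<Omega> \<in> sets lebesgue \<Longrightarrow> (AE x in lebesgue_on \<Omega>. P x) \<longleftrightarrow> (AE x in lebesgue. x \<in> \<Omega> \<longrightarrow> P x)"
  by (rule AE_restrict_space_iff) auto

lemma weak_gradient_mono:
  assumes "is_weak_gradient \<Omega> u G" "open \<Omega>" "open \<Omega>'" "\<Omega>' \<subseteq> \<Omega>"
  shows "is_weak_gradient \<Omega>' u G"
  unfolding is_weak_gradient_def
proof (intro conjI allI impI ballI)
  show "locally_integrable \<Omega>' u" "locally_integrable \<Omega>' G"
    using assms by (auto simp: is_weak_gradient_def locally_integrable_def)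
  fix \<phi> and b :: 'a assume \<phi>: "test_function \<Omega>' \<phi>" and b: "b \<in> Basis"
  have s: "\<Omega> \<in> sets lebesgue" "\<Omega>' \<in> sets lebesgue" using assms by auto
  have z: "\<phi> x = 0" "partial_deriv b \<phi> x = 0" if "x \<notin> \<Omega>'" for x
    using that test_function_eq_0'[OF \<phi>] test_function_eq_0'[OF test_function_partial_deriv[OF \<phi> b]]
        by auto
  have "(\<integral>x. u x * partial_deriv b \<phi> x \<partial>(lebesgue_on \<Omega>)) = - (\<integral>x. (G x \<bullet> b) * \<phi> x \<partial>(lebesgue_on \<Omega>))"
    using assms(1) test_function_mono[OF \<phi> assms(4)] b by (auto simp: is_weak_gradient_def)
  then show "(\<integral>x. u x * partial_deriv b \<phi> x \<partial>(lebesgue_on \<Omega>')) = - (\<integral>x. (G x \<bullet> b) * \<phi> x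
      \<partial>(lebesgue_on \<Omega>'))"
    using z by (simp add: integral_lebesgue_on_subset[OF s assms(4)])
qed

lemma locally_integrable_mult_test:
  fixes u :: "'a::euclidean_space \<Rightarrow> real"
  assumes \<Omega>: "open \<Omega>" and u: "locally_integrable \<Omega> u" and \<phi>: "test_function \<Omega> \<phi>"
  shows "integrable lebesgue (\<lambda>x. indicator \<Omega> x * u x * \<phi> x)"
    and "integrable (lebesgue_on \<Omega>) (\<lambda>x. u x * \<phi> x)"
proof -
  define K where "K = closure {x. \<phi> x \<noteq> 0}"
  have K: "compact K" "K \<subseteq> \<Omega>" using \<phi> by (auto simp: K_def test_function_def)
  have Kl: "K \<in> sets lebesgue" using lmeasurable_compact[OF K(1)] by (rule fmeasurableD)
  have "integrable (lebesgue_on K) u" using u K by (auto simp: locally_integrable_def)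
  then have "integrable lebesgue (\<lambda>x. indicator K x * u x)"
    using Kl by (simp add: integral_lebesgue_on)
  then have "integrable lebesgue (\<lambda>x. indicator K x * u x * \<phi> x)"
    by (rule integrable_mult_test_function[OF _ \<phi>])
  moreover have "indicator K x * u x * \<phi> x = indicator \<Omega> x * u x * \<phi> x" for x
    using K(2) test_function_eq_0[OF \<phi>, of x] by (auto simp: indicator_def K_def)
  ultimately show 1: "integrable lebesgue (\<lambda>x. indicator \<Omega> x * u x * \<phi> x)" by simp
  have "\<Omega> \<in> sets lebesgue" using \<Omega> by auto
  then show "integrable (lebesgue_on \<Omega>) (\<lambda>x. u x * \<phi> x)"
    using 1 by (simp add: integral_lebesgue_on mult.assoc)
qed

text \<open>A cutoff \<open>\<zeta>\<close> turns \<open>u\<close> into a function \<open>w\<close>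
  integrable over the whole space. The mollification of \<open>w\<close> at \<open>x\<close> is the
  integral of \<open>u\<close> against the test function y \<mapsto> \<rho>(x - y) \<zeta>(y), hence
  zero, and the mollifications converge to \<open>w\<close> in the first mean.\<close>

lemma fundamental_lemma:
  fixes u :: "'a::euclidean_space \<Rightarrow> real"
  assumes \<Omega>: "open \<Omega>" and u: "locally_integrable \<Omega> u"
    and zero: "\<And>\<phi>. test_function \<Omega> \<phi> \<Longrightarrow> (\<integral>x. u x * \<phi> x \<partial>(lebesgue_on \<Omega>)) = 0"
  shows "AE x in lebesgue_on \<Omega>. u x = 0"
proof -
  have sl: "\<Omega> \<in> sets lebesgue" using \<Omega> by auto
  have on_compact: "AE x in lebesgue. x \<in> K \<longrightarrow> u x = 0" if K: "compact K" "K \<subseteq> \<Omega>" for K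
  proof -
    obtain \<zeta> V where \<zeta>: "test_function \<Omega> \<zeta>" "open V" "K \<subseteq> V" "\<And>x. x \<in> V \<Longrightarrow> \<zeta> x = 1"
      using test_function_cutoff[OF K(1) \<Omega> K(2)] by blast
    define w where "w = (\<lambda>x. indicator \<Omega> x * u x * \<zeta> x)"
    have w: "integrable lebesgue w" unfolding w_def by (rule locally_integrable_mult_test[OF \<Omega> u
        \<zeta>(1)])
    define \<epsilon> where "\<epsilon> = (\<lambda>k. 1 / real (Suc k))"
    have \<epsilon>: "\<epsilon> \<longlonglongrightarrow> 0" "\<epsilon> k > 0" for k
      unfolding \<epsilon>_def using LIMSEQ_inverse_real_of_nat by (auto simp: inverse_eq_divide)
    have c0: "conv w (mollifier (\<epsilon> k)) x = 0" for k x
    proof -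
      have "test_function UNIV (mollifier (\<epsilon> k) :: 'a \<Rightarrow> real)"
        by (rule test_function_mollifier[OF \<epsilon>(2)]) simp
      then have "test_function UNIV (\<lambda>y. mollifier (\<epsilon> k) (x - y))" by (rule test_function_reflect)
      then have "test_function \<Omega> (\<lambda>y. mollifier (\<epsilon> k) (x - y) * \<zeta> y)"
        using test_function_mult[OF \<zeta>(1)] test_function_smooth by blast
      from zero[OF this] show ?thesis
        unfolding integral_lebesgue_on[OF sl] conv_def w_def by (simp add: mult_ac)
    qed
    have "(\<lambda>k. \<integral>\<^sup>+x. ennreal (\<bar>conv w (mollifier (\<epsilon> k)) x - w x\<bar> powr 1) \<partial>lebesgue) \<longlonglongrightarrow> 0"
      using w by (intro conv_mollifier_Lp_tendsto \<epsilon>) auto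
    then have "(\<integral>\<^sup>+x. ennreal (\<bar>w x\<bar>) \<partial>lebesgue) = 0" by (simp add: c0 LIMSEQ_const_iff)
    then have "AE x in lebesgue. w x = 0" using w by (subst (asm) nn_integral_0_iff_AE) auto
    then show ?thesis
    proof eventually_elim
      case (elim x)
      show ?case
      proof
        assume "x \<in> K"
        then have "x \<in> V" "x \<in> \<Omega>" using \<zeta>(3) K(2) by auto
        then show "u x = 0" using elim \<zeta>(4)[of x] by (simp add: w_def)
      qed
    qed
  qed
  obtain C where C: "\<And>n::nat. compact (C n)" "\<And>n. C n \<subseteq> \<Omega>" "(\<Union>n. C n) = \<Omega>"
    using open_Union_compact_subsets[OF \<Omega>] by metis
  have "AE x in lebesgue. \<forall>n. x \<in> C n \<longrightarrow> u x = 0"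
    unfolding AE_all_countable using on_compact C by blast
  then have "AE x in lebesgue. x \<in> \<Omega> \<longrightarrow> u x = 0"
    by eventually_elim (use C(3) in blast)
  then show ?thesis by (simp add: AE_lebesgue_on_iff[OF sl])
qed

lemma locally_integrable_inner:
  "locally_integrable \<Omega> G \<Longrightarrow> locally_integrable \<Omega> (\<lambda>x. G x \<bullet> b)"
  unfolding locally_integrable_def by auto

lemma locally_integrable_diff:
  "locally_integrable \<Omega> u \<Longrightarrow> locally_integrable \<Omega> v \<Longrightarrow> locally_integrable \<Omega> (\<lambda>x. u x - v x)"
  unfolding locally_integrable_def by auto

lemma locally_integrable_add:
  "locally_integrable \<Omega> u \<Longrightarrow> locally_integrable \<Omega> v \<Longrightarrow> locally_integrable \<Omega> (\<lambda>x. u x + v x)"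
  unfolding locally_integrable_def by auto

text \<open>The fundamental lemma for each component. The two functions need to agree only almost
  everywhere, so that a function vanishing almost everywhere can be compared with the zero
  function.\<close>

lemma weak_gradient_unique:
  fixes u :: "'a::euclidean_space \<Rightarrow> real"
  assumes \<Omega>: "open \<Omega>" and G: "is_weak_gradient \<Omega> u G" and G': "is_weak_gradient \<Omega> u' G'"
    and eq: "AE x in lebesgue_on \<Omega>. u x = u' x"
  shows "AE x in lebesgue_on \<Omega>. G x = G' x"
proof -
  have loc: "locally_integrable \<Omega> u" "locally_integrable \<Omega> u'" "locally_integrable \<Omega> G"
      "locally_integrable \<Omega> G'"
    using G G' by (auto simp: is_weak_gradient_def)
  have comp: "AE x in lebesgue_on \<Omega>. (G x - G' x) \<bullet> b = 0" if b: "b \<in> Basis" for b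
  proof (rule fundamental_lemma[OF \<Omega>])
    show "locally_integrable \<Omega> (\<lambda>x. (G x - G' x) \<bullet> b)"
      by (intro locally_integrable_inner locally_integrable_diff loc)
    fix \<phi> assume \<phi>: "test_function \<Omega> \<phi>"
    have "(\<integral>x. u x * partial_deriv b \<phi> x \<partial>(lebesgue_on \<Omega>)) = (\<integral>x. u' x * partial_deriv b \<phi> x
        \<partial>(lebesgue_on \<Omega>))"
    proof (rule integral_cong_AE)
      show "AE x in lebesgue_on \<Omega>. u x * partial_deriv b \<phi> x = u' x * partial_deriv b \<phi> x"
        using eq by eventually_elim simp
    qed (use locally_integrable_mult_test(2)[OF \<Omega> _ test_function_partial_deriv[OF \<phi> b]] loc in
        blast)+
    moreover have "(\<integral>x. u x * partial_deriv b \<phi> x \<partial>(lebesgue_on \<Omega>)) = - (\<integral>x. (G x \<bullet> b) * \<phi> x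
        \<partial>(lebesgue_on \<Omega>))"
      "(\<integral>x. u' x * partial_deriv b \<phi> x \<partial>(lebesgue_on \<Omega>)) = - (\<integral>x. (G' x \<bullet> b) * \<phi> x \<partial>(lebesgue_on
          \<Omega>))"
      using G G' \<phi> b by (auto simp: is_weak_gradient_def)
    ultimately show "(\<integral>x. ((G x - G' x) \<bullet> b) * \<phi> x \<partial>(lebesgue_on \<Omega>)) = 0"
      using locally_integrable_mult_test(2)[OF \<Omega> locally_integrable_inner[OF loc(3)] \<phi>, of b]
        locally_integrable_mult_test(2)[OF \<Omega> locally_integrable_inner[OF loc(4)] \<phi>, of b]
      by (simp add: inner_diff_left left_diff_distrib)
  qed
  have "AE x in lebesgue_on \<Omega>. \<forall>b\<in>Basis. (G x - G' x) \<bullet> b = 0"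
    using comp by (simp add: AE_ball_countable countable_finite)
  then show ?thesis by eventually_elim (auto intro: euclidean_eqI simp: inner_diff_left)
qed

lemma weak_gradient_add:
  assumes \<Omega>: "open \<Omega>" and G: "is_weak_gradient \<Omega> u G" and H: "is_weak_gradient \<Omega> v H"
  shows "is_weak_gradient \<Omega> (\<lambda>x. u x + v x) (\<lambda>x. G x + H x)"
  unfolding is_weak_gradient_def
proof (intro conjI allI impI ballI)
  have loc: "locally_integrable \<Omega> u" "locally_integrable \<Omega> v" "locally_integrable \<Omega> G"
      "locally_integrable \<Omega> H"
    using G H by (auto simp: is_weak_gradient_def)
  show "locally_integrable \<Omega> (\<lambda>x. u x + v x)" "locally_integrable \<Omega> (\<lambda>x. G x + H x)"
    by (intro locally_integrable_add loc)+
  fix \<phi> and b :: 'a assume \<phi>: "test_function \<Omega> \<phi>" and b: "b \<in> Basis"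
  note i = locally_integrable_mult_test(2)[OF \<Omega> _ \<phi>] locally_integrable_mult_test(2)[OF \<Omega> _
      test_function_partial_deriv[OF \<phi> b]]
  show "(\<integral>x. (u x + v x) * partial_deriv b \<phi> x \<partial>(lebesgue_on \<Omega>)) =
        - (\<integral>x. ((G x + H x) \<bullet> b) * \<phi> x \<partial>(lebesgue_on \<Omega>))"
    using G H \<phi> b i(2)[OF loc(1)] i(2)[OF loc(2)] i(1)[OF locally_integrable_inner[OF loc(3)]]
        i(1)[OF locally_integrable_inner[OF loc(4)]]
    by (simp add: is_weak_gradient_def inner_add_left distrib_right)
qed

lemma weak_gradient_uminus:
  assumes "is_weak_gradient \<Omega> u G"
  shows "is_weak_gradient \<Omega> (\<lambda>x. - u x) (\<lambda>x. - G x)"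
  using assms unfolding is_weak_gradient_def locally_integrable_def by auto

text \<open>The product of \<open>\<zeta>\<close> and \<open>\<phi>\<close> is inserted as test
  function into the identity for \<open>u\<close>; the Leibniz rule for that product yields both
  terms of the new gradient.\<close>

lemma weak_gradient_test_mult:
  fixes u :: "'a::euclidean_space \<Rightarrow> real"
  assumes \<Omega>: "open \<Omega>" and G: "is_weak_gradient \<Omega> u G" and \<zeta>: "test_function \<Omega> \<zeta>"
    and loc': "locally_integrable \<Omega> (\<lambda>x. \<zeta> x * u x)" "locally_integrable \<Omega> (\<lambda>x. \<zeta> x *\<^sub>R G x + u x
        *\<^sub>R grad \<zeta> x)"
  shows "is_weak_gradient \<Omega> (\<lambda>x. \<zeta> x * u x) (\<lambda>x. \<zeta> x *\<^sub>R G x + u x *\<^sub>R grad \<zeta> x)"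
  unfolding is_weak_gradient_def
proof (intro conjI allI impI ballI loc')
  have loc: "locally_integrable \<Omega> u" "locally_integrable \<Omega> G"
    using G by (auto simp: is_weak_gradient_def)
  fix \<phi> and b :: 'a assume \<phi>: "test_function \<Omega> \<phi>" and b: "b \<in> Basis"
  have \<zeta>\<phi>: "test_function \<Omega> (\<lambda>x. \<zeta> x * \<phi> x)" by (rule test_function_mult[OF \<phi>
      test_function_smooth[OF \<zeta>]])
  have t1: "test_function \<Omega> (\<lambda>x. \<zeta> x * partial_deriv b \<phi> x)"
    by (rule test_function_mult[OF test_function_partial_deriv[OF \<phi> b] test_function_smooth[OF \<zeta>]])
  have t2: "test_function \<Omega> (\<lambda>x. partial_deriv b \<zeta> x * \<phi> x)"
    by (rule test_function_mult[OF \<phi> test_function_smooth[OF test_function_partial_deriv[OF \<zeta> b]]])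
  have pd: "partial_deriv b (\<lambda>x. \<zeta> x * \<phi> x) x = \<zeta> x * partial_deriv b \<phi> x + partial_deriv b \<zeta> x * \<phi>
      x" for x
    by (rule partial_deriv_mult[OF test_function_differentiable[OF \<zeta>]
        test_function_differentiable[OF \<phi>]])
  note i = locally_integrable_mult_test(2)[OF \<Omega>]
  have i1: "integrable (lebesgue_on \<Omega>) (\<lambda>x. u x * (\<zeta> x * partial_deriv b \<phi> x))"
    and i2: "integrable (lebesgue_on \<Omega>) (\<lambda>x. u x * (partial_deriv b \<zeta> x * \<phi> x))"
    and i3: "integrable (lebesgue_on \<Omega>) (\<lambda>x. (G x \<bullet> b) * (\<zeta> x * \<phi> x))"
    using i[OF loc(1) t1] i[OF loc(1) t2] i[OF locally_integrable_inner[OF loc(2)] \<zeta>\<phi>] by auto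
  have "(\<integral>x. u x * partial_deriv b (\<lambda>x. \<zeta> x * \<phi> x) x \<partial>(lebesgue_on \<Omega>)) = - (\<integral>x. (G x \<bullet> b) * (\<zeta> x * \<phi>
      x) \<partial>(lebesgue_on \<Omega>))"
    using G \<zeta>\<phi> b by (auto simp: is_weak_gradient_def)
  moreover have "(\<integral>x. u x * partial_deriv b (\<lambda>x. \<zeta> x * \<phi> x) x \<partial>(lebesgue_on \<Omega>))
      = (\<integral>x. u x * (\<zeta> x * partial_deriv b \<phi> x) \<partial>(lebesgue_on \<Omega>)) + (\<integral>x. u x * (partial_deriv b \<zeta> x *
          \<phi> x) \<partial>(lebesgue_on \<Omega>))"
    unfolding pd distrib_left using i1 i2 by (rule Bochner_Integration.integral_add)
  moreover have "(\<integral>x. ((\<zeta> x *\<^sub>R G x + u x *\<^sub>R grad \<zeta> x) \<bullet> b) * \<phi> x \<partial>(lebesgue_on \<Omega>))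
      = (\<integral>x. (G x \<bullet> b) * (\<zeta> x * \<phi> x) + u x * (partial_deriv b \<zeta> x * \<phi> x) \<partial>(lebesgue_on \<Omega>))"
    by (rule Bochner_Integration.integral_cong) (simp_all add: inner_add_left grad_inner_Basis b
        algebra_simps)
  moreover have "\<dots> = (\<integral>x. (G x \<bullet> b) * (\<zeta> x * \<phi> x) \<partial>(lebesgue_on \<Omega>)) + (\<integral>x. u x * (partial_deriv b \<zeta>
      x * \<phi> x) \<partial>(lebesgue_on \<Omega>))"
    by (rule Bochner_Integration.integral_add[OF i3 i2])
  ultimately show "(\<integral>x. \<zeta> x * u x * partial_deriv b \<phi> x \<partial>(lebesgue_on \<Omega>)) =
        - (\<integral>x. ((\<zeta> x *\<^sub>R G x + u x *\<^sub>R grad \<zeta> x) \<bullet> b) * \<phi> x \<partial>(lebesgue_on \<Omega>))"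
    by (simp add: mult_ac)
qed

section \<open>Sobolev functions\<close>

text \<open>The gradient is carried along explicitly, so that estimates refer to a given field and
  not to the choice made in \<open>weak_gradient\<close>.\<close>

definition sob :: "'a::euclidean_space set \<Rightarrow> real \<Rightarrow> ('a \<Rightarrow> real) \<Rightarrow> ('a \<Rightarrow> 'a) \<Rightarrow> bool" where
  "sob \<Omega> p u G \<longleftrightarrow> Lp (lebesgue_on \<Omega>) p u \<and> Lp (lebesgue_on \<Omega>) p G \<and> is_weak_gradient \<Omega> u G"

text \<open>That \<open>G\<close> is a weak gradient of \<open>u\<close> is a consequence of the two
  limits, proved in \<open>sob0_imp_sob\<close>.\<close>

definition sob0 :: "'a::euclidean_space set \<Rightarrow> real \<Rightarrow> ('a \<Rightarrow> real) \<Rightarrow> ('a \<Rightarrow> 'a) \<Rightarrow> bool" where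
  "sob0 \<Omega> p u G \<longleftrightarrow> Lp (lebesgue_on \<Omega>) p u \<and> Lp (lebesgue_on \<Omega>) p G \<and>
    (\<exists>\<phi>::nat \<Rightarrow> 'a \<Rightarrow> real. (\<forall>k. test_function \<Omega> (\<phi> k)) \<and>
      (\<lambda>k. Lp_mod (lebesgue_on \<Omega>) p (\<lambda>x. u x - \<phi> k x)) \<longlonglongrightarrow> 0 \<and>
      (\<lambda>k. Lp_mod (lebesgue_on \<Omega>) p (\<lambda>x. G x - grad (\<phi> k) x)) \<longlonglongrightarrow> 0)"

text \<open>Like the positive part it vanishes exactly on the nonpositive numbers. Continuity of its
  derivative lets the chain rule pass through almost everywhere limits. That the derivative stays
  strictly below one keeps the fraction in convex variations in the range where strict convexity
  applies.\<close>

definition eta :: "real \<Rightarrow> real" where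
  "eta t = (if t \<le> 0 then 0 else sqrt (1 + t\<^sup>2) - 1)"

definition eta' :: "real \<Rightarrow> real" where
  "eta' t = (if t \<le> 0 then 0 else t / sqrt (1 + t\<^sup>2))"

lemma eta'_range: "0 \<le> eta' t" "eta' t < 1"
proof -
  show "0 \<le> eta' t" by (simp add: eta'_def)
  have "t < sqrt (1 + t\<^sup>2)" by (rule real_less_rsqrt) simp
  moreover have "0 < sqrt (1 + t\<^sup>2)" by (simp add: add_pos_nonneg)
  ultimately show "eta' t < 1" by (simp add: eta'_def)
qed

lemma eta_nonneg: "0 \<le> eta t"
  by (simp add: eta_def)

lemma eta_pos_iff: "eta t > 0 \<longleftrightarrow> t > 0"
  by (auto simp: eta_def)

lemma eta_le_0: "t \<le> 0 \<Longrightarrow> eta t = 0" "t \<le> 0 \<Longrightarrow> eta' t = 0"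
  by (auto simp: eta_def eta'_def)

lemma continuous_eta': "continuous_on UNIV eta'"
proof -
  have eq: "eta' = (\<lambda>t. max 0 t / sqrt (1 + t\<^sup>2))" by (auto simp: eta'_def max_def)
  have ne: "1 + t\<^sup>2 \<noteq> 0" for t :: real
    by (metis add_pos_nonneg less_irrefl zero_le_power2 zero_less_one)
  show ?thesis unfolding eq using ne by (intro continuous_intros) auto
qed

lemma eta_deriv: "(eta has_real_derivative eta' t) (at t)"
proof -
  consider "t > 0" | "t < 0" | "t = 0" by linarith
  then show ?thesis
  proof cases
    case 1
    have "1 + t\<^sup>2 > 0" by (simp add: add_pos_nonneg)
    then have "((\<lambda>t. sqrt (1 + t\<^sup>2) - 1) has_real_derivative eta' t) (at t)"
      using 1 by (auto intro!: derivative_eq_intros simp: eta'_def field_simps)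
    moreover have ev: "\<forall>\<^sub>F s in nhds t. eta s = sqrt (1 + s\<^sup>2) - 1"
      using eventually_nhds_in_open[of "{0<..}" t] 1 by (auto elim!: eventually_mono simp: eta_def)
    ultimately show ?thesis by (simp add: DERIV_cong_ev[OF refl ev refl])
  next
    case 2
    have ev: "\<forall>\<^sub>F s in nhds t. eta s = 0"
      using eventually_nhds_in_open[of "{..<0}" t] 2 by (auto elim!: eventually_mono simp: eta_def)
    then show ?thesis using 2 by (simp add: DERIV_cong_ev[OF refl ev refl] eta'_def)
  next
    case 3
    have "(eta has_derivative (\<lambda>h. 0)) (at 0)"
    proof (rule has_derivative_quadratic[where C = 1])
      fix h :: real
      have "sqrt (1 + h\<^sup>2) \<le> 1 + h\<^sup>2"
      proof (rule real_le_lsqrt)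
        have "(1 + h\<^sup>2)\<^sup>2 = 1 + 2 * h\<^sup>2 + (h\<^sup>2)\<^sup>2" by (simp add: power2_sum)
        then show "1 + h\<^sup>2 \<le> (1 + h\<^sup>2)\<^sup>2" using zero_le_power2[of h] zero_le_power2[of "h\<^sup>2"] by
            linarith
      qed simp
      then show "\<bar>eta (0 + h) - eta 0 - 0\<bar> \<le> 1 * (norm h)\<^sup>2" by (auto simp: eta_def)
    qed simp
    moreover have "(*) (0::real) = (\<lambda>h. 0)" by auto
    ultimately show ?thesis using 3 by (simp add: has_field_derivative_def eta'_def)
  qed
qed

lemma continuous_eta: "continuous_on UNIV eta"
  using eta_deriv DERIV_isCont continuous_at_imp_continuous_on by blast

lemma eta_lipschitz: "\<bar>eta a - eta b\<bar> \<le> \<bar>a - b\<bar>"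
proof -
  have "norm (eta a - eta b) \<le> 1 * norm (a - b)"
  proof (rule field_differentiable_bound[of UNIV])
    show "norm (eta' x) \<le> 1" for x using eta'_range[of x] by simp
  qed (auto intro: eta_deriv)
  then show ?thesis by simp
qed

lemma eta_abs_le: "\<bar>eta a\<bar> \<le> \<bar>a\<bar>"
  using eta_lipschitz[of a 0] by (simp add: eta_def)

lemma continuous_grad_test: "test_function \<Omega> \<phi> \<Longrightarrow> continuous_on S (grad \<phi>)"
  unfolding grad_def[abs_def]
  by (intro continuous_intros test_function_continuous[OF test_function_partial_deriv])

lemma grad_test_bounded:
  assumes "test_function \<Omega> \<phi>"
  obtains B where "B > 0" "\<And>x. norm (grad \<phi> x) \<le> B"
proof -
  have "compact (grad \<phi> ` closure {x. \<phi> x \<noteq> 0})"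
    using assms continuous_grad_test[OF assms] by (intro compact_continuous_image) (auto simp:
        test_function_def)
  then obtain B where B: "\<forall>y\<in>grad \<phi> ` closure {x. \<phi> x \<noteq> 0}. norm y \<le> B" and B0: "B > 0"
    by (metis bounded_pos compact_imp_bounded)
  have "norm (grad \<phi> x) \<le> B" for x
    using B B0 grad_eq_0[of x \<phi>] by (cases "x \<in> closure {x. \<phi> x \<noteq> 0}") auto
  then show ?thesis using that B0 by blast
qed

lemma grad_add:
  assumes "f differentiable (at x)" "g differentiable (at x)"
  shows "grad (\<lambda>x. f x + g x) x = grad f x + grad g x"
  by (rule grad_unique, rule has_derivative_eq_rhs,
      rule has_derivative_add[OF has_derivative_grad_inner[OF assms(1)] has_derivative_grad_inner[OF
          assms(2)]])
    (simp add: inner_add_left)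

lemma grad_scale:
  assumes "f differentiable (at x)"
  shows "grad (\<lambda>x. c * f x) x = c *\<^sub>R grad f x"
  by (rule grad_unique, rule has_derivative_eq_rhs,
      rule has_derivative_mult_right[OF has_derivative_grad_inner[OF assms]]) simp

lemma grad_eq_0_on_const:
  assumes "open V" "x \<in> V" "\<And>y. y \<in> V \<Longrightarrow> f y = c"
  shows "grad f x = 0"
proof (rule grad_unique)
  show "(f has_derivative (\<lambda>h. 0 \<bullet> h)) (at x)"
    by (rule has_derivative_transform_within_open[of "\<lambda>x. c" _ _ _ V]) (use assms in auto)
qed

lemma sobD:
  assumes "sob \<Omega> p u G"
  shows "Lp (lebesgue_on \<Omega>) p u" "Lp (lebesgue_on \<Omega>) p G" "is_weak_gradient \<Omega> u G"
  using assms by (auto simp: sob_def)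

context
  fixes \<Omega> :: "'a::euclidean_space set" and p :: real
  assumes \<Omega>: "open \<Omega>" "bounded \<Omega>" and p: "p > 1"
begin

lemma domain_facts:
  "\<Omega> \<in> sets lebesgue" "finite_measure (lebesgue_on \<Omega>)" "p \<ge> 1" "p \<ge> 0" "p > 0"
  "space (lebesgue_on \<Omega>) = \<Omega>"
  using \<Omega> p finite_measure_lebesgue_on[OF \<Omega>(2)] by (auto simp: space_restrict_space)

lemma continuous_measurable_on:
  fixes f :: "'a \<Rightarrow> 'b::euclidean_space"
  assumes "continuous_on \<Omega> f" shows "f \<in> borel_measurable (lebesgue_on \<Omega>)"
  using continuous_imp_measurable_on_sets_lebesgue[OF assms domain_facts(1)] .

lemma Lp_bounded_continuous:
  fixes f :: "'a \<Rightarrow> 'b::euclidean_space"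
  assumes "continuous_on \<Omega> f" "\<And>x. x \<in> \<Omega> \<Longrightarrow> norm (f x) \<le> B"
  shows "Lp (lebesgue_on \<Omega>) p f"
  by (rule Lp_bounded_fun[OF domain_facts(2,4) continuous_measurable_on[OF assms(1)], where c=B])
    (use assms(2) domain_facts(6) in auto)

lemma Lp_locally_integrable: "Lp (lebesgue_on \<Omega>) p f \<Longrightarrow> locally_integrable \<Omega> f"
  using Lp_integrable[OF domain_facts(2,3)] integrable_imp_locally_integrable domain_facts(1) by
      blast

lemma sob_C1:
  assumes "\<And>x. x \<in> \<Omega> \<Longrightarrow> (f has_derivative (\<lambda>h. F x \<bullet> h)) (at x)" "continuous_on \<Omega> F"
    "\<And>x. x \<in> \<Omega> \<Longrightarrow> \<bar>f x\<bar> \<le> B" "\<And>x. x \<in> \<Omega> \<Longrightarrow> norm (F x) \<le> B"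
  shows "sob \<Omega> p f F"
proof -
  have "continuous_on \<Omega> f"
    using assms(1) by (meson \<Omega>(1) has_derivative_continuous continuous_at_imp_continuous_on)
  then show ?thesis
    unfolding sob_def using assms
    by (intro conjI Lp_bounded_continuous[where B=B] is_weak_gradient_C1 \<Omega>) auto
qed

lemma sob_test:
  assumes "test_function \<Omega> \<phi>" shows "sob \<Omega> p \<phi> (grad \<phi>)"
proof -
  obtain B where B: "\<And>x. \<bar>\<phi> x\<bar> \<le> B" using test_function_bounded[OF assms] by metis
  obtain C where C: "\<And>x. norm (grad \<phi> x) \<le> C" using grad_test_bounded[OF assms] by metis
  show ?thesis
    by (rule sob_C1[where B = "max B C"])
      (auto intro: has_derivative_grad_inner test_function_differentiable[OF assms]
          continuous_grad_test[OF assms]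
        max.coboundedI1[OF B] max.coboundedI2[OF C])
qed

text \<open>The defining identity pairs \<open>u\<close> and \<open>G\<close> with bounded functions
  only, so it passes to limits in the p-th mean over a set of finite measure.\<close>

lemma sob_limit:
  assumes s: "\<And>k::nat. sob \<Omega> p (u k) (G k)" and L: "Lp (lebesgue_on \<Omega>) p v" "Lp (lebesgue_on \<Omega>) p H"
    and lim: "(\<lambda>k. Lp_mod (lebesgue_on \<Omega>) p (\<lambda>x. u k x - v x)) \<longlonglongrightarrow> 0"
      "(\<lambda>k. Lp_mod (lebesgue_on \<Omega>) p (\<lambda>x. G k x - H x)) \<longlonglongrightarrow> 0"
  shows "sob \<Omega> p v H"
proof -
  have "is_weak_gradient \<Omega> v H"
    unfolding is_weak_gradient_def
  proof (intro conjI allI impI ballI Lp_locally_integrable L)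
    fix \<phi> and b :: 'a assume \<phi>: "test_function \<Omega> \<phi>" and b: "b \<in> Basis"
    have \<phi>': "test_function \<Omega> (partial_deriv b \<phi>)" by (rule test_function_partial_deriv[OF \<phi> b])
    obtain B where B: "\<And>x. \<bar>\<phi> x\<bar> \<le> B" using test_function_bounded[OF \<phi>] by metis
    obtain B' where B': "\<And>x. \<bar>partial_deriv b \<phi> x\<bar> \<le> B'" using test_function_bounded[OF \<phi>'] by metis
    have 1: "(\<lambda>k. \<integral>x. u k x \<bullet> partial_deriv b \<phi> x \<partial>(lebesgue_on \<Omega>)) \<longlonglongrightarrow> (\<integral>x. v x \<bullet> partial_deriv b \<phi> x
        \<partial>(lebesgue_on \<Omega>))"
      by (rule Lp_mod_tendsto_integral(1)[OF domain_facts(2,3) sobD(1)[OF s] L(1) lim(1), where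
          B=B'])
        (use B' in \<open>auto intro: continuous_measurable_on test_function_continuous[OF \<phi>']\<close>)
    have 2: "(\<lambda>k. \<integral>x. G k x \<bullet> (\<phi> x *\<^sub>R b) \<partial>(lebesgue_on \<Omega>)) \<longlonglongrightarrow> (\<integral>x. H x \<bullet> (\<phi> x *\<^sub>R b) \<partial>(lebesgue_on
        \<Omega>))"
      by (rule Lp_mod_tendsto_integral(1)[OF domain_facts(2,3) sobD(2)[OF s] L(2) lim(2), where
          B=B])
        (use B b in \<open>auto intro!: continuous_measurable_on continuous_intros
            test_function_continuous[OF \<phi>]\<close>)
    have "(\<integral>x. u k x * partial_deriv b \<phi> x \<partial>(lebesgue_on \<Omega>)) = - (\<integral>x. (G k x \<bullet> b) * \<phi> x
        \<partial>(lebesgue_on \<Omega>))" for k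
      using sobD(3)[OF s[of k]] \<phi> b unfolding is_weak_gradient_def by blast
    then have 3: "(\<integral>x. u k x \<bullet> partial_deriv b \<phi> x \<partial>(lebesgue_on \<Omega>)) = - (\<integral>x. G k x \<bullet> (\<phi> x *\<^sub>R b)
        \<partial>(lebesgue_on \<Omega>))" for k
      by (simp add: mult.commute)
    have "(\<integral>x. v x \<bullet> partial_deriv b \<phi> x \<partial>(lebesgue_on \<Omega>)) = - (\<integral>x. H x \<bullet> (\<phi> x *\<^sub>R b) \<partial>(lebesgue_on
        \<Omega>))"
      using LIMSEQ_unique[OF 1] tendsto_minus[OF 2] unfolding 3 by blast
    then show "(\<integral>x. v x * partial_deriv b \<phi> x \<partial>(lebesgue_on \<Omega>)) = - (\<integral>x. (H x \<bullet> b) * \<phi> x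
        \<partial>(lebesgue_on \<Omega>))"
      by (simp add: mult.commute)
  qed
  then show ?thesis using L by (simp add: sob_def)
qed

lemma sob0_imp_sob:
  assumes "sob0 \<Omega> p u G" shows "sob \<Omega> p u G"
proof -
  obtain \<phi> :: "nat \<Rightarrow> 'a \<Rightarrow> real" where \<phi>: "\<And>k. test_function \<Omega> (\<phi> k)"
    "(\<lambda>k. Lp_mod (lebesgue_on \<Omega>) p (\<lambda>x. u x - \<phi> k x)) \<longlonglongrightarrow> 0"
    "(\<lambda>k. Lp_mod (lebesgue_on \<Omega>) p (\<lambda>x. G x - grad (\<phi> k) x)) \<longlonglongrightarrow> 0"
    and L: "Lp (lebesgue_on \<Omega>) p u" "Lp (lebesgue_on \<Omega>) p G"
    using assms unfolding sob0_def by blast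
  show ?thesis
    by (rule sob_limit[OF sob_test[OF \<phi>(1)] L])
      (subst Lp_mod_minus_commute, rule \<phi>)+
qed

lemma sob_add: "sob \<Omega> p u G \<Longrightarrow> sob \<Omega> p v H \<Longrightarrow> sob \<Omega> p (\<lambda>x. u x + v x) (\<lambda>x. G x + H x)"
  unfolding sob_def by (intro conjI Lp_add[OF domain_facts(4)] weak_gradient_add[OF \<Omega>(1)]) simp_all

lemma sob_uminus: "sob \<Omega> p u G \<Longrightarrow> sob \<Omega> p (\<lambda>x. - u x) (\<lambda>x. - G x)"
  unfolding sob_def by (intro conjI Lp_uminus weak_gradient_uminus) simp_all

lemma sob_diff: "sob \<Omega> p u G \<Longrightarrow> sob \<Omega> p v H \<Longrightarrow> sob \<Omega> p (\<lambda>x. u x - v x) (\<lambda>x. G x - H x)"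
  using sob_add[OF _ sob_uminus, of u G v H] by simp

lemma sob0_add:
  assumes "sob0 \<Omega> p u G" "sob0 \<Omega> p v H"
  shows "sob0 \<Omega> p (\<lambda>x. u x + v x) (\<lambda>x. G x + H x)"
proof -
  obtain \<phi> :: "nat \<Rightarrow> 'a \<Rightarrow> real" where \<phi>: "\<And>k. test_function \<Omega> (\<phi> k)"
    "(\<lambda>k. Lp_mod (lebesgue_on \<Omega>) p (\<lambda>x. u x - \<phi> k x)) \<longlonglongrightarrow> 0"
    "(\<lambda>k. Lp_mod (lebesgue_on \<Omega>) p (\<lambda>x. G x - grad (\<phi> k) x)) \<longlonglongrightarrow> 0"
    using assms(1) unfolding sob0_def by blast
  obtain \<psi> :: "nat \<Rightarrow> 'a \<Rightarrow> real" where \<psi>: "\<And>k. test_function \<Omega> (\<psi> k)"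
    "(\<lambda>k. Lp_mod (lebesgue_on \<Omega>) p (\<lambda>x. v x - \<psi> k x)) \<longlonglongrightarrow> 0"
    "(\<lambda>k. Lp_mod (lebesgue_on \<Omega>) p (\<lambda>x. H x - grad (\<psi> k) x)) \<longlonglongrightarrow> 0"
    using assms(2) unfolding sob0_def by blast
  have L: "Lp (lebesgue_on \<Omega>) p u" "Lp (lebesgue_on \<Omega>) p G" "Lp (lebesgue_on \<Omega>) p v" "Lp
      (lebesgue_on \<Omega>) p H"
    using assms by (auto simp: sob0_def)
  note m = Lp_measurable[OF sobD(1)[OF sob_test]] Lp_measurable[OF sobD(2)[OF sob_test]]
  show ?thesis
    unfolding sob0_def
  proof (intro conjI exI allI)
    show "Lp (lebesgue_on \<Omega>) p (\<lambda>x. u x + v x)" "Lp (lebesgue_on \<Omega>) p (\<lambda>x. G x + H x)"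
      by (intro Lp_add domain_facts L)+
    show "test_function \<Omega> (\<lambda>x. \<phi> k x + \<psi> k x)" for k by (intro test_function_add \<phi> \<psi>)
    have "(\<lambda>k. Lp_mod (lebesgue_on \<Omega>) p (\<lambda>x. (u x - \<phi> k x) + (v x - \<psi> k x))) \<longlonglongrightarrow> 0"
      by (intro Lp_mod_add_tendsto \<phi> \<psi> domain_facts borel_measurable_diff m Lp_measurable[OF L(1)]
          Lp_measurable[OF L(3)])
    then show "(\<lambda>k. Lp_mod (lebesgue_on \<Omega>) p (\<lambda>x. u x + v x - (\<phi> k x + \<psi> k x))) \<longlonglongrightarrow> 0"
      by (simp add: algebra_simps)
    have "(\<lambda>k. Lp_mod (lebesgue_on \<Omega>) p (\<lambda>x. (G x - grad (\<phi> k) x) + (H x - grad (\<psi> k) x))) \<longlonglongrightarrow> 0"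
      by (intro Lp_mod_add_tendsto \<phi> \<psi> domain_facts borel_measurable_diff m Lp_measurable[OF L(2)]
          Lp_measurable[OF L(4)])
    moreover have "grad (\<lambda>x. \<phi> k x + \<psi> k x) x = grad (\<phi> k) x + grad (\<psi> k) x" for k x
      by (intro grad_add test_function_differentiable[OF \<phi>(1)] test_function_differentiable[OF
          \<psi>(1)])
    ultimately show "(\<lambda>k. Lp_mod (lebesgue_on \<Omega>) p (\<lambda>x. G x + H x - grad (\<lambda>x. \<phi> k x + \<psi> k x) x)) \<longlonglongrightarrow>
        0"
      by (simp add: algebra_simps)
  qed
qed

lemma sob0_uminus:
  assumes "sob0 \<Omega> p u G"
  shows "sob0 \<Omega> p (\<lambda>x. - u x) (\<lambda>x. - G x)"
proof -
  obtain \<phi> :: "nat \<Rightarrow> 'a \<Rightarrow> real" where \<phi>: "\<And>k. test_function \<Omega> (\<phi> k)"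
    "(\<lambda>k. Lp_mod (lebesgue_on \<Omega>) p (\<lambda>x. u x - \<phi> k x)) \<longlonglongrightarrow> 0"
    "(\<lambda>k. Lp_mod (lebesgue_on \<Omega>) p (\<lambda>x. G x - grad (\<phi> k) x)) \<longlonglongrightarrow> 0"
    and L: "Lp (lebesgue_on \<Omega>) p u" "Lp (lebesgue_on \<Omega>) p G"
    using assms(1) unfolding sob0_def by blast
  have t: "test_function \<Omega> (\<lambda>x. - \<phi> k x)" for k using test_function_scale[OF \<phi>(1), of "-1" k] by
      simp
  have g: "grad (\<lambda>x. - \<phi> k x) x = - grad (\<phi> k) x" for k x
    using grad_scale[OF test_function_differentiable[OF \<phi>(1)], of "-1" k x] by simp
  have "(\<lambda>k. Lp_mod (lebesgue_on \<Omega>) p (\<lambda>x. - (u x - \<phi> k x))) \<longlonglongrightarrow> 0"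
    "(\<lambda>k. Lp_mod (lebesgue_on \<Omega>) p (\<lambda>x. - (G x - grad (\<phi> k) x))) \<longlonglongrightarrow> 0"
    unfolding Lp_mod_minus by (intro \<phi>)+
  then have "(\<lambda>k. Lp_mod (lebesgue_on \<Omega>) p (\<lambda>x. - u x - - \<phi> k x)) \<longlonglongrightarrow> 0"
    "(\<lambda>k. Lp_mod (lebesgue_on \<Omega>) p (\<lambda>x. - G x - grad (\<lambda>x. - \<phi> k x) x)) \<longlonglongrightarrow> 0"
    unfolding g by (simp_all add: algebra_simps)
  then show ?thesis
    unfolding sob0_def
    by (intro conjI Lp_uminus L exI[of _ "\<lambda>k x. - \<phi> k x"] allI t)
qed

lemma W1p_iff: "u \<in> W1p \<Omega> p \<longleftrightarrow> (\<exists>G. sob \<Omega> p u G)"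
  unfolding W1p_def sob_def Lp_space_iff by auto

text \<open>The selected gradient agrees with \<open>G\<close> almost everywhere by uniqueness and
  inherits p-integrability from it.\<close>

lemma weak_gradient_sob:
  assumes "sob \<Omega> p u G"
  shows "AE x in lebesgue_on \<Omega>. weak_gradient \<Omega> u x = G x" and "Lp (lebesgue_on \<Omega>) p (weak_gradient
      \<Omega> u)"
proof -
  have G: "is_weak_gradient \<Omega> u G" using assms by (simp add: sob_def)
  have W: "is_weak_gradient \<Omega> u (weak_gradient \<Omega> u)"
    unfolding weak_gradient_def by (rule someI[of "is_weak_gradient \<Omega> u"]) (rule G)
  show ae: "AE x in lebesgue_on \<Omega>. weak_gradient \<Omega> u x = G x"
    by (rule weak_gradient_unique[OF \<Omega>(1) W G]) simp
  have "weak_gradient \<Omega> u \<in> borel_measurable (lebesgue_on \<Omega>)"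
    using W locally_integrable_measurable[OF \<Omega>(1)] unfolding is_weak_gradient_def by blast
  then show "Lp (lebesgue_on \<Omega>) p (weak_gradient \<Omega> u)"
    by (rule Lp_bounded[OF domain_facts(4) sobD(2)[OF assms], where c = 1])
      (simp, use ae in eventually_elim, simp)
qed

lemma p_energy_sob:
  assumes "sob \<Omega> p u G"
  shows "p_energy \<Omega> p u = 1 / p * (\<integral>x. norm (G x) powr p \<partial>(lebesgue_on \<Omega>))"
proof -
  have "(\<integral>x. norm (weak_gradient \<Omega> u x) powr p \<partial>(lebesgue_on \<Omega>)) = (\<integral>x. norm (G x) powr p
      \<partial>(lebesgue_on \<Omega>))"
  proof (rule integral_cong_AE)
    show "AE x in lebesgue_on \<Omega>. norm (weak_gradient \<Omega> u x) powr p = norm (G x) powr p"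
      using weak_gradient_sob(1)[OF assms] by eventually_elim simp
  qed (use weak_gradient_sob(2)[OF assms] sobD(2)[OF assms] in \<open>auto simp: Lp_def\<close>)
  then show ?thesis by (simp add: p_energy_def)
qed

lemma W1p_norm_sob:
  assumes "sob \<Omega> p u G"
  shows "ennreal (W1p_norm \<Omega> p u powr p) = Lp_mod (lebesgue_on \<Omega>) p u + Lp_mod (lebesgue_on \<Omega>) p G"
proof -
  define a where "a = (\<integral>x. \<bar>u x\<bar> powr p \<partial>(lebesgue_on \<Omega>))"
  define b where "b = (\<integral>x. norm (weak_gradient \<Omega> u x) powr p \<partial>(lebesgue_on \<Omega>))"
  have ab: "a \<ge> 0" "b \<ge> 0" by (auto simp: a_def b_def)
  have "W1p_norm \<Omega> p u powr p = a + b"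
    using ab domain_facts(5) by (simp add: W1p_norm_def a_def b_def powr_powr)
  then have "ennreal (W1p_norm \<Omega> p u powr p) = ennreal a + ennreal b" using ab by simp
  also have "ennreal a = Lp_mod (lebesgue_on \<Omega>) p u"
    using Lp_mod_eq_integral[OF sobD(1)[OF assms]] by (simp add: a_def)
  also have "ennreal b = Lp_mod (lebesgue_on \<Omega>) p (weak_gradient \<Omega> u)"
    using Lp_mod_eq_integral[OF weak_gradient_sob(2)[OF assms]] by (simp add: b_def)
  also have "\<dots> = Lp_mod (lebesgue_on \<Omega>) p G"
    by (rule Lp_mod_cong_AE) (use weak_gradient_sob(1)[OF assms] in eventually_elim, simp)
  finally show ?thesis .
qed

lemma W1p_norm_tendsto_iff:
  assumes "\<And>k::nat. sob \<Omega> p (u k) (G k)"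
  shows "(\<lambda>k. W1p_norm \<Omega> p (u k)) \<longlonglongrightarrow> 0 \<longleftrightarrow>
    (\<lambda>k. Lp_mod (lebesgue_on \<Omega>) p (u k)) \<longlonglongrightarrow> 0 \<and> (\<lambda>k. Lp_mod (lebesgue_on \<Omega>) p (G k)) \<longlonglongrightarrow> 0"
proof -
  have nn: "W1p_norm \<Omega> p (u k) \<ge> 0" for k by (simp add: W1p_norm_def)
  have "(\<lambda>k. W1p_norm \<Omega> p (u k)) \<longlonglongrightarrow> 0 \<longleftrightarrow> (\<lambda>k. W1p_norm \<Omega> p (u k) powr p) \<longlonglongrightarrow> 0"
  proof
    assume "(\<lambda>k. W1p_norm \<Omega> p (u k)) \<longlonglongrightarrow> 0"
    then show "(\<lambda>k. W1p_norm \<Omega> p (u k) powr p) \<longlonglongrightarrow> 0"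
      using nn domain_facts(5) by (intro tendsto_zero_powrI[OF _ tendsto_const]) auto
  next
    assume "(\<lambda>k. W1p_norm \<Omega> p (u k) powr p) \<longlonglongrightarrow> 0"
    from tendsto_zero_powrI[OF this tendsto_const, of "1 / p"]
    have "(\<lambda>k. (W1p_norm \<Omega> p (u k) powr p) powr (1 / p)) \<longlonglongrightarrow> 0"
      using domain_facts(5) by simp
    then show "(\<lambda>k. W1p_norm \<Omega> p (u k)) \<longlonglongrightarrow> 0"
      using nn domain_facts(5) by (simp add: powr_powr)
  qed
  also have "\<dots> \<longleftrightarrow> (\<lambda>k. ennreal (W1p_norm \<Omega> p (u k) powr p)) \<longlonglongrightarrow> ennreal 0"
    by (subst tendsto_ennreal_iff) auto
  also have "\<dots> \<longleftrightarrow> (\<lambda>k. Lp_mod (lebesgue_on \<Omega>) p (u k) + Lp_mod (lebesgue_on \<Omega>) p (G k)) \<longlonglongrightarrow> 0"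
    by (simp add: W1p_norm_sob[OF assms])
  also have "\<dots> \<longleftrightarrow> (\<lambda>k. Lp_mod (lebesgue_on \<Omega>) p (u k)) \<longlonglongrightarrow> 0 \<and> (\<lambda>k. Lp_mod (lebesgue_on \<Omega>) p (G k)) \<longlonglongrightarrow>
      0"
  proof
    assume lim: "(\<lambda>k. Lp_mod (lebesgue_on \<Omega>) p (u k) + Lp_mod (lebesgue_on \<Omega>) p (G k)) \<longlonglongrightarrow> 0"
    show "(\<lambda>k. Lp_mod (lebesgue_on \<Omega>) p (u k)) \<longlonglongrightarrow> 0 \<and> (\<lambda>k. Lp_mod (lebesgue_on \<Omega>) p (G k)) \<longlonglongrightarrow> 0"
      by (intro conjI; rule tendsto_sandwich[OF _ _ tendsto_const lim]) auto
  next
    assume "(\<lambda>k. Lp_mod (lebesgue_on \<Omega>) p (u k)) \<longlonglongrightarrow> 0 \<and> (\<lambda>k. Lp_mod (lebesgue_on \<Omega>) p (G k)) \<longlonglongrightarrow> 0"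
    then have "(\<lambda>k. Lp_mod (lebesgue_on \<Omega>) p (u k) + Lp_mod (lebesgue_on \<Omega>) p (G k)) \<longlonglongrightarrow> 0 + 0"
      by (intro tendsto_add) auto
    then show "(\<lambda>k. Lp_mod (lebesgue_on \<Omega>) p (u k) + Lp_mod (lebesgue_on \<Omega>) p (G k)) \<longlonglongrightarrow> 0" by simp
  qed
  finally show ?thesis .
qed

lemma W1p_0_iff: "u \<in> W1p_0 \<Omega> p \<longleftrightarrow> (\<exists>G. sob0 \<Omega> p u G)"
proof
  assume u: "u \<in> W1p_0 \<Omega> p"
  then obtain G where G: "sob \<Omega> p u G" unfolding W1p_0_def W1p_iff by blast
  obtain \<phi> :: "nat \<Rightarrow> 'a \<Rightarrow> real" where \<phi>: "\<And>k. test_function \<Omega> (\<phi> k)"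
    "(\<lambda>k. W1p_norm \<Omega> p (\<lambda>x. u x - \<phi> k x)) \<longlonglongrightarrow> 0"
    using u unfolding W1p_0_def by blast
  have "sob \<Omega> p (\<lambda>x. u x - \<phi> k x) (\<lambda>x. G x - grad (\<phi> k) x)" for k
    by (rule sob_diff[OF G sob_test[OF \<phi>(1)]])
  from W1p_norm_tendsto_iff[OF this] \<phi>(2) have
    "(\<lambda>k. Lp_mod (lebesgue_on \<Omega>) p (\<lambda>x. u x - \<phi> k x)) \<longlonglongrightarrow> 0"
    "(\<lambda>k. Lp_mod (lebesgue_on \<Omega>) p (\<lambda>x. G x - grad (\<phi> k) x)) \<longlonglongrightarrow> 0"
    by simp_all
  then show "\<exists>G. sob0 \<Omega> p u G"
    unfolding sob0_def by (intro exI[of _ G] conjI sobD(1,2)[OF G] exI[of _ \<phi>] allI \<phi>(1))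
next
  assume "\<exists>G. sob0 \<Omega> p u G"
  then obtain G where G0: "sob0 \<Omega> p u G" by blast
  have G: "sob \<Omega> p u G" by (rule sob0_imp_sob[OF G0])
  obtain \<phi> :: "nat \<Rightarrow> 'a \<Rightarrow> real" where \<phi>: "\<And>k. test_function \<Omega> (\<phi> k)"
    "(\<lambda>k. Lp_mod (lebesgue_on \<Omega>) p (\<lambda>x. u x - \<phi> k x)) \<longlonglongrightarrow> 0"
    "(\<lambda>k. Lp_mod (lebesgue_on \<Omega>) p (\<lambda>x. G x - grad (\<phi> k) x)) \<longlonglongrightarrow> 0"
    using G0 unfolding sob0_def by blast
  have "sob \<Omega> p (\<lambda>x. u x - \<phi> k x) (\<lambda>x. G x - grad (\<phi> k) x)" for k
    by (rule sob_diff[OF G sob_test[OF \<phi>(1)]])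
  from W1p_norm_tendsto_iff[OF this] \<phi>(2,3) have "(\<lambda>k. W1p_norm \<Omega> p (\<lambda>x. u x - \<phi> k x)) \<longlonglongrightarrow> 0"
    by simp
  then show "u \<in> W1p_0 \<Omega> p"
    unfolding W1p_0_def W1p_iff by (intro CollectI conjI exI[of _ G] G exI[of _ \<phi>] allI \<phi>(1))
qed

text \<open>A diagonal choice: \<open>\<psi> k\<close> is a test function within 1/(k+1) of
  \<open>u k\<close>, with gradient within 1/(k+1) of \<open>G k\<close>, so it converges together
  with them.\<close>

lemma sob0_closed:
  assumes s: "\<And>k::nat. sob0 \<Omega> p (u k) (G k)" and L: "Lp (lebesgue_on \<Omega>) p v" "Lp (lebesgue_on \<Omega>) p
      H"
    and lim: "(\<lambda>k. Lp_mod (lebesgue_on \<Omega>) p (\<lambda>x. u k x - v x)) \<longlonglongrightarrow> 0"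
      "(\<lambda>k. Lp_mod (lebesgue_on \<Omega>) p (\<lambda>x. G k x - H x)) \<longlonglongrightarrow> 0"
  shows "sob0 \<Omega> p v H"
proof -
  have "\<exists>\<psi>. test_function \<Omega> \<psi> \<and> Lp_mod (lebesgue_on \<Omega>) p (\<lambda>x. u k x - \<psi> x) \<le> ennreal (1 / real (Suc
      k))
      \<and> Lp_mod (lebesgue_on \<Omega>) p (\<lambda>x. G k x - grad \<psi> x) \<le> ennreal (1 / real (Suc k))" for k
  proof -
    obtain \<phi> :: "nat \<Rightarrow> 'a \<Rightarrow> real" where \<phi>: "\<And>j. test_function \<Omega> (\<phi> j)"
      "(\<lambda>j. Lp_mod (lebesgue_on \<Omega>) p (\<lambda>x. u k x - \<phi> j x)) \<longlonglongrightarrow> 0"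
      "(\<lambda>j. Lp_mod (lebesgue_on \<Omega>) p (\<lambda>x. G k x - grad (\<phi> j) x)) \<longlonglongrightarrow> 0"
      using s[of k] unfolding sob0_def by blast
    have pos: "0 < ennreal (1 / real (Suc k))" by simp
    have "\<forall>\<^sub>F j in sequentially. Lp_mod (lebesgue_on \<Omega>) p (\<lambda>x. u k x - \<phi> j x) < ennreal (1 / real
        (Suc k))
      \<and> Lp_mod (lebesgue_on \<Omega>) p (\<lambda>x. G k x - grad (\<phi> j) x) < ennreal (1 / real (Suc k))"
      using order_tendstoD(2)[OF \<phi>(2) pos] order_tendstoD(2)[OF \<phi>(3) pos] by (rule eventually_conj)
    then obtain j where "Lp_mod (lebesgue_on \<Omega>) p (\<lambda>x. u k x - \<phi> j x) < ennreal (1 / real (Suc k))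
      \<and> Lp_mod (lebesgue_on \<Omega>) p (\<lambda>x. G k x - grad (\<phi> j) x) < ennreal (1 / real (Suc k))"
      using eventually_happens'[OF sequentially_bot] by blast
    then show ?thesis using \<phi>(1) less_imp_le by blast
  qed
  then obtain \<psi> where \<psi>: "\<And>k. test_function \<Omega> (\<psi> k)"
    "\<And>k. Lp_mod (lebesgue_on \<Omega>) p (\<lambda>x. u k x - \<psi> k x) \<le> ennreal (1 / real (Suc k))"
    "\<And>k. Lp_mod (lebesgue_on \<Omega>) p (\<lambda>x. G k x - grad (\<psi> k) x) \<le> ennreal (1 / real (Suc k))"
    by metis
  have "(\<lambda>k. ennreal (1 / real (Suc k))) \<longlonglongrightarrow> ennreal 0"
    using LIMSEQ_inverse_real_of_nat by (intro tendsto_ennrealI) (simp add: inverse_eq_divide)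
  then have e0: "(\<lambda>k. ennreal (1 / real (Suc k))) \<longlonglongrightarrow> 0" by simp
  have 1: "(\<lambda>k. Lp_mod (lebesgue_on \<Omega>) p (\<lambda>x. u k x - \<psi> k x)) \<longlonglongrightarrow> 0"
    by (rule tendsto_sandwich[OF _ _ tendsto_const e0]) (use \<psi> in auto)
  have 2: "(\<lambda>k. Lp_mod (lebesgue_on \<Omega>) p (\<lambda>x. G k x - grad (\<psi> k) x)) \<longlonglongrightarrow> 0"
    by (rule tendsto_sandwich[OF _ _ tendsto_const e0]) (use \<psi> in auto)
  have su: "sob \<Omega> p (u k) (G k)" for k by (rule sob0_imp_sob[OF s])
  note m = Lp_measurable[OF sobD(1)[OF sob_test[OF \<psi>(1)]]] Lp_measurable[OF sobD(2)[OF sob_test[OF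
      \<psi>(1)]]]
    Lp_measurable[OF sobD(1)[OF su]] Lp_measurable[OF sobD(2)[OF su]]
  show ?thesis
    unfolding sob0_def
  proof (intro conjI L exI allI)
    show "test_function \<Omega> (\<psi> k)" for k by (rule \<psi>)
    have "(\<lambda>k. Lp_mod (lebesgue_on \<Omega>) p (\<lambda>x. (v x - u k x) + (u k x - \<psi> k x))) \<longlonglongrightarrow> 0"
      by (intro Lp_mod_add_tendsto 1 domain_facts borel_measurable_diff m Lp_measurable[OF L(1)])
        (subst Lp_mod_minus_commute, rule lim)
    then show "(\<lambda>k. Lp_mod (lebesgue_on \<Omega>) p (\<lambda>x. v x - \<psi> k x)) \<longlonglongrightarrow> 0" by simp
    have "(\<lambda>k. Lp_mod (lebesgue_on \<Omega>) p (\<lambda>x. (H x - G k x) + (G k x - grad (\<psi> k) x))) \<longlonglongrightarrow> 0"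
      by (intro Lp_mod_add_tendsto 2 domain_facts borel_measurable_diff m Lp_measurable[OF L(2)])
        (subst Lp_mod_minus_commute, rule lim)
    then show "(\<lambda>k. Lp_mod (lebesgue_on \<Omega>) p (\<lambda>x. H x - grad (\<psi> k) x)) \<longlonglongrightarrow> 0" by simp
  qed
qed

text \<open>Integrating by parts against a coordinate replaces the Poincare inequality: a nonnegative
  element of \<open>W\<^sub>0\<^sup>1\<^sup>,\<^sup>p\<close> with vanishing gradient vanishes.\<close>

lemma sob0_integral_eq_0:
  assumes s: "sob0 \<Omega> p u G" and G0: "AE x in lebesgue_on \<Omega>. G x = 0"
  shows "(\<integral>x. u x \<partial>(lebesgue_on \<Omega>)) = 0"
proof -
  obtain \<phi> :: "nat \<Rightarrow> 'a \<Rightarrow> real" where \<phi>: "\<And>k. test_function \<Omega> (\<phi> k)"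
    "(\<lambda>k. Lp_mod (lebesgue_on \<Omega>) p (\<lambda>x. u x - \<phi> k x)) \<longlonglongrightarrow> 0"
    "(\<lambda>k. Lp_mod (lebesgue_on \<Omega>) p (\<lambda>x. G x - grad (\<phi> k) x)) \<longlonglongrightarrow> 0"
    and L: "Lp (lebesgue_on \<Omega>) p u" "Lp (lebesgue_on \<Omega>) p G"
    using s unfolding sob0_def by blast
  obtain b :: 'a where b: "b \<in> Basis" using nonempty_Basis by blast
  obtain R where R: "\<And>x. x \<in> \<Omega> \<Longrightarrow> norm x \<le> R" using \<Omega>(2) by (auto simp: bounded_iff)
  have lim1: "(\<lambda>k. Lp_mod (lebesgue_on \<Omega>) p (\<lambda>x. \<phi> k x - u x)) \<longlonglongrightarrow> 0"
    "(\<lambda>k. Lp_mod (lebesgue_on \<Omega>) p (\<lambda>x. grad (\<phi> k) x - G x)) \<longlonglongrightarrow> 0"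
    by (subst Lp_mod_minus_commute, rule \<phi>)+
  have 1: "(\<lambda>k. \<integral>x. \<phi> k x \<bullet> 1 \<partial>(lebesgue_on \<Omega>)) \<longlonglongrightarrow> (\<integral>x. u x \<bullet> 1 \<partial>(lebesgue_on \<Omega>))"
    by (rule Lp_mod_tendsto_integral(1)[OF domain_facts(2,3) sobD(1)[OF sob_test[OF \<phi>(1)]] L(1)
        lim1(1), where B=1]) auto
  have 2: "(\<lambda>k. \<integral>x. grad (\<phi> k) x \<bullet> ((x \<bullet> b) *\<^sub>R b) \<partial>(lebesgue_on \<Omega>)) \<longlonglongrightarrow> (\<integral>x. G x \<bullet> ((x \<bullet> b) *\<^sub>R b)
      \<partial>(lebesgue_on \<Omega>))"
  proof (rule Lp_mod_tendsto_integral(1)[OF domain_facts(2,3) sobD(2)[OF sob_test[OF \<phi>(1)]] L(2)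
      lim1(2), where B=R])
    show "norm ((x \<bullet> b) *\<^sub>R b) \<le> R" if "x \<in> space (lebesgue_on \<Omega>)" for x
      using R[of x] that Basis_le_norm[OF b, of x] b by (simp add: domain_facts)
  qed (auto intro!: continuous_measurable_on continuous_intros)
  have "(\<integral>x. G x \<bullet> ((x \<bullet> b) *\<^sub>R b) \<partial>(lebesgue_on \<Omega>)) = 0"
    by (rule integral_eq_zero_AE) (use G0 in eventually_elim, simp)
  moreover have "(\<integral>x. grad (\<phi> k) x \<bullet> ((x \<bullet> b) *\<^sub>R b) \<partial>(lebesgue_on \<Omega>)) = - (\<integral>x. \<phi> k x \<bullet> 1
      \<partial>(lebesgue_on \<Omega>))" for k
  proof -
    have "is_weak_gradient \<Omega> (\<lambda>x. x \<bullet> b) (\<lambda>x. b)"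
      by (rule is_weak_gradient_C1[OF \<Omega>(1)]) (auto intro!: derivative_eq_intros simp: inner_commute)
    then have "(\<integral>x. (x \<bullet> b) * partial_deriv b (\<phi> k) x \<partial>(lebesgue_on \<Omega>)) = - (\<integral>x. (b \<bullet> b) * \<phi> k x
        \<partial>(lebesgue_on \<Omega>))"
      using \<phi>(1) b unfolding is_weak_gradient_def by blast
    then show ?thesis using b by (simp add: grad_inner_Basis)
  qed
  ultimately have "(\<lambda>k. - (\<integral>x. \<phi> k x \<bullet> 1 \<partial>(lebesgue_on \<Omega>))) \<longlonglongrightarrow> 0" using 2 by simp
  from tendsto_minus[OF this] have "(\<lambda>k. \<integral>x. \<phi> k x \<bullet> 1 \<partial>(lebesgue_on \<Omega>)) \<longlonglongrightarrow> 0" by simp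
  from LIMSEQ_unique[OF 1 this] show ?thesis by simp
qed

end

section \<open>Chain rule and compactly supported Sobolev functions\<close>

text \<open>The difference splits into eta'(u_k) (G_k - H) and (eta'(u_k) - eta'(v)) H. The first
  part is controlled by the boundedness of \<open>eta'\<close>. The second converges by domination
  with H, which calls for almost everywhere convergence of u_k and hence for a subsequence.\<close>

lemma eta'_chain_subseq:
  fixes G :: "nat \<Rightarrow> 'a \<Rightarrow> 'b::euclidean_space"
  assumes p: "p > 0" and L: "\<And>k. Lp M p (u k)" "\<And>k. Lp M p (G k)" "Lp M p v" "Lp M p H"
    and lim: "(\<lambda>k. Lp_mod M p (\<lambda>x. u k x - v x)) \<longlonglongrightarrow> 0" "(\<lambda>k. Lp_mod M p (\<lambda>x. G k x - H x)) \<longlonglongrightarrow> 0"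
  shows "\<exists>r. strict_mono r \<and> (\<lambda>k. Lp_mod M p (\<lambda>x. eta' (u (r k) x) *\<^sub>R G (r k) x - eta' (v x) *\<^sub>R H
      x)) \<longlonglongrightarrow> 0"
proof -
  have p0: "p \<ge> 0" using p by simp
  obtain r :: "nat \<Rightarrow> nat" where r: "strict_mono r" "AE x in M. (\<lambda>k. u (r k) x - v x) \<longlonglongrightarrow> 0"
    using Lp_mod_AE_subseq[OF p Lp_diff[OF p0 L(1,3)] lim(1)] by blast
  have [measurable]: "eta' \<in> borel_measurable borel"
    using continuous_eta' by (rule borel_measurable_continuous_onI)
  have [measurable]: "u k \<in> borel_measurable M" "G k \<in> borel_measurable M" "v \<in> borel_measurable M"
      "H \<in> borel_measurable M" for k
    using L by (auto intro: Lp_measurable)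
  have 1: "(\<lambda>k. Lp_mod M p (\<lambda>x. eta' (u (r k) x) *\<^sub>R (G (r k) x - H x))) \<longlonglongrightarrow> 0"
  proof (rule Lp_mod_dominated_tendsto[OF p0, where c = 1])
    show "(\<lambda>k. Lp_mod M p (\<lambda>x. G (r k) x - H x)) \<longlonglongrightarrow> 0"
      using LIMSEQ_subseq_LIMSEQ[OF lim(2) r(1)] by (simp add: comp_def)
    show "AE x in M. norm (eta' (u (r k) x) *\<^sub>R (G (r k) x - H x)) \<le> 1 * norm (G (r k) x - H x)" for
        k
    proof (rule AE_I2)
      fix x
      have "\<bar>eta' (u (r k) x)\<bar> \<le> 1" using eta'_range[of "u (r k) x"] by simp
      then show "norm (eta' (u (r k) x) *\<^sub>R (G (r k) x - H x)) \<le> 1 * norm (G (r k) x - H x)"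
        unfolding norm_scaleR by (intro mult_right_mono) auto
    qed
  qed auto
  have 2: "(\<lambda>k. Lp_mod M p (\<lambda>x. (eta' (u (r k) x) - eta' (v x)) *\<^sub>R H x)) \<longlonglongrightarrow> 0"
    unfolding Lp_mod_def
  proof (rule Lp_dominated_convergence[OF p, where w = "\<lambda>x. norm (H x) powr p"])
    show "integrable M (\<lambda>x. norm (H x) powr p)" using L(4) by (simp add: Lp_def)
    show "AE x in M. norm ((eta' (u (r k) x) - eta' (v x)) *\<^sub>R H x) powr p \<le> norm (H x) powr p" for
        k
    proof (intro AE_I2 powr_mono2)
      fix x
      have "\<bar>eta' (u (r k) x) - eta' (v x)\<bar> \<le> 1" using eta'_range[of "u (r k) x"] eta'_range[of "v
          x"] by linarith
      then have "\<bar>eta' (u (r k) x) - eta' (v x)\<bar> * norm (H x) \<le> 1 * norm (H x)" by (intro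
          mult_right_mono) auto
      then show "norm ((eta' (u (r k) x) - eta' (v x)) *\<^sub>R H x) \<le> norm (H x)" by simp
    qed (use p in auto)
    show "AE x in M. (\<lambda>k. (eta' (u (r k) x) - eta' (v x)) *\<^sub>R H x) \<longlonglongrightarrow> 0"
      using r(2)
    proof eventually_elim
      case (elim x)
      have "(\<lambda>k. u (r k) x) \<longlonglongrightarrow> v x" using elim by (simp add: LIM_zero_iff)
      then have "(\<lambda>k. eta' (u (r k) x)) \<longlonglongrightarrow> eta' (v x)"
        using continuous_on_tendsto_compose[OF continuous_eta'] by simp
      then have "(\<lambda>k. (eta' (u (r k) x) - eta' (v x)) *\<^sub>R H x) \<longlonglongrightarrow> (eta' (v x) - eta' (v x)) *\<^sub>R H x"
        by (intro tendsto_intros)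
      then show ?case by simp
    qed
  qed auto
  have "(\<lambda>k. Lp_mod M p (\<lambda>x. eta' (u (r k) x) *\<^sub>R (G (r k) x - H x) + (eta' (u (r k) x) - eta' (v
      x)) *\<^sub>R H x)) \<longlonglongrightarrow> 0"
    by (rule Lp_mod_add_tendsto[OF p0 _ _ 1 2]) auto
  moreover have "eta' (u (r k) x) *\<^sub>R (G (r k) x - H x) + (eta' (u (r k) x) - eta' (v x)) *\<^sub>R H x
      = eta' (u (r k) x) *\<^sub>R G (r k) x - eta' (v x) *\<^sub>R H x" for k x
    by (simp add: algebra_simps)
  ultimately show ?thesis using r(1) by auto
qed

lemma Lp_eta:
  assumes "p \<ge> 0" "Lp M p v"
  shows "Lp M p (\<lambda>x. eta (v x))"
proof -
  have [measurable]: "eta \<in> borel_measurable borel"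
    using continuous_eta by (rule borel_measurable_continuous_onI)
  have [measurable]: "v \<in> borel_measurable M" using assms by (auto intro: Lp_measurable)
  show ?thesis by (rule Lp_bounded[OF assms, where c=1]) (auto simp: eta_abs_le)
qed

lemma Lp_eta':
  fixes H :: "'a \<Rightarrow> 'b::euclidean_space"
  assumes "p \<ge> 0" "v \<in> borel_measurable M" "Lp M p H"
  shows "Lp M p (\<lambda>x. eta' (v x) *\<^sub>R H x)"
proof (rule Lp_bounded[OF assms(1,3), where c=1])
  have [measurable]: "eta' \<in> borel_measurable borel"
    using continuous_eta' by (rule borel_measurable_continuous_onI)
  have [measurable]: "v \<in> borel_measurable M" "H \<in> borel_measurable M"
    using assms by (auto intro: Lp_measurable)
  show "(\<lambda>x. eta' (v x) *\<^sub>R H x) \<in> borel_measurable M" by measurable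
  show "AE x in M. norm (eta' (v x) *\<^sub>R H x) \<le> 1 * norm (H x)"
  proof (rule AE_I2)
    fix x
    have "\<bar>eta' (v x)\<bar> \<le> 1" using eta'_range[of "v x"] by simp
    then show "norm (eta' (v x) *\<^sub>R H x) \<le> 1 * norm (H x)"
      unfolding norm_scaleR by (intro mult_right_mono) auto
  qed
qed simp

lemma eta_tendsto:
  assumes p: "p \<ge> 0" and m: "\<And>k. u k \<in> borel_measurable M" "v \<in> borel_measurable M"
    and lim: "(\<lambda>k. Lp_mod M p (\<lambda>x. u k x - v x)) \<longlonglongrightarrow> 0"
  shows "(\<lambda>k. Lp_mod M p (\<lambda>x. eta (u k x) - eta (v x))) \<longlonglongrightarrow> 0"
  by (rule Lp_mod_dominated_tendsto[OF p _ _ _ lim, where c=1])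
    (use m eta_lipschitz in \<open>auto intro: borel_measurable_diff\<close>)

context
  fixes \<Omega> :: "'a::euclidean_space set" and p :: real
  assumes \<Omega>: "open \<Omega>" "bounded \<Omega>" and p: "p > 1"
begin

lemmas dom = domain_facts[OF \<Omega> p]

text \<open>For test functions the chain rule is classical. It passes to the limit along the
  subsequence of \<open>eta'_chain_subseq\<close>, the functions themselves converging because
  \<open>eta\<close> is 1-Lipschitz.\<close>

lemma sob_eta_of_sob0:
  assumes "sob0 \<Omega> p w H"
  shows "sob \<Omega> p (\<lambda>x. eta (w x)) (\<lambda>x. eta' (w x) *\<^sub>R H x)"
proof -
  obtain \<phi> :: "nat \<Rightarrow> 'a \<Rightarrow> real" where \<phi>: "\<And>k. test_function \<Omega> (\<phi> k)"
    "(\<lambda>k. Lp_mod (lebesgue_on \<Omega>) p (\<lambda>x. w x - \<phi> k x)) \<longlonglongrightarrow> 0"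
    "(\<lambda>k. Lp_mod (lebesgue_on \<Omega>) p (\<lambda>x. H x - grad (\<phi> k) x)) \<longlonglongrightarrow> 0"
    and L: "Lp (lebesgue_on \<Omega>) p w" "Lp (lebesgue_on \<Omega>) p H"
    using assms unfolding sob0_def by blast
  have lim: "(\<lambda>k. Lp_mod (lebesgue_on \<Omega>) p (\<lambda>x. \<phi> k x - w x)) \<longlonglongrightarrow> 0"
    "(\<lambda>k. Lp_mod (lebesgue_on \<Omega>) p (\<lambda>x. grad (\<phi> k) x - H x)) \<longlonglongrightarrow> 0"
    by (subst Lp_mod_minus_commute, rule \<phi>)+
  note st = sob_test[OF \<Omega> p \<phi>(1)]
  obtain r where r: "strict_mono r"
    "(\<lambda>k. Lp_mod (lebesgue_on \<Omega>) p (\<lambda>x. eta' (\<phi> (r k) x) *\<^sub>R grad (\<phi> (r k)) x - eta' (w x) *\<^sub>R H x))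
        \<longlonglongrightarrow> 0"
    using eta'_chain_subseq[OF dom(5) sobD(1)[OF st] sobD(2)[OF st] L lim] by blast
  have s: "sob \<Omega> p (\<lambda>x. eta (\<phi> k x)) (\<lambda>x. eta' (\<phi> k x) *\<^sub>R grad (\<phi> k) x)" for k
    unfolding sob_def
  proof (intro conjI Lp_eta[OF dom(4)] Lp_eta'[OF dom(4)] sobD(1)[OF st] sobD(2)[OF st]
      Lp_measurable[OF sobD(1)[OF st]] is_weak_gradient_C1 \<Omega>)
    show "continuous_on \<Omega> (\<lambda>x. eta' (\<phi> k x) *\<^sub>R grad (\<phi> k) x)"
      by (intro continuous_intros continuous_grad_test[OF \<phi>(1)] continuous_on_compose2[OF
          continuous_eta' test_function_continuous[OF \<phi>(1)]]) auto
    fix x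
    have "(\<phi> k has_derivative (\<lambda>h. grad (\<phi> k) x \<bullet> h)) (at x)"
      by (intro has_derivative_grad_inner test_function_differentiable[OF \<phi>(1)])
    then have "((\<lambda>x. eta (\<phi> k x)) has_derivative (\<lambda>h. eta' (\<phi> k x) * (grad (\<phi> k) x \<bullet> h))) (at x)"
      using has_derivative_compose eta_deriv unfolding has_field_derivative_def by blast
    then show "((\<lambda>x. eta (\<phi> k x)) has_derivative (\<lambda>h. (eta' (\<phi> k x) *\<^sub>R grad (\<phi> k) x) \<bullet> h)) (at x)"
      by simp
  qed
  show ?thesis
  proof (rule sob_limit[OF \<Omega> p s[of "r _"] Lp_eta[OF dom(4) L(1)] Lp_eta'[OF dom(4) Lp_measurable[OF
      L(1)] L(2)] _ r(2)])
    have "(\<lambda>k. Lp_mod (lebesgue_on \<Omega>) p (\<lambda>x. \<phi> (r k) x - w x)) \<longlonglongrightarrow> 0"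
      using LIMSEQ_subseq_LIMSEQ[OF lim(1) r(1)] by (simp add: comp_def)
    then show "(\<lambda>k. Lp_mod (lebesgue_on \<Omega>) p (\<lambda>x. eta (\<phi> (r k) x) - eta (w x))) \<longlonglongrightarrow> 0"
      by (rule eta_tendsto[OF dom(4) Lp_measurable[OF sobD(1)[OF st]] Lp_measurable[OF L(1)]])
  qed
qed

text \<open>On the open set \<open>\<Omega> - K\<close> the function agrees almost everywhere with
  zero, and weak gradients are unique there.\<close>

lemma sob_gradient_eq_0_outside:
  assumes s: "sob \<Omega> p u G" and K: "compact K" and z: "AE x in lebesgue_on \<Omega>. x \<notin> K \<longrightarrow> u x = 0"
  shows "AE x in lebesgue_on \<Omega>. x \<notin> K \<longrightarrow> G x = 0"
proof -
  have O: "open (\<Omega> - K)" using \<Omega>(1) compact_imp_closed[OF K] by (rule open_Diff)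
  have sl: "\<Omega> - K \<in> sets lebesgue" using O by auto
  have "is_weak_gradient (\<Omega> - K) u G"
    using weak_gradient_mono[OF sobD(3)[OF s] \<Omega>(1) O] by simp
  moreover have "is_weak_gradient (\<Omega> - K) (\<lambda>x. 0) (\<lambda>x. 0)"
    by (rule is_weak_gradient_C1[OF O]) auto
  moreover have "AE x in lebesgue_on (\<Omega> - K). u x = 0"
    using z by (auto simp: AE_lebesgue_on_iff dom sl elim: eventually_mono)
  ultimately have "AE x in lebesgue_on (\<Omega> - K). G x = 0"
    using weak_gradient_unique[OF O] by blast
  then show ?thesis by (auto simp: AE_lebesgue_on_iff dom sl elim: eventually_mono)
qed

text \<open>Mollifications of the extension by zero are test functions in \<open>\<Omega>\<close> as
  soon as the radius is small compared with the distance from \<open>K\<close> to the complement.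
  Their partial derivatives are the mollified components of \<open>G\<close>, so functions and
  gradients both converge in the p-th mean.\<close>

lemma sob0_compact_support:
  assumes s: "sob \<Omega> p u G" and K: "compact K" "K \<subseteq> \<Omega>" and z: "AE x in lebesgue_on \<Omega>. x \<notin> K \<longrightarrow> u x =
      0"
  shows "sob0 \<Omega> p u G"
proof -
  define M where "M = lebesgue_on \<Omega>"
  define u0 where "u0 = (\<lambda>x. indicator \<Omega> x * u x)"
  define G0 where "G0 = (\<lambda>b x. indicator \<Omega> x * (G x \<bullet> b))"
  have zG: "AE x in lebesgue_on \<Omega>. x \<notin> K \<longrightarrow> G x = 0" by (rule sob_gradient_eq_0_outside[OF s K(1) z])
  have intu: "integrable lebesgue u0"
    using Lp_integrable[OF dom(2,3) sobD(1)[OF s]] by (simp add: u0_def integral_lebesgue_on dom)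
  have Gb: "Lp (lebesgue_on \<Omega>) p (\<lambda>x. G x \<bullet> b)" if b: "b \<in> Basis" for b
    by (rule Lp_bounded[OF dom(4) sobD(2)[OF s], where c=1])
      (use Lp_measurable[OF sobD(2)[OF s]] Basis_le_norm[OF b] in auto)
  have intG: "integrable lebesgue (G0 b)" if "b \<in> Basis" for b
    using Lp_integrable[OF dom(2,3) Gb[OF that]] by (simp add: G0_def integral_lebesgue_on dom)
  have powr_ind: "\<bar>indicator \<Omega> x * f\<bar> powr p = indicator \<Omega> x * \<bar>f\<bar> powr p" for x f
    using p by (auto simp: indicator_def)
  have pu: "integrable lebesgue (\<lambda>x. \<bar>u0 x\<bar> powr p)"
    using sobD(1)[OF s] by (simp add: u0_def Lp_def integral_lebesgue_on dom powr_ind)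
  have pG: "integrable lebesgue (\<lambda>x. \<bar>G0 b x\<bar> powr p)" if "b \<in> Basis" for b
    using Gb[OF that] by (simp add: G0_def Lp_def integral_lebesgue_on dom powr_ind)
  obtain d where d: "d > 0" "\<And>x y. y \<in> K \<Longrightarrow> norm (x - y) \<le> d \<Longrightarrow> x \<in> \<Omega>"
    using compact_neighbourhood_subset_open[OF K(1) \<Omega>(1) K(2)] by blast
  define \<epsilon> where "\<epsilon> = (\<lambda>k. d * (1 / real (Suc k)))"
  have \<epsilon>: "\<epsilon> \<longlonglongrightarrow> 0" "\<epsilon> k > 0" "\<epsilon> k \<le> d" for k
  proof -
    have "(\<lambda>k. d * (1 / real (Suc k))) \<longlonglongrightarrow> d * 0"
      by (intro tendsto_mult_left) (use LIMSEQ_inverse_real_of_nat in \<open>simp add: inverse_eq_divide\<close>)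
    then show "\<epsilon> \<longlonglongrightarrow> 0" by (simp add: \<epsilon>_def)
    show "\<epsilon> k > 0" using d by (simp add: \<epsilon>_def)
    show "\<epsilon> k \<le> d" using d(1) unfolding \<epsilon>_def by (intro mult_left_le) auto
  qed
  define \<phi> where "\<phi> = (\<lambda>k. conv u0 (mollifier (\<epsilon> k)))"
  have u0K: "AE x in lebesgue. x \<notin> K \<longrightarrow> u0 x = 0"
    using z by (auto simp: AE_lebesgue_on_iff dom u0_def indicator_def elim: eventually_mono)
  have test: "test_function \<Omega> (\<phi> k)" for k
    unfolding \<phi>_def
    by (rule test_function_conv[OF intu K(1) u0K \<epsilon>(2)]) (use d(2) \<epsilon>(3)[of k] order_trans in blast)
  obtain \<zeta> V where \<zeta>: "test_function \<Omega> \<zeta>" "open V" "K \<subseteq> V" "\<And>x. x \<in> V \<Longrightarrow> \<zeta> x = 1"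
    using test_function_cutoff[OF K(1) \<Omega>(1) K(2)] by blast
  \<comment> \<open>The kernel centred at \<open>x\<close> may reach beyond \<open>\<Omega>\<close>;
    multiplied by the cutoff \<open>\<zeta>\<close> it becomes admissible in the weak formulation.
    Since \<open>\<zeta>\<close> is one near \<open>K\<close>, and \<open>u\<close> and
    \<open>G\<close> vanish almost everywhere off \<open>K\<close>, this factor changes neither
    integral.\<close>
  have pd: "partial_deriv b (\<phi> k) x = conv (G0 b) (mollifier (\<epsilon> k)) x" if b: "b \<in> Basis" for b k x
  proof -
    define \<rho> where "\<rho> = (mollifier (\<epsilon> k) :: 'a \<Rightarrow> real)"
    have \<rho>: "test_function UNIV \<rho>" unfolding \<rho>_def by (rule test_function_mollifier[OF \<epsilon>(2)]) simp
    have r: "test_function UNIV (\<lambda>y. \<rho> (x - y))" by (rule test_function_reflect[OF \<rho>])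
    have t: "test_function \<Omega> (\<lambda>y. \<rho> (x - y) * \<zeta> y)"
      by (rule test_function_mult[OF \<zeta>(1) test_function_smooth[OF r]])
    have pdr: "partial_deriv b (\<lambda>y. \<rho> (x - y)) y = - partial_deriv b \<rho> (x - y)" for y
      using partial_deriv_affine[of \<rho> x "-1" y b] test_function_differentiable[OF \<rho>] by simp
    have pdt: "partial_deriv b (\<lambda>y. \<rho> (x - y) * \<zeta> y) y
        = \<rho> (x - y) * partial_deriv b \<zeta> y - partial_deriv b \<rho> (x - y) * \<zeta> y" for y
      using partial_deriv_mult[OF test_function_differentiable[OF r, of y]
          test_function_differentiable[OF \<zeta>(1), of y], of b]
      by (simp add: pdr)
    have V: "partial_deriv b \<zeta> y = 0" "\<zeta> y = 1" if "y \<in> K" for y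
      using grad_eq_0_on_const[OF \<zeta>(2) _ \<zeta>(4), of y] \<zeta>(3,4) that grad_inner_Basis[OF b, of \<zeta> y] by
          auto
    have "conv u0 (partial_deriv b \<rho>) x = - (\<integral>y. u y * partial_deriv b (\<lambda>y. \<rho> (x - y) * \<zeta> y) y
        \<partial>(lebesgue_on \<Omega>))"
    proof -
      have i: "integrable lebesgue (\<lambda>y. u0 y * partial_deriv b (\<lambda>y. \<rho> (x - y) * \<zeta> y) y)"
        by (rule integrable_mult_test_function[OF intu test_function_partial_deriv[OF t b]])
      have "conv u0 (partial_deriv b \<rho>) x = (\<integral>y. - (u0 y * partial_deriv b (\<lambda>y. \<rho> (x - y) * \<zeta> y) y)
          \<partial>lebesgue)"
        unfolding conv_def
      proof (rule integral_cong_AE)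
        show "AE y in lebesgue. u0 y * partial_deriv b \<rho> (x - y) = - (u0 y * partial_deriv b (\<lambda>y. \<rho>
            (x - y) * \<zeta> y) y)"
          using u0K by eventually_elim (use V in \<open>auto simp: pdt\<close>)
      qed (use i conv_integrable[OF intu test_function_partial_deriv[OF \<rho> b]] in auto)
      then show ?thesis by (simp add: integral_lebesgue_on dom u0_def mult.assoc)
    qed
    also have "\<dots> = (\<integral>y. (G y \<bullet> b) * (\<rho> (x - y) * \<zeta> y) \<partial>(lebesgue_on \<Omega>))"
      using sobD(3)[OF s] t b by (simp add: is_weak_gradient_def)
    also have "\<dots> = conv (G0 b) \<rho> x"
    proof -
      have "(\<integral>y. (G y \<bullet> b) * (\<rho> (x - y) * \<zeta> y) \<partial>(lebesgue_on \<Omega>)) = (\<integral>y. G0 b y * (\<rho> (x - y) * \<zeta> y)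
          \<partial>lebesgue)"
        by (simp add: integral_lebesgue_on dom G0_def mult.assoc)
      also have "\<dots> = (\<integral>y. G0 b y * \<rho> (x - y) \<partial>lebesgue)"
      proof (rule integral_cong_AE)
        have "AE y in lebesgue. y \<in> \<Omega> \<longrightarrow> y \<notin> K \<longrightarrow> G y = 0" using zG by (simp add: AE_lebesgue_on_iff
            dom)
        then show "AE y in lebesgue. G0 b y * (\<rho> (x - y) * \<zeta> y) = G0 b y * \<rho> (x - y)"
          by eventually_elim (use V in \<open>auto simp: G0_def indicator_def\<close>)
      qed (use integrable_mult_test_function[OF intG[OF b] t] conv_integrable[OF intG[OF b] \<rho>] in
          auto)
      finally show ?thesis by (simp add: conv_def)
    qed
    finally show ?thesis
      unfolding \<phi>_def \<rho>_def[symmetric] partial_deriv_conv[OF intu \<rho> b] .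
  qed
  have restrict: "Lp_mod (lebesgue_on \<Omega>) p f \<le> (\<integral>\<^sup>+x. ennreal (\<bar>h x\<bar> powr p) \<partial>lebesgue)"
    if "\<And>x. x \<in> \<Omega> \<Longrightarrow> \<bar>f x\<bar> = \<bar>h x\<bar>" for f h :: "'a \<Rightarrow> real"
    unfolding Lp_mod_def
    by (subst nn_integral_restrict_space) (use that dom in \<open>auto intro!: nn_integral_mono simp:
        indicator_def\<close>)
  show ?thesis
    unfolding sob0_def
  proof (intro conjI sobD(1,2)[OF s] exI[of _ \<phi>] allI test)
    have "(\<lambda>k. \<integral>\<^sup>+x. ennreal (\<bar>conv u0 (mollifier (\<epsilon> k)) x - u0 x\<bar> powr p) \<partial>lebesgue) \<longlonglongrightarrow> 0"
      by (rule conv_mollifier_Lp_tendsto[OF dom(3) intu pu \<epsilon>(1,2)])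
    then show "(\<lambda>k. Lp_mod (lebesgue_on \<Omega>) p (\<lambda>x. u x - \<phi> k x)) \<longlonglongrightarrow> 0"
      by (rule tendsto_sandwich[OF _ _ tendsto_const, rotated 2])
        (auto intro!: always_eventually restrict simp: \<phi>_def u0_def abs_minus_commute)
    have comp: "(\<lambda>k. Lp_mod (lebesgue_on \<Omega>) p (\<lambda>x. (G x - grad (\<phi> k) x) \<bullet> b)) \<longlonglongrightarrow> 0" if b: "b \<in> Basis"
        for b
    proof -
      have "(\<lambda>k. \<integral>\<^sup>+x. ennreal (\<bar>conv (G0 b) (mollifier (\<epsilon> k)) x - G0 b x\<bar> powr p) \<partial>lebesgue) \<longlonglongrightarrow> 0"
        by (rule conv_mollifier_Lp_tendsto[OF dom(3) intG[OF b] pG[OF b] \<epsilon>(1,2)])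
      then show ?thesis
        by (rule tendsto_sandwich[OF _ _ tendsto_const, rotated 2])
          (auto intro!: always_eventually restrict simp: inner_diff_left grad_inner_Basis b pd
              G0_def abs_minus_commute)
    qed
    have mG: "(\<lambda>x. G x - grad (\<phi> k) x) \<in> borel_measurable (lebesgue_on \<Omega>)" for k
      by (intro borel_measurable_diff Lp_measurable[OF sobD(2)[OF s]] Lp_measurable[OF sobD(2)[OF
          sob_test[OF \<Omega> p test]]])
    have "(\<lambda>k. Lp_mod (lebesgue_on \<Omega>) p (\<lambda>x. \<Sum>b\<in>B. ((G x - grad (\<phi> k) x) \<bullet> b) *\<^sub>R b)) \<longlonglongrightarrow> 0"
      if "finite B" "B \<subseteq> Basis" for B
      using that
    proof (induction B)
      case empty
      then show ?case using dom by (simp add: Lp_mod_def)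
    next
      case (insert c B)
      have "(\<lambda>k. Lp_mod (lebesgue_on \<Omega>) p (\<lambda>x. ((G x - grad (\<phi> k) x) \<bullet> c) *\<^sub>R c)) \<longlonglongrightarrow> 0"
        by (rule Lp_mod_dominated_tendsto[OF dom(4) _ _ _ comp[of c], where c=1]) (use insert mG in
            auto)
      then have "(\<lambda>k. Lp_mod (lebesgue_on \<Omega>) p (\<lambda>x. ((G x - grad (\<phi> k) x) \<bullet> c) *\<^sub>R c
          + (\<Sum>b\<in>B. ((G x - grad (\<phi> k) x) \<bullet> b) *\<^sub>R b))) \<longlonglongrightarrow> 0"
        using insert mG by (intro Lp_mod_add_tendsto dom borel_measurable_sum
            borel_measurable_scaleR borel_measurable_inner) auto
      then show ?case using insert by simp
    qed
    from this[OF finite_Basis order_refl]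
    show "(\<lambda>k. Lp_mod (lebesgue_on \<Omega>) p (\<lambda>x. G x - grad (\<phi> k) x)) \<longlonglongrightarrow> 0"
      by (simp add: euclidean_representation)
  qed
qed

text \<open>The identity for a fixed test function \<open>\<phi>\<close> involves \<open>u\<close>
  only near the support of \<open>\<phi>\<close>. There \<open>u\<close> may be multiplied by a
  cutoff equal to one, and the product has compact support, so that the chain rule on the
  zero-boundary class applies to it.\<close>

lemma sob_eta:
  assumes s: "sob \<Omega> p u G"
  shows "sob \<Omega> p (\<lambda>x. eta (u x)) (\<lambda>x. eta' (u x) *\<^sub>R G x)"
proof -
  note L = Lp_eta[OF dom(4) sobD(1)[OF s]] Lp_eta'[OF dom(4) Lp_measurable[OF sobD(1)[OF s]]
      sobD(2)[OF s]]
  have "is_weak_gradient \<Omega> (\<lambda>x. eta (u x)) (\<lambda>x. eta' (u x) *\<^sub>R G x)"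
    unfolding is_weak_gradient_def
  proof (intro conjI allI impI ballI Lp_locally_integrable[OF \<Omega> p] L)
    fix \<phi> and b :: 'a assume \<phi>: "test_function \<Omega> \<phi>" and b: "b \<in> Basis"
    define K where "K = closure {x. \<phi> x \<noteq> 0}"
    have K: "compact K" "K \<subseteq> \<Omega>" using \<phi> by (auto simp: K_def test_function_def)
    obtain \<zeta> V where \<zeta>: "test_function \<Omega> \<zeta>" "open V" "K \<subseteq> V" "\<And>x. x \<in> V \<Longrightarrow> \<zeta> x = 1"
      using test_function_cutoff[OF K(1) \<Omega>(1) K(2)] by blast
    define w where "w = (\<lambda>x. \<zeta> x * u x)"
    define H where "H = (\<lambda>x. \<zeta> x *\<^sub>R G x + u x *\<^sub>R grad \<zeta> x)"
    obtain B where B: "B > 0" "\<And>x. \<bar>\<zeta> x\<bar> \<le> B" using test_function_bounded[OF \<zeta>(1)] by metis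
    obtain C where C: "C > 0" "\<And>x. norm (grad \<zeta> x) \<le> C" using grad_test_bounded[OF \<zeta>(1)] by metis
    note mz = Lp_measurable[OF sobD(1)[OF sob_test[OF \<Omega> p \<zeta>(1)]]] Lp_measurable[OF sobD(2)[OF
        sob_test[OF \<Omega> p \<zeta>(1)]]]
      Lp_measurable[OF sobD(1)[OF s]] Lp_measurable[OF sobD(2)[OF s]]
    have Lw: "Lp (lebesgue_on \<Omega>) p w"
      unfolding w_def
      by (rule Lp_bounded[OF dom(4) sobD(1)[OF s], where c=B])
        (use mz B in \<open>auto simp: abs_mult intro!: mult_right_mono\<close>)
    have "Lp (lebesgue_on \<Omega>) p (\<lambda>x. \<zeta> x *\<^sub>R G x)"
      by (rule Lp_bounded[OF dom(4) sobD(2)[OF s], where c=B])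
        (use mz B in \<open>auto intro!: mult_right_mono\<close>)
    moreover have "Lp (lebesgue_on \<Omega>) p (\<lambda>x. u x *\<^sub>R grad \<zeta> x)"
      by (rule Lp_bounded[OF dom(4) sobD(1)[OF s], where c=C])
        (use mz C in \<open>auto simp: mult.commute[of C] intro!: mult_left_mono\<close>)
    ultimately have LH: "Lp (lebesgue_on \<Omega>) p H" unfolding H_def by (rule Lp_add[OF dom(4)])
    have "is_weak_gradient \<Omega> w H"
      unfolding w_def H_def
      by (rule weak_gradient_test_mult[OF \<Omega>(1) sobD(3)[OF s] \<zeta>(1)])
        (use Lp_locally_integrable[OF \<Omega> p Lw] Lp_locally_integrable[OF \<Omega> p LH] in \<open>auto simp: w_def
            H_def\<close>)
    then have sw: "sob \<Omega> p w H" using Lw LH by (simp add: sob_def)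
    have "sob0 \<Omega> p w H"
    proof (rule sob0_compact_support[OF sw])
      show "compact (closure {x. \<zeta> x \<noteq> 0})" "closure {x. \<zeta> x \<noteq> 0} \<subseteq> \<Omega>"
        using \<zeta>(1) by (auto simp: test_function_def)
      show "AE x in lebesgue_on \<Omega>. x \<notin> closure {x. \<zeta> x \<noteq> 0} \<longrightarrow> w x = 0"
      proof (intro AE_I2 impI)
        fix x assume "x \<notin> closure {x. \<zeta> x \<noteq> 0}"
        from test_function_eq_0[OF \<zeta>(1) this] show "w x = 0" by (simp add: w_def)
      qed
    qed
    from sobD(3)[OF sob_eta_of_sob0[OF this]]
    have "(\<integral>x. eta (w x) * partial_deriv b \<phi> x \<partial>(lebesgue_on \<Omega>)) = - (\<integral>x. (eta' (w x) *\<^sub>R H x \<bullet> b) *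
        \<phi> x \<partial>(lebesgue_on \<Omega>))"
      using \<phi> b unfolding is_weak_gradient_def by blast
    moreover have "eta (w x) * partial_deriv b \<phi> x = eta (u x) * partial_deriv b \<phi> x"
      "(eta' (w x) *\<^sub>R H x \<bullet> b) * \<phi> x = (eta' (u x) *\<^sub>R G x \<bullet> b) * \<phi> x" for x
    proof -
      have "w x = u x \<and> H x = G x \<or> \<phi> x = 0 \<and> partial_deriv b \<phi> x = 0"
      proof (cases "x \<in> V")
        case True
        then show ?thesis using \<zeta>(4)[OF True] grad_eq_0_on_const[OF \<zeta>(2) True \<zeta>(4)] by (simp add:
            w_def H_def)
      next
        case False
        then have "x \<notin> closure {x. \<phi> x \<noteq> 0}" using \<zeta>(3) by (auto simp: K_def)
        from test_function_eq_0[OF \<phi> this] partial_deriv_eq_0[OF this, of b] show ?thesis by blast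
      qed
      then show "eta (w x) * partial_deriv b \<phi> x = eta (u x) * partial_deriv b \<phi> x"
        "(eta' (w x) *\<^sub>R H x \<bullet> b) * \<phi> x = (eta' (u x) *\<^sub>R G x \<bullet> b) * \<phi> x" by auto
    qed
    ultimately show "(\<integral>x. eta (u x) * partial_deriv b \<phi> x \<partial>(lebesgue_on \<Omega>)) = - (\<integral>x. (eta' (u x) *\<^sub>R
        G x \<bullet> b) * \<phi> x \<partial>(lebesgue_on \<Omega>))"
      by (simp only:)
  qed
  then show ?thesis using L by (simp add: sob_def)
qed

end

section \<open>Comparison principles for minimizers\<close>

lemma lebesgue_on_shift:
  fixes \<Omega> :: "'a::euclidean_space set"
  assumes "\<Omega> \<in> sets lebesgue"
  shows "(\<lambda>x. x + h) \<in> lebesgue_on ((\<lambda>x. x + h) -` \<Omega>) \<rightarrow>\<^sub>M lebesgue_on \<Omega>"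
    and "distr (lebesgue_on ((\<lambda>x. x + h) -` \<Omega>)) (lebesgue_on \<Omega>) (\<lambda>x. x + h) = lebesgue_on \<Omega>"
    and "(\<lambda>x. x + h) -` \<Omega> \<in> sets lebesgue"
proof -
  have T: "(\<lambda>x::'a. x + h) \<in> lebesgue \<rightarrow>\<^sub>M lebesgue" "distr lebesgue lebesgue (\<lambda>x::'a. x + h) =
      lebesgue"
    using lebesgue_distr_affine[of 1 h] by (simp_all add: add.commute)
  show s: "(\<lambda>x. x + h) -` \<Omega> \<in> sets lebesgue" using measurable_sets[OF T(1) assms] by simp
  show m: "(\<lambda>x. x + h) \<in> lebesgue_on ((\<lambda>x. x + h) -` \<Omega>) \<rightarrow>\<^sub>M lebesgue_on \<Omega>"
    using assms by (intro measurable_restrict_space3[OF T(1)]) auto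
  show "distr (lebesgue_on ((\<lambda>x. x + h) -` \<Omega>)) (lebesgue_on \<Omega>) (\<lambda>x. x + h) = lebesgue_on \<Omega>"
  proof (rule measure_eqI)
    fix A assume "A \<in> sets (distr (lebesgue_on ((\<lambda>x. x + h) -` \<Omega>)) (lebesgue_on \<Omega>) (\<lambda>x. x + h))"
    then have A': "A \<in> sets (lebesgue_on \<Omega>)" by simp
    then have A: "A \<in> sets lebesgue" "A \<subseteq> \<Omega>" using assms by (auto simp: sets_restrict_space)
    have v: "(\<lambda>x. x + h) -` A \<in> sets lebesgue" using measurable_sets[OF T(1) A(1)] by simp
    have "emeasure (distr (lebesgue_on ((\<lambda>x. x + h) -` \<Omega>)) (lebesgue_on \<Omega>) (\<lambda>x. x + h)) A
        = emeasure (lebesgue_on ((\<lambda>x. x + h) -` \<Omega>)) ((\<lambda>x. x + h) -` A \<inter> space (lebesgue_on ((\<lambda>x. x +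
            h) -` \<Omega>)))"
      by (rule emeasure_distr[OF m A'])
    also have "(\<lambda>x. x + h) -` A \<inter> space (lebesgue_on ((\<lambda>x. x + h) -` \<Omega>)) = (\<lambda>x. x + h) -` A"
      using A(2) by (auto simp: space_restrict_space)
    also have "emeasure (lebesgue_on ((\<lambda>x. x + h) -` \<Omega>)) ((\<lambda>x. x + h) -` A) = emeasure lebesgue
        ((\<lambda>x. x + h) -` A)"
      using s A(2) by (intro emeasure_restrict_space) auto
    also have "\<dots> = emeasure (distr lebesgue lebesgue (\<lambda>x. x + h)) A"
      using emeasure_distr[OF T(1) A(1)] by simp
    also have "\<dots> = emeasure lebesgue A" unfolding T(2) ..
    also have "\<dots> = emeasure (lebesgue_on \<Omega>) A"
      using assms A(2) by (intro emeasure_restrict_space[symmetric]) auto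
    finally show "emeasure (distr (lebesgue_on ((\<lambda>x. x + h) -` \<Omega>)) (lebesgue_on \<Omega>) (\<lambda>x. x + h)) A =
        emeasure (lebesgue_on \<Omega>) A" .
  qed simp
qed

lemma Lp_mod_shift:
  fixes f :: "'a::euclidean_space \<Rightarrow> 'b::euclidean_space"
  assumes "\<Omega> \<in> sets lebesgue" "f \<in> borel_measurable (lebesgue_on \<Omega>)"
  shows "Lp_mod (lebesgue_on ((\<lambda>x. x + h) -` \<Omega>)) p (\<lambda>x. f (x + h)) = Lp_mod (lebesgue_on \<Omega>) p f"
  unfolding Lp_mod_def
  using nn_integral_distr[OF lebesgue_on_shift(1)[OF assms(1), of h], of "\<lambda>x. ennreal (norm (f x)
      powr p)"]
    assms(2) lebesgue_on_shift(2)[OF assms(1), of h] by simp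

lemma Lp_shift:
  fixes f :: "'a::euclidean_space \<Rightarrow> 'b::euclidean_space"
  assumes "\<Omega> \<in> sets lebesgue" "Lp (lebesgue_on \<Omega>) p f"
  shows "Lp (lebesgue_on ((\<lambda>x. x + h) -` \<Omega>)) p (\<lambda>x. f (x + h))"
  using Lp_mod_shift[OF assms(1) Lp_measurable[OF assms(2)], of h p] assms(2)
    measurable_compose[OF lebesgue_on_shift(1)[OF assms(1), of h] Lp_measurable[OF assms(2)]]
  by (simp add: Lp_iff_Lp_mod)

lemma test_function_shift:
  assumes "test_function \<Omega> \<phi>"
  shows "test_function ((\<lambda>x. x + h) -` \<Omega>) (\<lambda>x. \<phi> (x + h))"
proof -
  have "(\<lambda>x. 1 *\<^sub>R (x - h)) ` \<Omega> = (\<lambda>x. x + h) -` \<Omega>"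
    by (auto simp: image_iff) (metis add_diff_cancel_right')
  then show ?thesis using test_function_affine[OF assms, of 1 h] by (simp add: add.commute)
qed

lemma partial_deriv_shift:
  "\<phi> differentiable (at (x + h)) \<Longrightarrow> partial_deriv b (\<lambda>x. \<phi> (x + h)) x = partial_deriv b \<phi> (x + h)"
  using partial_deriv_affine[of \<phi> h 1 x b] by (simp add: add.commute)

lemma sob_shift:
  fixes u :: "'a::euclidean_space \<Rightarrow> real"
  assumes \<Omega>: "open \<Omega>" "bounded \<Omega>" and p: "p > 1" and s: "sob \<Omega> p u G"
  shows "sob ((\<lambda>x. x + h) -` \<Omega>) p (\<lambda>x. u (x + h)) (\<lambda>x. G (x + h))"
proof -
  note dom = domain_facts[OF \<Omega> p]
  define D where "D = (\<lambda>x. x + h) -` \<Omega>"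
  have D: "open D" "bounded D"
  proof -
    show "open D" unfolding D_def by (rule open_vimage[OF \<Omega>(1)]) (intro continuous_intros)
    have "D = (\<lambda>x. x - h) ` \<Omega>"
      unfolding D_def by (auto simp: image_iff) (metis add_diff_cancel_right')
    then show "bounded D" using \<Omega>(2) bounded_translation_minus by simp
  qed
  note L = Lp_shift[OF dom(1) sobD(1)[OF s], of h] Lp_shift[OF dom(1) sobD(2)[OF s], of h]
  have "is_weak_gradient D (\<lambda>x. u (x + h)) (\<lambda>x. G (x + h))"
    unfolding is_weak_gradient_def
  proof (intro conjI allI impI ballI)
    show "locally_integrable D (\<lambda>x. u (x + h))" "locally_integrable D (\<lambda>x. G (x + h))"
      using L Lp_locally_integrable[OF D p] by (auto simp: D_def)
    fix \<phi> and b :: 'a assume \<phi>: "test_function D \<phi>" and b: "b \<in> Basis"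
    have sub: "(\<lambda>x. x + - h) -` D \<subseteq> \<Omega>" by (auto simp: D_def)
    define \<psi> where "\<psi> = (\<lambda>x. \<phi> (x + - h))"
    have \<psi>: "test_function \<Omega> \<psi>"
      unfolding \<psi>_def by (rule test_function_mono[OF test_function_shift[OF \<phi>] sub])
    have pd: "partial_deriv b \<psi> (x + h) = partial_deriv b \<phi> x" "\<psi> (x + h) = \<phi> x" for x
      using partial_deriv_shift[of \<phi> "x + h" "- h" b] test_function_differentiable[OF \<phi>] by (auto
          simp: \<psi>_def)
    have mu: "(\<lambda>x. u x * partial_deriv b \<psi> x) \<in> borel_measurable (lebesgue_on \<Omega>)"
      "(\<lambda>x. (G x \<bullet> b) * \<psi> x) \<in> borel_measurable (lebesgue_on \<Omega>)"
      using Lp_measurable[OF sobD(1)[OF s]] Lp_measurable[OF sobD(2)[OF s]]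
        Lp_measurable[OF sobD(1)[OF sob_test[OF \<Omega> p \<psi>]]]
        Lp_measurable[OF sobD(1)[OF sob_test[OF \<Omega> p test_function_partial_deriv[OF \<psi> b]]]] by auto
    have tr: "(\<integral>x. f (x + h) \<partial>(lebesgue_on D)) = (\<integral>x. f x \<partial>(lebesgue_on \<Omega>))"
      if "f \<in> borel_measurable (lebesgue_on \<Omega>)" for f :: "'a \<Rightarrow> real"
      using integral_distr[OF lebesgue_on_shift(1)[OF dom(1), of h] that] lebesgue_on_shift(2)[OF
          dom(1), of h]
      by (simp add: D_def)
    have "(\<integral>x. u x * partial_deriv b \<psi> x \<partial>(lebesgue_on \<Omega>)) = - (\<integral>x. (G x \<bullet> b) * \<psi> x \<partial>(lebesgue_on
        \<Omega>))"
      using sobD(3)[OF s] \<psi> b unfolding is_weak_gradient_def by blast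
    then show "(\<integral>x. u (x + h) * partial_deriv b \<phi> x \<partial>(lebesgue_on D)) = - (\<integral>x. (G (x + h) \<bullet> b) * \<phi> x
        \<partial>(lebesgue_on D))"
      using tr[OF mu(1)] tr[OF mu(2)] by (simp add: pd)
  qed
  then show ?thesis using L by (simp add: sob_def D_def)
qed

lemma sob0_shift:
  fixes u :: "'a::euclidean_space \<Rightarrow> real"
  assumes \<Omega>: "open \<Omega>" "bounded \<Omega>" and p: "p > 1" and s: "sob0 \<Omega> p u G"
  shows "sob0 ((\<lambda>x. x + h) -` \<Omega>) p (\<lambda>x. u (x + h)) (\<lambda>x. G (x + h))"
proof -
  note dom = domain_facts[OF \<Omega> p]
  obtain \<phi> :: "nat \<Rightarrow> 'a \<Rightarrow> real" where \<phi>: "\<And>k. test_function \<Omega> (\<phi> k)"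
    "(\<lambda>k. Lp_mod (lebesgue_on \<Omega>) p (\<lambda>x. u x - \<phi> k x)) \<longlonglongrightarrow> 0"
    "(\<lambda>k. Lp_mod (lebesgue_on \<Omega>) p (\<lambda>x. G x - grad (\<phi> k) x)) \<longlonglongrightarrow> 0"
    and L: "Lp (lebesgue_on \<Omega>) p u" "Lp (lebesgue_on \<Omega>) p G"
    using s unfolding sob0_def by blast
  have st: "sob \<Omega> p (\<phi> k) (grad (\<phi> k))" for k by (rule sob_test[OF \<Omega> p \<phi>(1)])
  have gr: "grad (\<lambda>x. \<phi> k (x + h)) x = grad (\<phi> k) (x + h)" for k x
    unfolding grad_def using partial_deriv_shift[OF test_function_differentiable[OF \<phi>(1)]] by simp
  show ?thesis
    unfolding sob0_def
  proof (intro conjI Lp_shift dom(1) L exI[of _ "\<lambda>k x. \<phi> k (x + h)"] allI test_function_shift \<phi>(1))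
    show "(\<lambda>k. Lp_mod (lebesgue_on ((\<lambda>x. x + h) -` \<Omega>)) p (\<lambda>x. u (x + h) - \<phi> k (x + h))) \<longlonglongrightarrow> 0"
      using \<phi>(2) Lp_mod_shift[OF dom(1) borel_measurable_diff[OF Lp_measurable[OF L(1)]
          Lp_measurable[OF sobD(1)[OF st]]]]
      by simp
    show "(\<lambda>k. Lp_mod (lebesgue_on ((\<lambda>x. x + h) -` \<Omega>)) p (\<lambda>x. G (x + h) - grad (\<lambda>x. \<phi> k (x + h)) x))
        \<longlonglongrightarrow> 0"
      using \<phi>(3) Lp_mod_shift[OF dom(1) borel_measurable_diff[OF Lp_measurable[OF L(2)]
          Lp_measurable[OF sobD(2)[OF st]]]]
      by (simp add: gr)
  qed
qed

lemma Lp_mod_extend: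
  fixes f :: "'a::euclidean_space \<Rightarrow> 'b::euclidean_space"
  assumes "\<Omega> \<in> sets lebesgue" "D \<in> sets lebesgue" "D \<subseteq> \<Omega>" "\<And>x. x \<in> \<Omega> \<Longrightarrow> x \<notin> D \<Longrightarrow> f x = 0" and p: "p >
      0"
  shows "Lp_mod (lebesgue_on \<Omega>) p f = Lp_mod (lebesgue_on D) p f"
proof -
  have "(\<integral>\<^sup>+x. ennreal (norm (f x) powr p) * indicator \<Omega> x \<partial>lebesgue) = (\<integral>\<^sup>+x. ennreal (norm (f x)
      powr p) * indicator D x \<partial>lebesgue)"
    by (rule nn_integral_cong) (use assms(3,4) p in \<open>auto simp: indicator_def\<close>)
  then show ?thesis
    unfolding Lp_mod_def using assms(1,2) by (simp add: nn_integral_restrict_space)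
qed

lemma measurable_lebesgue_on_iff:
  fixes f :: "'a::euclidean_space \<Rightarrow> 'b::euclidean_space"
  assumes "D \<in> sets lebesgue"
  shows "f \<in> borel_measurable (lebesgue_on D) \<longleftrightarrow> (\<lambda>x. indicator D x *\<^sub>R f x) \<in> borel_measurable
      lebesgue"
  using borel_measurable_restrict_space_iff[of D lebesgue f] assms by simp

lemma Lp_extend:
  fixes f :: "'a::euclidean_space \<Rightarrow> 'b::euclidean_space"
  assumes "\<Omega> \<in> sets lebesgue" "D \<in> sets lebesgue" "D \<subseteq> \<Omega>" "p > 0" "Lp (lebesgue_on D) p f"
  shows "Lp (lebesgue_on \<Omega>) p (\<lambda>x. indicator D x *\<^sub>R f x)"
proof -
  have "Lp_mod (lebesgue_on \<Omega>) p (\<lambda>x. indicator D x *\<^sub>R f x) = Lp_mod (lebesgue_on D) p (\<lambda>x.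
      indicator D x *\<^sub>R f x)"
    by (rule Lp_mod_extend[OF assms(1-3) _ assms(4)]) auto
  also have "\<dots> = Lp_mod (lebesgue_on D) p f"
    by (rule Lp_mod_cong_AE) (use assms(2) in \<open>auto simp: AE_lebesgue_on_iff\<close>)
  finally have "Lp_mod (lebesgue_on \<Omega>) p (\<lambda>x. indicator D x *\<^sub>R f x) < \<infinity>" using assms(5) by (simp
      add: Lp_iff_Lp_mod)
  moreover have "(\<lambda>x. indicator D x *\<^sub>R f x) \<in> borel_measurable (lebesgue_on \<Omega>)"
    using Lp_measurable[OF assms(5)] unfolding measurable_lebesgue_on_iff[OF assms(2)]
    by (rule measurable_restrict_space1)
  ultimately show ?thesis by (simp add: Lp_iff_Lp_mod)
qed

text \<open>The approximating test functions on \<open>D\<close> are also test functions on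
  \<open>\<Omega>\<close> and vanish outside \<open>D\<close>, so both distances are unchanged by
  the extension.\<close>

lemma sob0_extend:
  fixes u :: "'a::euclidean_space \<Rightarrow> real"
  assumes "open \<Omega>" "open D" "D \<subseteq> \<Omega>" "p > 0" and s: "sob0 D p u G"
  shows "sob0 \<Omega> p (\<lambda>x. indicator D x * u x) (\<lambda>x. indicator D x *\<^sub>R G x)"
proof -
  have sets: "\<Omega> \<in> sets lebesgue" "D \<in> sets lebesgue" using assms by auto
  obtain \<phi> :: "nat \<Rightarrow> 'a \<Rightarrow> real" where \<phi>: "\<And>k. test_function D (\<phi> k)"
    "(\<lambda>k. Lp_mod (lebesgue_on D) p (\<lambda>x. u x - \<phi> k x)) \<longlonglongrightarrow> 0"
    "(\<lambda>k. Lp_mod (lebesgue_on D) p (\<lambda>x. G x - grad (\<phi> k) x)) \<longlonglongrightarrow> 0"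
    and L: "Lp (lebesgue_on D) p u" "Lp (lebesgue_on D) p G"
    using s unfolding sob0_def by blast
  have z: "\<phi> k x = 0" "grad (\<phi> k) x = 0" if "x \<notin> D" for k x
    using test_function_eq_0'[OF \<phi>(1) that] grad_eq_0[of x "\<phi> k"] \<phi>(1)[of k] that by (auto simp:
        test_function_def)
  have e1: "Lp_mod (lebesgue_on \<Omega>) p (\<lambda>x. indicator D x * u x - \<phi> k x) = Lp_mod (lebesgue_on D) p
      (\<lambda>x. u x - \<phi> k x)" for k
    by (subst Lp_mod_extend[OF sets assms(3) _ assms(4)], simp add: z, rule Lp_mod_cong_AE)
      (use sets in \<open>auto simp: AE_lebesgue_on_iff\<close>)
  have e2: "Lp_mod (lebesgue_on \<Omega>) p (\<lambda>x. indicator D x *\<^sub>R G x - grad (\<phi> k) x) = Lp_mod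
      (lebesgue_on D) p (\<lambda>x. G x - grad (\<phi> k) x)" for k
    by (subst Lp_mod_extend[OF sets assms(3) _ assms(4)], simp add: z, rule Lp_mod_cong_AE)
      (use sets in \<open>auto simp: AE_lebesgue_on_iff\<close>)
  show ?thesis
    unfolding sob0_def
    using Lp_extend[OF sets assms(3,4) L(1)] Lp_extend[OF sets assms(3,4) L(2)]
    by (intro conjI exI[of _ \<phi>] allI test_function_mono[OF \<phi>(1) assms(3)]) (simp_all add: e1 e2 \<phi>)
qed

lemma Lp_restrict:
  fixes f :: "'a::euclidean_space \<Rightarrow> 'b::euclidean_space"
  assumes "\<Omega> \<in> sets lebesgue" "D \<in> sets lebesgue" "D \<subseteq> \<Omega>" "Lp (lebesgue_on \<Omega>) p f"
  shows "Lp (lebesgue_on D) p f"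
proof -
  have "f \<in> borel_measurable (restrict_space (lebesgue_on \<Omega>) D)"
    using Lp_measurable[OF assms(4)] by (rule measurable_restrict_space1)
  moreover have "restrict_space (lebesgue_on \<Omega>) D = lebesgue_on D"
    using assms by (simp add: restrict_restrict_space Int_absorb1 Int_absorb2)
  ultimately have "f \<in> borel_measurable (lebesgue_on D)" by simp
  moreover have "integrable (lebesgue_on D) (\<lambda>x. norm (f x) powr p)"
    by (rule integrable_lebesgue_on_subset[OF _ assms(1-3)]) (use assms(4) in \<open>simp add: Lp_def\<close>)
  ultimately show ?thesis by (simp add: Lp_def)
qed

lemma sob_restrict:
  fixes u :: "'a::euclidean_space \<Rightarrow> real"
  assumes "open \<Omega>" "open D" "D \<subseteq> \<Omega>" "sob \<Omega> p u G"
  shows "sob D p u G"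
proof -
  have sets: "\<Omega> \<in> sets lebesgue" "D \<in> sets lebesgue" using assms by auto
  show ?thesis
    unfolding sob_def
    by (intro conjI Lp_restrict[OF sets assms(3)] sobD[OF assms(4)] weak_gradient_mono[OF sobD(3)[OF
        assms(4)] assms(1-3)])
qed

section \<open>Variations of a minimizer\<close>

context
  fixes \<Omega> :: "'a::euclidean_space set" and p :: real and v :: "'a \<Rightarrow> real" and V :: "'a \<Rightarrow> 'a"
  assumes \<Omega>: "open \<Omega>" "bounded \<Omega>" and p: "p > 1" and v: "sob \<Omega> p v V"
    and minimal: "\<And>\<psi> H. sob0 \<Omega> p \<psi> H \<Longrightarrow>
      (\<integral>x. norm (V x) powr p \<partial>(lebesgue_on \<Omega>)) \<le> (\<integral>x. norm (V x + H x) powr p \<partial>(lebesgue_on \<Omega>))"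
begin

lemmas dom' = domain_facts[OF \<Omega> p]

text \<open>Convexity of \<open>\<bar>\<cdot>\<bar>\<^sup>p\<close> replaces the Euler-Lagrange equation: moving the gradient of the
  minimizer from \<open>V\<close> towards \<open>Q\<close> by the fraction \<open>\<theta>\<close> cannot decrease the energy.\<close>

lemma minimizer_convex_variation:
  assumes \<psi>: "sob0 \<Omega> p \<psi> H" and H: "AE x in lebesgue_on \<Omega>. H x = \<theta> x *\<^sub>R (Q x - V x)"
    and \<theta>: "\<theta> \<in> borel_measurable (lebesgue_on \<Omega>)" "\<And>x. 0 \<le> \<theta> x" "\<And>x. \<theta> x < 1"
    and Q: "integrable (lebesgue_on \<Omega>) (\<lambda>x. \<theta> x * norm (Q x) powr p)"
  shows "0 \<le> (\<integral>x. \<theta> x * norm (Q x) powr p - \<theta> x * norm (V x) powr p \<partial>(lebesgue_on \<Omega>))" (is ?A)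
    and "(\<integral>x. \<theta> x * norm (Q x) powr p - \<theta> x * norm (V x) powr p \<partial>(lebesgue_on \<Omega>)) \<le> 0 \<Longrightarrow>
      AE x in lebesgue_on \<Omega>. H x = 0" (is "?B \<Longrightarrow> ?C")
proof -
  define M where "M = lebesgue_on \<Omega>"
  have V: "integrable M (\<lambda>x. norm (V x) powr p)" using sobD(2)[OF v] by (simp add: Lp_def M_def)
  have VH: "integrable M (\<lambda>x. norm (V x + H x) powr p)"
    using Lp_add[OF dom'(4) sobD(2)[OF v] sobD(2)[OF sob0_imp_sob[OF \<Omega> p \<psi>]]] by (simp add: Lp_def
        M_def)
  have \<theta>V: "integrable M (\<lambda>x. \<theta> x * norm (V x) powr p)"
  proof (rule Bochner_Integration.integrable_bound[OF V])
    show "(\<lambda>x. \<theta> x * norm (V x) powr p) \<in> borel_measurable M" using \<theta>(1) V by (auto simp: M_def)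
    show "AE x in M. norm (\<theta> x * norm (V x) powr p) \<le> norm (norm (V x) powr p)"
      using \<theta>(2) less_imp_le[OF \<theta>(3)] by (intro AE_I2) (auto simp: abs_mult intro!:
          mult_left_le_one_le)
  qed
  have \<theta>Q: "integrable M (\<lambda>x. \<theta> x * norm (Q x) powr p)" using Q by (simp add: M_def)
  \<comment> \<open>The defect in the convexity inequality at V + H = (1 - \<theta>) V + \<theta> Q.
    It is nonnegative, and by minimality its integral is at most the integral in the claim. If the
    latter is not positive, the defect vanishes almost everywhere, and strict convexity leaves only
    \<open>H x = 0\<close>.\<close>
  define f where "f = (\<lambda>x. norm (V x) powr p + (\<theta> x * norm (Q x) powr p - \<theta> x * norm (V x) powr p) -
      norm (V x + H x) powr p)"
  have f: "integrable M f" unfolding f_def using V VH \<theta>V \<theta>Q by auto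
  have f0: "AE x in M. 0 \<le> f x"
    using H unfolding M_def
  proof eventually_elim
    case (elim x)
    show ?case
      using norm_powr_convex[OF dom'(3) \<theta>(2)[of x] less_imp_le[OF \<theta>(3)[of x]], of "V x" "Q x"]
      by (simp add: f_def elim algebra_simps)
  qed
  have intf: "(\<integral>x. f x \<partial>M) = (\<integral>x. norm (V x) powr p \<partial>M) + (\<integral>x. \<theta> x * norm (Q x) powr p - \<theta> x * norm
      (V x) powr p \<partial>M)
      - (\<integral>x. norm (V x + H x) powr p \<partial>M)"
    unfolding f_def using V VH \<theta>V \<theta>Q by simp
  have min: "(\<integral>x. norm (V x) powr p \<partial>M) \<le> (\<integral>x. norm (V x + H x) powr p \<partial>M)"
    unfolding M_def by (rule minimal[OF \<psi>])
  have "0 \<le> (\<integral>x. f x \<partial>M)" by (rule integral_nonneg_AE[OF f0])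
  then show ?A using intf min by (simp add: M_def)
  show ?C if ?B
  proof -
    have "(\<integral>x. f x \<partial>M) \<le> 0" using that intf min by (simp add: M_def)
    then have "(\<integral>x. f x \<partial>M) = 0" using \<open>0 \<le> (\<integral>x. f x \<partial>M)\<close> by simp
    then have "AE x in M. f x = 0" using integral_nonneg_eq_0_iff_AE[OF f f0] by simp
    then show ?C
      using H unfolding M_def
    proof eventually_elim
      case (elim x)
      show ?case
      proof (rule ccontr)
        assume "H x \<noteq> 0"
        then have "\<theta> x > 0" "V x \<noteq> Q x" using elim(2) \<theta>(2)[of x] by (auto simp: less_le)
        from norm_powr_strict_convex[OF p this(1) \<theta>(3) this(2)] elim show False
          by (simp add: f_def algebra_simps)
      qed
    qed
  qed
qed

text \<open>Since \<open>g \<le> F\<close>, the function eta(v - F) is a limit of compactly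
  supported ones and hence an admissible variation. Moving \<open>V\<close> towards \<open>D\<close>
  by the fraction eta'(v - F) gives a comparison integral that is at most a negative multiple of the
  pairing with the flux of \<open>D\<close>, and the supersolution property makes this pairing
  nonnegative. The equality case of the convex variation forces the gradient of eta(v - F) to
  vanish.\<close>

lemma minimizer_le_supersolution:
  fixes F :: "'a \<Rightarrow> real" and D :: "'a \<Rightarrow> 'a" and U :: "'a \<Rightarrow> 'a \<Rightarrow> 'a"
  assumes vg: "sob0 \<Omega> p (\<lambda>x. v x - g x) (\<lambda>x. V x - G x)" and g: "sob \<Omega> p g G"
    and F: "\<And>x. x \<in> \<Omega> \<Longrightarrow> (F has_derivative (\<lambda>h. D x \<bullet> h)) (at x)" "continuous_on \<Omega> D"
      "\<And>x. x \<in> \<Omega> \<Longrightarrow> \<bar>F x\<bar> \<le> B" "\<And>x. x \<in> \<Omega> \<Longrightarrow> norm (D x) \<le> B"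
    and U: "\<And>b x. b \<in> Basis \<Longrightarrow> x \<in> \<Omega> \<Longrightarrow> ((\<lambda>x. pflux p (D x) \<bullet> b) has_derivative (\<lambda>h. U b x \<bullet> h)) (at
        x)"
      "\<And>b. b \<in> Basis \<Longrightarrow> continuous_on \<Omega> (U b)"
      "\<And>x. x \<in> \<Omega> \<Longrightarrow> \<bar>\<Sum>b\<in>Basis. U b x \<bullet> b\<bar> \<le> B'"
    and super: "\<And>x. x \<in> \<Omega> \<Longrightarrow> (\<Sum>b\<in>Basis. U b x \<bullet> b) \<le> 0"
    and gF: "AE x in lebesgue_on \<Omega>. g x \<le> F x"
  shows "AE x in lebesgue_on \<Omega>. v x \<le> F x"
proof -
  define M where "M = lebesgue_on \<Omega>"
  have sF: "sob \<Omega> p F D" by (rule sob_C1[OF \<Omega> p F])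
  obtain \<phi> :: "nat \<Rightarrow> 'a \<Rightarrow> real" where \<phi>: "\<And>k. test_function \<Omega> (\<phi> k)"
    "(\<lambda>k. Lp_mod M p (\<lambda>x. (v x - g x) - \<phi> k x)) \<longlonglongrightarrow> 0"
    "(\<lambda>k. Lp_mod M p (\<lambda>x. (V x - G x) - grad (\<phi> k) x)) \<longlonglongrightarrow> 0"
    using vg unfolding sob0_def M_def by blast
  \<comment> \<open>Approximations of \<open>v - F\<close> that coincide with \<open>g - F\<close>
    off the support of \<open>\<phi> k\<close>. As \<open>g - F\<close> is nonpositive almost
    everywhere, \<open>eta (u k x)\<close> vanishes off this support up to a null set, although
    \<open>F\<close> has no prescribed boundary values.\<close>
  define u where "u = (\<lambda>k x. \<phi> k x + (g x - F x))"
  define W where "W = (\<lambda>k x. grad (\<phi> k) x + (G x - D x))"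
  have su: "sob \<Omega> p (u k) (W k)" for k
    unfolding u_def W_def by (intro sob_add[OF \<Omega> p] sob_diff[OF \<Omega> p] sob_test[OF \<Omega> p] \<phi>(1) g sF)
  have svF: "sob \<Omega> p (\<lambda>x. v x - F x) (\<lambda>x. V x - D x)" by (rule sob_diff[OF \<Omega> p v sF])
  have lim: "(\<lambda>k. Lp_mod M p (\<lambda>x. u k x - (v x - F x))) \<longlonglongrightarrow> 0" "(\<lambda>k. Lp_mod M p (\<lambda>x. W k x - (V x - D
      x))) \<longlonglongrightarrow> 0"
    using \<phi>(2,3) by (subst (asm) Lp_mod_minus_commute, simp add: u_def W_def algebra_simps)+
  obtain r where r: "strict_mono r"
    "(\<lambda>k. Lp_mod M p (\<lambda>x. eta' (u (r k) x) *\<^sub>R W (r k) x - eta' (v x - F x) *\<^sub>R (V x - D x))) \<longlonglongrightarrow> 0"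
    using eta'_chain_subseq[where u = u and G = W, OF dom'(5) sobD(1)[OF su] sobD(2)[OF su]
        sobD(1)[OF svF] sobD(2)[OF svF]] lim
    unfolding M_def by blast
  have s0: "sob0 \<Omega> p (\<lambda>x. eta (u k x)) (\<lambda>x. eta' (u k x) *\<^sub>R W k x)" for k
  proof (rule sob0_compact_support[OF \<Omega> p sob_eta[OF \<Omega> p su]])
    show "compact (closure {x. \<phi> k x \<noteq> 0})" "closure {x. \<phi> k x \<noteq> 0} \<subseteq> \<Omega>"
      using \<phi>(1)[of k] by (auto simp: test_function_def)
    show "AE x in lebesgue_on \<Omega>. x \<notin> closure {x. \<phi> k x \<noteq> 0} \<longrightarrow> eta (u k x) = 0"
      using gF
    proof eventually_elim
      case (elim x)
      show ?case
      proof
        assume x: "x \<notin> closure {x. \<phi> k x \<noteq> 0}"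
        then have "\<phi> k x = 0" using test_function_eq_0[OF \<phi>(1)] by blast
        then show "eta (u k x) = 0" using elim x by (intro eta_le_0) (auto simp: u_def)
      qed
    qed
  qed
  have se: "sob \<Omega> p (\<lambda>x. eta (v x - F x)) (\<lambda>x. eta' (v x - F x) *\<^sub>R (V x - D x))"
    by (rule sob_eta[OF \<Omega> p svF])
  have s1: "sob0 \<Omega> p (\<lambda>x. eta (v x - F x)) (\<lambda>x. eta' (v x - F x) *\<^sub>R (V x - D x))"
  proof (rule sob0_closed[OF \<Omega> p s0[of "r _"] sobD(1)[OF se] sobD(2)[OF se] _ r(2)[unfolded M_def]])
    have "(\<lambda>k. Lp_mod M p (\<lambda>x. u (r k) x - (v x - F x))) \<longlonglongrightarrow> 0"
      using LIMSEQ_subseq_LIMSEQ[OF lim(1) r(1)] by (simp add: comp_def)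
    then show "(\<lambda>k. Lp_mod (lebesgue_on \<Omega>) p (\<lambda>x. eta (u (r k) x) - eta (v x - F x))) \<longlonglongrightarrow> 0"
      unfolding M_def by (rule eta_tendsto[OF dom'(4) Lp_measurable[OF sobD(1)[OF su]]
          Lp_measurable[OF sobD(1)[OF svF]]])
  qed
  define \<theta> where "\<theta> = (\<lambda>x. eta' (v x - F x))"
  have se\<theta>: "sob \<Omega> p (\<lambda>x. eta (v x - F x)) (\<lambda>x. \<theta> x *\<^sub>R (V x - D x))" using se by (simp add: \<theta>_def)
  have s1\<theta>: "sob0 \<Omega> p (\<lambda>x. eta (v x - F x)) (\<lambda>x. \<theta> x *\<^sub>R (V x - D x))" using s1 by (simp add: \<theta>_def)
  define X where "X = (\<lambda>x. pflux p (D x))"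
  have mD: "D \<in> borel_measurable M" unfolding M_def using Lp_measurable[OF sobD(2)[OF sF]] .
  have mX: "X \<in> borel_measurable M"
    unfolding X_def pflux_def using mD by measurable
  have X: "norm (X x) \<le> B powr (p - 1)" if "x \<in> \<Omega>" for x
    using F(4)[OF that] p by (auto simp: X_def norm_pflux intro: powr_mono2)
  have \<theta>m: "\<theta> \<in> borel_measurable M"
    unfolding \<theta>_def M_def using Lp_measurable[OF sobD(1)[OF svF]] continuous_eta'
    by (intro measurable_compose[of "\<lambda>x. v x - F x" _ borel eta'] borel_measurable_continuous_onI)
        auto
  \<comment> \<open>The approximating \<open>\<tau> k\<close> carry no sign. Integration by parts is
    performed for them, and the sign of the divergence is used only in the limit, against the
    nonnegative eta(v - F); boundedness of the flux and of its divergence permits this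
    passage.\<close>
  have flux: "0 \<le> (\<integral>x. (\<theta> x *\<^sub>R (V x - D x)) \<bullet> X x \<partial>M)"
    and fluxi: "integrable M (\<lambda>x. (\<theta> x *\<^sub>R (V x - D x)) \<bullet> X x)"
  proof -
    obtain \<tau> :: "nat \<Rightarrow> 'a \<Rightarrow> real" where t: "\<And>k. test_function \<Omega> (\<tau> k)"
      "(\<lambda>k. Lp_mod M p (\<lambda>x. eta (v x - F x) - \<tau> k x)) \<longlonglongrightarrow> 0"
      "(\<lambda>k. Lp_mod M p (\<lambda>x. \<theta> x *\<^sub>R (V x - D x) - grad (\<tau> k) x)) \<longlonglongrightarrow> 0"
      using s1 unfolding sob0_def M_def \<theta>_def by blast
    have tl: "(\<lambda>k. Lp_mod M p (\<lambda>x. \<tau> k x - eta (v x - F x))) \<longlonglongrightarrow> 0"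
      "(\<lambda>k. Lp_mod M p (\<lambda>x. grad (\<tau> k) x - \<theta> x *\<^sub>R (V x - D x))) \<longlonglongrightarrow> 0"
      by (subst Lp_mod_minus_commute, rule t)+
    note st = sob_test[OF \<Omega> p t(1)]
    define dv where "dv = (\<lambda>x. \<Sum>b\<in>Basis. U b x \<bullet> b)"
    have cdiv: "continuous_on \<Omega> dv" unfolding dv_def by (intro continuous_intros U(2))
    have bdiv: "norm (dv x) \<le> B'" if "x \<in> \<Omega>" for x using U(3)[OF that] by (simp add: dv_def)
    note g1 = Lp_mod_tendsto_integral[OF dom'(2,3) sobD(2)[OF st] sobD(2)[OF se\<theta>] tl(2)[unfolded
        M_def] mX[unfolded M_def], of "B powr (p - 1)"]
    have L1: "(\<lambda>k. \<integral>x. grad (\<tau> k) x \<bullet> X x \<partial>M) \<longlonglongrightarrow> (\<integral>x. (\<theta> x *\<^sub>R (V x - D x)) \<bullet> X x \<partial>M)"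
      unfolding M_def by (rule g1(1)) (use X dom'(6) in auto)
    show "integrable M (\<lambda>x. (\<theta> x *\<^sub>R (V x - D x)) \<bullet> X x)"
      unfolding M_def by (rule g1(2)) (use X dom'(6) in auto)
    have L2: "(\<lambda>k. \<integral>x. \<tau> k x \<bullet> dv x \<partial>M) \<longlonglongrightarrow> (\<integral>x. eta (v x - F x) \<bullet> dv x \<partial>M)"
      unfolding M_def
      by (rule Lp_mod_tendsto_integral(1)[OF dom'(2,3) sobD(1)[OF st] sobD(1)[OF se] tl(1)[unfolded
          M_def]
          continuous_measurable_on[OF \<Omega> p cdiv], where B = B'])
        (use bdiv dom'(6) in auto)
    have eq: "(\<integral>x. grad (\<tau> k) x \<bullet> X x \<partial>M) = - (\<integral>x. \<tau> k x \<bullet> dv x \<partial>M)" for k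
    proof -
      have w: "is_weak_gradient \<Omega> (\<lambda>x. X x \<bullet> b) (U b)" if "b \<in> Basis" for b
        unfolding X_def using U(1,2)[OF that] by (intro is_weak_gradient_C1[OF \<Omega>(1)]) auto
      have loc: "locally_integrable \<Omega> (\<lambda>x. X x \<bullet> b)" "locally_integrable \<Omega> (U b)" if "b \<in> Basis" for
          b
        using w[OF that] by (auto simp: is_weak_gradient_def)
      have i: "integrable M (\<lambda>x. (X x \<bullet> b) * partial_deriv b (\<tau> k) x)" "integrable M (\<lambda>x. (U b x \<bullet>
          b) * \<tau> k x)" if "b \<in> Basis" for b
        unfolding M_def
        using locally_integrable_mult_test(2)[OF \<Omega>(1) loc(1)[OF that] test_function_partial_deriv[OF
            t(1) that]]
          locally_integrable_mult_test(2)[OF \<Omega>(1) locally_integrable_inner[OF loc(2)[OF that]] t(1)]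
              by auto
      have "(\<integral>x. grad (\<tau> k) x \<bullet> X x \<partial>M) = (\<integral>x. (\<Sum>b\<in>Basis. (X x \<bullet> b) * partial_deriv b (\<tau> k) x) \<partial>M)"
        by (simp add: grad_inner)
      also have "\<dots> = (\<Sum>b\<in>Basis. \<integral>x. (X x \<bullet> b) * partial_deriv b (\<tau> k) x \<partial>M)"
        by (rule Bochner_Integration.integral_sum) (rule i)
      also have "\<dots> = (\<Sum>b\<in>Basis. - (\<integral>x. (U b x \<bullet> b) * \<tau> k x \<partial>M))"
        by (rule sum.cong) (use w t(1) in \<open>auto simp: is_weak_gradient_def M_def\<close>)
      also have "\<dots> = - (\<integral>x. (\<Sum>b\<in>Basis. (U b x \<bullet> b) * \<tau> k x) \<partial>M)"
        by (subst Bochner_Integration.integral_sum) (auto simp: sum_negf intro: i)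
      finally show ?thesis by (simp add: dv_def sum_distrib_left mult.commute)
    qed
    have "(\<integral>x. (\<theta> x *\<^sub>R (V x - D x)) \<bullet> X x \<partial>M) = - (\<integral>x. eta (v x - F x) \<bullet> dv x \<partial>M)"
      using LIMSEQ_unique[OF L1] tendsto_minus[OF L2] unfolding eq by blast
    also have "\<dots> = (\<integral>x. - (eta (v x - F x) * dv x) \<partial>M)" by simp
    also have "\<dots> \<ge> 0"
    proof (rule integral_nonneg_AE, rule AE_I2)
      fix x assume "x \<in> space M"
      then have "dv x \<le> 0" using super dom'(6) by (simp add: M_def dv_def)
      then show "0 \<le> - (eta (v x - F x) * dv x)" using eta_nonneg[of "v x - F x"] by (simp add:
          mult_nonneg_nonpos)
    qed
    finally show "0 \<le> (\<integral>x. (\<theta> x *\<^sub>R (V x - D x)) \<bullet> X x \<partial>M)" .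
  qed
  have \<theta>r: "0 \<le> \<theta> x" "\<theta> x < 1" for x using eta'_range by (auto simp: \<theta>_def)
  have iD: "integrable M (\<lambda>x. \<theta> x * norm (D x) powr p)"
  proof (rule Bochner_Integration.integrable_bound)
    show "integrable M (\<lambda>x. norm (D x) powr p)" using sobD(2)[OF sF] by (simp add: Lp_def M_def)
    show "(\<lambda>x. \<theta> x * norm (D x) powr p) \<in> borel_measurable M" using \<theta>m mD by measurable
    show "AE x in M. norm (\<theta> x * norm (D x) powr p) \<le> norm (norm (D x) powr p)"
      using \<theta>r(1) less_imp_le[OF \<theta>r(2)] by (intro AE_I2) (auto simp: abs_mult intro!:
          mult_left_le_one_le)
  qed
  have iV: "integrable M (\<lambda>x. \<theta> x * norm (V x) powr p)"
  proof (rule Bochner_Integration.integrable_bound)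
    show "integrable M (\<lambda>x. norm (V x) powr p)" using sobD(2)[OF v] by (simp add: Lp_def M_def)
    show "(\<lambda>x. \<theta> x * norm (V x) powr p) \<in> borel_measurable M"
      using \<theta>m Lp_measurable[OF sobD(2)[OF v], folded M_def] by measurable
    show "AE x in M. norm (\<theta> x * norm (V x) powr p) \<le> norm (norm (V x) powr p)"
      using \<theta>r(1) less_imp_le[OF \<theta>r(2)] by (intro AE_I2) (auto simp: abs_mult intro!:
          mult_left_le_one_le)
  qed
  \<comment> \<open>The tangent inequality at \<open>D\<close>, weighted by \<open>\<theta>\<close>,
    turns the difference of energies into the pairing with the flux.\<close>
  have "(\<integral>x. \<theta> x * norm (D x) powr p - \<theta> x * norm (V x) powr p \<partial>M) \<le> (\<integral>x. - p * ((\<theta> x *\<^sub>R (V x - D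
      x)) \<bullet> X x) \<partial>M)"
  proof (rule integral_mono)
    fix x
    have "\<theta> x * (norm (D x) powr p + p * (X x \<bullet> (V x - D x))) \<le> \<theta> x * norm (V x) powr p"
      unfolding X_def by (intro mult_left_mono norm_powr_tangent dom' \<theta>r)
    then show "\<theta> x * norm (D x) powr p - \<theta> x * norm (V x) powr p \<le> - p * ((\<theta> x *\<^sub>R (V x - D x)) \<bullet> X
        x)"
      by (simp add: inner_commute[of "X x"] algebra_simps)
  qed (use iD iV fluxi in auto)
  also have "\<dots> = - p * (\<integral>x. (\<theta> x *\<^sub>R (V x - D x)) \<bullet> X x \<partial>M)" by simp
  also have "\<dots> \<le> 0" using flux p by (simp add: mult_nonpos_nonneg)
  finally have le0: "(\<integral>x. \<theta> x * norm (D x) powr p - \<theta> x * norm (V x) powr p \<partial>M) \<le> 0" .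
  have "AE x in lebesgue_on \<Omega>. - (\<theta> x *\<^sub>R (V x - D x)) = 0"
  proof (rule minimizer_convex_variation(2)[OF sob0_uminus[OF \<Omega> p s1\<theta>], where \<theta> = \<theta> and Q = D])
    show "AE x in lebesgue_on \<Omega>. - (\<theta> x *\<^sub>R (V x - D x)) = \<theta> x *\<^sub>R (D x - V x)"
      by (intro AE_I2) (simp add: algebra_simps)
  qed (use \<theta>m \<theta>r iD le0 in \<open>auto simp: M_def\<close>)
  then have "AE x in lebesgue_on \<Omega>. eta' (v x - F x) *\<^sub>R (V x - D x) = 0" by (simp add: \<theta>_def)
  from sob0_integral_eq_0[OF \<Omega> p s1 this]
  have "AE x in lebesgue_on \<Omega>. eta (v x - F x) = 0"
    using integral_nonneg_eq_0_iff_AE[OF Lp_integrable[OF dom'(2,3) sobD(1)[OF se]]] eta_nonneg by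
        simp
  then show ?thesis
  proof eventually_elim
    case (elim x)
    then show ?case using eta_pos_iff[of "v x - F x"] by (simp add: not_less)
  qed
qed

text \<open>Minimizer and translate exchange pieces. Moving \<open>V\<close> towards V(x + h) on
  \<open>D\<close>, and towards V(x - h) on \<open>D + h\<close>, produces two comparison integrals
  that are negatives of each other after a shift by \<open>h\<close>. Minimality makes both
  nonnegative, so both vanish, and the gradient of eta(v(x + h) - v(x) - c) is zero. The compact set
  \<open>K\<close> makes this function a compactly supported variation in \<open>D\<close>.\<close>

lemma minimizer_translation:
  fixes h :: 'a and c :: real
  defines "D \<equiv> \<Omega> \<inter> (\<lambda>x. x + h) -` \<Omega>"
  assumes K: "compact K" "K \<subseteq> D" "AE x in lebesgue_on D. x \<notin> K \<longrightarrow> v (x + h) - v x \<le> c"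
  shows "AE x in lebesgue_on D. v (x + h) - v x \<le> c"
proof -
  define \<Omega>' where "\<Omega>' = (\<lambda>x. x + h) -` \<Omega>"
  have \<Omega>': "open \<Omega>'" unfolding \<Omega>'_def by (rule open_vimage[OF \<Omega>(1)]) (intro continuous_intros)
  have D: "open D" "bounded D" "D \<subseteq> \<Omega>" "D \<subseteq> \<Omega>'"
    using \<Omega> \<Omega>' by (auto simp: D_def \<Omega>'_def intro: bounded_subset)
  note domD = domain_facts[OF D(1,2) p]
  have svD: "sob D p v V" by (rule sob_restrict[OF \<Omega>(1) D(1,3) v])
  have shD: "sob D p (\<lambda>x. v (x + h)) (\<lambda>x. V (x + h))"
    by (rule sob_restrict[OF \<Omega>' D(1,4) sob_shift[OF \<Omega> p v, of h, folded \<Omega>'_def]])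
  have scD: "sob D p (\<lambda>x. c) (\<lambda>x. 0)"
    by (rule sob_C1[OF D(1,2) p, where B = "\<bar>c\<bar>"]) auto
  define u where "u = (\<lambda>x. v (x + h) - v x - c)"
  have su: "sob D p u (\<lambda>x. V (x + h) - V x)"
    using sob_diff[OF D(1,2) p sob_diff[OF D(1,2) p shD svD] scD] by (simp add: u_def)
  note se = sob_eta[OF D(1,2) p su]
  have s0: "sob0 D p (\<lambda>x. eta (u x)) (\<lambda>x. eta' (u x) *\<^sub>R (V (x + h) - V x))"
    by (rule sob0_compact_support[OF D(1,2) p se K(1,2)])
      (use K(3) in eventually_elim, auto simp: u_def intro: eta_le_0)
  define \<theta> where "\<theta> = (\<lambda>x. indicator D x * eta' (u x))"
  have \<theta>r: "0 \<le> \<theta> x" "\<theta> x < 1" for x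
    using eta'_range[of "u x"] by (auto simp: \<theta>_def indicator_def)
  have meta: "(\<lambda>x. eta' (u x)) \<in> borel_measurable (lebesgue_on D)"
    using Lp_measurable[OF sobD(1)[OF su]] continuous_eta'
    by (intro measurable_compose[of u _ borel eta'] borel_measurable_continuous_onI) auto
  have \<theta>m: "\<theta> \<in> borel_measurable lebesgue"
    using meta measurable_lebesgue_on_iff[OF domD(1), of "\<lambda>x. eta' (u x)"] by (simp add: \<theta>_def)
  have int: "integrable lebesgue (\<lambda>x. \<theta> x * norm (W x) powr p)" if W: "Lp (lebesgue_on D) p W" for W
      :: "'a \<Rightarrow> 'a"
  proof -
    have "integrable (lebesgue_on D) (\<lambda>x. eta' (u x) * norm (W x) powr p)"
    proof (rule Bochner_Integration.integrable_bound)
      show "integrable (lebesgue_on D) (\<lambda>x. norm (W x) powr p)" using W by (simp add: Lp_def)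
      show "(\<lambda>x. eta' (u x) * norm (W x) powr p) \<in> borel_measurable (lebesgue_on D)"
        using meta Lp_measurable[OF W] by measurable
      show "AE x in lebesgue_on D. norm (eta' (u x) * norm (W x) powr p) \<le> norm (norm (W x) powr p)"
        using eta'_range(1) less_imp_le[OF eta'_range(2)]
        by (intro AE_I2) (auto simp: abs_mult intro!: mult_left_le_one_le)
    qed
    then show ?thesis by (simp add: \<theta>_def integral_lebesgue_on domD mult.assoc)
  qed
  \<comment> \<open>The weighted energy densities of the translate and, next, of \<open>v\<close>
    itself. The factor \<open>\<theta>\<close> vanishes off \<open>D\<close>, so both can be
    integrated over the whole space and shifted there.\<close>
  define J where "J = (\<lambda>x. \<theta> x * norm (V (x + h)) powr p)"
  define L where "L = (\<lambda>x. \<theta> x * norm (V x) powr p)"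
  have J: "integrable lebesgue J" unfolding J_def by (rule int[OF sobD(2)[OF shD]])
  have L: "integrable lebesgue L" unfolding L_def by (rule int[OF sobD(2)[OF svD]])
  have LJ: "(\<lambda>x. L x - J x) \<in> borel_measurable lebesgue" using J L by auto
  have shift: "(\<lambda>x. f (x - h)) \<in> borel_measurable lebesgue" "(\<integral>x. f (x - h) \<partial>lebesgue) = (\<integral>x. f x
      \<partial>lebesgue)"
    "integrable lebesgue (\<lambda>x. f (x - h)) \<longleftrightarrow> integrable lebesgue f"
    if "f \<in> borel_measurable lebesgue" for f :: "'a \<Rightarrow> real"
    using lebesgue_affine_integral[of 1 f "- h"] that by simp_all
  have z: "\<theta> x = 0" if "x \<notin> D" for x using that by (simp add: \<theta>_def)
  have z1: "\<theta> x = 0" if "x \<notin> \<Omega>" for x using that D(3) by (intro z) auto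
  have inD: "x \<in> \<Omega> \<and> x + h \<in> \<Omega>" if "x \<in> D" for x using that by (simp add: D_def)
  have z2: "\<theta> (x - h) = 0" if "x \<notin> \<Omega>" for x
    using that inD[of "x - h"] by (intro z) auto
  \<comment> \<open>The variation is the negative of the function shifted to \<open>D + h\<close>, a
    subset of \<open>\<Omega>\<close>, and extended by zero; it moves \<open>V x\<close> towards
    \<open>V (x - h)\<close>.\<close>
  have "0 \<le> (\<integral>x. \<theta> (x - h) * norm (V (x - h)) powr p - \<theta> (x - h) * norm (V x) powr p \<partial>(lebesgue_on
      \<Omega>))"
  proof (rule minimizer_convex_variation(1)[where \<theta> = "\<lambda>x. \<theta> (x - h)" and Q = "\<lambda>x. V (x - h)"])
    define D2 where "D2 = (\<lambda>x. x + - h) -` D"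
    have D2: "open D2" "D2 \<subseteq> \<Omega>"
      using open_vimage[OF D(1), of "\<lambda>x. x + - h"] inD by (force simp: D2_def intro:
          continuous_intros)+
    show "sob0 \<Omega> p (\<lambda>x. - (indicator D2 x * eta (u (x + - h))))
        (\<lambda>x. - (indicator D2 x *\<^sub>R (eta' (u (x + - h)) *\<^sub>R (V (x + - h + h) - V (x + - h)))))"
      by (intro sob0_uminus[OF \<Omega> p] sob0_extend[OF \<Omega>(1) D2 dom'(5)]
          sob0_shift[OF D(1,2) p s0, of "- h", folded D2_def])
    have ind: "indicator D2 x = (indicator D (x - h) :: real)" for x by (simp add: D2_def
        indicator_def)
    show "AE x in lebesgue_on \<Omega>. - (indicator D2 x *\<^sub>R (eta' (u (x + - h)) *\<^sub>R (V (x + - h + h) - V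
        (x + - h))))
        = \<theta> (x - h) *\<^sub>R (V (x - h) - V x)"
      by (intro AE_I2) (simp add: ind \<theta>_def algebra_simps)
    show "(\<lambda>x. \<theta> (x - h)) \<in> borel_measurable (lebesgue_on \<Omega>)"
      by (rule measurable_restrict_space1[OF shift(1)[OF \<theta>m]])
    have "integrable lebesgue (\<lambda>x. L (x - h))" using shift(3)[of L] L by auto
    then have "integrable lebesgue (\<lambda>x. indicator \<Omega> x * L (x - h))"
      using integrable_mult_indicator[OF dom'(1), of "\<lambda>x. L (x - h)"] by simp
    then show "integrable (lebesgue_on \<Omega>) (\<lambda>x. \<theta> (x - h) * norm (V (x - h)) powr p)"
      by (simp add: integral_lebesgue_on dom' L_def)
  qed (use \<theta>r in auto)
  also have "\<dots> = (\<integral>x. L (x - h) - J (x - h) \<partial>lebesgue)"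
    unfolding integral_lebesgue_on[OF dom'(1)]
    by (rule Bochner_Integration.integral_cong) (auto simp: L_def J_def z2 indicator_def)
  also have "\<dots> = (\<integral>x. L x \<partial>lebesgue) - (\<integral>x. J x \<partial>lebesgue)"
    using shift(2)[OF LJ] J L by simp
  finally have le: "(\<integral>x. J x \<partial>lebesgue) \<le> (\<integral>x. L x \<partial>lebesgue)" by simp
  \<comment> \<open>The other variation lives on \<open>D\<close>. By the inequality just obtained
    its comparison integral is nonpositive, so the equality case applies.\<close>
  have "AE x in lebesgue_on \<Omega>. indicator D x *\<^sub>R (eta' (u x) *\<^sub>R (V (x + h) - V x)) = 0"
  proof (rule minimizer_convex_variation(2)[OF sob0_extend[OF \<Omega>(1) D(1,3) dom'(5) s0], where \<theta> = \<theta>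
      and Q = "\<lambda>x. V (x + h)"])
    show "AE x in lebesgue_on \<Omega>. indicator D x *\<^sub>R (eta' (u x) *\<^sub>R (V (x + h) - V x)) = \<theta> x *\<^sub>R (V
        (x + h) - V x)"
      by (intro AE_I2) (simp add: \<theta>_def)
    show "\<theta> \<in> borel_measurable (lebesgue_on \<Omega>)" by (rule measurable_restrict_space1[OF \<theta>m])
    have "integrable lebesgue (\<lambda>x. indicator \<Omega> x * J x)"
      using integrable_mult_indicator[OF dom'(1) J] by simp
    then show "integrable (lebesgue_on \<Omega>) (\<lambda>x. \<theta> x * norm (V (x + h)) powr p)"
      by (simp add: integral_lebesgue_on dom' J_def)
    have "(\<integral>x. \<theta> x * norm (V (x + h)) powr p - \<theta> x * norm (V x) powr p \<partial>(lebesgue_on \<Omega>)) = (\<integral>x. J x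
        - L x \<partial>lebesgue)"
      unfolding integral_lebesgue_on[OF dom'(1)]
      by (rule Bochner_Integration.integral_cong) (auto simp: L_def J_def z1 indicator_def)
    then show "(\<integral>x. \<theta> x * norm (V (x + h)) powr p - \<theta> x * norm (V x) powr p \<partial>(lebesgue_on \<Omega>)) \<le> 0"
      using le J L by simp
  qed (use \<theta>r in auto)
  then have "AE x in lebesgue_on D. eta' (u x) *\<^sub>R (V (x + h) - V x) = 0"
    unfolding AE_lebesgue_on_iff[OF dom'(1)] AE_lebesgue_on_iff[OF domD(1)]
    by eventually_elim (use D(3) in auto)
  from sob0_integral_eq_0[OF D(1,2) p s0 this]
  have "AE x in lebesgue_on D. eta (u x) = 0"
    using integral_nonneg_eq_0_iff_AE[OF Lp_integrable[OF domD(2,3) sobD(1)[OF se]]] eta_nonneg by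
        simp
  then show ?thesis
  proof eventually_elim
    case (elim x)
    then show ?case using eta_pos_iff[of "u x"] by (simp add: not_less u_def)
  qed
qed

end

section \<open>Exterior balls and radial supersolutions\<close>

text \<open>The vector \<open>\<nu>\<close> is the unit normal pointing below the graph, and
  Taylor's formula leaves a quadratic error. In geometric terms the inequality says that for t \<le>
  1/(2L) the open ball of radius t centred at z + t \<nu>, which touches at \<open>z\<close>, does
  not meet \<open>\<Omega>\<close>.\<close>

lemma local_exterior_ball:
  fixes \<Omega> :: "'a::euclidean_space set"
  assumes \<Omega>: "open \<Omega>" and r: "r > 0" and e: "norm e = 1" and \<gamma>: "Ck 2 \<gamma>"
    and graph: "\<Omega> \<inter> ball x0 r = {x \<in> ball x0 r. x \<bullet> e > \<gamma> (x - (x \<bullet> e) *\<^sub>R e)}"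
  shows "\<exists>L>0. \<forall>z\<in>frontier \<Omega> \<inter> ball x0 (r / 2). \<exists>\<nu>. norm \<nu> = 1 \<and> (\<forall>x\<in>\<Omega>. (x - z) \<bullet> \<nu> \<le> L * (norm (x -
      z))\<^sup>2)"
proof -
  \<comment> \<open>Orthogonal projection onto the hyperplane normal to \<open>e\<close>, on which
    \<open>\<gamma>\<close> is evaluated; it is symmetric and does not increase norms.\<close>
  define P where "P = (\<lambda>x. x - (x \<bullet> e) *\<^sub>R e)"
  have ee: "e \<bullet> e = 1" using e by (simp add: dot_square_norm)
  have Pdiff: "P x - P y = P (x - y)" for x y by (simp add: P_def inner_diff_left algebra_simps)
  have Psym: "a \<bullet> P b = P a \<bullet> b" for a b by (simp add: P_def inner_diff_left inner_diff_right
      inner_commute)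
  have Pnorm: "norm (P x) \<le> norm x" for x
  proof -
    have "(norm (P x))\<^sup>2 = (norm x)\<^sup>2 - (x \<bullet> e)\<^sup>2"
      unfolding power2_norm_eq_inner P_def
      by (simp add: inner_diff_left inner_diff_right ee inner_commute power2_eq_square)
    then show ?thesis by (intro power2_le_imp_le[of "norm (P x)"]) auto
  qed
  define S where "S = cball (P x0) r"
  have cont: "continuous_on S (partial_deriv c (partial_deriv b \<gamma>))" if "b \<in> Basis" "c \<in> Basis" for
      b c
  proof -
    have "continuous_on UNIV (partial_deriv c (partial_deriv b \<gamma>))"
      using \<gamma> that by (auto simp: numeral_2_eq_2)
    then show ?thesis by (rule continuous_on_subset) simp
  qed
  have "\<exists>B. \<forall>x\<in>S. \<bar>partial_deriv c (partial_deriv b \<gamma>) x\<bar> \<le> B" if "b \<in> Basis" "c \<in> Basis" for b c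
  proof -
    have "bounded (partial_deriv c (partial_deriv b \<gamma>) ` S)"
      using compact_continuous_image[OF cont[OF that]] by (simp add: S_def compact_imp_bounded)
    then show ?thesis by (auto simp: bounded_iff)
  qed
  then obtain BB where BB: "\<And>b c x. b \<in> Basis \<Longrightarrow> c \<in> Basis \<Longrightarrow> x \<in> S \<Longrightarrow> \<bar>partial_deriv c (partial_deriv
      b \<gamma>) x\<bar> \<le> BB b c"
    by metis
  define B where "B = (\<Sum>b\<in>Basis. \<Sum>c\<in>Basis. \<bar>BB b c\<bar>)"
  have B0: "B \<ge> 0" by (simp add: B_def sum_nonneg)
  have B: "\<bar>partial_deriv c (partial_deriv b \<gamma>) x\<bar> \<le> B" if "b \<in> Basis" "c \<in> Basis" "x \<in> S" for b c x
  proof -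
    have "\<bar>BB b c\<bar> \<le> (\<Sum>c\<in>Basis. \<bar>BB b c\<bar>)" using that by (intro member_le_sum) auto
    also have "\<dots> \<le> B" unfolding B_def using that by (intro member_le_sum) (auto intro: sum_nonneg)
    finally show ?thesis using BB[OF that] by linarith
  qed
  define C where "C = (real DIM('a))\<^sup>2 * B"
  have C0: "C \<ge> 0" using B0 by (simp add: C_def)
  \<comment> \<open>\<open>C\<close> serves the points inside the chart. A point of
    \<open>\<Omega>\<close> outside it is at least r/2 away from \<open>z\<close>, which is taken
    from the ball of half the radius, and there |x - z| \<le> (2/r) |x - z|^2.\<close>
  define L where "L = C + 2 / r"
  have "L > 0" using C0 r by (simp add: L_def add_nonneg_pos)
  moreover have "\<exists>\<nu>. norm \<nu> = 1 \<and> (\<forall>x\<in>\<Omega>. (x - z) \<bullet> \<nu> \<le> L * (norm (x - z))\<^sup>2)"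
    if z: "z \<in> frontier \<Omega>" "z \<in> ball x0 (r / 2)" for z
  proof -
    have zr: "z \<in> ball x0 r" using z r by auto
    have "z \<notin> \<Omega>" using z \<Omega> by (simp add: frontier_def interior_open)
    then have zg: "z \<bullet> e \<le> \<gamma> (P z)" using graph zr by (force simp: P_def)
    have inS: "P y \<in> S" if "y \<in> ball x0 r" for y
      using Pnorm[of "x0 - y"] that by (simp add: S_def dist_norm Pdiff)
    \<comment> \<open>A normal to the graph. The gradient is projected because
      \<open>\<gamma>\<close> enters only through its restriction to the hyperplane. The component
      of \<open>N\<close> along \<open>e\<close> is then one, so |N| \<ge> 1 and normalising does
      not worsen the constant.\<close>
    define N where "N = e - P (grad \<gamma> (P z))"
    have Ne: "N \<bullet> e = 1" by (simp add: N_def P_def inner_diff_left ee)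
    have N1: "norm N \<ge> 1" using norm_cauchy_schwarz[of N e] Ne e by simp
    define \<nu> where "\<nu> = (- 1 / norm N) *\<^sub>R N"
    have "N \<noteq> 0" using N1 by (metis norm_zero not_one_le_zero)
    then have \<nu>1: "norm \<nu> = 1" by (simp add: \<nu>_def)
    have "(x - z) \<bullet> \<nu> \<le> L * (norm (x - z))\<^sup>2" if x: "x \<in> \<Omega>" for x
    proof (cases "x \<in> ball x0 r")
      case True
      have "x \<in> \<Omega> \<inter> ball x0 r" using x True by blast
      then have "x \<bullet> e > \<gamma> (P x)" unfolding graph by (simp add: P_def)
      then have "(x - z) \<bullet> e \<ge> \<gamma> (P x) - \<gamma> (P z)" using zg by (simp add: inner_diff_left)
      moreover have "\<bar>\<gamma> (P x) - \<gamma> (P z) - grad \<gamma> (P z) \<bullet> (P x - P z)\<bar> \<le> C * (norm (P x - P z))\<^sup>2"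
        unfolding C_def by (rule taylor_bound[OF \<gamma>, of S]) (use B B0 inS True zr in \<open>auto simp:
            S_def\<close>)
      moreover have "C * (norm (P x - P z))\<^sup>2 \<le> C * (norm (x - z))\<^sup>2"
        using C0 Pnorm[of "x - z"] by (intro mult_left_mono power_mono) (auto simp: Pdiff)
      moreover have "(x - z) \<bullet> N = (x - z) \<bullet> e - grad \<gamma> (P z) \<bullet> (P x - P z)"
      proof -
        have "(x - z) \<bullet> N = (x - z) \<bullet> e - (x - z) \<bullet> P (grad \<gamma> (P z))"
          unfolding N_def by (rule inner_diff_right)
        also have "(x - z) \<bullet> P (grad \<gamma> (P z)) = P (x - z) \<bullet> grad \<gamma> (P z)" by (rule Psym)
        also have "\<dots> = grad \<gamma> (P z) \<bullet> (P x - P z)" unfolding Pdiff by (rule inner_commute)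
        finally show ?thesis .
      qed
      ultimately have "- ((x - z) \<bullet> N) \<le> C * (norm (x - z))\<^sup>2" by linarith
      then have "(- ((x - z) \<bullet> N)) / norm N \<le> C * (norm (x - z))\<^sup>2 / norm N"
        using N1 by (intro divide_right_mono) auto
      also have "\<dots> \<le> C * (norm (x - z))\<^sup>2 / 1"
        using N1 C0 by (intro divide_left_mono) auto
      also have "\<dots> \<le> L * (norm (x - z))\<^sup>2" unfolding L_def div_by_1 using r by (intro
          mult_right_mono) auto
      finally show ?thesis by (simp add: \<nu>_def)
    next
      case False
      have "norm (x - z) \<ge> r / 2"
        using False z norm_triangle_ineq[of "x0 - z" "z - x"] by (simp add: dist_norm
            norm_minus_commute)
      then have "norm (x - z) * 1 \<le> norm (x - z) * (2 / r * norm (x - z))"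
        using r by (intro mult_left_mono) (auto simp: field_simps)
      also have "\<dots> = (2 / r) * (norm (x - z))\<^sup>2" by (simp add: power2_eq_square)
      also have "\<dots> \<le> L * (norm (x - z))\<^sup>2" unfolding L_def using C0 by (intro mult_right_mono) auto
      finally show ?thesis using norm_cauchy_schwarz[of "x - z" \<nu>] \<nu>1 by simp
    qed
    then show ?thesis using \<nu>1 by blast
  qed
  ultimately show ?thesis by auto
qed

text \<open>Compactness of the boundary: finitely many charts cover it, and the inequality persists
  when its constant grows. The summand 1 makes the constant positive whatever the cover.\<close>

lemma uniform_exterior_ball:
  fixes \<Omega> :: "'a::euclidean_space set"
  assumes "bounded_C2_domain \<Omega>"
  shows "\<exists>L>0. \<forall>z\<in>frontier \<Omega>. \<exists>\<nu>. norm \<nu> = 1 \<and> (\<forall>x\<in>\<Omega>. (x - z) \<bullet> \<nu> \<le> L * (norm (x - z))\<^sup>2)"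
proof -
  have \<Omega>: "open \<Omega>" "bounded \<Omega>" "C2_boundary \<Omega>" using assms by (auto simp: bounded_C2_domain_def)
  have comp: "compact (frontier \<Omega>)" by (rule compact_frontier_bounded[OF \<Omega>(2)])
  define good where "good = (\<lambda>L z. \<exists>\<nu>::'a. norm \<nu> = 1 \<and> (\<forall>x\<in>\<Omega>. (x - z) \<bullet> \<nu> \<le> L * (norm (x - z))\<^sup>2))"
  have mono: "good L' z" if "good L z" "L \<le> L'" for L L' z
  proof -
    from that(1) obtain \<nu> :: 'a where \<nu>: "norm \<nu> = 1" "\<And>x. x \<in> \<Omega> \<Longrightarrow> (x - z) \<bullet> \<nu> \<le> L * (norm (x -
        z))\<^sup>2"
      unfolding good_def by blast
    have "(x - z) \<bullet> \<nu> \<le> L' * (norm (x - z))\<^sup>2" if "x \<in> \<Omega>" for x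
      using \<nu>(2)[OF that] mult_right_mono[OF \<open>L \<le> L'\<close>, of "(norm (x - z))\<^sup>2"] by simp
    then show ?thesis unfolding good_def using \<nu>(1) by blast
  qed
  have "\<exists>r L. r > 0 \<and> L > 0 \<and> (\<forall>z\<in>frontier \<Omega> \<inter> ball x0 r. good L z)" if x0: "x0 \<in> frontier \<Omega>" for x0
  proof -
    obtain r e \<gamma> where "r > 0" "norm e = 1" "Ck 2 \<gamma>"
      "\<Omega> \<inter> ball x0 r = {x \<in> ball x0 r. x \<bullet> e > \<gamma> (x - (x \<bullet> e) *\<^sub>R e)}"
      using \<Omega>(3) x0 unfolding C2_boundary_def by meson
    from local_exterior_ball[OF \<Omega>(1) this] obtain L where "L > 0"
      "\<forall>z\<in>frontier \<Omega> \<inter> ball x0 (r / 2). good L z" unfolding good_def by blast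
    with \<open>r > 0\<close> show ?thesis by (intro exI[of _ "r / 2"] exI[of _ L]) auto
  qed
  then obtain r L where rL: "\<And>x0. x0 \<in> frontier \<Omega> \<Longrightarrow> r x0 > 0 \<and> L x0 > 0 \<and> (\<forall>z\<in>frontier \<Omega> \<inter> ball x0
      (r x0). good (L x0) z)"
    by metis
  have cover: "frontier \<Omega> \<subseteq> (\<Union>x\<in>frontier \<Omega>. ball x (r x))" using rL by force
  obtain T where T: "T \<subseteq> frontier \<Omega>" "finite T" "frontier \<Omega> \<subseteq> (\<Union>x\<in>T. ball x (r x))"
    using compactE_image[OF comp _ cover] by blast
  have "good (1 + (\<Sum>x\<in>T. L x)) z" if z: "z \<in> frontier \<Omega>" for z
  proof -
    obtain x0 where x0: "x0 \<in> T" "z \<in> ball x0 (r x0)" using T(3) z by blast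
    have "L x0 \<le> (\<Sum>x\<in>T. L x)" using T rL x0 by (intro member_le_sum) (auto intro: less_imp_le)
    moreover have "good (L x0) z" using rL[of x0] T(1) x0 z by blast
    ultimately show ?thesis using mono[of "L x0" z "1 + (\<Sum>x\<in>T. L x)"] by linarith
  qed
  moreover have "1 + (\<Sum>x\<in>T. L x) > 0" using T(1) rL by (intro add_pos_nonneg sum_nonneg) (auto
      intro: less_imp_le)
  ultimately show ?thesis unfolding good_def by blast
qed

section \<open>Radial fields and sums of radial potentials\<close>

lemma has_derivative_norm_powr:
  fixes f :: "'a::real_normed_vector \<Rightarrow> 'b::euclidean_space"
  assumes f: "(f has_derivative f') (at x)" and x: "f x \<noteq> 0"
  shows "((\<lambda>x. norm (f x) powr a) has_derivative (\<lambda>h. a * norm (f x) powr (a - 2) * (f x \<bullet> f' h)))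
      (at x)"
proof -
  have "(norm has_derivative (\<lambda>h. h \<bullet> sgn (f x))) (at (f x))"
    by (rule has_derivative_norm[OF x])
  from has_derivative_compose[OF f this]
  have "((\<lambda>x. norm (f x)) has_derivative (\<lambda>h. sgn (f x) \<bullet> f' h)) (at x)"
    unfolding inner_commute[of "sgn (f x)"] .
  moreover have "((\<lambda>t. t powr a) has_derivative (\<lambda>h. a * norm (f x) powr (a - 1) * h)) (at (norm (f
      x)))"
  proof -
    have "((\<lambda>t. t powr a) has_real_derivative a * norm (f x) powr (a - 1)) (at (norm (f x)))"
      using x by (auto intro!: derivative_eq_intros simp: powr_diff)
    then show ?thesis by (simp add: has_field_derivative_def)
  qed
  ultimately have "((\<lambda>x. norm (f x) powr a) has_derivative (\<lambda>h. a * norm (f x) powr (a - 1) * (sgn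
      (f x) \<bullet> f' h))) (at x)"
    by (rule has_derivative_compose)
  moreover have "a * norm (f x) powr (a - 1) * (sgn (f x) \<bullet> f' h) = a * norm (f x) powr (a - 2) * (f
      x \<bullet> f' h)" for h
  proof -
    have "norm (f x) powr (a - 1) = norm (f x) powr (a - 2) * norm (f x)"
      using powr_add[of "norm (f x)" "a - 2" 1] x by simp
    then show ?thesis using x by (simp add: sgn_div_norm)
  qed
  ultimately show ?thesis by simp
qed

text \<open>With \<open>q = s + 2\<close> this is the gradient of -|x - y|^(-s) / s, a potential
  that increases away from its pole \<open>y\<close>; \<open>radial'\<close> is the corresponding
  Hessian, a linear map in its last argument.\<close>

definition radial :: "real \<Rightarrow> 'a::euclidean_space \<Rightarrow> 'a \<Rightarrow> 'a" where
  "radial q y x = norm (x - y) powr (- q) *\<^sub>R (x - y)"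

definition radial' :: "real \<Rightarrow> 'a::euclidean_space \<Rightarrow> 'a \<Rightarrow> 'a \<Rightarrow> 'a" where
  "radial' q y x h = norm (x - y) powr (- q) *\<^sub>R h
    - (q * norm (x - y) powr (- q - 2) * ((x - y) \<bullet> h)) *\<^sub>R (x - y)"

lemma radial_has_derivative:
  assumes "x \<noteq> y"
  shows "(radial q y has_derivative radial' q y x) (at x)"
proof -
  have d: "((\<lambda>x. x - y) has_derivative (\<lambda>h. h)) (at x)" by (auto intro!: derivative_eq_intros)
  have "((\<lambda>x. norm (x - y) powr (- q) *\<^sub>R (x - y)) has_derivative
      (\<lambda>h. norm (x - y) powr (- q) *\<^sub>R h + (- q * norm (x - y) powr (- q - 2) * ((x - y) \<bullet> h)) *\<^sub>R
          (x - y))) (at x)"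
    by (rule has_derivative_scaleR[OF has_derivative_norm_powr[OF d] d]) (use assms in simp)
  then show ?thesis unfolding radial_def[abs_def] radial'_def[abs_def] by simp
qed

lemma radial_potential_has_derivative:
  assumes "x \<noteq> y"
  shows "((\<lambda>x. norm (x - y) powr (- s)) has_derivative (\<lambda>h. - (s * (radial (s + 2) y x \<bullet> h)))) (at
      x)"
proof -
  have d: "((\<lambda>x. x - y) has_derivative (\<lambda>h. h)) (at x)" by (auto intro!: derivative_eq_intros)
  have e: "- s - 2 = - (s + 2)" by simp
  have "((\<lambda>x. norm (x - y) powr (- s)) has_derivative (\<lambda>h. - s * norm (x - y) powr (- s - 2) * ((x -
      y) \<bullet> h))) (at x)"
    by (rule has_derivative_norm_powr[OF d]) (use assms in simp)
  moreover have "- s * norm (x - y) powr (- s - 2) * ((x - y) \<bullet> h) = - (s * (radial (s + 2) y x \<bullet>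
      h))" for h
    unfolding e radial_def by simp
  ultimately show ?thesis by (simp only:)
qed

lemma radial'_sym: "radial' q y x h \<bullet> k = h \<bullet> radial' q y x k"
  by (simp add: radial'_def inner_diff_left[of "_ *\<^sub>R _" "_ *\<^sub>R _"] inner_diff_right[of _ "_ *\<^sub>R _"
      "_ *\<^sub>R _"]
      inner_commute[of h "x - y"])

lemma continuous_radial:
  assumes "y \<notin> S" shows "continuous_on S (radial q y)"
  unfolding radial_def[abs_def] using assms by (intro continuous_intros) auto

lemma continuous_radial':
  assumes "y \<notin> S" "continuous_on S E" shows "continuous_on S (\<lambda>x. radial' q y x (E x))"
  unfolding radial'_def using assms by (intro continuous_intros) auto

text \<open>For large \<open>q\<close> the bound holds whatever the direction of \<open>D\<close>; this makes sums of
  radial supersolutions supersolutions, although the operator is nonlinear.\<close>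

lemma radial_pucci:
  fixes x y D :: "'a::euclidean_space"
  assumes xy: "x \<noteq> y" and D: "D \<noteq> 0" and q: "q \<ge> 0" "real DIM('a) + p - 2 \<le> q" "real DIM('a) + p - 2
      \<le> (p - 1) * q"
  shows "norm D powr (p - 2) * (\<Sum>b\<in>Basis. radial' q y x b \<bullet> b)
    + (p - 2) * norm D powr (p - 4) * (radial' q y x D \<bullet> D) \<le> 0"
proof -
  define N where "N = real DIM('a)"
  define w where "w = x - y"
  \<comment> \<open>Two quantities describe everything: the expression equals (N - q) \<alpha> + (p
    - 2) (\<alpha> - q \<mu>). The angle between \<open>D\<close> and the radial direction enters
    only through \<mu>, which Cauchy-Schwarz confines to the interval from 0 to \<alpha>.\<close>
  define \<alpha> where "\<alpha> = norm D powr (p - 2) * norm w powr (- q)"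
  define \<mu> where "\<mu> = norm D powr (p - 4) * norm w powr (- q - 2) * (w \<bullet> D)\<^sup>2"
  have w: "w \<noteq> 0" using xy by (simp add: w_def)
  have w2: "norm w powr (- q - 2) * (w \<bullet> w) = norm w powr (- q)"
    using powr_add[of "norm w" "- q - 2" 2] w by (simp add: dot_square_norm)
  have D2: "norm D powr (p - 4) * (D \<bullet> D) = norm D powr (p - 2)"
    using powr_add[of "norm D" "p - 4" 2] D by (simp add: dot_square_norm)
  have \<mu>0: "\<mu> \<ge> 0" by (simp add: \<mu>_def)
  have "(w \<bullet> D)\<^sup>2 \<le> (w \<bullet> w) * (D \<bullet> D)" by (rule Cauchy_Schwarz_ineq)
  then have "\<mu> \<le> norm D powr (p - 4) * norm w powr (- q - 2) * ((w \<bullet> w) * (D \<bullet> D))"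
    unfolding \<mu>_def by (intro mult_left_mono) auto
  also have "\<dots> = (norm D powr (p - 4) * (D \<bullet> D)) * (norm w powr (- q - 2) * (w \<bullet> w))" by (simp add:
      mult_ac)
  also have "\<dots> = \<alpha>" unfolding w2 D2 \<alpha>_def ..
  finally have \<mu>\<alpha>: "\<mu> \<le> \<alpha>" .
  have \<alpha>0: "\<alpha> \<ge> 0" by (simp add: \<alpha>_def)
  have "(\<Sum>b\<in>Basis. radial' q y x b \<bullet> b) = (\<Sum>b\<in>(Basis::'a set). norm w powr (- q) - q * norm w powr
      (- q - 2) * ((w \<bullet> b) * (w \<bullet> b)))"
    by (rule sum.cong) (simp_all add: radial'_def inner_diff_left w_def)
  also have "\<dots> = N * norm w powr (- q) - q * norm w powr (- q - 2) * (w \<bullet> w)"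
    by (simp add: sum_subtractf N_def sum_distrib_left[symmetric] euclidean_inner[of w w])
  also have "\<dots> = (N - q) * norm w powr (- q)" using w2 by (simp add: algebra_simps)
  finally have tr: "norm D powr (p - 2) * (\<Sum>b\<in>Basis. radial' q y x b \<bullet> b) = (N - q) * \<alpha>"
    by (simp add: \<alpha>_def)
  have rD: "radial' q y x D \<bullet> D = norm w powr (- q) * (D \<bullet> D) - q * norm w powr (- q - 2) * (w \<bullet>
      D)\<^sup>2"
    by (simp add: radial'_def inner_diff_left w_def power2_eq_square)
  have "norm D powr (p - 4) * (radial' q y x D \<bullet> D) = (norm D powr (p - 4) * (D \<bullet> D)) * norm w powr
      (- q) - q * \<mu>"
    unfolding rD by (simp add: \<mu>_def algebra_simps)
  then have dd: "norm D powr (p - 4) * (radial' q y x D \<bullet> D) = \<alpha> - q * \<mu>" unfolding D2 by (simp add: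
      \<alpha>_def)
  \<comment> \<open>The expression is affine in \<mu>, so the worst direction is an extreme one:
    \<mu> = 0 for p \<ge> 2, and \<mu> = \<alpha> for p < 2. These two cases are the origin of the
    two lower bounds on \<open>q\<close>.\<close>
  have "(N - q) * \<alpha> + (p - 2) * (\<alpha> - q * \<mu>) \<le> 0"
  proof (cases "p \<ge> 2")
    case True
    have "0 \<le> (p - 2) * (q * \<mu>)" using True q \<mu>0 by simp
    moreover have "(N + p - 2 - q) * \<alpha> \<le> 0" using q \<alpha>0 by (intro mult_nonpos_nonneg) (auto simp:
        N_def)
    ultimately show ?thesis by (simp add: algebra_simps)
  next
    case False
    have "(2 - p) * (q * \<mu>) \<le> (2 - p) * (q * \<alpha>)" using False q \<mu>\<alpha> by (intro mult_left_mono) auto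
    moreover have "(N + p - 2 - (p - 1) * q) * \<alpha> \<le> 0" using q \<alpha>0 by (intro mult_nonpos_nonneg) (auto
        simp: N_def)
    ultimately show ?thesis by (simp add: algebra_simps)
  qed
  then show ?thesis by (simp add: tr dd mult.assoc)
qed

context
  fixes \<Omega> :: "'a::euclidean_space set" and p :: real and v :: "'a \<Rightarrow> real" and V :: "'a \<Rightarrow> 'a"
  assumes \<Omega>: "open \<Omega>" "bounded \<Omega>" and p: "p > 1" and v: "sob \<Omega> p v V"
    and minimal: "\<And>\<psi> H. sob0 \<Omega> p \<psi> H \<Longrightarrow>
      (\<integral>x. norm (V x) powr p \<partial>(lebesgue_on \<Omega>)) \<le> (\<integral>x. norm (V x + H x) powr p \<partial>(lebesgue_on \<Omega>))"
begin

text \<open>For a frozen gradient \<open>D\<close> the divergence of the flux is linear in the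
  second derivatives. It therefore splits over the poles, and \<open>radial_pucci\<close> applies to
  each term with the common \<open>D\<close>. That \<open>D\<close> does not vanish on the closure
  keeps powers of |D| with negative exponents smooth and, by compactness, bounded.\<close>

lemma minimizer_le_radial_barrier:
  fixes c :: "'j \<Rightarrow> real" and y :: "'j \<Rightarrow> 'a"
  assumes vg: "sob0 \<Omega> p (\<lambda>x. v x - g x) (\<lambda>x. V x - G x)" and g: "sob \<Omega> p g G"
    and J: "finite J" "\<And>j. j \<in> J \<Longrightarrow> c j > 0" "\<And>j. j \<in> J \<Longrightarrow> y j \<notin> closure \<Omega>"
    and s: "s > 0" "real DIM('a) + p - 2 \<le> s + 2" "real DIM('a) + p - 2 \<le> (p - 1) * (s + 2)"
    and D0: "\<And>x. x \<in> closure \<Omega> \<Longrightarrow> (\<Sum>j\<in>J. c j *\<^sub>R radial (s + 2) (y j) x) \<noteq> 0"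
    and gF: "AE x in lebesgue_on \<Omega>. g x \<le> A - (\<Sum>j\<in>J. (c j / s) * norm (x - y j) powr (- s))"
  shows "AE x in lebesgue_on \<Omega>. v x \<le> A - (\<Sum>j\<in>J. (c j / s) * norm (x - y j) powr (- s))"
proof -
  define q where "q = s + 2"
  define F where "F = (\<lambda>x. A - (\<Sum>j\<in>J. (c j / s) * norm (x - y j) powr (- s)))"
  define D where "D = (\<lambda>x. \<Sum>j\<in>J. c j *\<^sub>R radial q (y j) x)"
  define D' where "D' = (\<lambda>x h. \<Sum>j\<in>J. c j *\<^sub>R radial' q (y j) x h)"
  \<comment> \<open>The gradient of the component along \<open>b\<close> of the flux |D|^(p-2) D;
    symmetry of the Hessian \<open>D'\<close> brings the derivative into the form of an inner
    product with the increment.\<close>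
  define U where "U = (\<lambda>b x. norm (D x) powr (p - 2) *\<^sub>R D' x b
    + ((p - 2) * norm (D x) powr (p - 4) * (D x \<bullet> b)) *\<^sub>R D' x (D x))"
  have cl: "x \<in> closure \<Omega>" if "x \<in> \<Omega>" for x using that closure_subset by blast
  have ne: "x \<noteq> y j" if "x \<in> \<Omega>" "j \<in> J" for x j using J(3)[OF that(2)] cl[OF that(1)] by blast
  have D0': "D x \<noteq> 0" if "x \<in> closure \<Omega>" for x using D0[OF that] by (simp add: D_def q_def)
  have cD: "continuous_on (closure \<Omega>) D"
    unfolding D_def by (intro continuous_intros continuous_radial J(3))
  have cD': "continuous_on (closure \<Omega>) (\<lambda>x. D' x (E x))" if "continuous_on (closure \<Omega>) E" for E
    unfolding D'_def using that by (intro continuous_intros continuous_radial' J(3))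
  have cU: "continuous_on (closure \<Omega>) (U b)" for b
    unfolding U_def using D0' by (intro continuous_intros cD cD') auto
  have cF: "continuous_on (closure \<Omega>) F"
    unfolding F_def using J(3) by (intro continuous_intros) auto
  have bdd: "\<exists>B\<ge>0. \<forall>x\<in>\<Omega>. norm (f x) \<le> B" if "continuous_on (closure \<Omega>) f" for f :: "'a \<Rightarrow>
      'b::real_normed_vector"
  proof -
    have "compact (f ` closure \<Omega>)" using that \<Omega>(2) by (intro compact_continuous_image) (auto simp:
        compact_closure)
    then obtain B where "B > 0" "\<forall>z\<in>f ` closure \<Omega>. norm z \<le> B" using compact_imp_bounded bounded_pos
        by metis
    then show ?thesis using cl by (intro exI[of _ B]) auto
  qed
  obtain B1 where B1: "B1 \<ge> 0" "\<And>x. x \<in> \<Omega> \<Longrightarrow> norm (F x) \<le> B1" using bdd[OF cF] by blast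
  obtain B2 where B2: "B2 \<ge> 0" "\<And>x. x \<in> \<Omega> \<Longrightarrow> norm (D x) \<le> B2" using bdd[OF cD] by blast
  have "continuous_on (closure \<Omega>) (\<lambda>x. \<Sum>b\<in>Basis. U b x \<bullet> b)" by (intro continuous_intros cU)
  from bdd[OF this] obtain B3 where B3: "\<And>x. x \<in> \<Omega> \<Longrightarrow> norm (\<Sum>b\<in>Basis. U b x \<bullet> b) \<le> B3" by blast
  have "AE x in lebesgue_on \<Omega>. v x \<le> F x"
  proof (rule minimizer_le_supersolution[OF \<Omega> p v minimal vg g, where D = D and U = U and B = "B1 +
      B2" and B' = B3])
    fix x assume x: "x \<in> \<Omega>"
    show "(F has_derivative (\<lambda>h. D x \<bullet> h)) (at x)"
    proof -
      have "(F has_derivative (\<lambda>h. 0 - (\<Sum>j\<in>J. (c j / s) * - (s * (radial (s + 2) (y j) x \<bullet> h)))))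
          (at x)"
        unfolding F_def
        by (intro has_derivative_diff has_derivative_const has_derivative_sum
            has_derivative_mult_right
            radial_potential_has_derivative ne x)
      then show ?thesis
        by (rule has_derivative_eq_rhs) (use s in \<open>simp add: D_def q_def inner_sum_left sum_negf\<close>)
    qed
    show "\<bar>F x\<bar> \<le> B1 + B2" "norm (D x) \<le> B1 + B2" using B1(2)[OF x] B2(2)[OF x] B1(1) B2(1) by auto
    show "\<bar>\<Sum>b\<in>Basis. U b x \<bullet> b\<bar> \<le> B3" using B3[OF x] by simp
    have dD: "(D has_derivative D' x) (at x)"
      unfolding D_def D'_def[abs_def]
      by (intro has_derivative_sum has_derivative_scaleR_right radial_has_derivative ne x)
    have sym: "D' x h \<bullet> k = h \<bullet> D' x k" for h k
      by (simp add: D'_def inner_sum_left inner_sum_right radial'_sym)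
    show "((\<lambda>x. pflux p (D x) \<bullet> b) has_derivative (\<lambda>h. U b x \<bullet> h)) (at x)" for b
    proof -
      have "((\<lambda>x. norm (D x) powr (p - 2) * (D x \<bullet> b)) has_derivative
         (\<lambda>h. norm (D x) powr (p - 2) * (D' x h \<bullet> b)
           + ((p - 2) * norm (D x) powr (p - 2 - 2) * (D x \<bullet> D' x h)) * (D x \<bullet> b))) (at x)"
        by (intro has_derivative_mult has_derivative_norm_powr[OF dD D0'[OF cl[OF x]]]
            has_derivative_inner_left dD)
      moreover have "norm (D x) powr (p - 2) * (D' x h \<bullet> b)
           + ((p - 2) * norm (D x) powr (p - 2 - 2) * (D x \<bullet> D' x h)) * (D x \<bullet> b) = U b x \<bullet> h" for h
        unfolding U_def inner_add_left inner_scaleR_left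
        by (simp add: sym[of h b] sym[of "D x" h, symmetric] inner_commute[of h] mult_ac)
      ultimately show ?thesis by (simp add: pflux_def)
    qed
    \<comment> \<open>The divergence of the flux: |D|^(p-2) times the trace of the Hessian, plus
      (p-2) |D|^(p-4) times the Hessian evaluated on \<open>D\<close>.\<close>
    have "(\<Sum>b\<in>Basis. U b x \<bullet> b) = norm (D x) powr (p - 2) * (\<Sum>b\<in>Basis. D' x b \<bullet> b)
        + (p - 2) * norm (D x) powr (p - 4) * (\<Sum>b\<in>Basis. (D x \<bullet> b) * (D' x (D x) \<bullet> b))"
      by (simp add: U_def inner_add_left sum.distrib sum_distrib_left sum_distrib_right mult_ac)
    also have "(\<Sum>b\<in>Basis. (D x \<bullet> b) * (D' x (D x) \<bullet> b)) = D' x (D x) \<bullet> D x"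
      unfolding inner_commute[of "D' x (D x)" "D x"] by (rule euclidean_inner[symmetric])
    also have "(\<Sum>b\<in>Basis. D' x b \<bullet> b) = (\<Sum>j\<in>J. c j * (\<Sum>b\<in>Basis. radial' q (y j) x b \<bullet> b))"
      unfolding D'_def inner_sum_left sum_distrib_left by (subst sum.swap) simp
    also have "D' x (D x) \<bullet> D x = (\<Sum>j\<in>J. c j * (radial' q (y j) x (D x) \<bullet> D x))"
      by (simp add: D'_def inner_sum_left)
    also have "norm (D x) powr (p - 2) * (\<Sum>j\<in>J. c j * (\<Sum>b\<in>Basis. radial' q (y j) x b \<bullet> b))
        + (p - 2) * norm (D x) powr (p - 4) * (\<Sum>j\<in>J. c j * (radial' q (y j) x (D x) \<bullet> D x))
        = (\<Sum>j\<in>J. c j * (norm (D x) powr (p - 2) * (\<Sum>b\<in>Basis. radial' q (y j) x b \<bullet> b)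
            + (p - 2) * norm (D x) powr (p - 4) * (radial' q (y j) x (D x) \<bullet> D x)))"
      by (simp add: sum.distrib[symmetric] sum_distrib_left distrib_left mult_ac)
    also have "\<dots> \<le> 0"
    proof (rule sum_nonpos)
      fix j assume j: "j \<in> J"
      have "norm (D x) powr (p - 2) * (\<Sum>b\<in>Basis. radial' q (y j) x b \<bullet> b)
            + (p - 2) * norm (D x) powr (p - 4) * (radial' q (y j) x (D x) \<bullet> D x) \<le> 0"
        using s unfolding q_def by (intro radial_pucci ne x j D0'[OF cl[OF x]]) auto
      then show "c j * (norm (D x) powr (p - 2) * (\<Sum>b\<in>Basis. radial' q (y j) x b \<bullet> b)
            + (p - 2) * norm (D x) powr (p - 4) * (radial' q (y j) x (D x) \<bullet> D x)) \<le> 0"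
        using J(2)[OF j] by (intro mult_nonneg_nonpos) auto
    qed
    finally show "(\<Sum>b\<in>Basis. U b x \<bullet> b) \<le> 0" .
  next
    show "continuous_on \<Omega> D" "continuous_on \<Omega> (U b)" for b
      by (rule continuous_on_subset[OF cD closure_subset], rule continuous_on_subset[OF cU
          closure_subset])
    show "AE x in lebesgue_on \<Omega>. g x \<le> F x" using gF by (simp add: F_def)
  qed
  then show ?thesis by (simp add: F_def)
qed

end

section \<open>Barriers at the boundary\<close>

text \<open>Touching from outside would follow from 2 L t \<le> 1. Halving the admissible radius
  leaves a surplus |x - z|^2 / 2, and this makes the barrier of order one at distance t from the
  contact point even in tangential directions.\<close>

lemma exterior_ball_dist:
  fixes x z \<nu> :: "'a::euclidean_space"
  assumes \<nu>: "norm \<nu> = 1" and L: "(x - z) \<bullet> \<nu> \<le> L * (norm (x - z))\<^sup>2" and t: "t > 0" "4 * L * t \<le> 1"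
  shows "t\<^sup>2 + (norm (x - z))\<^sup>2 / 2 \<le> (norm (x - (z + t *\<^sub>R \<nu>)))\<^sup>2"
proof -
  have "x - (z + t *\<^sub>R \<nu>) = (x - z) - t *\<^sub>R \<nu>" by simp
  then have "(norm (x - (z + t *\<^sub>R \<nu>)))\<^sup>2 = (norm (x - z))\<^sup>2 - 2 * t * ((x - z) \<bullet> \<nu>) + t\<^sup>2 * (norm
      \<nu>)\<^sup>2"
    unfolding power2_norm_eq_inner
    by (simp only: inner_diff_left inner_diff_right inner_scaleR_left inner_scaleR_right)
      (simp add: inner_commute power2_eq_square algebra_simps)
  moreover have "2 * t * ((x - z) \<bullet> \<nu>) \<le> 2 * t * (L * (norm (x - z))\<^sup>2)"
    using t(1) by (intro mult_left_mono L) auto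
  moreover have "2 * t * (L * (norm (x - z))\<^sup>2) \<le> (norm (x - z))\<^sup>2 / 2"
    using mult_right_mono[OF t(2), of "(norm (x - z))\<^sup>2"] by (simp add: algebra_simps)
  ultimately show ?thesis using \<nu> by simp
qed

text \<open>The barrier at scale \<open>t\<close>: zero on the exterior ball of radius \<open>t\<close>, of order one at
  distance \<open>t\<close> from the contact point, and growing with slope of order \<open>1 / t\<close>.\<close>

definition ball_barrier :: "real \<Rightarrow> real \<Rightarrow> 'a::euclidean_space \<Rightarrow> 'a \<Rightarrow> real" where
  "ball_barrier s t y x = 1 - t powr s * norm (x - y) powr (- s)"

text \<open>With r the distance to the centre, the barrier is 1 - (r/t)^(-s). The bounds come from r
  \<ge> t, from r^2 \<ge> (3/2) t^2 once |x - z| \<ge> t, and from r \<le> t + |x - z| together with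
  (1 + d)^(-s) \<ge> 1 - s d.\<close>

lemma ball_barrier_bounds:
  fixes x z \<nu> :: "'a::euclidean_space"
  assumes \<nu>: "norm \<nu> = 1" and L: "(x - z) \<bullet> \<nu> \<le> L * (norm (x - z))\<^sup>2" and t: "t > 0" "4 * L * t \<le> 1"
      and s: "s > 0"
  shows "0 \<le> ball_barrier s t (z + t *\<^sub>R \<nu>) x"
    and "ball_barrier s t (z + t *\<^sub>R \<nu>) x \<le> 1"
    and "norm (x - z) \<ge> t \<Longrightarrow> 1 - sqrt (3 / 2) powr (- s) \<le> ball_barrier s t (z + t *\<^sub>R \<nu>) x"
    and "ball_barrier s t (z + t *\<^sub>R \<nu>) x \<le> s * norm (x - z) / t"
proof -
  define r where "r = norm (x - (z + t *\<^sub>R \<nu>))"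
  have r2: "t\<^sup>2 + (norm (x - z))\<^sup>2 / 2 \<le> r\<^sup>2" unfolding r_def by (rule exterior_ball_dist[OF \<nu> L t])
  have r0: "r \<ge> 0" by (simp add: r_def)
  have rt: "t \<le> r" by (rule power2_le_imp_le[OF _ r0]) (use r2 zero_le_power2[of "norm (x - z)"] in
      linarith)
  then have rpos: "r > 0" using t by simp
  have b: "ball_barrier s t (z + t *\<^sub>R \<nu>) x = 1 - (r / t) powr (- s)"
  proof -
    have "(r / t) powr (- s) = t powr s * r powr (- s)"
      using rpos t by (simp add: powr_divide powr_minus field_simps)
    then show ?thesis by (simp add: ball_barrier_def r_def)
  qed
  have mono: "(r / t) powr (- s) \<le> a powr (- s)" if "0 < a" "a \<le> r / t" for a
    using that s by (intro powr_mono2') auto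
  show "0 \<le> ball_barrier s t (z + t *\<^sub>R \<nu>) x"
    using mono[of 1] rt t unfolding b by simp
  show "ball_barrier s t (z + t *\<^sub>R \<nu>) x \<le> 1" unfolding b by simp
  show "1 - sqrt (3 / 2) powr (- s) \<le> ball_barrier s t (z + t *\<^sub>R \<nu>) x" if d: "norm (x - z) \<ge> t"
  proof -
    have "t\<^sup>2 \<le> (norm (x - z))\<^sup>2" using d t by (intro power_mono) auto
    then have "3 / 2 * t\<^sup>2 \<le> r\<^sup>2" using r2 by linarith
    then have "(sqrt (3 / 2) * t)\<^sup>2 \<le> r\<^sup>2" by (simp add: power_mult_distrib)
    then have "sqrt (3 / 2) * t \<le> r" by (rule power2_le_imp_le[OF _ r0])
    then have "sqrt (3 / 2) \<le> r / t" using t by (simp add: pos_le_divide_eq)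
    then show ?thesis unfolding b using mono[of "sqrt (3 / 2)"] by simp
  qed
  show "ball_barrier s t (z + t *\<^sub>R \<nu>) x \<le> s * norm (x - z) / t"
  proof -
    define d where "d = norm (x - z) / t"
    have d0: "d \<ge> 0" using t by (simp add: d_def)
    have "x - (z + t *\<^sub>R \<nu>) = (x - z) - t *\<^sub>R \<nu>" by simp
    then have "r \<le> norm (x - z) + norm (t *\<^sub>R \<nu>)"
      unfolding r_def using norm_triangle_ineq4[of "x - z" "t *\<^sub>R \<nu>"] by metis
    then have "r \<le> norm (x - z) + t" using \<nu> t by simp
    then have "r / t \<le> 1 + d" using t by (simp add: d_def field_simps)
    then have "(1 + d) powr (- s) \<le> (r / t) powr (- s)" using rpos t s by (intro powr_mono2') auto
    moreover have "1 - s * d \<le> (1 + d) powr (- s)"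
    proof -
      have "1 + (- s * ln (1 + d)) \<le> exp (- s * ln (1 + d))" by (rule exp_ge_add_one_self)
      moreover have "s * ln (1 + d) \<le> s * d" using s d0 by (intro mult_left_mono
          ln_add_one_self_le_self) auto
      ultimately show ?thesis using d0 by (simp add: powr_def)
    qed
    ultimately show ?thesis unfolding b by (simp add: d_def)
  qed
qed

text \<open>The centres approach \<open>z\<close> as the radii shrink, so the sum is cut at
  \<open>m\<close>; in the estimates the constant \<open>(t0 / 2 ^ m) powr \<beta>\<close> makes up
  for the missing scales.\<close>

definition barrier_sum :: "real \<Rightarrow> real \<Rightarrow> real \<Rightarrow> 'a::euclidean_space \<Rightarrow> 'a \<Rightarrow> nat \<Rightarrow> 'a \<Rightarrow> real" where
  "barrier_sum \<beta> s t0 z \<nu> m x = (\<Sum>j\<le>m. (t0 / 2 ^ j) powr \<beta> * ball_barrier s (t0 / 2 ^ j) (z + (t0 /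
      2 ^ j) *\<^sub>R \<nu>) x)"

text \<open>Let d = |x - z|. Unless d is below the last radius, where the constant alone suffices,
  one term gives the lower bound: the barrier whose radius is comparable to d, or the largest one.
  For the upper bound with d below the largest radius, the last radius is taken comparable to d; the
  others are larger, their barriers are at most s d / t, and the terms t^\<beta> s d / t add up
  geometrically because \<beta> < 1. Comparison on the whole domain uses one \<open>m\<close> at a
  time, hence the lower bound for every \<open>m\<close>; the upper bound is read at a single point,
  so there \<open>m\<close> may depend on it.\<close>

lemma barrier_sum_bounds:
  assumes \<beta>: "0 < \<beta>" "\<beta> < 1" and s: "s > 0" and L: "L > 0" and R: "R > 0"
  defines "t0 \<equiv> 1 / (4 * L)"
  shows "\<exists>E>0. \<exists>C>0. \<forall>(z::'a::euclidean_space) \<nu> x. norm \<nu> = 1 \<longrightarrow> (x - z) \<bullet> \<nu> \<le> L * (norm (x - z))\<^sup>2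
      \<longrightarrow> norm (x - z) \<le> R \<longrightarrow> x \<noteq> z \<longrightarrow>
    (\<forall>m. norm (x - z) powr \<beta> \<le> (t0 / 2 ^ m) powr \<beta> + E * barrier_sum \<beta> s t0 z \<nu> m x) \<and>
    (\<exists>m. (t0 / 2 ^ m) powr \<beta> + E * barrier_sum \<beta> s t0 z \<nu> m x \<le> C * norm (x - z) powr \<beta>)"
proof -
  \<comment> \<open>\<open>c\<close> bounds a barrier from below at distances of at least its
    radius. \<open>\<kappa>\<close> compares the selected radius with d: 1/2 for dyadic scales,
    (t0/R)^\<beta> if d exceeds the largest radius. \<open>\<sigma>\<close> is the ratio of the
    geometric series, and the 2 in \<open>C\<close> comes from 2^\<beta> \<le> 2.\<close>
  define c where "c = 1 - sqrt (3 / 2) powr (- s)"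
  define \<kappa> where "\<kappa> = min (1 / 2) ((t0 / R) powr \<beta>)"
  define E where "E = 1 / (c * \<kappa>)"
  define \<sigma> where "\<sigma> = 2 powr (\<beta> - 1)"
  define C where "C = 2 + E * (1 + s / (1 - \<sigma>))"
  have t0: "t0 > 0" using L by (simp add: t0_def)
  have "sqrt (3 / 2) powr (- s) < 1 powr (- s)" using s by (intro powr_less_mono2_neg) auto
  then have c: "c > 0" by (simp add: c_def)
  have \<kappa>: "\<kappa> > 0" using t0 R by (simp add: \<kappa>_def)
  have E: "E > 0" using c \<kappa> by (simp add: E_def)
  have "\<sigma> < 2 powr 0" unfolding \<sigma>_def using \<beta> by (intro powr_less_mono) auto
  then have \<sigma>: "0 < \<sigma>" "\<sigma> < 1" by (simp_all add: \<sigma>_def)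
  have C: "C > 0" using E s \<sigma> by (simp add: C_def add_pos_nonneg)
  define t where "t = (\<lambda>j::nat. t0 / 2 ^ j)"
  have t: "t j > 0" "4 * L * t j \<le> 1" "t (Suc j) = t j / 2" for j
    using L t0 by (auto simp: t_def t0_def field_simps)
  have main: "(\<forall>m. norm (x - z) powr \<beta> \<le> (t m) powr \<beta> + E * barrier_sum \<beta> s t0 z \<nu> m x) \<and>
    (\<exists>m. (t m) powr \<beta> + E * barrier_sum \<beta> s t0 z \<nu> m x \<le> C * norm (x - z) powr \<beta>)"
    if \<nu>: "norm \<nu> = 1" and xL: "(x - z) \<bullet> \<nu> \<le> L * (norm (x - z))\<^sup>2" and xR: "norm (x - z) \<le> R" and
        xz: "x \<noteq> z"
    for z \<nu> x :: 'a
  proof -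
    define d where "d = norm (x - z)"
    define b where "b = (\<lambda>j. ball_barrier s (t j) (z + t j *\<^sub>R \<nu>) x)"
    have d: "d > 0" "d \<le> R" using xz xR by (auto simp: d_def)
    have b: "0 \<le> b j" "b j \<le> 1" "d \<ge> t j \<Longrightarrow> c \<le> b j" "b j \<le> s * d / t j" for j
      using ball_barrier_bounds[OF \<nu> xL t(1,2) s] by (auto simp: b_def c_def d_def)
    have w: "barrier_sum \<beta> s t0 z \<nu> m x = (\<Sum>j\<le>m. t j powr \<beta> * b j)" for m
      by (simp add: barrier_sum_def b_def t_def)
    have tn: "0 \<le> t j powr \<beta> * b j" for j using b(1)[of j] by simp
    have lower: "d powr \<beta> \<le> t m powr \<beta> + E * (\<Sum>j\<le>m. t j powr \<beta> * b j)" for m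
    proof (cases "d < t m")
      case True
      have "d powr \<beta> \<le> t m powr \<beta>" using True d \<beta> by (intro powr_mono2) auto
      then show ?thesis using E tn by (simp add: add_increasing2 sum_nonneg)
    next
      case False
      \<comment> \<open>The largest radius not above d. Either it is \<open>t0\<close>, or its
        predecessor exceeds d and it is at least d / 2.\<close>
      define j where "j = (LEAST j. t j \<le> d)"
      have j: "t j \<le> d" unfolding j_def by (rule LeastI[of _ m]) (use False in simp)
      have jm: "j \<le> m" unfolding j_def by (rule Least_le) (use False in simp)
      have "\<kappa> * d powr \<beta> \<le> t j powr \<beta>"
      proof (cases j)
        case 0
        have "\<kappa> * d powr \<beta> \<le> (t0 / R) powr \<beta> * R powr \<beta>"
          using d \<beta> by (intro mult_mono powr_mono2) (auto simp: \<kappa>_def)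
        also have "\<dots> = t0 powr \<beta>" using t0 R by (simp add: powr_divide)
        finally show ?thesis by (simp add: 0 t_def)
      next
        case (Suc i)
        have "\<not> t i \<le> d" using not_less_Least[of i "\<lambda>j. t j \<le> d"] Suc by (simp add: j_def)
        then have "d / 2 \<le> t j" by (simp add: Suc t(3))
        then have "(d / 2) powr \<beta> \<le> t j powr \<beta>" using d \<beta> by (intro powr_mono2) auto
        moreover have "\<kappa> * d powr \<beta> \<le> (d / 2) powr \<beta>"
        proof -
          have "2 powr \<beta> \<le> 2 powr (1::real)" using \<beta> by (intro powr_mono) auto
          then have "1 / 2 \<le> 1 / 2 powr \<beta>" by (intro divide_left_mono) auto
          moreover have "\<kappa> \<le> 1 / 2" by (simp add: \<kappa>_def)
          ultimately have "\<kappa> \<le> 1 / 2 powr \<beta>" by linarith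
          then have "\<kappa> * d powr \<beta> \<le> 1 / 2 powr \<beta> * d powr \<beta>" by (intro mult_right_mono) auto
          then show ?thesis using d by (simp add: powr_divide)
        qed
        ultimately show ?thesis by linarith
      qed
      then have "c * (\<kappa> * d powr \<beta>) \<le> b j * t j powr \<beta>"
        using b(3)[OF j] c \<kappa> b(1)[of j] by (intro mult_mono) auto
      also have "\<dots> \<le> (\<Sum>j\<le>m. t j powr \<beta> * b j)"
        using member_le_sum[of j "{..m}" "\<lambda>j. t j powr \<beta> * b j"] jm tn by (simp add: mult.commute)
      finally have "E * (c * (\<kappa> * d powr \<beta>)) \<le> E * (\<Sum>j\<le>m. t j powr \<beta> * b j)"
        using E by (intro mult_left_mono) auto
      moreover have "E * (c * (\<kappa> * d powr \<beta>)) = d powr \<beta>" using c \<kappa> by (simp add: E_def)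
      ultimately show ?thesis using powr_ge_zero[of "t m" \<beta>] by linarith
    qed
    have upper: "\<exists>m. t m powr \<beta> + E * (\<Sum>j\<le>m. t j powr \<beta> * b j) \<le> C * d powr \<beta>"
    proof (cases "d \<ge> t0")
      case True
      have t0d: "t0 powr \<beta> \<le> d powr \<beta>" using True t0 \<beta> by (intro powr_mono2) auto
      have "t0 powr \<beta> * b 0 \<le> d powr \<beta> * 1" using t0d b(1,2)[of 0] by (intro mult_mono) auto
      then have "E * (t0 powr \<beta> * b 0) \<le> E * d powr \<beta>" using E by (intro mult_left_mono) auto
      then have "t0 powr \<beta> + E * (t0 powr \<beta> * b 0) \<le> (1 + E) * d powr \<beta>" using t0d by (simp add:
          algebra_simps)
      also have "\<dots> \<le> C * d powr \<beta>"
      proof (rule mult_right_mono)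
        have "0 \<le> E * (s / (1 - \<sigma>))" using E s \<sigma> by simp
        then show "1 + E \<le> C" unfolding C_def distrib_left by linarith
      qed simp
      finally show ?thesis by (intro exI[of _ 0]) (simp add: t_def)
    next
      case False
      have "(\<lambda>k. t0 * (1 / 2) ^ k) \<longlonglongrightarrow> t0 * 0" by (intro tendsto_mult_left LIMSEQ_power_zero) auto
      then have "t \<longlonglongrightarrow> 0" by (simp add: t_def power_divide)
      then have "\<forall>\<^sub>F k in sequentially. t k < d" using order_tendstoD(2) d(1) by blast
      then obtain k0 where k0: "t k0 < d" using eventually_happens'[OF sequentially_bot] by blast
      \<comment> \<open>The first radius below d; it is not the initial one, since here d < t0. Its
        predecessor \<open>m\<close> therefore satisfies d \<le> t m \<le> 2 d.\<close>
      define k where "k = (LEAST k. t k < d)"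
      have k: "t k < d" unfolding k_def by (rule LeastI[of _ k0]) (use k0 in simp)
      have "k \<noteq> 0"
      proof
        assume "k = 0"
        then show False using k False by (simp add: t_def)
      qed
      then obtain m where m: "k = Suc m" using not0_implies_Suc by blast
      have "\<not> t m < d" using not_less_Least[of m "\<lambda>k. t k < d"] m by (simp add: k_def)
      then have tm: "d \<le> t m" "t m \<le> 2 * d" using k by (auto simp: m t(3))
      have "t m powr \<beta> \<le> (2 * d) powr \<beta>" using tm t(1)[of m] \<beta> by (intro powr_mono2) (auto intro:
          less_imp_le)
      also have "\<dots> = 2 powr \<beta> * d powr \<beta>" using d by (simp add: powr_mult)
      also have "\<dots> \<le> 2 * d powr \<beta>"
        using \<beta> powr_mono[of \<beta> 1 "2::real"] by (intro mult_right_mono) auto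
      finally have 1: "t m powr \<beta> \<le> 2 * d powr \<beta>" .
      \<comment> \<open>As \<beta> - 1 is negative, each doubling of the radius gains a factor
        \<sigma>, and at the last radius \<open>t m\<close> \<ge> d one has (t m)^(\<beta>-1) \<le>
        d^(\<beta>-1).\<close>
      have scale: "t j powr \<beta> * b j \<le> s * d powr \<beta> * \<sigma> ^ (m - j)" if "j \<le> m" for j
      proof -
        have tj: "t j = t m * 2 ^ (m - j)"
          using that by (simp add: t_def power_diff field_simps)
        have "t j powr \<beta> * b j \<le> t j powr \<beta> * (s * d / t j)" by (intro mult_left_mono b(4)) simp
        also have "\<dots> = s * d * t j powr (\<beta> - 1)" using t(1)[of j] by (simp add: powr_diff)
        also have "t j powr (\<beta> - 1) = t m powr (\<beta> - 1) * \<sigma> ^ (m - j)"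
          unfolding tj \<sigma>_def using t(1)[of m]
          by (simp add: powr_mult powr_powr powr_realpow[symmetric] mult.commute)
        also have "s * d * (t m powr (\<beta> - 1) * \<sigma> ^ (m - j)) \<le> s * d * (d powr (\<beta> - 1) * \<sigma> ^ (m -
            j))"
          using s d tm \<beta> \<sigma> by (intro mult_left_mono mult_right_mono powr_mono2') auto
        also have "\<dots> = s * (d * d powr (\<beta> - 1)) * \<sigma> ^ (m - j)" by simp
        also have "d * d powr (\<beta> - 1) = d powr \<beta>" using d by (simp add: powr_mult_base)
        finally show ?thesis .
      qed
      have "(\<Sum>j\<le>m. t j powr \<beta> * b j) \<le> (\<Sum>j\<le>m. s * d powr \<beta> * \<sigma> ^ (m - j))"
        by (intro sum_mono scale) auto
      also have "\<dots> = s * d powr \<beta> * (\<Sum>j\<le>m. \<sigma> ^ (m - j))" by (simp add: sum_distrib_left)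
      also have "(\<Sum>j\<le>m. \<sigma> ^ (m - j)) = (\<Sum>j\<le>m. \<sigma> ^ j)"
        by (rule sum.reindex_bij_witness[of _ "\<lambda>j. m - j" "\<lambda>j. m - j"]) auto
      also have "(\<Sum>j\<le>m. \<sigma> ^ j) = (1 - \<sigma> ^ Suc m) / (1 - \<sigma>)" using \<sigma> by (subst sum_gp0) auto
      also have "s * d powr \<beta> * ((1 - \<sigma> ^ Suc m) / (1 - \<sigma>)) \<le> s * d powr \<beta> * (1 / (1 - \<sigma>))"
        using s \<sigma> by (intro mult_left_mono divide_right_mono) auto
      finally have "E * (\<Sum>j\<le>m. t j powr \<beta> * b j) \<le> E * (s * d powr \<beta> * (1 / (1 - \<sigma>)))"
        using E by (intro mult_left_mono) auto
      then have "t m powr \<beta> + E * (\<Sum>j\<le>m. t j powr \<beta> * b j) \<le> (2 + E * (s / (1 - \<sigma>))) * d powr \<beta>"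
        using 1 by (simp add: algebra_simps)
      also have "\<dots> \<le> C * d powr \<beta>" unfolding C_def using E by (intro mult_right_mono add_left_mono
          mult_left_mono) auto
      finally show ?thesis by blast
    qed
    show ?thesis using lower upper by (simp add: w d_def)
  qed
  show ?thesis
    by (intro exI[of _ E] exI[of _ C] conjI E C allI impI) (use main in \<open>auto simp: t_def\<close>)
qed

context
  fixes \<Omega> :: "'a::euclidean_space set" and p :: real and v :: "'a \<Rightarrow> real" and V :: "'a \<Rightarrow> 'a"
  assumes \<Omega>: "open \<Omega>" "bounded \<Omega>" and p: "p > 1" and v: "sob \<Omega> p v V"
    and minimal: "\<And>\<psi> H. sob0 \<Omega> p \<psi> H \<Longrightarrow>
      (\<integral>x. norm (V x) powr p \<partial>(lebesgue_on \<Omega>)) \<le> (\<integral>x. norm (V x + H x) powr p \<partial>(lebesgue_on \<Omega>))"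
begin

text \<open>For each \<open>m\<close> the barrier dominates \<open>g\<close>, hence \<open>v\<close>
  almost everywhere. The exceptional null sets are countably many, so outside their union the most
  favourable \<open>m\<close> may be picked at each point.\<close>

lemma minimizer_boundary_upper:
  fixes z \<nu> :: 'a and \<gamma>z :: real
  assumes vg: "sob0 \<Omega> p (\<lambda>x. v x - g x) (\<lambda>x. V x - G x)" and g: "sob \<Omega> p g G"
    and s: "s > 0" "real DIM('a) + p - 2 \<le> s + 2" "real DIM('a) + p - 2 \<le> (p - 1) * (s + 2)"
    and L: "L > 0" and M: "M > 0" and E: "E > 0"
    and \<nu>: "norm \<nu> = 1" "\<And>x. x \<in> \<Omega> \<Longrightarrow> (x - z) \<bullet> \<nu> \<le> L * (norm (x - z))\<^sup>2"
    and lower: "\<And>m x. x \<in> \<Omega> \<Longrightarrow> norm (x - z) powr \<beta> \<le> (1 / (4 * L) / 2 ^ m) powr \<beta> + E * barrier_sum \<beta>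
        s (1 / (4 * L)) z \<nu> m x"
    and upper: "\<And>x. x \<in> \<Omega> \<Longrightarrow> \<exists>m. (1 / (4 * L) / 2 ^ m) powr \<beta> + E * barrier_sum \<beta> s (1 / (4 * L)) z \<nu>
        m x \<le> C * norm (x - z) powr \<beta>"
    and gz: "AE x in lebesgue_on \<Omega>. g x \<le> \<gamma>z + M * norm (x - z) powr \<beta>"
  shows "AE x in lebesgue_on \<Omega>. v x \<le> \<gamma>z + M * (C * norm (x - z) powr \<beta>)"
proof -
  define t where "t = (\<lambda>j::nat. 1 / (4 * L) / 2 ^ j)"
  define y where "y = (\<lambda>j. z + t j *\<^sub>R \<nu>)"
  define F where "F = (\<lambda>m x. \<gamma>z + M * (t m powr \<beta> + E * barrier_sum \<beta> s (1 / (4 * L)) z \<nu> m x))"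
  have t: "t j > 0" "4 * L * t j \<le> 1" for j using L by (auto simp: t_def field_simps)
  \<comment> \<open>The exterior ball inequality is a closed condition. It is extended to the
    closure because poles and gradient of the barrier have to be controlled up to the
    boundary.\<close>
  have cl: "(x - z) \<bullet> \<nu> \<le> L * (norm (x - z))\<^sup>2" if "x \<in> closure \<Omega>" for x
  proof -
    have "closed {x. (x - z) \<bullet> \<nu> \<le> L * (norm (x - z))\<^sup>2}"
      by (intro closed_Collect_le continuous_intros)
    then have "closure \<Omega> \<subseteq> {x. (x - z) \<bullet> \<nu> \<le> L * (norm (x - z))\<^sup>2}"
      using \<nu>(2) by (intro closure_minimal) auto
    then show ?thesis using that by auto
  qed
  have le: "AE x in lebesgue_on \<Omega>. v x \<le> F m x" for m
  proof -
    \<comment> \<open>The barrier sum is rewritten as a constant minus potentials; the factor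
      \<open>s\<close> cancels the division by \<open>s\<close> in the form required by
      \<open>minimizer_le_radial_barrier\<close>.\<close>
    define c where "c = (\<lambda>j. s * (M * E * t j powr \<beta> * t j powr s))"
    define A where "A = \<gamma>z + M * (t m powr \<beta> + E * (\<Sum>j\<le>m. t j powr \<beta>))"
    have c: "c j > 0" for j using s M E t(1)[of j] by (simp add: c_def)
    have F: "F m x = A - (\<Sum>j\<le>m. (c j / s) * norm (x - y j) powr (- s))" for x
    proof -
      have "barrier_sum \<beta> s (1 / (4 * L)) z \<nu> m x = (\<Sum>j\<le>m. t j powr \<beta> - t j powr \<beta> * t j powr s *
          norm (x - y j) powr (- s))"
        by (simp add: barrier_sum_def ball_barrier_def t_def y_def right_diff_distrib mult.assoc)
      also have "\<dots> = (\<Sum>j\<le>m. t j powr \<beta>) - (\<Sum>j\<le>m. t j powr \<beta> * t j powr s * norm (x - y j) powr (-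
          s))"
        by (rule sum_subtractf)
      finally have "M * (E * barrier_sum \<beta> s (1 / (4 * L)) z \<nu> m x)
          = M * (E * (\<Sum>j\<le>m. t j powr \<beta>)) - (\<Sum>j\<le>m. (c j / s) * norm (x - y j) powr (- s))"
        using s by (simp add: c_def right_diff_distrib sum_distrib_left mult_ac)
      then show ?thesis by (simp add: F_def A_def algebra_simps)
    qed
    have "AE x in lebesgue_on \<Omega>. v x \<le> A - (\<Sum>j\<le>m. (c j / s) * norm (x - y j) powr (- s))"
    proof (rule minimizer_le_radial_barrier[OF \<Omega> p v minimal vg g _ c _ s])
      show "y j \<notin> closure \<Omega>" for j
      proof
        assume "y j \<in> closure \<Omega>"
        from exterior_ball_dist[OF \<nu>(1) cl[OF this] t(1)[of j] t(2)[of j]]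
        have "(t j)\<^sup>2 + (norm (y j - z))\<^sup>2 / 2 \<le> 0" by (simp add: y_def)
        then have "(t j)\<^sup>2 \<le> 0" using zero_le_power2[of "norm (y j - z)"] by linarith
        then show False using t(1)[of j] by simp
      qed
      fix x assume x: "x \<in> closure \<Omega>"
      define a where "a = (\<lambda>j. c j * norm (x - y j) powr (- (s + 2)))"
      have a: "a j > 0" for j
      proof -
        have "(norm (x - y j))\<^sup>2 > 0"
          using exterior_ball_dist[OF \<nu>(1) cl[OF x] t, of j] t(1)[of j] zero_le_power2[of "norm (x -
              z)"]
          unfolding y_def by (smt (verit) zero_less_power2 divide_nonneg_pos)
        then show ?thesis using c by (simp add: a_def)
      qed
      have D: "(\<Sum>j\<le>m. c j *\<^sub>R radial (s + 2) (y j) x) = (\<Sum>j\<le>m. a j *\<^sub>R (x - y j))"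
        by (simp add: radial_def a_def)
      \<comment> \<open>All contributions to the gradient lie in one open half-space and cannot
        cancel: for x \<noteq> z each \<open>x - y j\<close> has inner product at least (3/4) |x -
        z|^2 with x - z, and at x = z each is a negative multiple of \<open>\<nu>\<close>.\<close>
      show "(\<Sum>j\<le>m. c j *\<^sub>R radial (s + 2) (y j) x) \<noteq> 0"
      proof (cases "x = z")
        case True
        have "(\<Sum>j\<le>m. a j *\<^sub>R (x - y j)) \<bullet> \<nu> = (\<Sum>j\<le>m. - (a j * t j))"
          using \<nu>(1) True by (simp add: inner_sum_left y_def dot_square_norm)
        moreover have "0 < (\<Sum>j\<le>m. a j * t j)" using a t(1) by (intro sum_pos) auto
        ultimately have "(\<Sum>j\<le>m. a j *\<^sub>R (x - y j)) \<bullet> \<nu> \<noteq> 0" by (simp add: sum_negf)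
        then show ?thesis unfolding D by auto
      next
        case False
        have "0 < (\<Sum>j\<le>m. a j * ((x - y j) \<bullet> (x - z)))"
        proof (rule sum_pos)
          fix j assume "j \<in> {..m}"
          have "x - y j = (x - z) - t j *\<^sub>R \<nu>" by (simp add: y_def)
          then have "(x - y j) \<bullet> (x - z) = (norm (x - z))\<^sup>2 - t j * ((x - z) \<bullet> \<nu>)"
            by (simp only: inner_diff_left[of "x - z" "t j *\<^sub>R \<nu>"] inner_scaleR_left
                power2_norm_eq_inner inner_commute[of \<nu>])
          moreover have "t j * ((x - z) \<bullet> \<nu>) \<le> t j * (L * (norm (x - z))\<^sup>2)"
            using t(1)[of j] by (intro mult_left_mono cl x) auto
          moreover have "t j * (L * (norm (x - z))\<^sup>2) \<le> (norm (x - z))\<^sup>2 / 4"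
            using mult_right_mono[OF t(2)[of j], of "(norm (x - z))\<^sup>2"] by (simp add: mult_ac)
          moreover have "0 < (norm (x - z))\<^sup>2" using False by simp
          ultimately have "0 < (x - y j) \<bullet> (x - z)" by linarith
          then show "0 < a j * ((x - y j) \<bullet> (x - z))" using a[of j] by simp
        qed auto
        then have "(\<Sum>j\<le>m. a j *\<^sub>R (x - y j)) \<bullet> (x - z) \<noteq> 0"
          by (simp only: inner_sum_left inner_scaleR_left)
        then show ?thesis unfolding D by auto
      qed
    next
      show "AE x in lebesgue_on \<Omega>. g x \<le> A - (\<Sum>j\<le>m. (c j / s) * norm (x - y j) powr (- s))"
        unfolding F[symmetric] AE_lebesgue_on_iff[OF domain_facts(1)[OF \<Omega> p]]
        using gz[unfolded AE_lebesgue_on_iff[OF domain_facts(1)[OF \<Omega> p]]]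
      proof eventually_elim
        case (elim x)
        show ?case
        proof
          assume x: "x \<in> \<Omega>"
          have "M * norm (x - z) powr \<beta> \<le> M * (t m powr \<beta> + E * barrier_sum \<beta> s (1 / (4 * L)) z \<nu> m
              x)"
            using lower[OF x, of m] M by (intro mult_left_mono) (auto simp: t_def)
          then show "g x \<le> F m x" using elim x by (auto simp: F_def)
        qed
      qed
    qed auto
    then show ?thesis by (simp only: F)
  qed
  have "AE x in lebesgue. \<forall>m. x \<in> \<Omega> \<longrightarrow> v x \<le> F m x"
    unfolding AE_all_countable using le by (simp add: AE_lebesgue_on_iff[OF domain_facts(1)[OF \<Omega>
        p]])
  then show ?thesis
    unfolding AE_lebesgue_on_iff[OF domain_facts(1)[OF \<Omega> p]]
  proof eventually_elim
    case (elim x)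
    show ?case
    proof
      assume x: "x \<in> \<Omega>"
      obtain m where "t m powr \<beta> + E * barrier_sum \<beta> s (1 / (4 * L)) z \<nu> m x \<le> C * norm (x - z) powr
          \<beta>"
        using upper[OF x] by (auto simp: t_def)
      then have "F m x \<le> \<gamma>z + M * (C * norm (x - z) powr \<beta>)"
        unfolding F_def using M by (intro add_left_mono mult_left_mono) auto
      then show "v x \<le> \<gamma>z + M * (C * norm (x - z) powr \<beta>)" using elim x order_trans by blast
    qed
  qed
qed

end

section \<open>Hoelder continuity of the minimizer\<close>

text \<open>Division by a + b reduces the claim to numbers in the unit interval, where t \<le>
  t^\<beta>.\<close>

lemma powr_subadditive:
  fixes a b \<beta> :: real
  assumes "0 \<le> a" "0 \<le> b" "0 < \<beta>" "\<beta> \<le> 1"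
  shows "(a + b) powr \<beta> \<le> a powr \<beta> + b powr \<beta>"
proof (cases "a + b = 0")
  case False
  then have ab: "a + b > 0" using assms by simp
  have le: "t \<le> t powr \<beta>" if "0 \<le> t" "t \<le> 1" for t :: real
  proof (cases "t = 0")
    case False
    then have "t powr 1 \<le> t powr \<beta>" using that assms by (intro powr_mono') auto
    then show ?thesis using that False by simp
  qed simp
  have "1 = a / (a + b) + b / (a + b)" using ab by (simp add: add_divide_distrib[symmetric])
  also have "\<dots> \<le> (a / (a + b)) powr \<beta> + (b / (a + b)) powr \<beta>"
    using assms ab by (intro add_mono le) auto
  also have "\<dots> = (a powr \<beta> + b powr \<beta>) / (a + b) powr \<beta>"
    using assms ab by (simp add: powr_divide add_divide_distrib)
  finally show ?thesis using ab by (simp add: pos_le_divide_eq)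
qed (use assms in auto)

lemma norm_powr_triangle:
  fixes x y z :: "'a::real_normed_vector"
  assumes "0 < \<beta>" "\<beta> \<le> 1"
  shows "norm (x - z) powr \<beta> \<le> norm (x - y) powr \<beta> + norm (y - z) powr \<beta>"
proof -
  have "norm (x - z) powr \<beta> \<le> (norm (x - y) + norm (y - z)) powr \<beta>"
    using norm_triangle_ineq[of "x - y" "y - z"] assms by (intro powr_mono2) auto
  also have "\<dots> \<le> norm (x - y) powr \<beta> + norm (y - z) powr \<beta>"
    by (rule powr_subadditive) (use assms in auto)
  finally show ?thesis .
qed

lemma holder_continuous:
  fixes f :: "'a::real_normed_vector \<Rightarrow> real"
  assumes "0 < \<beta>" and f: "\<And>x y. x \<in> S \<Longrightarrow> y \<in> S \<Longrightarrow> \<bar>f x - f y\<bar> \<le> M * norm (x - y) powr \<beta>"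
  shows "continuous_on S f"
  unfolding continuous_on_def
proof
  fix x assume x: "x \<in> S"
  have "((\<lambda>y. norm (y - x) powr \<beta>) \<longlongrightarrow> 0) (at x within S)"
  proof (rule tendsto_zero_powrI[where b=\<beta>])
    have "((\<lambda>y. norm (y - x)) \<longlongrightarrow> norm (x - x)) (at x within S)" by (intro tendsto_intros)
    then show "((\<lambda>y. norm (y - x)) \<longlongrightarrow> 0) (at x within S)" by simp
  qed (use assms in auto)
  from tendsto_mult_left[OF this, of M]
  have lim: "((\<lambda>y. M * norm (y - x) powr \<beta>) \<longlongrightarrow> 0) (at x within S)" by simp
  have "((\<lambda>y. f y - f x) \<longlongrightarrow> 0) (at x within S)"
  proof (rule Lim_null_comparison[OF _ lim])
    show "\<forall>\<^sub>F y in at x within S. norm (f y - f x) \<le> M * norm (y - x) powr \<beta>"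
      unfolding eventually_at_filter by (rule always_eventually) (use f x in auto)
  qed
  then show "(f \<longlongrightarrow> f x) (at x within S)" by (simp add: LIM_zero_iff)
qed

text \<open>The subset of \<open>\<Omega>\<close> where \<open>f\<close> exceeds \<open>a\<close> is
  open and null, hence empty; continuity reaches the closure.\<close>

lemma AE_le_imp_le_closure:
  fixes f :: "'a::euclidean_space \<Rightarrow> real"
  assumes \<Omega>: "open \<Omega>" and f: "continuous_on (closure \<Omega>) f" and ae: "AE x in lebesgue_on \<Omega>. f x \<le> a"
    and x: "x \<in> closure \<Omega>"
  shows "f x \<le> a"
proof (rule continuous_le_on_closure[OF f x])
  fix y assume y: "y \<in> \<Omega>"
  have sl: "\<Omega> \<in> sets lebesgue" using \<Omega> by auto
  define N where "N = \<Omega> \<inter> f -` {a<..}"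
  have "continuous_on \<Omega> f" using f closure_subset continuous_on_subset by blast
  then have "open N" unfolding N_def using \<Omega> by (intro continuous_open_preimage) auto
  have "AE x in lebesgue. x \<notin> N"
    using ae unfolding AE_lebesgue_on_iff[OF sl] by eventually_elim (auto simp: N_def)
  then have "N \<in> null_sets lebesgue" using \<open>open N\<close> by (subst (asm) AE_iff_null_sets[symmetric])
      auto
  then have "negligible N" by (simp add: negligible_iff_null_sets)
  then have "N = {}" using open_not_negligible[OF \<open>open N\<close>] by blast
  then have "y \<notin> N" by simp
  then show "f y \<le> a" using y by (simp add: N_def)
qed

text \<open>The null set in the hypothesis depends on \<open>h\<close>. By Fubini's theorem almost
  every point satisfies the bound for almost every \<open>h\<close>. Two such points are linked
  through a common third point close to the first, whose distance is then sent to zero. This gives a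
  Hoelder function on a set \<open>S\<close> of full measure, which is extended with the same
  constant.\<close>

lemma AE_difference_quotient_imp_holder_rep:
  fixes v :: "'a::euclidean_space \<Rightarrow> real"
  assumes \<Omega>: "open \<Omega>" "\<Omega> \<noteq> {}" and v: "v \<in> borel_measurable (lebesgue_on \<Omega>)" and \<beta>: "0 < \<beta>" "\<beta> \<le> 1"
      and K: "K \<ge> 0"
    and dq: "\<And>h. AE x in lebesgue. x \<in> \<Omega> \<longrightarrow> x + h \<in> \<Omega> \<longrightarrow> v (x + h) - v x \<le> K * norm h powr \<beta>"
  shows "\<exists>f. (AE x in lebesgue_on \<Omega>. v x = f x) \<and> (\<forall>x y. \<bar>f x - f y\<bar> \<le> K * norm (x - y) powr \<beta>)"
proof -
  have sl: "\<Omega> \<in> sets lebesgue" using \<Omega> by auto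
  have [measurable]: "\<Omega> \<in> sets borel" using \<Omega> by auto
  \<comment> \<open>A Borel representative, so that the good pairs form a measurable set in the
    product.\<close>
  obtain v' where v'[measurable]: "v' \<in> borel_measurable borel" and eq: "AE x in lborel. indicator \<Omega>
      x * v x = v' x"
    using completion_ex_borel_measurable_real[of "\<lambda>x. indicator \<Omega> x * v x" lborel]
      v measurable_lebesgue_on_iff[OF sl, of v] by auto
  have eql: "AE x in lebesgue. x \<in> \<Omega> \<longrightarrow> v x = v' x"
    using AE_completion[OF eq] by eventually_elim (auto simp: indicator_def)
  define Q where "Q = (\<lambda>x h. x \<in> \<Omega> \<longrightarrow> x + h \<in> \<Omega> \<longrightarrow> \<bar>v' (x + h) - v' x\<bar> \<le> K * norm h powr \<beta>)"
  have shift: "AE x in lebesgue. P (x + h)" if "AE x in lebesgue. P x" for P and h :: 'a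
    using AE_lebesgue_affine[of 1 P h] that by (simp add: add.commute)
  \<comment> \<open>The bound for \<open>h\<close> at \<open>x\<close> and the one for
    \<open>- h\<close> at \<open>x + h\<close> combine to the absolute value.\<close>
  have Qh: "AE x in lebesgue. Q x h" for h
    using dq[of h] shift[OF dq[of "- h"], of h] eql shift[OF eql, of h]
    by eventually_elim (auto simp: Q_def)
  have Qh': "AE x in lborel. Q x h" for h
  proof -
    have s: "{x. \<not> Q x h} \<in> sets borel" unfolding Q_def by measurable
    have "AE x in lebesgue. x \<notin> {x. \<not> Q x h}" using Qh by simp
    then have "{x. \<not> Q x h} \<in> null_sets lebesgue" using s by (subst (asm)
        AE_iff_null_sets[symmetric]) auto
    then have "{x. \<not> Q x h} \<in> null_sets lborel" using s by (simp add: null_sets_def)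
    then show ?thesis using AE_not_in by fastforce
  qed
  have meas: "{w \<in> space (lborel \<Otimes>\<^sub>M lborel). Q (fst w) (snd w)} \<in> sets (lborel \<Otimes>\<^sub>M lborel)"
    unfolding Q_def by measurable
  have "AE x in lborel. AE h in lborel. Q x h"
    unfolding lborel_pair.AE_commute[OF meas] using Qh' by simp
  then have good: "AE x in lebesgue. AE h in lborel. Q x h" by (rule AE_completion)
  define S where "S = {x \<in> \<Omega>. v x = v' x \<and> (AE h in lborel. Q x h)}"
  have AES: "AE x in lebesgue. x \<in> \<Omega> \<longrightarrow> x \<in> S"
    using good eql by eventually_elim (auto simp: S_def)
  have pair: "\<bar>v' x - v' x'\<bar> \<le> K * norm (x - x') powr \<beta>" if x: "x \<in> S" and x': "x' \<in> S" for x x'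
  proof -
    \<comment> \<open>The linking point \<open>y\<close> lies in \<open>\<Omega>\<close> within
      \<open>\<delta>\<close> of \<open>x\<close> and is good for both points; it exists because the
      good set meets every nonempty open set.\<close>
    have near: "\<bar>v' x - v' x'\<bar> \<le> K * \<delta> powr \<beta> + K * (norm (x - x') + \<delta>) powr \<beta>" if \<delta>: "\<delta> > 0" for \<delta>
    proof -
      have xO: "x \<in> \<Omega>" "x' \<in> \<Omega>" using x x' by (auto simp: S_def)
      have Qy: "AE y in lebesgue. Q w (y + - w)" if "w \<in> S" for w
      proof (rule shift)
        have "AE h in lborel. Q w h" using that by (simp add: S_def)
        then show "AE h in lebesgue. Q w h" by (rule AE_completion)
      qed
      have ae: "AE y in lebesgue. Q x (y - x) \<and> Q x' (y - x')"
        using Qy[OF x] Qy[OF x'] by eventually_elim simp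
      define B where "B = \<Omega> \<inter> ball x \<delta>"
      have B: "open B" "B \<noteq> {}" using \<Omega> xO \<delta> by (auto simp: B_def)
      have "\<exists>y\<in>B. Q x (y - x) \<and> Q x' (y - x')"
      proof (rule ccontr)
        assume no: "\<not> (\<exists>y\<in>B. Q x (y - x) \<and> Q x' (y - x'))"
        have "AE y in lebesgue. y \<notin> B" using ae by eventually_elim (use no in blast)
        then have "B \<in> null_sets lebesgue" using B by (subst (asm) AE_iff_null_sets[symmetric]) auto
        then show False using open_not_negligible[OF B] by (simp add: negligible_iff_null_sets)
      qed
      then obtain y where y: "y \<in> \<Omega>" "norm (y - x) < \<delta>" "Q x (y - x)" "Q x' (y - x')"
        by (auto simp: B_def dist_norm norm_minus_commute)
      have 1: "\<bar>v' y - v' x\<bar> \<le> K * norm (y - x) powr \<beta>" using y xO by (simp add: Q_def)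
      have 2: "\<bar>v' y - v' x'\<bar> \<le> K * norm (y - x') powr \<beta>" using y xO by (simp add: Q_def)
      have 3: "K * norm (y - x) powr \<beta> \<le> K * \<delta> powr \<beta>"
        using y \<beta> K by (intro mult_left_mono powr_mono2) auto
      have "norm (y - x') \<le> norm (x - x') + \<delta>" using norm_triangle_ineq[of "y - x" "x - x'"] y by
          simp
      then have 4: "K * norm (y - x') powr \<beta> \<le> K * (norm (x - x') + \<delta>) powr \<beta>"
        using \<beta> K by (intro mult_left_mono powr_mono2) auto
      show ?thesis using 1 2 3 4 by linarith
    qed
    have \<delta>lim: "(\<lambda>k. 1 / real (Suc k)) \<longlonglongrightarrow> 0" using LIMSEQ_inverse_real_of_nat by (simp add:
        inverse_eq_divide)
    have "(\<lambda>k. K * (1 / real (Suc k)) powr \<beta> + K * (norm (x - x') + 1 / real (Suc k)) powr \<beta>)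
        \<longlonglongrightarrow> K * 0 powr \<beta> + K * (norm (x - x') + 0) powr \<beta>"
      by (intro tendsto_add tendsto_mult tendsto_const tendsto_powr2 \<delta>lim) (use \<beta> in auto)
    then have "(\<lambda>k. K * (1 / real (Suc k)) powr \<beta> + K * (norm (x - x') + 1 / real (Suc k)) powr \<beta>)
        \<longlonglongrightarrow> K * norm (x - x') powr \<beta>" by simp
    then show ?thesis by (rule LIMSEQ_le_const) (use near in auto)
  qed
  have S0: "S \<noteq> {}"
  proof
    assume "S = {}"
    then have "AE x in lebesgue. x \<notin> \<Omega>" using AES by simp
    then have "\<Omega> \<in> null_sets lebesgue" using sl by (subst (asm) AE_iff_null_sets[symmetric]) auto
    then show False using open_not_negligible[OF \<Omega>] by (simp add: negligible_iff_null_sets)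
  qed
  \<comment> \<open>McShane's extension formula. The triangle inequality for |.|^\<beta>, valid as
    \<beta> \<le> 1, preserves the Hoelder constant.\<close>
  define f where "f = (\<lambda>x. INF s\<in>S. v' s + K * norm (x - s) powr \<beta>)"
  have bdd: "bdd_below ((\<lambda>s. v' s + K * norm (x - s) powr \<beta>) ` S)" for x
  proof -
    obtain s0 where s0: "s0 \<in> S" using S0 by blast
    have "v' s0 - K * norm (s0 - x) powr \<beta> \<le> v' s + K * norm (x - s) powr \<beta>" if "s \<in> S" for s
    proof -
      have "K * norm (s0 - s) powr \<beta> \<le> K * norm (s0 - x) powr \<beta> + K * norm (x - s) powr \<beta>"
        using mult_left_mono[OF norm_powr_triangle[OF \<beta>, of s0 s x] K] by (simp add: distrib_left)
      then show ?thesis using pair[OF s0 that] by linarith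
    qed
    then show ?thesis by (intro bdd_belowI2)
  qed
  have f_le: "f x \<le> v' s + K * norm (x - s) powr \<beta>" if "s \<in> S" for x s
    unfolding f_def by (rule cINF_lower[OF bdd that])
  have f_ge: "a \<le> f x" if "\<And>s. s \<in> S \<Longrightarrow> a \<le> v' s + K * norm (x - s) powr \<beta>" for a x
    unfolding f_def by (rule cINF_greatest[OF S0]) (rule that)
  have half: "f x \<le> f y + K * norm (x - y) powr \<beta>" for x y
  proof -
    have "f x - K * norm (x - y) powr \<beta> \<le> f y"
    proof (rule f_ge)
      fix s assume s: "s \<in> S"
      have "K * norm (x - s) powr \<beta> \<le> K * norm (x - y) powr \<beta> + K * norm (y - s) powr \<beta>"
        using mult_left_mono[OF norm_powr_triangle[OF \<beta>, of x s y] K] by (simp add: distrib_left)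
      then show "f x - K * norm (x - y) powr \<beta> \<le> v' s + K * norm (y - s) powr \<beta>"
        using f_le[OF s, of x] by linarith
    qed
    then show ?thesis by simp
  qed
  have fS: "f s = v' s" if s: "s \<in> S" for s
  proof (rule antisym)
    show "f s \<le> v' s" using f_le[OF s, of s] by simp
    show "v' s \<le> f s"
    proof (rule f_ge)
      fix s' assume "s' \<in> S"
      from pair[OF s this] show "v' s \<le> v' s' + K * norm (s - s') powr \<beta>" by linarith
    qed
  qed
  have "AE x in lebesgue_on \<Omega>. v x = f x"
    unfolding AE_lebesgue_on_iff[OF sl] using AES
    by eventually_elim (auto simp: fS, auto simp: S_def)
  moreover have "\<bar>f x - f y\<bar> \<le> K * norm (x - y) powr \<beta>" for x y
    using half[of x y] half[of y x] by (simp add: norm_minus_commute[of y x])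
  ultimately show ?thesis by blast
qed

lemma separable_subset:
  fixes S :: "'a::euclidean_space set"
  obtains T where "countable T" "T \<subseteq> S" "S \<subseteq> closure T"
  using separable[of S] by metis

context
  fixes \<Omega> :: "'a::euclidean_space set" and p :: real and v :: "'a \<Rightarrow> real" and V :: "'a \<Rightarrow> 'a"
  assumes \<Omega>: "open \<Omega>" "bounded \<Omega>" and p: "p > 1" and v: "sob \<Omega> p v V"
    and minimal: "\<And>\<psi> H. sob0 \<Omega> p \<psi> H \<Longrightarrow>
      (\<integral>x. norm (V x) powr p \<partial>(lebesgue_on \<Omega>)) \<le> (\<integral>x. norm (V x + H x) powr p \<partial>(lebesgue_on \<Omega>))"
begin

lemma minimizer_uminus:
  assumes "sob0 \<Omega> p \<psi> H"
  shows "(\<integral>x. norm (- V x) powr p \<partial>(lebesgue_on \<Omega>)) \<le> (\<integral>x. norm (- V x + H x) powr p \<partial>(lebesgue_on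
      \<Omega>))"
proof -
  have "norm (- V x + H x) = norm (V x + - H x)" for x
    using norm_minus_cancel[of "V x + - H x"] by simp
  then show ?thesis using minimal[OF sob0_uminus[OF \<Omega> p assms]] by simp
qed

text \<open>The upper estimate serves for \<open>v\<close> and also for \<open>- v\<close>, which
  minimizes with datum \<open>- g\<close>. Each boundary point comes with its own null set; a
  countable dense set of them shares one, and continuity of both sides in \<open>z\<close> reaches
  the rest of the boundary.\<close>

lemma minimizer_boundary_estimate:
  fixes \<gamma> :: "'a \<Rightarrow> real"
  assumes vg: "sob0 \<Omega> p (\<lambda>x. v x - g x) (\<lambda>x. V x - G x)" and g: "sob \<Omega> p g G"
    and s: "s > 0" "real DIM('a) + p - 2 \<le> s + 2" "real DIM('a) + p - 2 \<le> (p - 1) * (s + 2)"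
    and L: "L > 0" and M: "M > 0" and E: "E > 0" and \<beta>: "0 < \<beta>"
    and ball: "\<And>z. z \<in> frontier \<Omega> \<Longrightarrow> \<exists>\<nu>. norm \<nu> = 1 \<and> (\<forall>x\<in>\<Omega>. (x - z) \<bullet> \<nu> \<le> L * (norm (x - z))\<^sup>2)"
    and R: "\<And>x z. x \<in> closure \<Omega> \<Longrightarrow> z \<in> closure \<Omega> \<Longrightarrow> norm (x - z) \<le> R"
    and EC: "\<forall>(z::'a) \<nu> x. norm \<nu> = 1 \<longrightarrow> (x - z) \<bullet> \<nu> \<le> L * (norm (x - z))\<^sup>2 \<longrightarrow> norm (x - z) \<le> R \<longrightarrow> x \<noteq>
        z \<longrightarrow>
      (\<forall>m. norm (x - z) powr \<beta> \<le> (1 / (4 * L) / 2 ^ m) powr \<beta> + E * barrier_sum \<beta> s (1 / (4 * L)) z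
          \<nu> m x) \<and>
      (\<exists>m. (1 / (4 * L) / 2 ^ m) powr \<beta> + E * barrier_sum \<beta> s (1 / (4 * L)) z \<nu> m x \<le> C * norm (x -
          z) powr \<beta>)"
    and \<gamma>: "AE x in lebesgue_on \<Omega>. g x = \<gamma> x"
      "\<And>x y. x \<in> closure \<Omega> \<Longrightarrow> y \<in> closure \<Omega> \<Longrightarrow> \<bar>\<gamma> x - \<gamma> y\<bar> \<le> M * norm (x - y) powr \<beta>"
  shows "AE x in lebesgue_on \<Omega>. \<forall>z\<in>frontier \<Omega>. \<bar>v x - \<gamma> z\<bar> \<le> M * (C * norm (x - z) powr \<beta>)"
proof -
  have sl: "\<Omega> \<in> sets lebesgue" using \<Omega> by auto
  have one: "AE x in lebesgue. x \<in> \<Omega> \<longrightarrow> \<bar>v x - \<gamma> z\<bar> \<le> M * (C * norm (x - z) powr \<beta>)" if z: "z \<in>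
      frontier \<Omega>" for z
  proof -
    obtain \<nu> where \<nu>: "norm \<nu> = 1" "\<And>x. x \<in> \<Omega> \<Longrightarrow> (x - z) \<bullet> \<nu> \<le> L * (norm (x - z))\<^sup>2"
      using ball[OF z] by blast
    have zcl: "z \<in> closure \<Omega>" using z by (simp add: frontier_def)
    have cl: "x \<in> closure \<Omega>" if "x \<in> \<Omega>" for x using that closure_subset by blast
    have xz: "x \<noteq> z" if "x \<in> \<Omega>" for x using that z \<Omega>(1) by (auto simp: frontier_def interior_open)
    have ec: "(\<forall>m. norm (x - z) powr \<beta> \<le> (1 / (4 * L) / 2 ^ m) powr \<beta> + E * barrier_sum \<beta> s (1 / (4
        * L)) z \<nu> m x) \<and>
      (\<exists>m. (1 / (4 * L) / 2 ^ m) powr \<beta> + E * barrier_sum \<beta> s (1 / (4 * L)) z \<nu> m x \<le> C * norm (x -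
          z) powr \<beta>)"
      if x: "x \<in> \<Omega>" for x
      using EC \<nu>(1) \<nu>(2)[OF x] R[OF cl[OF x] zcl] xz[OF x] by blast
    have ec1: "norm (x - z) powr \<beta> \<le> (1 / (4 * L) / 2 ^ m) powr \<beta> + E * barrier_sum \<beta> s (1 / (4 *
        L)) z \<nu> m x" if "x \<in> \<Omega>" for m x
      using ec[OF that] by blast
    have ec2: "\<exists>m. (1 / (4 * L) / 2 ^ m) powr \<beta> + E * barrier_sum \<beta> s (1 / (4 * L)) z \<nu> m x \<le> C *
        norm (x - z) powr \<beta>" if "x \<in> \<Omega>" for x
      using ec[OF that] by blast
    have gae: "AE x in lebesgue_on \<Omega>. \<bar>g x - \<gamma> z\<bar> \<le> M * norm (x - z) powr \<beta>"
      using \<gamma>(1) unfolding AE_lebesgue_on_iff[OF sl] by eventually_elim (use \<gamma>(2) cl zcl in auto)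
    have g1: "AE x in lebesgue_on \<Omega>. g x \<le> \<gamma> z + M * norm (x - z) powr \<beta>"
      using gae by eventually_elim linarith
    have g2: "AE x in lebesgue_on \<Omega>. - g x \<le> - \<gamma> z + M * norm (x - z) powr \<beta>"
      using gae by eventually_elim linarith
    have 1: "AE x in lebesgue_on \<Omega>. v x \<le> \<gamma> z + M * (C * norm (x - z) powr \<beta>)"
      by (rule minimizer_boundary_upper[OF \<Omega> p v minimal vg g s L M E \<nu> ec1 ec2 g1])
    have vg': "sob0 \<Omega> p (\<lambda>x. - v x - - g x) (\<lambda>x. - V x - - G x)"
      using sob0_uminus[OF \<Omega> p vg] by simp
    have 2: "AE x in lebesgue_on \<Omega>. - v x \<le> - \<gamma> z + M * (C * norm (x - z) powr \<beta>)"
      by (rule minimizer_boundary_upper[OF \<Omega> p sob_uminus[OF \<Omega> p v] minimizer_uminus vg'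
          sob_uminus[OF \<Omega> p g] s L M E \<nu> ec1 ec2 g2])
    show ?thesis
      using 1 2 unfolding AE_lebesgue_on_iff[OF sl] by eventually_elim auto
  qed
  obtain T where T: "countable T" "T \<subseteq> frontier \<Omega>" "frontier \<Omega> \<subseteq> closure T"
    by (rule separable_subset)
  have "AE x in lebesgue. \<forall>z\<in>T. x \<in> \<Omega> \<longrightarrow> \<bar>v x - \<gamma> z\<bar> \<le> M * (C * norm (x - z) powr \<beta>)"
    unfolding AE_ball_countable[OF T(1)] using one T(2) by blast
  then show ?thesis
    unfolding AE_lebesgue_on_iff[OF sl]
  proof eventually_elim
    case (elim x)
    show ?case
    proof (intro impI ballI)
      fix z assume x: "x \<in> \<Omega>" and z: "z \<in> frontier \<Omega>"
      have sub: "closure T \<subseteq> frontier \<Omega>" using T(2) by (intro closure_minimal) (auto simp: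
          frontier_closed)
      have sub2: "frontier \<Omega> \<subseteq> closure \<Omega>" by (auto simp: frontier_def)
      have c\<gamma>: "continuous_on (closure T) \<gamma>"
        using holder_continuous[OF \<beta> \<gamma>(2)] sub sub2 continuous_on_subset by blast
      have ne: "x \<noteq> z" if "z \<in> closure T" for z
        using that sub x \<Omega>(1) by (auto simp: frontier_def interior_open)
      have "continuous_on (closure T) (\<lambda>z. \<bar>v x - \<gamma> z\<bar> - M * (C * norm (x - z) powr \<beta>))"
        using ne by (intro continuous_intros c\<gamma>) auto
      from continuous_le_on_closure[OF this, of z 0] show "\<bar>v x - \<gamma> z\<bar> \<le> M * (C * norm (x - z) powr
          \<beta>)"
        using T(3) z elim x by auto
    qed
  qed
qed

text \<open>If \<open>x\<close> or \<open>x + h\<close> is closer than |h| to a boundary point, both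
  are within 2 |h| of it, and the boundary bound gives (1 + 2^\<beta>) K |h|^\<beta>, at most 3 K
  |h|^\<beta>. The remaining points form a compact subset of the overlap, from which
  \<open>minimizer_translation\<close> takes over.\<close>

lemma minimizer_difference_estimate:
  fixes \<gamma> :: "'a \<Rightarrow> real"
  assumes bd: "AE x in lebesgue_on \<Omega>. \<forall>z\<in>frontier \<Omega>. \<bar>v x - \<gamma> z\<bar> \<le> K * norm (x - z) powr \<beta>"
    and K: "K \<ge> 0" and \<beta>: "0 < \<beta>" "\<beta> \<le> 1"
  shows "AE x in lebesgue. x \<in> \<Omega> \<longrightarrow> x + h \<in> \<Omega> \<longrightarrow> v (x + h) - v x \<le> 3 * K * norm h powr \<beta>"
proof (cases "h = 0")
  case False
  have sl: "\<Omega> \<in> sets lebesgue" using \<Omega> by auto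
  define D where "D = \<Omega> \<inter> (\<lambda>x. x + h) -` \<Omega>"
  have "open ((\<lambda>x. x + h) -` \<Omega>)" by (rule open_vimage[OF \<Omega>(1)]) (intro continuous_intros)
  then have slD: "D \<in> sets lebesgue" using \<Omega>(1) by (auto simp: D_def)
  \<comment> \<open>Nonstrict inequalities make \<open>C\<close> closed, and |h| > 0 keeps it away
    from the boundary. For \<open>h = 0\<close> it would contain boundary points, but there the
    claim is trivial.\<close>
  define C where "C = closure \<Omega> \<inter> (\<lambda>x. x + h) -` closure \<Omega> \<inter>
    (\<Inter>z\<in>frontier \<Omega>. {x. norm h \<le> norm (x - z)} \<inter> {x. norm h \<le> norm (x + h - z)})"
  have "closed C"
    unfolding C_def
    by (intro closed_Int closed_INT ballI closed_vimage closed_Collect_le continuous_intros) auto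
  moreover have "bounded C"
    by (rule bounded_subset[OF bounded_closure[OF \<Omega>(2)]]) (auto simp: C_def)
  ultimately have C: "compact C" by (simp add: compact_eq_bounded_closed)
  have CD: "C \<subseteq> D"
  proof
    fix x assume x: "x \<in> C"
    have "y \<in> \<Omega>" if "y \<in> closure \<Omega>" "\<And>z. z \<in> frontier \<Omega> \<Longrightarrow> norm h \<le> norm (y - z)" for y
    proof (rule ccontr)
      assume "y \<notin> \<Omega>"
      then have "y \<in> frontier \<Omega>" using that(1) \<Omega>(1) by (simp add: frontier_def interior_open)
      from that(2)[OF this] False show False by simp
    qed
    then show "x \<in> D" using x by (auto simp: C_def D_def)
  qed
  have bdl: "AE x in lebesgue. x \<in> \<Omega> \<longrightarrow> (\<forall>z\<in>frontier \<Omega>. \<bar>v x - \<gamma> z\<bar> \<le> K * norm (x - z) powr \<beta>)"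
    using bd by (simp add: AE_lebesgue_on_iff[OF sl])
  have bdl': "AE x in lebesgue. x + h \<in> \<Omega> \<longrightarrow> (\<forall>z\<in>frontier \<Omega>. \<bar>v (x + h) - \<gamma> z\<bar> \<le> K * norm (x + h - z)
      powr \<beta>)"
    using AE_lebesgue_affine[OF _ bdl, of 1 h] by (simp add: add.commute)
  have "AE x in lebesgue_on D. x \<notin> C \<longrightarrow> v (x + h) - v x \<le> 3 * K * norm h powr \<beta>"
    unfolding AE_lebesgue_on_iff[OF slD] using bdl bdl'
  proof eventually_elim
    case (elim x)
    show ?case
    proof (intro impI)
      assume xD: "x \<in> D" and xC: "x \<notin> C"
      have xO: "x \<in> \<Omega>" "x + h \<in> \<Omega>" using xD by (auto simp: D_def)
      then have "x \<in> closure \<Omega>" "x + h \<in> closure \<Omega>" using closure_subset by blast+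
      then obtain z where z: "z \<in> frontier \<Omega>" "norm (x - z) < norm h \<or> norm (x + h - z) < norm h"
        using xC by (auto simp: C_def not_le)
      have two: "norm (x - z) \<le> 2 * norm h" "norm (x + h - z) \<le> 2 * norm h"
        using z(2) norm_triangle_ineq[of "x - z" h] norm_triangle_ineq4[of "x + h - z" h]
        by (auto simp: algebra_simps)
      have p2: "2 powr \<beta> \<le> 2" using powr_mono[of \<beta> 1 "2::real"] \<beta> by simp
      have "norm (x - z) powr \<beta> + norm (x + h - z) powr \<beta> \<le> norm h powr \<beta> + (2 * norm h) powr \<beta>"
        using z(2)
      proof
        assume "norm (x - z) < norm h"
        then show ?thesis using two(2) \<beta> by (intro add_mono powr_mono2) auto
      next
        assume "norm (x + h - z) < norm h"
        then have "norm (x + h - z) powr \<beta> + norm (x - z) powr \<beta> \<le> norm h powr \<beta> + (2 * norm h) powr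
            \<beta>"
          using two(1) \<beta> by (intro add_mono powr_mono2) auto
        then show ?thesis by simp
      qed
      also have "\<dots> \<le> 3 * norm h powr \<beta>"
        using mult_right_mono[OF p2, of "norm h powr \<beta>"] by (simp add: powr_mult)
      finally have "K * (norm (x - z) powr \<beta> + norm (x + h - z) powr \<beta>) \<le> K * (3 * norm h powr \<beta>)"
        using K by (rule mult_left_mono)
      moreover have "\<bar>v x - \<gamma> z\<bar> \<le> K * norm (x - z) powr \<beta>" "\<bar>v (x + h) - \<gamma> z\<bar> \<le> K * norm (x + h -
          z) powr \<beta>"
        using elim xO z(1) by auto
      ultimately show "v (x + h) - v x \<le> 3 * K * norm h powr \<beta>"
        by (simp add: distrib_left)
    qed
  qed
  then have "AE x in lebesgue_on D. v (x + h) - v x \<le> 3 * K * norm h powr \<beta>"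
    using CD unfolding D_def by (intro minimizer_translation[OF \<Omega> p v minimal C])
  then show ?thesis unfolding AE_lebesgue_on_iff[OF slD]
    by eventually_elim (auto simp: D_def)
qed simp

end

text \<open>A supremum is informative only over a nonempty set bounded above. Boundedness of
  \<open>K\<close> and the Hoelder property give the upper bounds; two distinct points make both
  index sets nonempty, so each summand is nonnegative and the sum dominates either one.\<close>

lemma holder_norm_bounds:
  fixes K :: "'a::euclidean_space set"
  assumes f: "f \<in> holder_space K \<beta>" and K: "bounded K" "x0 \<in> K" "y0 \<in> K" "x0 \<noteq> y0" and \<beta>: "0 < \<beta>"
  shows "\<And>x. x \<in> K \<Longrightarrow> \<bar>f x\<bar> \<le> holder_norm K \<beta> f"
    and "\<And>x y. x \<in> K \<Longrightarrow> y \<in> K \<Longrightarrow> \<bar>f x - f y\<bar> \<le> holder_norm K \<beta> f * norm (x - y) powr \<beta>"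
proof -
  define P where "P = {(x, y). x \<in> K \<and> y \<in> K \<and> x \<noteq> y}"
  define S1 where "S1 = (SUP x\<in>K. \<bar>f x\<bar>)"
  define S2 where "S2 = (SUP (x, y)\<in>P. \<bar>f x - f y\<bar> / norm (x - y) powr \<beta>)"
  have hn: "holder_norm K \<beta> f = S1 + S2" by (simp add: holder_norm_def S1_def S2_def P_def)
  obtain M where M: "\<And>x y. x \<in> K \<Longrightarrow> y \<in> K \<Longrightarrow> \<bar>f x - f y\<bar> \<le> M * norm (x - y) powr \<beta>"
    using f by (auto simp: holder_space_def)
  obtain R where R: "\<And>x. x \<in> K \<Longrightarrow> norm x \<le> R" using K(1) by (auto simp: bounded_iff)
  have bdd1: "bdd_above ((\<lambda>x. \<bar>f x\<bar>) ` K)"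
  proof (rule bdd_aboveI2)
    fix x assume x: "x \<in> K"
    have "norm (x - x0) \<le> 2 * R" using norm_triangle_ineq4[of x x0] R[OF x] R[OF K(2)] by linarith
    then have "\<bar>M\<bar> * norm (x - x0) powr \<beta> \<le> \<bar>M\<bar> * (2 * R) powr \<beta>"
      using \<beta> by (intro mult_left_mono powr_mono2) auto
    moreover have "M * norm (x - x0) powr \<beta> \<le> \<bar>M\<bar> * norm (x - x0) powr \<beta>"
      by (intro mult_right_mono) auto
    ultimately show "\<bar>f x\<bar> \<le> \<bar>f x0\<bar> + \<bar>M\<bar> * (2 * R) powr \<beta>" using M[OF x K(2)] by linarith
  qed
  have bdd2: "bdd_above ((\<lambda>(x, y). \<bar>f x - f y\<bar> / norm (x - y) powr \<beta>) ` P)"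
    by (rule bdd_aboveI2[where M = M]) (use M in \<open>auto simp: P_def pos_divide_le_eq\<close>)
  have 1: "\<bar>f x\<bar> \<le> S1" if "x \<in> K" for x unfolding S1_def by (rule cSUP_upper[OF that bdd1])
  have 2: "\<bar>f x - f y\<bar> / norm (x - y) powr \<beta> \<le> S2" if "x \<in> K" "y \<in> K" "x \<noteq> y" for x y
    using cSUP_upper[OF _ bdd2, of "(x, y)"] that by (simp add: S2_def P_def)
  have S1: "S1 \<ge> 0" using 1[OF K(2)] by linarith
  have "0 \<le> \<bar>f x0 - f y0\<bar> / norm (x0 - y0) powr \<beta>" by simp
  then have S2: "S2 \<ge> 0" using 2[OF K(2-4)] by linarith
  show "\<bar>f x\<bar> \<le> holder_norm K \<beta> f" if "x \<in> K" for x using 1[OF that] S2 by (simp add: hn)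
  show "\<bar>f x - f y\<bar> \<le> holder_norm K \<beta> f * norm (x - y) powr \<beta>" if xy: "x \<in> K" "y \<in> K" for x y
  proof (cases "x = y")
    case False
    have "\<bar>f x - f y\<bar> \<le> S2 * norm (x - y) powr \<beta>" using 2[OF xy False] False by (simp add:
        pos_divide_le_eq)
    also have "\<dots> \<le> holder_norm K \<beta> f * norm (x - y) powr \<beta>" unfolding hn using S1 by (intro
        mult_right_mono) auto
    finally show ?thesis .
  qed simp
qed

lemma holder_norm_le:
  fixes K :: "'a::euclidean_space set"
  assumes "x0 \<in> K" "y0 \<in> K" "x0 \<noteq> y0" "\<And>x. x \<in> K \<Longrightarrow> \<bar>f x\<bar> \<le> A"
    "\<And>x y. x \<in> K \<Longrightarrow> y \<in> K \<Longrightarrow> \<bar>f x - f y\<bar> \<le> B * norm (x - y) powr \<beta>"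
  shows "holder_norm K \<beta> f \<le> A + B"
  unfolding holder_norm_def
proof (rule add_mono)
  show "(SUP x\<in>K. \<bar>f x\<bar>) \<le> A" using assms by (intro cSUP_least) auto
  show "(SUP (x, y)\<in>{(x, y). x \<in> K \<and> y \<in> K \<and> x \<noteq> y}. \<bar>f x - f y\<bar> / norm (x - y) powr \<beta>) \<le> B"
    using assms by (intro cSUP_least) (auto simp: pos_divide_le_eq)
qed

theorem theorem4p1:
  fixes \<Omega> :: "(real ^ 'n) set" and p \<beta> :: real
  assumes "bounded_C2_domain \<Omega>" and "1 < p" and "0 < \<beta>" and "\<beta> < 1"
  shows "\<exists>C::real. \<forall>g v.
    g \<in> W1p \<Omega> p \<inter> holder_class \<Omega> \<beta> \<and>
    is_arg_min (p_energy \<Omega> p) (\<lambda>w. w \<in> dirichlet_class \<Omega> p g) v \<longrightarrow>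
      v \<in> holder_class \<Omega> \<beta> \<and>
      holder_class_norm \<Omega> \<beta> v \<le> C * holder_class_norm \<Omega> \<beta> g"
proof -
  have \<Omega>: "open \<Omega>" "bounded \<Omega>" "\<Omega> \<noteq> {}" using assms(1) by (auto simp: bounded_C2_domain_def)
  note p = assms(2) and \<beta> = assms(3,4)
  note dom = domain_facts[OF \<Omega>(1,2) p]
  define n where "n = real DIM(real ^ 'n)"
  have n: "n \<ge> 0" by (simp add: n_def)
  \<comment> \<open>The second factor exceeds one, so s \<ge> n + p; multiplied by p - 1 it equals
    p, so (p - 1) s \<ge> n + p. Both lower bounds on the exponent follow, also for p near
    one.\<close>
  define s where "s = (n + p) * (1 + 1 / (p - 1))"
  have s: "s > 0" "n + p - 2 \<le> s + 2" "n + p - 2 \<le> (p - 1) * (s + 2)"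
  proof -
    have np: "n + p > 0" using n p by simp
    have "1 + 1 / (p - 1) > 0" using p by (intro add_pos_pos) auto
    with np show "s > 0" unfolding s_def by (rule mult_pos_pos)
    have "(n + p) * 1 \<le> s" unfolding s_def using np p by (intro mult_left_mono) auto
    then show "n + p - 2 \<le> s + 2" by simp
    have "(p - 1) * s = (n + p) * ((p - 1) + 1)" using p by (simp add: s_def field_simps)
    also have "\<dots> \<ge> (n + p) * 1" using np p by (intro mult_left_mono) auto
    finally show "n + p - 2 \<le> (p - 1) * (s + 2)" using p by (simp add: distrib_left)
  qed
  obtain L where L: "L > 0" "\<And>z. z \<in> frontier \<Omega> \<Longrightarrow> \<exists>\<nu>. norm \<nu> = 1 \<and> (\<forall>x\<in>\<Omega>. (x - z) \<bullet> \<nu> \<le> L * (norm (x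
      - z))\<^sup>2)"
    using uniform_exterior_ball[OF assms(1)] by blast
  obtain r where r: "\<And>x. x \<in> closure \<Omega> \<Longrightarrow> norm x \<le> r"
    using bounded_closure[OF \<Omega>(2)] by (auto simp: bounded_iff)
  \<comment> \<open>A bound for the diameter of the closure, made positive by the summand 1.\<close>
  define R where "R = 2 * \<bar>r\<bar> + 1"
  have R: "R > 0" "norm (x - z) \<le> R" if "x \<in> closure \<Omega>" "z \<in> closure \<Omega>" for x z
    using norm_triangle_ineq4[of x z] r[OF that(1)] r[OF that(2)] by (auto simp: R_def)
  have R0: "R > 0" by (simp add: R_def)
  obtain E C where E: "E > 0" and C: "C > 0"
    and EC: "\<forall>(z::real ^ 'n) \<nu> x. norm \<nu> = 1 \<longrightarrow> (x - z) \<bullet> \<nu> \<le> L * (norm (x - z))\<^sup>2 \<longrightarrow> norm (x - z) \<le> R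
        \<longrightarrow> x \<noteq> z \<longrightarrow>
      (\<forall>m. norm (x - z) powr \<beta> \<le> (1 / (4 * L) / 2 ^ m) powr \<beta> + E * barrier_sum \<beta> s (1 / (4 * L)) z
          \<nu> m x) \<and>
      (\<exists>m. (1 / (4 * L) / 2 ^ m) powr \<beta> + E * barrier_sum \<beta> s (1 / (4 * L)) z \<nu> m x \<le> C * norm (x -
          z) powr \<beta>)"
    using barrier_sum_bounds[OF \<beta> s(1) L(1) R0, where 'a = "real ^ 'n"] by blast
  obtain x0 where x0: "x0 \<in> \<Omega>" using \<Omega>(3) by blast
  obtain e where e: "e > 0" "ball x0 e \<subseteq> \<Omega>" using \<Omega>(1) x0 open_contains_ball by blast
  obtain b :: "real ^ 'n" where b: "b \<in> Basis" using nonempty_Basis by blast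
  \<comment> \<open>A second point of \<open>\<Omega>\<close>, since the Hoelder seminorm refers to
    pairs of distinct points.\<close>
  define y0 where "y0 = x0 + (e / 2) *\<^sub>R b"
  have y0: "y0 \<in> \<Omega>" "x0 \<noteq> y0" using e b by (auto simp: y0_def dist_norm intro!: subsetD[OF e(2)])
  have cl: "x \<in> closure \<Omega>" if "x \<in> \<Omega>" for x using that closure_subset by blast
  have "frontier \<Omega> \<noteq> {}"
    using \<Omega>(2,3) by (auto simp: frontier_eq_empty)
  then obtain z0 where z0: "z0 \<in> frontier \<Omega>" by blast
  have z0cl: "z0 \<in> closure \<Omega>" using z0 by (simp add: frontier_def)
  \<comment> \<open>\<open>1 + C * R powr \<beta>\<close> accounts for the maximum and
    \<open>3 * C\<close> for the seminorm. All ingredients are fixed before \<open>g\<close> and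
    \<open>v\<close> appear.\<close>
  define K where "K = 1 + C * R powr \<beta> + 3 * C"
  have K: "K > 0" using C by (simp add: K_def add_pos_nonneg add_nonneg_pos)
  show ?thesis
  proof (intro exI[of _ K] allI impI)
    fix g v assume gv: "g \<in> W1p \<Omega> p \<inter> holder_class \<Omega> \<beta> \<and>
      is_arg_min (p_energy \<Omega> p) (\<lambda>w. w \<in> dirichlet_class \<Omega> p g) v"
    obtain G where g: "sob \<Omega> p g G" using gv W1p_iff[OF \<Omega>(1,2) p] by blast
    have vmem: "(\<lambda>x. v x - g x) \<in> W1p_0 \<Omega> p"
      and vmin: "\<And>w. w \<in> dirichlet_class \<Omega> p g \<Longrightarrow> p_energy \<Omega> p v \<le> p_energy \<Omega> p w"
      using gv by (auto simp: is_arg_min_def dirichlet_class_def not_less)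
    obtain H0 where H0: "sob0 \<Omega> p (\<lambda>x. v x - g x) H0" using vmem W1p_0_iff[OF \<Omega>(1,2) p] by blast
    define V where "V = (\<lambda>x. H0 x + G x)"
    have vg: "sob0 \<Omega> p (\<lambda>x. v x - g x) (\<lambda>x. V x - G x)" using H0 by (simp add: V_def)
    have v: "sob \<Omega> p v V"
      using sob_add[OF \<Omega>(1,2) p sob0_imp_sob[OF \<Omega>(1,2) p H0] g] by (simp add: V_def)
    \<comment> \<open>Adding an element of the zero-boundary class keeps \<open>v\<close> in its
      Dirichlet class, and the energy comparison is restated in terms of explicit gradients.\<close>
    have minimal: "(\<integral>x. norm (V x) powr p \<partial>(lebesgue_on \<Omega>)) \<le> (\<integral>x. norm (V x + H x) powr p
        \<partial>(lebesgue_on \<Omega>))"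
      if \<psi>: "sob0 \<Omega> p \<psi> H" for \<psi> H
    proof -
      have "sob0 \<Omega> p (\<lambda>x. (v x + \<psi> x) - g x) (\<lambda>x. H0 x + H x)"
        using sob0_add[OF \<Omega>(1,2) p H0 \<psi>] by (simp add: algebra_simps)
      then have "(\<lambda>x. v x + \<psi> x) \<in> dirichlet_class \<Omega> p g"
        unfolding dirichlet_class_def using W1p_0_iff[OF \<Omega>(1,2) p] by blast
      from vmin[OF this] show ?thesis
        unfolding p_energy_sob[OF \<Omega>(1,2) p v]
          p_energy_sob[OF \<Omega>(1,2) p sob_add[OF \<Omega>(1,2) p v sob0_imp_sob[OF \<Omega>(1,2) p \<psi>]]]
        using p by (simp add: divide_le_cancel)
    qed
    define \<gamma> where "\<gamma> = (SOME h. is_holder_rep \<Omega> \<beta> g h)"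
    have "\<exists>h. is_holder_rep \<Omega> \<beta> g h" using gv by (simp add: holder_class_def)
    then have "is_holder_rep \<Omega> \<beta> g \<gamma>" unfolding \<gamma>_def by (rule someI_ex)
    then have \<gamma>: "\<gamma> \<in> holder_space (closure \<Omega>) \<beta>" "AE x in lebesgue_on \<Omega>. g x = \<gamma> x"
      by (auto simp: is_holder_rep_def)
    define N where "N = holder_class_norm \<Omega> \<beta> g"
    have N: "N = holder_norm (closure \<Omega>) \<beta> \<gamma>" by (simp add: N_def holder_class_norm_def \<gamma>_def)
    note hb = holder_norm_bounds[OF \<gamma>(1) bounded_closure[OF \<Omega>(2)] cl[OF x0] cl[OF y0(1)] y0(2) \<beta>(1),
        folded N]
    have N0: "N \<ge> 0" using hb(1)[OF z0cl] by linarith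
    \<comment> \<open>The barriers need a positive amplitude, whereas the norm \<open>N\<close> of
      the datum may be zero; a strict majorant \<open>M\<close> is used here and finally lowered to
      \<open>N\<close>.\<close>
    have main: "\<exists>f. (AE x in lebesgue_on \<Omega>. v x = f x) \<and> (\<forall>x y. \<bar>f x - f y\<bar> \<le> 3 * (M * C) * norm (x
        - y) powr \<beta>) \<and>
        (\<forall>x\<in>closure \<Omega>. \<bar>f x\<bar> \<le> M * (1 + C * R powr \<beta>))" if M: "M > N" for M
    proof -
      have M0: "M > 0" using M N0 by simp
      have hM: "\<bar>\<gamma> x - \<gamma> y\<bar> \<le> M * norm (x - y) powr \<beta>" if "x \<in> closure \<Omega>" "y \<in> closure \<Omega>" for x y
        using hb(2)[OF that] mult_right_mono[of N M "norm (x - y) powr \<beta>"] M by simp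
      have bd: "AE x in lebesgue_on \<Omega>. \<forall>z\<in>frontier \<Omega>. \<bar>v x - \<gamma> z\<bar> \<le> M * (C * norm (x - z) powr \<beta>)"
        by (rule minimizer_boundary_estimate[OF \<Omega>(1,2) p v minimal vg g s[unfolded n_def] L(1) M0 E
            \<beta>(1) L(2) R(2) EC \<gamma>(2) hM])
      then have bd': "AE x in lebesgue_on \<Omega>. \<forall>z\<in>frontier \<Omega>. \<bar>v x - \<gamma> z\<bar> \<le> (M * C) * norm (x - z)
          powr \<beta>"
        by (simp add: mult.assoc)
      have MC: "M * C \<ge> 0" using M0 C by simp
      have dq: "AE x in lebesgue. x \<in> \<Omega> \<longrightarrow> x + h \<in> \<Omega> \<longrightarrow> v (x + h) - v x \<le> 3 * (M * C) * norm h powr \<beta>"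
          for h
        by (rule minimizer_difference_estimate[OF \<Omega>(1,2) p v minimal bd' MC \<beta>(1) less_imp_le[OF
            \<beta>(2)]])
      obtain f where f: "AE x in lebesgue_on \<Omega>. v x = f x" "\<And>x y. \<bar>f x - f y\<bar> \<le> 3 * (M * C) * norm
          (x - y) powr \<beta>"
        using AE_difference_quotient_imp_holder_rep[OF \<Omega>(1,3) Lp_measurable[OF sobD(1)[OF v]] \<beta>(1)
            less_imp_le[OF \<beta>(2)] _ dq]
          M0 C by auto
      have cf: "continuous_on (closure \<Omega>) (\<lambda>x. \<bar>f x\<bar>)"
        using holder_continuous[OF \<beta>(1), of "closure \<Omega>" f] f(2) by (intro continuous_intros) blast
      \<comment> \<open>A single boundary point \<open>z0\<close> controls the maximum: |f| is at
        most |\<gamma>(z0)| plus the boundary estimate over a distance of at most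
        \<open>R\<close>.\<close>
      have ae: "AE x in lebesgue_on \<Omega>. \<bar>f x\<bar> \<le> M * (1 + C * R powr \<beta>)"
        using f(1) bd unfolding AE_lebesgue_on_iff[OF dom(1)]
      proof eventually_elim
        case (elim x)
        show ?case
        proof
          assume x: "x \<in> \<Omega>"
          have "\<bar>f x - \<gamma> z0\<bar> \<le> M * (C * norm (x - z0) powr \<beta>)" using elim x z0 by auto
          also have "\<dots> \<le> M * (C * R powr \<beta>)"
            using M0 C \<beta> R(2)[OF cl[OF x] z0cl] by (intro mult_left_mono powr_mono2) auto
          finally show "\<bar>f x\<bar> \<le> M * (1 + C * R powr \<beta>)"
            using hb(1)[OF z0cl] M by (simp add: distrib_left)
        qed
      qed
      have "\<bar>f x\<bar> \<le> M * (1 + C * R powr \<beta>)" if "x \<in> closure \<Omega>" for x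
        by (rule AE_le_imp_le_closure[OF \<Omega>(1) cf ae that])
      then show ?thesis using f by blast
    qed
    have "\<exists>h. is_holder_rep \<Omega> \<beta> v h"
    proof -
      obtain f where "AE x in lebesgue_on \<Omega>. v x = f x" "\<forall>x y. \<bar>f x - f y\<bar> \<le> 3 * ((N + 1) * C) *
          norm (x - y) powr \<beta>"
        using main[of "N + 1"] by auto
      then have "is_holder_rep \<Omega> \<beta> v f" unfolding is_holder_rep_def holder_space_def by blast
      then show ?thesis by blast
    qed
    note vrep = this
    define h where "h = (SOME h. is_holder_rep \<Omega> \<beta> v h)"
    have "is_holder_rep \<Omega> \<beta> v h" unfolding h_def using vrep by (rule someI_ex)
    then have h: "h \<in> holder_space (closure \<Omega>) \<beta>" "AE x in lebesgue_on \<Omega>. v x = h x"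
      by (auto simp: is_holder_rep_def)
    have le: "holder_norm (closure \<Omega>) \<beta> h \<le> K * M" if M: "M > N" for M
    proof -
      obtain f where f: "AE x in lebesgue_on \<Omega>. v x = f x" "\<And>x y. \<bar>f x - f y\<bar> \<le> 3 * (M * C) * norm
          (x - y) powr \<beta>"
        "\<And>x. x \<in> closure \<Omega> \<Longrightarrow> \<bar>f x\<bar> \<le> M * (1 + C * R powr \<beta>)"
        using main[OF M] by blast
      obtain Mh where Mh: "\<And>x y. x \<in> closure \<Omega> \<Longrightarrow> y \<in> closure \<Omega> \<Longrightarrow> \<bar>h x - h y\<bar> \<le> Mh * norm (x - y)
          powr \<beta>"
        using h(1) by (auto simp: holder_space_def)
      have c: "continuous_on (closure \<Omega>) (\<lambda>x. \<bar>f x - h x\<bar>)"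
        using holder_continuous[OF \<beta>(1), of "closure \<Omega>" f "3 * (M * C)"] f(2) holder_continuous[OF
            \<beta>(1) Mh]
        by (intro continuous_intros) blast+
      have ae: "AE x in lebesgue_on \<Omega>. \<bar>f x - h x\<bar> \<le> 0"
        using f(1) h(2) by eventually_elim simp
      \<comment> \<open>The norm refers to the representative \<open>h\<close> selected
        independently of \<open>M\<close>; the functions \<open>f\<close> found for different
        \<open>M\<close> all coincide with it on the closure.\<close>
      have eq: "h x = f x" if "x \<in> closure \<Omega>" for x
        using AE_le_imp_le_closure[OF \<Omega>(1) c ae that] by simp
      have "holder_norm (closure \<Omega>) \<beta> h \<le> M * (1 + C * R powr \<beta>) + 3 * (M * C)"
        using f(2,3) by (intro holder_norm_le[OF cl[OF x0] cl[OF y0(1)] y0(2)]) (simp_all add: eq)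
      also have "\<dots> = K * M" by (simp add: K_def algebra_simps)
      finally show ?thesis .
    qed
    \<comment> \<open>The limit of \<open>M\<close> towards \<open>N\<close>, with the excess scaled
      by 1 / K.\<close>
    have "holder_norm (closure \<Omega>) \<beta> h \<le> K * N"
    proof (rule field_le_epsilon)
      fix \<epsilon> :: real assume "\<epsilon> > 0"
      then have "holder_norm (closure \<Omega>) \<beta> h \<le> K * (N + \<epsilon> / K)" using K by (intro le) simp
      also have "\<dots> = K * N + \<epsilon>" using K by (simp add: distrib_left)
      finally show "holder_norm (closure \<Omega>) \<beta> h \<le> K * N + \<epsilon>" .
    qed
    then show "v \<in> holder_class \<Omega> \<beta> \<and> holder_class_norm \<Omega> \<beta> v \<le> K * holder_class_norm \<Omega> \<beta> g"
      using vrep by (simp add: holder_class_def holder_class_norm_def h_def N_def)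
  qed
qed

end
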